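(* (ZFC) If $2^\omega\le\omega_2$, then for every inaccessible cardinal $\delta$ there is no precipitous tower of ideals of height $\delta$ which concentrates on $GIC_{\omega_1}$ and is definable over $(V_\delta,\in)$.
   Context: $[X]^\omega$ is the set of countable subsets of $X$; a club in $[X]^\omega$ is a $\subseteq$-cofinal subset closed under unions of countable increasing chains. $GIC_{\omega_1}$. $ZF^-$ is ZF without Power Set. A transitive $ZF^-$ model $H$ with $\omega_1\in H$ has the $\omega_1$-approximation property iff for every $\eta\in H$ and $A\subseteq\eta$: if $z\cap A\in H$ for every $z\in H$ which is countable in $H$, then $A\in H$. A set $M$ with $\omega_1\subset M\prec H_\theta$ for some regular uncountable $\theta$ is $\omega_1$-guessing iff its transitive collapse has the $\omega_1$-approximation property. $G_{\omega_1}$ is the class of $\omega_1$-guessing $M$ with $|M|=\omega_1\subset M$. $IC_{\omega_1}$ (internally club sets) is the class of $M$ with $(M,\in)\models ZF^-$, $\omega_1\subseteq M$, $|M|=\omega_1$, such that $M\cap[M]^\omega$ contains a club in $[M]^\omega$. $GIC_{\omega_1}=G_{\omega_1}\cap IC_{\omega_1}$. Ideals. For a set $Z$, an ideal $I\subset\wp(Z)$ is always proper, countably complete, fine (for every $b\in\bigcup Z$, $\{M\in Z: b\notin M\}\in I$) and normal (if $S\notin I$ and $g$ is a function on $S$ with $g(M)\in M$ for all $M\in S$, then $g$ is constant on some $S'\subseteq S$ with $S'\notin I$). $I^+=\wp(Z)\setminus I$. $I$ concentrates on a class $\Gamma$ iff some $A\subseteq\Gamma$ belongs to the dual filter of $I$.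 If $I\subset\wp(Z)$, $I'\subset\wp(Z')$ and $\bigcup Z\subseteq\bigcup Z'$, then $I$ is the canonical projection of $I'$ to $Z$ iff $I=\{A\subseteq Z:\{M'\in Z': M'\cap\bigcup Z\in A\}\in I'\}$. Towers. A tower of ideals of height $\delta$ is a sequence $\vec I=\langle I_\lambda\rangle$, indexed by the regular cardinals $\lambda$ with $\omega_2\le\lambda<\delta$, where $I_\lambda$ is an ideal on $Z_\lambda=\wp_{\omega_2}(H_\lambda)$ and, for $\lambda\le\lambda'$, $I_\lambda$ is the canonical projection of $I_{\lambda'}$ to $Z_\lambda$. $\vec I$ concentrates on $\Gamma$ iff every $I_\lambda$ does. $\vec I$ is definable over $(V_\delta,\in)$ iff the relation $\{(\lambda,A): A\in I_\lambda\}\subseteq V_\delta$ is first-order definable over $(V_\delta,\in)$ (parameters from $V_\delta$ allowed). $\mathbb P_{\vec I}$ is the poset of pairs $(\lambda,S)$ with $S\in I_\lambda^+$, ordered by $(\lambda',S')\le(\lambda,S)$ iff $\lambda'\ge\lambda$ and $S'\subseteq\{M'\in Z_{\lambda'}: M'\cap H_\lambda\in S\}$. Generic ultrapower. Let $G$ be $(V,\mathbb P_{\vec I})$-generic and $proj(G,\lambda)=\{S:(\lambda,S)\in G\}$. A (partial) function $f\in V$ from $V_\delta$ to $V$ has bounded support if for some $\lambda<\delta$, $f(x)$ depends only on $x\cap H_\lambda$. $ult(V,G)$ is the set of classes $[f]_G$ of functions $f\in V$ with bounded support, where $[f]_G=[g]_G$ (resp. $[f]_G\in[g]_G$) iff $\{M\in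 Z_\lambda: f(M)=g(M)\}$ (resp. $f(M)\in g(M)$) is in $proj(G,\lambda)$ for all sufficiently large $\lambda<\delta$. $\vec I$ is precipitous iff $ult(V,G)$ is wellfounded for every $(V,\mathbb P_{\vec I})$-generic $G$. *)

theory Defs
  imports Main
begin

text \<open>
  The library has no axiomatic set theory, so the ambient universe is an arbitrary structure
  \<open>(V, E)\<close> satisfying first-order ZFC: a type \<open>'v\<close> with a binary relation \<open>E\<close> such that
  \<open>ZFC E\<close> below holds, Separation and Replacement being schemas over the formulas \<open>fm\<close>.
  By completeness, truth in all such structures is the same as provability in ZFC.
  Nothing makes \<open>E\<close> well-founded or \<open>\<omega>\<close> standard from the outside. Therefore every
  set-theoretic notion is interpreted inside \<open>(V, E)\<close>, by quantifying over elements of \<open>'v\<close> only;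
  in particular \<open>fm\<close> serves only for the schemas of \<open>ZFC E\<close>, whereas satisfaction in structures
  that are elements of \<open>V\<close> uses formula codes that are elements of \<open>V\<close>.
\<close>

section \<open>First-order ZFC\<close>

datatype fm = Mem nat nat | Eq nat nat | Neg fm | Conj fm fm | All nat fm

primrec sat :: "('v \<Rightarrow> 'v \<Rightarrow> bool) \<Rightarrow> (nat \<Rightarrow> 'v) \<Rightarrow> fm \<Rightarrow> bool" where
  "sat E s (Mem i j) \<longleftrightarrow> E (s i) (s j)"
| "sat E s (Eq i j) \<longleftrightarrow> s i = s j"
| "sat E s (Neg \<phi>) \<longleftrightarrow> \<not> sat E s \<phi>"
| "sat E s (Conj \<phi> \<psi>) \<longleftrightarrow> sat E s \<phi> \<and> sat E s \<psi>"
| "sat E s (All i \<phi>) \<longleftrightarrow> (\<forall>x. sat E (s(i := x)) \<phi>)"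

text \<open>
  The axioms of ZF without Power Set for the structure \<open>(D, E)\<close>. The argument \<open>R\<close> is the collection
  of binary relations on \<open>D\<close> that are definable with parameters; it instantiates the two schemas.
\<close>

definition ZF_minus :: "('v \<Rightarrow> 'v \<Rightarrow> bool) \<Rightarrow> 'v set \<Rightarrow> ('v \<Rightarrow> 'v \<Rightarrow> bool) set \<Rightarrow> bool" where
  "ZF_minus E D R \<longleftrightarrow>
     \<comment> \<open>Extensionality\<close>
     (\<forall>a\<in>D. \<forall>b\<in>D. (\<forall>x\<in>D. E x a \<longleftrightarrow> E x b) \<longrightarrow> a = b) \<and>
     \<comment> \<open>Foundation\<close>
     (\<forall>a\<in>D. (\<exists>x\<in>D. E x a) \<longrightarrow> (\<exists>x\<in>D. E x a \<and> (\<forall>y\<in>D. E y x \<longrightarrow> \<not> E y a))) \<and>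
     \<comment> \<open>Pairing\<close>
     (\<forall>a\<in>D. \<forall>b\<in>D. \<exists>c\<in>D. \<forall>x\<in>D. E x c \<longleftrightarrow> x = a \<or> x = b) \<and>
     \<comment> \<open>Union\<close>
     (\<forall>a\<in>D. \<exists>u\<in>D. \<forall>x\<in>D. E x u \<longleftrightarrow> (\<exists>y\<in>D. E y a \<and> E x y)) \<and>
     \<comment> \<open>Infinity\<close>
     (\<exists>w\<in>D. (\<exists>z\<in>D. E z w \<and> (\<forall>x\<in>D. \<not> E x z)) \<and>
        (\<forall>x\<in>D. E x w \<longrightarrow> (\<exists>y\<in>D. E y w \<and> (\<forall>z\<in>D. E z y \<longleftrightarrow> E z x \<or> z = x)))) \<and>
     \<comment> \<open>Separation\<close>
     (\<forall>P\<in>R. \<forall>c\<in>D. \<forall>a\<in>D. \<exists>b\<in>D. \<forall>x\<in>D. E x b \<longleftrightarrow> E x a \<and> P x c) \<and>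
     \<comment> \<open>Replacement\<close>
     (\<forall>P\<in>R. \<forall>a\<in>D. (\<forall>x\<in>D. E x a \<longrightarrow> (\<exists>!y. y \<in> D \<and> P x y)) \<longrightarrow>
        (\<exists>b\<in>D. \<forall>y\<in>D. E y b \<longleftrightarrow> (\<exists>x\<in>D. E x a \<and> P x y)))"

definition ZFC :: "('v \<Rightarrow> 'v \<Rightarrow> bool) \<Rightarrow> bool" where
  "ZFC E \<longleftrightarrow>
     ZF_minus E UNIV {\<lambda>x y. sat E (s(0 := x, 1 := y)) \<phi> | s \<phi>. True} \<and>
     \<comment> \<open>Power Set\<close>
     (\<forall>a. \<exists>p. \<forall>x. E x p \<longleftrightarrow> (\<forall>y. E y x \<longrightarrow> E y a)) \<and>
     \<comment> \<open>Choice: every set of pairwise disjoint nonempty sets has a transversal\<close>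
     (\<forall>a. (\<forall>x. E x a \<longrightarrow> (\<exists>y. E y x)) \<and>
          (\<forall>x y z. E x a \<and> E y a \<and> E z x \<and> E z y \<longrightarrow> x = y) \<longrightarrow>
          (\<exists>c. \<forall>x. E x a \<longrightarrow> (\<exists>!y. E y x \<and> E y c)))"

section \<open>Forcing semantics\<close>

text \<open>
  Generic filters over \<open>V\<close> need not exist, so, as usual, ``for every \<open>(V, P)\<close>-generic \<open>G\<close>''
  means ``forced by every condition''. A statement of the forcing language is represented by
  the predicate ``\<open>p\<close> forces it'' on conditions \<open>p\<close>; the operations below are the
  clauses of the forcing relation. The poset is given as the relation \<open>L\<close> of all pairs \<open>(q, p)\<close> of
  conditions with \<open>q \<le> p\<close>. The predicate \<open>fground b\<close> forces a statement \<open>b\<close> about the ground model.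
\<close>

definition fground :: "bool \<Rightarrow> 'c \<Rightarrow> bool" where
  "fground b p \<longleftrightarrow> b"

definition fneg :: "('c \<times> 'c) set \<Rightarrow> ('c \<Rightarrow> bool) \<Rightarrow> 'c \<Rightarrow> bool" where
  "fneg L \<phi> p \<longleftrightarrow> (\<forall>q. (q, p) \<in> L \<longrightarrow> \<not> \<phi> q)"

definition fconj :: "('c \<Rightarrow> bool) \<Rightarrow> ('c \<Rightarrow> bool) \<Rightarrow> 'c \<Rightarrow> bool" where
  "fconj \<phi> \<psi> p \<longleftrightarrow> \<phi> p \<and> \<psi> p"

definition fall :: "('a \<Rightarrow> 'c \<Rightarrow> bool) \<Rightarrow> 'c \<Rightarrow> bool" where
  "fall \<phi> p \<longleftrightarrow> (\<forall>x. \<phi> x p)"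

definition fimp :: "('c \<times> 'c) set \<Rightarrow> ('c \<Rightarrow> bool) \<Rightarrow> ('c \<Rightarrow> bool) \<Rightarrow> 'c \<Rightarrow> bool" where
  "fimp L \<phi> \<psi> = fneg L (fconj \<phi> (fneg L \<psi>))"

definition fex :: "('c \<times> 'c) set \<Rightarrow> ('a \<Rightarrow> 'c \<Rightarrow> bool) \<Rightarrow> 'c \<Rightarrow> bool" where
  "fex L \<phi> = fneg L (fall (\<lambda>x. fneg L (\<phi> x)))"

text \<open>The statement ``\<open>c\<close> belongs to the generic filter'' (forced by nothing if \<open>c\<close> is no condition).\<close>

definition fgeneric :: "('c \<times> 'c) set \<Rightarrow> 'c \<Rightarrow> 'c \<Rightarrow> bool" where
  "fgeneric L c p \<longleftrightarrow> (\<forall>q. (q, p) \<in> L \<longrightarrow> (\<exists>r. (r, q) \<in> L \<and> (r, c) \<in> L))"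

section \<open>Set theory inside a universe\<close>

locale set_universe =
  fixes mem :: "'v \<Rightarrow> 'v \<Rightarrow> bool"  (infix "\<epsilon>" 50)
begin

subsection \<open>Basic notions\<close>

text \<open>
  The set of all \<open>x\<close> with \<open>P x\<close>, meaningful when there is such an element of \<open>V\<close>.
\<close>

definition coll :: "('v \<Rightarrow> bool) \<Rightarrow> 'v"  (binder "SET " 10) where
  "(SET x. P x) = (THE a. \<forall>x. x \<epsilon> a \<longleftrightarrow> P x)"

definition subset :: "'v \<Rightarrow> 'v \<Rightarrow> bool"  (infix "\<sqsubseteq>" 50) where
  "a \<sqsubseteq> b \<longleftrightarrow> (\<forall>x. x \<epsilon> a \<longrightarrow> x \<epsilon> b)"

definition empty :: 'v where
  "empty = (SET x. False)"

definition inter :: "'v \<Rightarrow> 'v \<Rightarrow> 'v" where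
  "inter a b = (SET x. x \<epsilon> a \<and> x \<epsilon> b)"

definition diff :: "'v \<Rightarrow> 'v \<Rightarrow> 'v" where
  "diff a b = (SET x. x \<epsilon> a \<and> \<not> x \<epsilon> b)"

definition Union :: "'v \<Rightarrow> 'v" where
  "Union a = (SET x. \<exists>y. y \<epsilon> a \<and> x \<epsilon> y)"

definition Pow :: "'v \<Rightarrow> 'v" where
  "Pow a = (SET x. x \<sqsubseteq> a)"

definition succ :: "'v \<Rightarrow> 'v" where
  "succ a = (SET x. x \<epsilon> a \<or> x = a)"

definition upair :: "'v \<Rightarrow> 'v \<Rightarrow> 'v" where
  "upair a b = (SET x. x = a \<or> x = b)"

definition opair :: "'v \<Rightarrow> 'v \<Rightarrow> 'v" where
  "opair a b = upair (upair a a) (upair a b)"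

definition partial_fun :: "'v \<Rightarrow> bool" where
  "partial_fun f \<longleftrightarrow>
     (\<forall>p. p \<epsilon> f \<longrightarrow> (\<exists>x y. p = opair x y)) \<and>
     (\<forall>x y z. opair x y \<epsilon> f \<and> opair x z \<epsilon> f \<longrightarrow> y = z)"

definition function_on :: "'v \<Rightarrow> 'v \<Rightarrow> bool" where
  "function_on f a \<longleftrightarrow> partial_fun f \<and> (\<forall>x. x \<epsilon> a \<longleftrightarrow> (\<exists>y. opair x y \<epsilon> f))"

definition app :: "'v \<Rightarrow> 'v \<Rightarrow> 'v" where
  "app f x = (THE y. opair x y \<epsilon> f)"

definition maps :: "'v \<Rightarrow> 'v \<Rightarrow> 'v \<Rightarrow> bool" where
  "maps f a b \<longleftrightarrow> function_on f a \<and> (\<forall>x. x \<epsilon> a \<longrightarrow> app f x \<epsilon> b)"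

definition injection :: "'v \<Rightarrow> 'v \<Rightarrow> 'v \<Rightarrow> bool" where
  "injection f a b \<longleftrightarrow>
     maps f a b \<and> (\<forall>x y. x \<epsilon> a \<and> y \<epsilon> a \<and> app f x = app f y \<longrightarrow> x = y)"

definition bijection :: "'v \<Rightarrow> 'v \<Rightarrow> 'v \<Rightarrow> bool" where
  "bijection f a b \<longleftrightarrow> injection f a b \<and> (\<forall>y. y \<epsilon> b \<longrightarrow> (\<exists>x. x \<epsilon> a \<and> app f x = y))"

definition lepoll :: "'v \<Rightarrow> 'v \<Rightarrow> bool" where
  "lepoll a b \<longleftrightarrow> (\<exists>f. injection f a b)"

definition eqpoll :: "'v \<Rightarrow> 'v \<Rightarrow> bool" where
  "eqpoll a b \<longleftrightarrow> (\<exists>f. bijection f a b)"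

subsection \<open>Ordinals and cardinals\<close>

definition transitive :: "'v \<Rightarrow> bool" where
  "transitive a \<longleftrightarrow> (\<forall>x. x \<epsilon> a \<longrightarrow> x \<sqsubseteq> a)"

definition ordinal :: "'v \<Rightarrow> bool" where
  "ordinal a \<longleftrightarrow> transitive a \<and> (\<forall>x. x \<epsilon> a \<longrightarrow> transitive x)"

definition natural :: "'v \<Rightarrow> bool" where
  "natural n \<longleftrightarrow> ordinal n \<and> (\<forall>m. m \<epsilon> succ n \<longrightarrow> m = empty \<or> (\<exists>k. m = succ k))"

definition omega :: 'v where
  "omega = (SET n. natural n)"

definition countable :: "'v \<Rightarrow> bool" where
  "countable a \<longleftrightarrow> lepoll a omega"

definition omega1 :: 'v where
  "omega1 = (SET \<alpha>. ordinal \<alpha> \<and> lepoll \<alpha> omega)"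

definition omega2 :: 'v where
  "omega2 = (SET \<alpha>. ordinal \<alpha> \<and> lepoll \<alpha> omega1)"

definition cardinal :: "'v \<Rightarrow> bool" where
  "cardinal \<kappa> \<longleftrightarrow> ordinal \<kappa> \<and> (\<forall>\<alpha>. \<alpha> \<epsilon> \<kappa> \<longrightarrow> \<not> eqpoll \<alpha> \<kappa>)"

text \<open>\<open>|a| < \<kappa>\<close>, for a cardinal \<open>\<kappa>\<close>\<close>

definition card_less :: "'v \<Rightarrow> 'v \<Rightarrow> bool" where
  "card_less a \<kappa> \<longleftrightarrow> (\<exists>\<alpha>. \<alpha> \<epsilon> \<kappa> \<and> eqpoll a \<alpha>)"

definition regular :: "'v \<Rightarrow> bool" where
  "regular \<kappa> \<longleftrightarrow> cardinal \<kappa> \<and> omega \<sqsubseteq> \<kappa> \<and>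
     (\<forall>\<alpha> f. \<alpha> \<epsilon> \<kappa> \<and> maps f \<alpha> \<kappa> \<longrightarrow> (\<exists>\<beta>. \<beta> \<epsilon> \<kappa> \<and> (\<forall>\<xi>. \<xi> \<epsilon> \<alpha> \<longrightarrow> app f \<xi> \<epsilon> \<beta>)))"

definition inaccessible :: "'v \<Rightarrow> bool" where
  "inaccessible \<kappa> \<longleftrightarrow> regular \<kappa> \<and> omega \<epsilon> \<kappa> \<and> (\<forall>\<alpha>. \<alpha> \<epsilon> \<kappa> \<longrightarrow> card_less (Pow \<alpha>) \<kappa>)"

definition trcl :: "'v \<Rightarrow> 'v" where
  "trcl a = (SET x. \<forall>t. transitive t \<and> a \<sqsubseteq> t \<longrightarrow> x \<epsilon> t)"

definition H :: "'v \<Rightarrow> 'v" where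
  "H \<theta> = (SET x. card_less (trcl x) \<theta>)"

definition cumulative :: "'v \<Rightarrow> 'v \<Rightarrow> bool" where
  "cumulative f \<alpha> \<longleftrightarrow> function_on f (succ \<alpha>) \<and>
     (\<forall>\<beta>. \<beta> \<epsilon> succ \<alpha> \<longrightarrow> app f \<beta> = (SET x. \<exists>\<gamma>. \<gamma> \<epsilon> \<beta> \<and> x \<sqsubseteq> app f \<gamma>))"

definition Vset :: "'v \<Rightarrow> 'v" where
  "Vset \<alpha> = (THE v. \<exists>f. cumulative f \<alpha> \<and> v = app f \<alpha>)"

subsection \<open>Satisfaction in a set structure\<close>

primrec num :: "nat \<Rightarrow> 'v" where
  "num 0 = empty"
| "num (Suc n) = succ (num n)"

definition cMem :: "'v \<Rightarrow> 'v \<Rightarrow> 'v" where "cMem i j = opair (num 0) (opair i j)"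
definition cEq :: "'v \<Rightarrow> 'v \<Rightarrow> 'v" where "cEq i j = opair (num 1) (opair i j)"
definition cNeg :: "'v \<Rightarrow> 'v" where "cNeg \<phi> = opair (num 2) \<phi>"
definition cConj :: "'v \<Rightarrow> 'v \<Rightarrow> 'v" where "cConj \<phi> \<psi> = opair (num 3) (opair \<phi> \<psi>)"
definition cAll :: "'v \<Rightarrow> 'v \<Rightarrow> 'v" where "cAll i \<phi> = opair (num 4) (opair i \<phi>)"

definition fml_closed :: "'v \<Rightarrow> bool" where
  "fml_closed F \<longleftrightarrow>
     (\<forall>i j. i \<epsilon> omega \<and> j \<epsilon> omega \<longrightarrow> cMem i j \<epsilon> F \<and> cEq i j \<epsilon> F) \<and>
     (\<forall>\<phi>. \<phi> \<epsilon> F \<longrightarrow> cNeg \<phi> \<epsilon> F) \<and>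
     (\<forall>\<phi> \<psi>. \<phi> \<epsilon> F \<and> \<psi> \<epsilon> F \<longrightarrow> cConj \<phi> \<psi> \<epsilon> F) \<and>
     (\<forall>i \<phi>. i \<epsilon> omega \<and> \<phi> \<epsilon> F \<longrightarrow> cAll i \<phi> \<epsilon> F)"

definition fml :: "'v \<Rightarrow> bool" where
  "fml \<phi> \<longleftrightarrow> (\<forall>F. fml_closed F \<longrightarrow> \<phi> \<epsilon> F)"

definition upd :: "'v \<Rightarrow> 'v \<Rightarrow> 'v \<Rightarrow> 'v" where
  "upd s i x = (SET p. \<exists>k. k \<epsilon> omega \<and> p = opair k (if k = i then x else app s k))"

text \<open>\<open>T\<close> consists of pairs of a formula and an assignment and obeys Tarski's clauses for \<open>(A, \<in>)\<close>.\<close>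

definition truth_set :: "'v \<Rightarrow> 'v \<Rightarrow> bool" where
  "truth_set A T \<longleftrightarrow> (\<forall>s. maps s omega A \<longrightarrow>
     (\<forall>i j. i \<epsilon> omega \<and> j \<epsilon> omega \<longrightarrow>
        (opair (cMem i j) s \<epsilon> T \<longleftrightarrow> app s i \<epsilon> app s j) \<and>
        (opair (cEq i j) s \<epsilon> T \<longleftrightarrow> app s i = app s j)) \<and>
     (\<forall>\<phi>. fml \<phi> \<longrightarrow> (opair (cNeg \<phi>) s \<epsilon> T \<longleftrightarrow> \<not> opair \<phi> s \<epsilon> T)) \<and>
     (\<forall>\<phi> \<psi>. fml \<phi> \<and> fml \<psi> \<longrightarrow>
        (opair (cConj \<phi> \<psi>) s \<epsilon> T \<longleftrightarrow> opair \<phi> s \<epsilon> T \<and> opair \<psi> s \<epsilon> T)) \<and>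
     (\<forall>i \<phi>. i \<epsilon> omega \<and> fml \<phi> \<longrightarrow>
        (opair (cAll i \<phi>) s \<epsilon> T \<longleftrightarrow> (\<forall>x. x \<epsilon> A \<longrightarrow> opair \<phi> (upd s i x) \<epsilon> T))))"

definition Sat :: "'v \<Rightarrow> 'v \<Rightarrow> 'v \<Rightarrow> bool" where
  "Sat A s \<phi> \<longleftrightarrow> (\<exists>T. truth_set A T \<and> opair \<phi> s \<epsilon> T)"

definition ZF_minus_model :: "'v \<Rightarrow> bool" where
  "ZF_minus_model M \<longleftrightarrow> ZF_minus mem {x. x \<epsilon> M}
     {\<lambda>x y. Sat M (upd (upd s (num 0) x) (num 1) y) \<phi> | s \<phi>. maps s omega M \<and> fml \<phi>}"

definition elem_sub :: "'v \<Rightarrow> 'v \<Rightarrow> bool" where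
  "elem_sub M N \<longleftrightarrow> M \<sqsubseteq> N \<and> (\<exists>x. x \<epsilon> M) \<and>
     (\<forall>s \<phi>. maps s omega M \<and> fml \<phi> \<longrightarrow> (Sat M s \<phi> \<longleftrightarrow> Sat N s \<phi>))"

definition definable_over :: "'v \<Rightarrow> 'v \<Rightarrow> bool" where
  "definable_over A R \<longleftrightarrow> R \<sqsubseteq> A \<and>
     (\<exists>s \<phi>. maps s omega A \<and> fml \<phi> \<and> (\<forall>x. x \<epsilon> A \<longrightarrow> (x \<epsilon> R \<longleftrightarrow> Sat A (upd s (num 0) x) \<phi>)))"

subsection \<open>Guessing and internally club sets\<close>

text \<open>
  ``Countable in \<open>N\<close>'' is witnessed by an injection belonging to \<open>N\<close>; for the transitive \<open>N\<close>
  considered here, with \<open>\<omega> \<in> N\<close>, being such an injection is absolute.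
\<close>

definition approximation_property :: "'v \<Rightarrow> bool" where
  "approximation_property N \<longleftrightarrow>
     transitive N \<and> ZF_minus_model N \<and> omega1 \<epsilon> N \<and>
     (\<forall>\<eta> A. \<eta> \<epsilon> N \<and> A \<sqsubseteq> \<eta> \<longrightarrow>
        (\<forall>z. z \<epsilon> N \<and> (\<exists>f. f \<epsilon> N \<and> injection f z omega) \<longrightarrow> inter z A \<epsilon> N) \<longrightarrow>
        A \<epsilon> N)"

definition transitive_collapse :: "'v \<Rightarrow> 'v \<Rightarrow> bool" where
  "transitive_collapse M N \<longleftrightarrow> transitive N \<and>
     (\<exists>\<pi>. bijection \<pi> M N \<and>
        (\<forall>x y. x \<epsilon> M \<and> y \<epsilon> M \<longrightarrow> (x \<epsilon> y \<longleftrightarrow> app \<pi> x \<epsilon> app \<pi> y)))"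

definition guessing :: "'v \<Rightarrow> bool" where
  "guessing M \<longleftrightarrow> omega1 \<sqsubseteq> M \<and>
     (\<exists>\<theta>. regular \<theta> \<and> omega \<epsilon> \<theta> \<and> elem_sub M (H \<theta>)) \<and>
     (\<exists>N. transitive_collapse M N \<and> approximation_property N)"

definition G_omega1 :: "'v \<Rightarrow> bool" where
  "G_omega1 M \<longleftrightarrow> guessing M \<and> eqpoll M omega1 \<and> omega1 \<sqsubseteq> M"

definition countable_subsets :: "'v \<Rightarrow> 'v" where
  "countable_subsets X = (SET x. x \<sqsubseteq> X \<and> countable x)"

text \<open>
  Countable increasing chains are taken as nonempty countable subsets linearly ordered by inclusion.
\<close>

definition club :: "'v \<Rightarrow> 'v \<Rightarrow> bool" where
  "club C X \<longleftrightarrow> C \<sqsubseteq> countable_subsets X \<and>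
     (\<forall>x. x \<epsilon> countable_subsets X \<longrightarrow> (\<exists>c. c \<epsilon> C \<and> x \<sqsubseteq> c)) \<and>
     (\<forall>D. D \<sqsubseteq> C \<and> countable D \<and> (\<exists>c. c \<epsilon> D) \<and>
        (\<forall>c d. c \<epsilon> D \<and> d \<epsilon> D \<longrightarrow> c \<sqsubseteq> d \<or> d \<sqsubseteq> c) \<longrightarrow> Union D \<epsilon> C)"

definition IC_omega1 :: "'v \<Rightarrow> bool" where
  "IC_omega1 M \<longleftrightarrow> ZF_minus_model M \<and> omega1 \<sqsubseteq> M \<and> eqpoll M omega1 \<and>
     (\<exists>C. club C M \<and> C \<sqsubseteq> inter M (countable_subsets M))"

definition GIC_omega1 :: "'v \<Rightarrow> bool" where
  "GIC_omega1 M \<longleftrightarrow> G_omega1 M \<and> IC_omega1 M"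

subsection \<open>Ideals and towers\<close>

definition ideal :: "'v \<Rightarrow> 'v \<Rightarrow> bool" where
  "ideal Z I \<longleftrightarrow> I \<sqsubseteq> Pow Z \<and>
     (\<forall>A B. A \<epsilon> I \<and> B \<sqsubseteq> A \<longrightarrow> B \<epsilon> I) \<and>
     \<comment> \<open>proper\<close>
     \<not> Z \<epsilon> I \<and>
     \<comment> \<open>countably complete; this includes the empty union\<close>
     (\<forall>D. D \<sqsubseteq> I \<and> countable D \<longrightarrow> Union D \<epsilon> I) \<and>
     \<comment> \<open>fine\<close>
     (\<forall>b. b \<epsilon> Union Z \<longrightarrow> (SET M. M \<epsilon> Z \<and> \<not> b \<epsilon> M) \<epsilon> I) \<and>
     \<comment> \<open>normal\<close>
     (\<forall>S g. S \<sqsubseteq> Z \<and> \<not> S \<epsilon> I \<and> function_on g S \<and> (\<forall>M. M \<epsilon> S \<longrightarrow> app g M \<epsilon> M) \<longrightarrow>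
        (\<exists>S' c. S' \<sqsubseteq> S \<and> \<not> S' \<epsilon> I \<and> (\<forall>M. M \<epsilon> S' \<longrightarrow> app g M = c)))"

definition ideal_concentrates :: "'v \<Rightarrow> 'v \<Rightarrow> ('v \<Rightarrow> bool) \<Rightarrow> bool" where
  "ideal_concentrates Z I \<Gamma> \<longleftrightarrow> (\<exists>A. A \<sqsubseteq> Z \<and> (\<forall>M. M \<epsilon> A \<longrightarrow> \<Gamma> M) \<and> diff Z A \<epsilon> I)"

definition canonical_projection :: "'v \<Rightarrow> 'v \<Rightarrow> 'v \<Rightarrow> 'v \<Rightarrow> bool" where
  "canonical_projection Z I Z' I' \<longleftrightarrow> Union Z \<sqsubseteq> Union Z' \<and>
     I = (SET A. A \<sqsubseteq> Z \<and> (SET M'. M' \<epsilon> Z' \<and> inter M' (Union Z) \<epsilon> A) \<epsilon> I')"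

definition index :: "'v \<Rightarrow> 'v" where
  "index \<delta> = (SET \<kappa>. regular \<kappa> \<and> omega2 \<sqsubseteq> \<kappa> \<and> \<kappa> \<epsilon> \<delta>)"

definition Zset :: "'v \<Rightarrow> 'v" where
  "Zset \<kappa> = (SET M. M \<sqsubseteq> H \<kappa> \<and> card_less M omega2)"

definition tower :: "'v \<Rightarrow> 'v \<Rightarrow> bool" where
  "tower \<delta> I \<longleftrightarrow> function_on I (index \<delta>) \<and>
     (\<forall>\<kappa>. \<kappa> \<epsilon> index \<delta> \<longrightarrow> ideal (Zset \<kappa>) (app I \<kappa>)) \<and>
     (\<forall>\<kappa> \<kappa>'. \<kappa> \<epsilon> index \<delta> \<and> \<kappa>' \<epsilon> index \<delta> \<and> \<kappa> \<sqsubseteq> \<kappa>' \<longrightarrow>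
        canonical_projection (Zset \<kappa>) (app I \<kappa>) (Zset \<kappa>') (app I \<kappa>'))"

definition tower_concentrates :: "'v \<Rightarrow> 'v \<Rightarrow> ('v \<Rightarrow> bool) \<Rightarrow> bool" where
  "tower_concentrates \<delta> I \<Gamma> \<longleftrightarrow>
     (\<forall>\<kappa>. \<kappa> \<epsilon> index \<delta> \<longrightarrow> ideal_concentrates (Zset \<kappa>) (app I \<kappa>) \<Gamma>)"

definition tower_definable :: "'v \<Rightarrow> 'v \<Rightarrow> bool" where
  "tower_definable \<delta> I \<longleftrightarrow>
     definable_over (Vset \<delta>) (SET p. \<exists>\<kappa> A. p = opair \<kappa> A \<and> \<kappa> \<epsilon> index \<delta> \<and> A \<epsilon> app I \<kappa>)"

subsection \<open>The generic ultrapower\<close>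

definition tower_condition :: "'v \<Rightarrow> 'v \<Rightarrow> 'v \<Rightarrow> bool" where
  "tower_condition \<delta> I p \<longleftrightarrow>
     (\<exists>\<kappa> S. p = opair \<kappa> S \<and> \<kappa> \<epsilon> index \<delta> \<and> S \<sqsubseteq> Zset \<kappa> \<and> \<not> S \<epsilon> app I \<kappa>)"

definition tower_le :: "'v \<Rightarrow> 'v \<Rightarrow> ('v \<times> 'v) set" where
  "tower_le \<delta> I = {(q, p). tower_condition \<delta> I q \<and> tower_condition \<delta> I p \<and>
     (\<exists>\<kappa> S \<kappa>' S'. q = opair \<kappa>' S' \<and> p = opair \<kappa> S \<and> \<kappa> \<sqsubseteq> \<kappa>' \<and>
        S' \<sqsubseteq> (SET M'. M' \<epsilon> Zset \<kappa>' \<and> inter M' (H \<kappa>) \<epsilon> S))}"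

text \<open>
  For a partial function, dependence on \<open>x \<inter> H\<^sub>\<kappa>\<close> only is understood to include whether the value
  at \<open>x\<close> is defined.
\<close>

definition bounded_support :: "'v \<Rightarrow> 'v \<Rightarrow> bool" where
  "bounded_support \<delta> f \<longleftrightarrow> partial_fun f \<and> (\<forall>x y. opair x y \<epsilon> f \<longrightarrow> x \<epsilon> Vset \<delta>) \<and>
     (\<exists>\<kappa>. \<kappa> \<epsilon> index \<delta> \<and>
        (\<forall>x x'. x \<epsilon> Vset \<delta> \<and> x' \<epsilon> Vset \<delta> \<and> inter x (H \<kappa>) = inter x' (H \<kappa>) \<longrightarrow>
           (\<forall>y. opair x y \<epsilon> f \<longleftrightarrow> opair x' y \<epsilon> f)))"

text \<open>The forcing statement \<open>[f]\<^sub>G \<in> [g]\<^sub>G\<close>\<close>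

definition ult_mem :: "'v \<Rightarrow> 'v \<Rightarrow> 'v \<Rightarrow> 'v \<Rightarrow> 'v \<Rightarrow> bool" where
  "ult_mem \<delta> I f g =
     (let L = tower_le \<delta> I in
      fex L (\<lambda>\<mu>. fconj (fground (\<mu> \<epsilon> index \<delta>))
        (fall (\<lambda>\<kappa>. fimp L (fground (\<kappa> \<epsilon> index \<delta> \<and> \<mu> \<sqsubseteq> \<kappa>))
          (fgeneric L (opair \<kappa>
            (SET M. M \<epsilon> Zset \<kappa> \<and> (\<exists>u v. opair M u \<epsilon> f \<and> opair M v \<epsilon> g \<and> u \<epsilon> v))))))))"

text \<open>
  The subsets of \<open>V\<close> in the generic extension are exactly the sets
  \<open>\<tau>\<^sub>G = {x. \<exists>q\<in>G. (q, x) \<in> \<tau>}\<close> with \<open>\<tau> \<in> V\<close>. The following is the forcing statement \<open>x \<in> \<tau>\<^sub>G\<close>.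
\<close>

definition in_name :: "'v \<Rightarrow> 'v \<Rightarrow> 'v \<Rightarrow> 'v \<Rightarrow> 'v \<Rightarrow> bool" where
  "in_name \<delta> I x \<tau> =
     (let L = tower_le \<delta> I in fex L (\<lambda>q. fconj (fground (opair q x \<epsilon> \<tau>)) (fgeneric L q)))"

text \<open>
  The forcing statement ``\<open>ult(V, G)\<close> is well-founded'': in the generic extension, every nonempty
  set of its elements has a minimal one. Sets of elements are given by
  sets of representing functions, and whether \<open>[g]\<^sub>G \<in> [f]\<^sub>G\<close> does not depend on the representatives.
\<close>

definition ult_wellfounded :: "'v \<Rightarrow> 'v \<Rightarrow> 'v \<Rightarrow> bool" where
  "ult_wellfounded \<delta> I =
     (let L = tower_le \<delta> I;
          is_rep = (\<lambda>\<tau> f. fconj (fground (bounded_support \<delta> f)) (in_name \<delta> I f \<tau>)) in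
      fall (\<lambda>\<tau>. fimp L
        (fex L (\<lambda>f. is_rep \<tau> f))
        (fex L (\<lambda>f. fconj (is_rep \<tau> f)
          (fall (\<lambda>g. fimp L (is_rep \<tau> g) (fneg L (ult_mem \<delta> I g f))))))))"

definition precipitous :: "'v \<Rightarrow> 'v \<Rightarrow> bool" where
  "precipitous \<delta> I \<longleftrightarrow> (\<forall>p. tower_condition \<delta> I p \<longrightarrow> ult_wellfounded \<delta> I p)"

end

end

theory Submission
  imports Defs
begin

text \<open>
  Suppose there is such a tower. Guessing and internal clubness imply that the collapse of
  \<open>V\<^sub>\<xi> \<inter> M\<close> depends, for almost all \<open>M\<close>, only on the trace \<open>M \<inter> H\<^sub>\<kappa>\<^sub>0\<close> and on the collapse of \<open>\<xi>\<close>; the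
  possible values form an increasing chain. Precipitousness then gives a minimal function bounding
  this chain, from which one obtains \<open>AA M\<close> in \<open>V\<^sub>\<delta>\<close> representing the image of \<open>V\<^sub>\<delta>\<close> in the
  generic ultrapower. As the tower is definable, ``I compute my generic ultrapower by my tower and
  some function'' is a first-order property of \<open>V\<^sub>\<delta>\<close>. By the theorem of Los, it is inherited by \<open>AA M\<close>
  for some \<open>M\<close>, then by a member of \<open>AA M\<close>, and so on, contradicting Foundation.
\<close>

section \<open>Definable predicates\<close>

abbreviation (input) iff_ASCII :: "bool => bool => bool"  (infixr "<->" 25) where
  "P <-> Q \<equiv> P = Q"

definition atomic_term :: "((nat => 'v) => 'v) => bool" where
  "atomic_term t <-> (\<exists>k. t = (\<lambda>e. e k)) \<or> (\<exists>c. t = (\<lambda>e. c))"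

lemma atomic_term_var: "atomic_term (\<lambda>e. e k)"
  and atomic_term_const: "atomic_term (\<lambda>e. c)"
  by (auto simp: atomic_term_def)

text \<open>
  \<open>fo E P\<close>: the predicate \<open>P\<close> of an environment is first-order definable with parameters over
  \<open>(V, E)\<close>. Environments are de Bruijn style, so that a quantifier over a HOL-bound variable can
  be introduced by unification.
\<close>

inductive fo :: "('v => 'v => bool) => ((nat => 'v) => bool) => bool" for E where
  fo_mem_atomic: "atomic_term t ==> atomic_term u ==> fo E (\<lambda>e. E (t e) (u e))"
| fo_eq_atomic: "atomic_term t ==> atomic_term u ==> fo E (\<lambda>e. t e = u e)"
| fo_neg: "fo E P ==> fo E (\<lambda>e. \<not> P e)"
| fo_conj: "fo E P ==> fo E Q ==> fo E (\<lambda>e. P e \<and> Q e)"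
| fo_all_env: "fo E P ==> fo E (\<lambda>e. \<forall>x. P (case_nat x e))"

lemma fo_all: "fo E (\<lambda>e. Q (e 0) (\<lambda>n. e (Suc n))) ==> fo E (\<lambda>e. \<forall>x. Q x e)"
  by (drule fo_all_env) simp

lemma atomic_term_subst:
  assumes "atomic_term t" "\<And>n. atomic_term (\<sigma> n)"
  shows "atomic_term (\<lambda>e. t (\<lambda>n. \<sigma> n e))"
  using assms by (auto simp: atomic_term_def)

lemma fo_subst:
  assumes "fo E P" "\<And>n. atomic_term (\<sigma> n)"
  shows "fo E (\<lambda>e. P (\<lambda>n. \<sigma> n e))"
  using assms
proof (induction P arbitrary: \<sigma> rule: fo.induct)
  case (fo_mem_atomic t u)
  show ?case
    by (rule fo.fo_mem_atomic;
        rule atomic_term_subst[OF fo_mem_atomic(1)] atomic_term_subst[OF fo_mem_atomic(2)];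
        rule fo_mem_atomic)
next
  case (fo_eq_atomic t u)
  show ?case
    by (rule fo.fo_eq_atomic;
        rule atomic_term_subst[OF fo_eq_atomic(1)] atomic_term_subst[OF fo_eq_atomic(2)];
        rule fo_eq_atomic)
next
  case (fo_all_env P)
  define \<sigma>' where "\<sigma>' = case_nat (\<lambda>e. e 0) (\<lambda>n e. \<sigma> n (\<lambda>m. e (Suc m)))"
  have a: "atomic_term (\<sigma>' n)" for n
    unfolding \<sigma>'_def
    by (cases n) (auto intro: atomic_term_var atomic_term_subst fo_all_env.prems
        simp: atomic_term_subst[OF fo_all_env.prems, of "\<lambda>m e. e (Suc m)", OF atomic_term_var])
  have "(\<lambda>n. \<sigma>' n (case_nat x e)) = case_nat x (\<lambda>n. \<sigma> n e)" for x e
    by (rule ext) (auto simp: \<sigma>'_def split: nat.split)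
  with fo.fo_all_env[OF fo_all_env.IH[of \<sigma>', OF a]] show ?case by simp
qed (auto intro: fo.intros atomic_term_subst)

subsection \<open>Every definable predicate is given by a formula\<close>

primrec rename :: "(nat => nat) => fm => fm" where
  "rename r (Mem i j) = Mem (r i) (r j)"
| "rename r (Eq i j) = Eq (r i) (r j)"
| "rename r (Neg \<phi>) = Neg (rename r \<phi>)"
| "rename r (Conj \<phi> \<psi>) = Conj (rename r \<phi>) (rename r \<psi>)"
| "rename r (All i \<phi>) = All (r i) (rename r \<phi>)"

lemma sat_rename:
  assumes "inj r"
  shows "sat E s (rename r \<phi>) <-> sat E (\<lambda>n. s (r n)) \<phi>"
proof (induction \<phi> arbitrary: s)
  case (All i \<phi>)
  have "(\<lambda>n. (s(r i := x)) (r n)) = (\<lambda>n. s (r n))(i := x)" for x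
    using assms by (auto simp: fun_eq_iff inj_eq)
  with All show ?case by simp
qed auto

text \<open>Positions \<open>3n\<close> hold the environment, \<open>3n+1\<close> the parameters, \<open>3n+2\<close> bound variables.\<close>

definition mix :: "(nat => 'v) => (nat => 'v) => (nat => 'v) => nat => 'v" where
  "mix e c z n = (if n mod 3 = 0 then e (n div 3) else if n mod 3 = 1 then c (n div 3) else z (n div 3))"

lemma mix_simps: "mix e c z (3 * n) = e n" "mix e c z (3 * n + 1) = c n" "mix e c z (3 * n + 2) = z n"
proof -
  have "(3 * n) mod 3 = 0" "(3 * n) div 3 = n" "(3 * n + 1) mod 3 = 1" "(3 * n + 1) div 3 = n"
    "(3 * n + 2) mod 3 = 2" "(3 * n + 2) div 3 = n"
    by presburger+
  then show "mix e c z (3 * n) = e n" "mix e c z (3 * n + 1) = c n" "mix e c z (3 * n + 2) = z n"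
    unfolding mix_def by (simp_all only: refl if_True if_False one_neq_zero zero_neq_numeral
        zero_neq_numeral[symmetric] simp_thms one_eq_numeral_iff) simp_all
qed

lemma nat_mod3: obtains m where "(n::nat) = 3 * m" | m where "n = 3 * m + 1" | m where "n = 3 * m + 2"
proof -
  have "n mod 3 = 0 \<or> n mod 3 = 1 \<or> n mod 3 = 2" by presburger
  moreover have "n = 3 * (n div 3) + n mod 3" by simp
  ultimately show thesis by (metis add.right_neutral that)
qed

lemma inj_mix:
  fixes f g h :: "nat => nat"
  assumes "inj f" "inj g" "inj h"
  shows "inj (mix (\<lambda>n. 3 * f n) (\<lambda>n. 3 * g n + 1) (\<lambda>n. 3 * h n + 2))"
proof (rule injI)
  have ne: "3 * a \<noteq> 3 * b + (1::nat)" "3 * a \<noteq> 3 * b + (2::nat)" "3 * a + 1 \<noteq> 3 * b + (2::nat)" for a b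
    by presburger+
  fix x y
  assume *: "mix (\<lambda>n. 3 * f n) (\<lambda>n. 3 * g n + 1) (\<lambda>n. 3 * h n + 2) x
    = mix (\<lambda>n. 3 * f n) (\<lambda>n. 3 * g n + 1) (\<lambda>n. 3 * h n + 2) y"
  show "x = y"
    by (rule nat_mod3[of x]; rule nat_mod3[of y]; use * in \<open>simp only: mix_simps\<close>;
        use ne ne[symmetric] in \<open>simp add: inj_eq[OF assms(1)] inj_eq[OF assms(2)] inj_eq[OF assms(3)]\<close>)
qed

lemma fo_formula:
  assumes "fo E P"
  shows "\<exists>\<phi> c. \<forall>e z. P e <-> sat E (mix e c z) \<phi>"
  using assms
proof induction
  case (fo_mem_atomic t u)
  obtain i c1 where i: "\<And>e c z. c 0 = c1 ==> t e = mix e c z i"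
  proof (cases "\<exists>k. t = (\<lambda>e. e k)")
    case True
    then obtain k where "t = (\<lambda>e. e k)" by auto
    with that[of undefined "3 * k"] show thesis by (simp add: mix_simps)
  next
    case False
    with fo_mem_atomic obtain c where "t = (\<lambda>e. c)" by (auto simp: atomic_term_def)
    with that[of c "3 * 0 + 1"] show thesis by (simp only: mix_simps)
  qed
  obtain j c2 where j: "\<And>e c z. c 1 = c2 ==> u e = mix e c z j"
  proof (cases "\<exists>k. u = (\<lambda>e. e k)")
    case True
    then obtain k where "u = (\<lambda>e. e k)" by auto
    with that[of undefined "3 * k"] show thesis by (simp add: mix_simps)
  next
    case False
    with fo_mem_atomic obtain c where "u = (\<lambda>e. c)" by (auto simp: atomic_term_def)
    with that[of c "3 * 1 + 1"] show thesis by (simp only: mix_simps)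
  qed
  show ?case
    by (rule exI[of _ "Mem i j"], rule exI[of _ "case_nat c1 (\<lambda>_. c2)"])
      (simp add: i[symmetric] j[symmetric])
next
  case (fo_eq_atomic t u)
  obtain i c1 where i: "\<And>e c z. c 0 = c1 ==> t e = mix e c z i"
  proof (cases "\<exists>k. t = (\<lambda>e. e k)")
    case True
    then obtain k where "t = (\<lambda>e. e k)" by auto
    with that[of undefined "3 * k"] show thesis by (simp add: mix_simps)
  next
    case False
    with fo_eq_atomic obtain c where "t = (\<lambda>e. c)" by (auto simp: atomic_term_def)
    with that[of c "3 * 0 + 1"] show thesis by (simp only: mix_simps)
  qed
  obtain j c2 where j: "\<And>e c z. c 1 = c2 ==> u e = mix e c z j"
  proof (cases "\<exists>k. u = (\<lambda>e. e k)")
    case True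
    then obtain k where "u = (\<lambda>e. e k)" by auto
    with that[of undefined "3 * k"] show thesis by (simp add: mix_simps)
  next
    case False
    with fo_eq_atomic obtain c where "u = (\<lambda>e. c)" by (auto simp: atomic_term_def)
    with that[of c "3 * 1 + 1"] show thesis by (simp only: mix_simps)
  qed
  show ?case
    by (rule exI[of _ "Eq i j"], rule exI[of _ "case_nat c1 (\<lambda>_. c2)"])
      (simp add: i[symmetric] j[symmetric])
next
  case (fo_neg P)
  then obtain \<phi> c where "\<forall>e z. P e <-> sat E (mix e c z) \<phi>" by auto
  then show ?case by (intro exI[of _ "Neg \<phi>"] exI[of _ c]) simp
next
  case (fo_conj P Q)
  then obtain \<phi> c \<psi> d where *: "\<And>e z. P e <-> sat E (mix e c z) \<phi>" "\<And>e z. Q e <-> sat E (mix e d z) \<psi>"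
    by metis
  define b where "b n = (if even n then c (n div 2) else d (n div 2))" for n
  define r1 where "r1 = mix (\<lambda>n. 3 * n) (\<lambda>n. 3 * (2 * n) + 1) (\<lambda>n. 3 * n + 2)"
  define r2 where "r2 = mix (\<lambda>n. 3 * n) (\<lambda>n. 3 * (2 * n + 1) + 1) (\<lambda>n. 3 * n + 2)"
  have inj: "inj r1" "inj r2"
    unfolding r1_def r2_def
    by (intro inj_mix injI; simp)+
  have "(\<lambda>n. mix e b z (r1 n)) = mix e c z" for e z
    by (rule ext, rename_tac n, rule_tac n = n in nat_mod3) (simp_all only: r1_def mix_simps b_def, simp_all)
  moreover have "(\<lambda>n. mix e b z (r2 n)) = mix e d z" for e z
    by (rule ext, rename_tac n, rule_tac n = n in nat_mod3) (simp_all only: r2_def mix_simps b_def, simp_all)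
  ultimately show ?case
    by (intro exI[of _ "Conj (rename r1 \<phi>) (rename r2 \<psi>)"] exI[of _ b])
      (simp add: sat_rename inj *[symmetric])
next
  case (fo_all_env P)
  then obtain \<phi> c where *: "\<And>e z. P e <-> sat E (mix e c z) \<phi>" by metis
  define r where "r = mix (case_nat 2 (\<lambda>n. 3 * n)) (\<lambda>n. 3 * n + 1) (\<lambda>n. 3 * (Suc n) + 2)"
  define r' where "r' n = (if n = 2 then 0 else if n mod 3 = 0 then n + 3 else if n mod 3 = 1 then n else n - 3)"
    for n :: nat
  have "r' (r n) = n" for n
  proof (cases rule: nat_mod3[of n])
    case (1 m)
    then show ?thesis
      by (cases m) (simp_all only: r_def mix_simps nat.case, simp_all add: r'_def, presburger?)
  next
    case (2 m)
    moreover have "(3 * m + 1) mod 3 = 1" "3 * m + 1 \<noteq> 2" by presburger+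
    ultimately show ?thesis by (simp only: r_def mix_simps) (simp add: r'_def)
  next
    case (3 m)
    moreover have "(3 * Suc m + 2) mod 3 = 2" "3 * Suc m + 2 \<noteq> 2" by presburger+
    ultimately show ?thesis by (simp only: r_def mix_simps) (simp add: r'_def)
  qed
  then have inj: "inj r" by (metis injI)
  have "(\<lambda>n. ((mix e c z)(2 := x)) (r n)) = mix (case_nat x e) c (\<lambda>n. z (Suc n))" for e z x
  proof (rule ext)
    fix n show "((mix e c z)(2 := x)) (r n) = mix (case_nat x e) c (\<lambda>n. z (Suc n)) n"
    proof (cases rule: nat_mod3[of n])
      case (1 m)
      then show ?thesis
        by (cases m) (simp_all only: r_def mix_simps nat.case fun_upd_def, simp_all add: mix_def, presburger?)
    next
      case (2 m)
      have "3 * m + 1 \<noteq> (2::nat)" by presburger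
      with 2 show ?thesis by (simp only: r_def mix_simps fun_upd_def) simp
    next
      case (3 m)
      have "3 * Suc m + 2 \<noteq> (2::nat)" by presburger
      with 3 show ?thesis by (simp only: r_def mix_simps fun_upd_def) simp
    qed
  qed
  then show ?case
    by (intro exI[of _ "All 2 (rename r \<phi>)"] exI[of _ c]) (simp add: sat_rename inj *[symmetric])
qed

lemma fo_schema_instance:
  assumes "fo E P"
  obtains s \<phi> where "\<And>x y. P (case_nat x (case_nat y (\<lambda>_. undefined))) <-> sat E (s(0 := x, 1 := y)) \<phi>"
proof -
  obtain \<phi> c where *: "\<And>e z. P e <-> sat E (mix e c z) \<phi>"
    using fo_formula[OF assms] by metis
  define r :: "nat => nat" where
    "r n = (if n = 0 then 0 else if n = 3 then 1 else n + 3)" for n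
  have inj: "inj r" by (rule injI) (auto simp: r_def split: if_splits)
  define s where "s n = mix (\<lambda>_. undefined) c (\<lambda>_. undefined) (n - 3)" for n
  have "(\<lambda>n. (s(0 := x, 1 := y)) (r n)) = mix (case_nat x (case_nat y (\<lambda>_. undefined))) c (\<lambda>_. undefined)" for x y
    by (rule ext) (auto simp: r_def s_def mix_def split: nat.split)
  then show thesis
    by (intro that[of s "rename r \<phi>"]) (simp add: sat_rename inj *[symmetric])
qed

subsection \<open>Closure properties\<close>

lemma fo_bool: "fo E (\<lambda>e. b)"
proof -
  have t: "fo E (\<lambda>e. (undefined :: 'v) = undefined)"
    using fo_eq_atomic[of "\<lambda>_. undefined" "\<lambda>_. undefined"] by (simp add: atomic_term_const)
  show ?thesis by (cases b) (use t fo_neg[OF t] in auto)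
qed

lemma fo_disj: "fo E P ==> fo E Q ==> fo E (\<lambda>e. P e \<or> Q e)"
proof -
  assume "fo E P" "fo E Q"
  then have "fo E (\<lambda>e. \<not> (\<not> P e \<and> \<not> Q e))" by (intro fo_neg fo_conj)
  then show ?thesis by simp
qed

lemma fo_imp: "fo E P ==> fo E Q ==> fo E (\<lambda>e. P e --> Q e)"
proof -
  assume "fo E P" "fo E Q"
  then have "fo E (\<lambda>e. \<not> (P e \<and> \<not> Q e))" by (intro fo_neg fo_conj)
  then show ?thesis by simp
qed

lemma fo_iff: "fo E P ==> fo E Q ==> fo E (\<lambda>e. P e <-> Q e)"
proof -
  assume "fo E P" "fo E Q"
  then have "fo E (\<lambda>e. (P e --> Q e) \<and> (Q e --> P e))" by (intro fo_imp fo_conj)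
  then show ?thesis by (simp add: iff_conv_conj_imp)
qed

lemma fo_ex: "fo E (\<lambda>e. Q (e 0) (\<lambda>n. e (Suc n))) ==> fo E (\<lambda>e. \<exists>x. Q x e)"
proof -
  assume "fo E (\<lambda>e. Q (e 0) (\<lambda>n. e (Suc n)))"
  then have "fo E (\<lambda>e. \<not> (\<forall>x. \<not> Q x e))" by (intro fo_neg fo_all)
  then show ?thesis by simp
qed

lemma fo_rename: "fo E P ==> fo E (\<lambda>e. P (\<lambda>n. e (r n)))"
  by (rule fo_subst) (auto intro: atomic_term_var)

definition fot :: "('v => 'v => bool) => ((nat => 'v) => 'v) => bool" where
  "fot E t <-> fo E (\<lambda>e. e 0 = t (\<lambda>n. e (Suc n)))"

lemma fot_var: "fot E (\<lambda>e. e k)"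
  unfolding fot_def by (intro fo_eq_atomic atomic_term_var)

lemma fot_const: "fot E (\<lambda>e. c)"
  unfolding fot_def by (intro fo_eq_atomic atomic_term_var atomic_term_const)

lemma fot_eq_renamed: "fot E t ==> fo E (\<lambda>e. e k = t (\<lambda>n. e (r n)))"
  unfolding fot_def by (drule fo_rename[where r = "case_nat k r"]) simp

lemma fo_sub1: 
  assumes "fo E (\<lambda>e. R (e 0))" "fot E t"
  shows "fo E (\<lambda>e. R (t e))"
proof -
  have "fo E (\<lambda>e. \<exists>x. x = t e \<and> R x)"
    by (intro fo_ex fo_conj fot_eq_renamed assms)
  then show ?thesis by simp
qed

lemma fo_sub2: 
  assumes "fo E (\<lambda>e. R (e 0) (e (Suc 0)))" "fot E t" "fot E u"
  shows "fo E (\<lambda>e. R (t e) (u e))"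
proof -
  have 1: "fo E (\<lambda>e. R (e (Suc 0)) (e 0))"
    using fo_rename[OF assms(1), of "case_nat 1 (\<lambda>_. 0)"] by simp
  have "fo E (\<lambda>e. \<exists>x y. x = t e \<and> y = u e \<and> R x y)"
    by (intro fo_ex fo_conj fot_eq_renamed assms 1)
  then show ?thesis by simp
qed

lemma fo_sub3: 
  assumes "fo E (\<lambda>e. R (e 0) (e (Suc 0)) (e (Suc (Suc 0))))" "fot E t" "fot E u" "fot E v"
  shows "fo E (\<lambda>e. R (t e) (u e) (v e))"
proof -
  have 1: "fo E (\<lambda>e. R (e (Suc (Suc 0))) (e (Suc 0)) (e 0))"
    using fo_rename[OF assms(1), of "case_nat 2 (case_nat 1 (\<lambda>_. 0))"] by (simp add: numeral_2_eq_2)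
  have "fo E (\<lambda>e. \<exists>x y z. x = t e \<and> y = u e \<and> z = v e \<and> R x y z)"
    by (intro fo_ex fo_conj fot_eq_renamed assms 1)
  then show ?thesis by simp
qed

lemma fo_sub4: 
  assumes "fo E (\<lambda>e. R (e 0) (e (Suc 0)) (e (Suc (Suc 0))) (e (Suc (Suc (Suc 0)))))"
    "fot E t" "fot E u" "fot E v" "fot E w"
  shows "fo E (\<lambda>e. R (t e) (u e) (v e) (w e))"
proof -
  have 1: "fo E (\<lambda>e. R (e (Suc (Suc (Suc 0)))) (e (Suc (Suc 0))) (e (Suc 0)) (e 0))"
    using fo_rename[OF assms(1), of "case_nat 3 (case_nat 2 (case_nat 1 (\<lambda>_. 0)))"]
    by (simp add: numeral_2_eq_2 numeral_3_eq_3)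
  have "fo E (\<lambda>e. \<exists>x y z z'. x = t e \<and> y = u e \<and> z = v e \<and> z' = w e \<and> R x y z z')"
    by (intro fo_ex fo_conj fot_eq_renamed assms 1)
  then show ?thesis by simp
qed

lemma fo_mem: "fot E t ==> fot E u ==> fo E (\<lambda>e. E (t e) (u e))"
  by (rule fo_sub2) (intro fo_mem_atomic atomic_term_var)

lemma fo_eq: "fot E t ==> fot E u ==> fo E (\<lambda>e. t e = u e)"
  by (rule fo_sub2) (intro fo_eq_atomic atomic_term_var)

lemma fot_sub1: "fot E (\<lambda>e. F (e 0)) ==> fot E t ==> fot E (\<lambda>e. F (t e))"
proof -
  assume F: "fot E (\<lambda>e. F (e 0))" and t: "fot E t"
  have 1: "fo E (\<lambda>e. e (Suc 0) = F (e 0))"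
    using fot_eq_renamed[OF F, of "Suc 0" "\<lambda>_. 0"] .
  have "fo E (\<lambda>e. \<exists>x. x = t (\<lambda>n. e (Suc n)) \<and> e 0 = F x)"
    by (intro fo_ex fo_conj 1 fot_eq_renamed t)
  then show ?thesis by (simp add: fot_def)
qed

lemma fot_sub2: "fot E (\<lambda>e. F (e 0) (e (Suc 0))) ==> fot E t ==> fot E u ==> fot E (\<lambda>e. F (t e) (u e))"
proof -
  assume F: "fot E (\<lambda>e. F (e 0) (e (Suc 0)))" and t: "fot E t" and u: "fot E u"
  have 1: "fo E (\<lambda>e. e (Suc (Suc 0)) = F (e (Suc 0)) (e 0))"
    using fot_eq_renamed[OF F, of "Suc (Suc 0)" "case_nat (Suc 0) (\<lambda>_. 0)"] by simp
  have "fo E (\<lambda>e. \<exists>x y. x = t (\<lambda>n. e (Suc n)) \<and> y = u (\<lambda>n. e (Suc n)) \<and> e 0 = F x y)"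
    by (intro fo_ex fo_conj 1 fot_eq_renamed t u)
  then show ?thesis by (simp add: fot_def)
qed

lemma fot_sub3: "fot E (\<lambda>e. F (e 0) (e (Suc 0)) (e (Suc (Suc 0)))) ==> fot E t ==> fot E u ==> fot E v
  ==> fot E (\<lambda>e. F (t e) (u e) (v e))"
proof -
  assume F: "fot E (\<lambda>e. F (e 0) (e (Suc 0)) (e (Suc (Suc 0))))" and t: "fot E t" and u: "fot E u" and v: "fot E v"
  have 1: "fo E (\<lambda>e. e (Suc (Suc (Suc 0))) = F (e (Suc (Suc 0))) (e (Suc 0)) (e 0))"
    using fot_eq_renamed[OF F, of "Suc (Suc (Suc 0))" "case_nat (Suc (Suc 0)) (case_nat (Suc 0) (\<lambda>_. 0))"] by simp
  have "fo E (\<lambda>e. \<exists>x y z. x = t (\<lambda>n. e (Suc n)) \<and> y = u (\<lambda>n. e (Suc n)) \<and> z = v (\<lambda>n. e (Suc n)) \<and> e 0 = F x y z)"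
    by (intro fo_ex fo_conj 1 fot_eq_renamed t u v)
  then show ?thesis by (simp add: fot_def)
qed

named_theorems fo_intros

lemmas [fo_intros] = fo_all fo_ex fo_imp fo_iff fo_disj fo_conj fo_neg fo_mem fo_eq fot_var fot_const fo_bool

section \<open>Set theory in a model of ZFC\<close>

locale zfc_universe = set_universe mem for mem :: "'v => 'v => bool" (infix "\<epsilon>" 50) +
  assumes zfc: "ZFC mem"
begin

abbreviation "fo1 P \<equiv> fo mem (\<lambda>e. P (e 0))"
abbreviation "fo2 R \<equiv> fo mem (\<lambda>e. R (e 0) (e (Suc 0)))"
abbreviation "fot1 F \<equiv> fot mem (\<lambda>e. F (e 0))"

lemma set_eqI: "(\<And>x. x \<epsilon> a <-> x \<epsilon> b) ==> a = b"
  using zfc unfolding ZFC_def ZF_minus_def by simp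

lemma set_eq_iff: "a = b <-> (\<forall>x. x \<epsilon> a <-> x \<epsilon> b)"
  using set_eqI by blast

lemma mem_coll: "\<exists>a. \<forall>x. x \<epsilon> a <-> P x ==> x \<epsilon> coll P <-> P x"
proof -
  assume "\<exists>a. \<forall>x. x \<epsilon> a <-> P x"
  then obtain a where a: "\<forall>x. x \<epsilon> a <-> P x" ..
  then have "coll P = a"
    unfolding coll_def by (intro the_equality) (auto intro: set_eqI)
  with a show ?thesis by simp
qed

lemma fot_set:
  assumes "\<And>e w. w \<epsilon> t e <-> Q w e" "fo mem (\<lambda>e. Q (e 0) (\<lambda>n. e (Suc n)))"
  shows "fot mem t"
proof -
  have 1: "fo mem (\<lambda>e. Q (e 0) (\<lambda>n. e (Suc (Suc n))))"
    using fo_rename[OF assms(2), of "case_nat 0 (\<lambda>n. Suc (Suc n))"] by simp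
  have "fo mem (\<lambda>e. \<forall>w. w \<epsilon> e 0 <-> Q w (\<lambda>n. e (Suc n)))"
    by (intro fo_intros 1)
  then show ?thesis by (simp add: fot_def set_eq_iff assms(1))
qed

lemma fot_if:
  assumes "fo mem P" "fot mem t" "fot mem u"
  shows "fot mem (\<lambda>e. if P e then t e else u e)"
proof -
  have "fo mem (\<lambda>e. (P (\<lambda>n. e (Suc n)) \<and> e 0 = t (\<lambda>n. e (Suc n))) \<or>
      (\<not> P (\<lambda>n. e (Suc n)) \<and> e 0 = u (\<lambda>n. e (Suc n))))"
    by (intro fo_intros fo_rename[OF assms(1), of Suc] fot_eq_renamed assms)
  moreover have "(\<lambda>e. (P (\<lambda>n. e (Suc n)) \<and> e 0 = t (\<lambda>n. e (Suc n))) \<or>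
      (\<not> P (\<lambda>n. e (Suc n)) \<and> e 0 = u (\<lambda>n. e (Suc n)))) =
    (\<lambda>e. e 0 = (if P (\<lambda>n. e (Suc n)) then t (\<lambda>n. e (Suc n)) else u (\<lambda>n. e (Suc n))))"
    by auto
  ultimately show ?thesis unfolding fot_def by simp
qed

lemma separation:
  assumes "fo1 P"
  shows "\<exists>b. \<forall>x. x \<epsilon> b <-> x \<epsilon> a \<and> P x"
proof -
  obtain s \<phi> where *: "\<And>x y. P x <-> sat mem (s(0 := x, 1 := y)) \<phi>"
    using fo_schema_instance[OF assms] by auto
  have "\<forall>P\<in>{\<lambda>x y. sat mem (s(0 := x, 1 := y)) \<phi> | s \<phi>. True}. \<forall>c a. \<exists>b. \<forall>x. x \<epsilon> b <-> x \<epsilon> a \<and> P x c"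
    using zfc unfolding ZFC_def ZF_minus_def by simp
  moreover have "(\<lambda>x y. P x) \<in> {\<lambda>x y. sat mem (s(0 := x, 1 := y)) \<phi> | s \<phi>. True}"
    using * by blast
  ultimately have "\<forall>(c::'v) a. \<exists>b. \<forall>x. x \<epsilon> b <-> x \<epsilon> a \<and> P x"
    by (rule bspec)
  then show ?thesis by simp
qed

lemma mem_sep:
  assumes "fo1 P"
  shows "x \<epsilon> (SET x. x \<epsilon> a \<and> P x) <-> x \<epsilon> a \<and> P x"
  by (rule mem_coll[OF separation[OF assms]])

lemma bounded_coll:
  assumes "fo1 P" "\<And>x. P x ==> x \<epsilon> a"
  shows "x \<epsilon> coll P <-> P x"
  by (rule mem_coll) (use separation[OF assms(1), of a] assms(2) in blast)

lemma replacement: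
  assumes "fo2 R" "\<And>x. x \<epsilon> a ==> \<exists>!y. R x y"
  shows "\<exists>b. \<forall>y. y \<epsilon> b <-> (\<exists>x. x \<epsilon> a \<and> R x y)"
proof -
  obtain s \<phi> where *: "\<And>x y. R x y <-> sat mem (s(0 := x, 1 := y)) \<phi>"
    using fo_schema_instance[OF assms(1)] by auto
  have "\<forall>P\<in>{\<lambda>x y. sat mem (s(0 := x, 1 := y)) \<phi> | s \<phi>. True}. \<forall>a. (\<forall>x. x \<epsilon> a --> (\<exists>!y. P x y)) -->
       (\<exists>b. \<forall>y. y \<epsilon> b <-> (\<exists>x. x \<epsilon> a \<and> P x y))"
    using zfc unfolding ZFC_def ZF_minus_def by simp
  moreover have "R \<in> {\<lambda>x y. sat mem (s(0 := x, 1 := y)) \<phi> | s \<phi>. True}"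
    using * by blast
  ultimately have "\<forall>a. (\<forall>x. x \<epsilon> a --> (\<exists>!y. R x y)) --> (\<exists>b. \<forall>y. y \<epsilon> b <-> (\<exists>x. x \<epsilon> a \<and> R x y))"
    by (rule bspec)
  with assms(2) show ?thesis by simp
qed

lemma mem_image:
  assumes "fot1 F"
  shows "y \<epsilon> (SET y. \<exists>x. x \<epsilon> a \<and> y = F x) <-> (\<exists>x. x \<epsilon> a \<and> y = F x)"
proof (rule mem_coll, rule replacement)
  show "fo mem (\<lambda>e. e (Suc 0) = F (e 0))"
    using fot_eq_renamed[OF assms, of "Suc 0" "\<lambda>_. 0"] by simp
qed auto

lemma foundation: "x \<epsilon> a ==> \<exists>x. x \<epsilon> a \<and> (\<forall>y. y \<epsilon> x --> \<not> y \<epsilon> a)"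
proof -
  have "\<forall>a. (\<exists>x. x \<epsilon> a) --> (\<exists>x. x \<epsilon> a \<and> (\<forall>y. y \<epsilon> x --> \<not> y \<epsilon> a))"
    using zfc unfolding ZFC_def ZF_minus_def by simp
  moreover assume "x \<epsilon> a"
  ultimately show ?thesis by blast
qed

lemma least_on:
  assumes "fo1 P" "x \<epsilon> a" "P x"
  obtains y where "y \<epsilon> a" "P y" "\<And>z. z \<epsilon> y ==> z \<epsilon> a ==> \<not> P z"
  using foundation[of x "SET x. x \<epsilon> a \<and> P x"] assms(2,3) unfolding mem_sep[OF assms(1)] by blast

lemma least_on_ex:
  assumes "fo1 P" "x \<epsilon> a" "P x"
  shows "\<exists>y. y \<epsilon> a \<and> P y \<and> (\<forall>z. z \<epsilon> y --> z \<epsilon> a --> \<not> P z)"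
  using least_on[OF assms] by metis

subsection \<open>Basic operations\<close>

lemma mem_empty [simp]: "\<not> x \<epsilon> empty"
proof -
  obtain b where "\<forall>x. x \<epsilon> b <-> x \<epsilon> undefined \<and> False" using separation[OF fo_bool] by blast
  then show ?thesis unfolding empty_def by (subst mem_coll) auto
qed

lemma mem_upair [simp]: "x \<epsilon> upair a b <-> x = a \<or> x = b"
  unfolding upair_def by (rule mem_coll) (use zfc in \<open>simp add: ZFC_def ZF_minus_def\<close>)

lemma mem_Union [simp]: "x \<epsilon> Union a <-> (\<exists>y. y \<epsilon> a \<and> x \<epsilon> y)"
  unfolding Union_def by (rule mem_coll) (use zfc in \<open>simp add: ZFC_def ZF_minus_def\<close>)

lemma subset_refl [simp]: "a \<sqsubseteq> a"
  by (simp add: subset_def)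

lemma subset_trans: "a \<sqsubseteq> b ==> b \<sqsubseteq> c ==> a \<sqsubseteq> c"
  by (simp add: subset_def)

lemma subset_antisym: "a \<sqsubseteq> b ==> b \<sqsubseteq> a ==> a = b"
  by (auto simp: subset_def set_eq_iff)

lemma subsetD: "a \<sqsubseteq> b ==> x \<epsilon> a ==> x \<epsilon> b"
  by (simp add: subset_def)

lemma empty_subset [simp]: "empty \<sqsubseteq> a"
  by (simp add: subset_def)

lemma mem_Pow [simp]: "x \<epsilon> Pow a <-> x \<sqsubseteq> a"
  unfolding Pow_def subset_def by (rule mem_coll) (use zfc in \<open>simp add: ZFC_def\<close>)

lemma fo_subset [fo_intros]: "fot mem t ==> fot mem u ==> fo mem (\<lambda>e. t e \<sqsubseteq> u e)"
  by (rule fo_sub2) (unfold subset_def, intro fo_intros)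

lemma fot_upair [fo_intros]: "fot mem t ==> fot mem u ==> fot mem (\<lambda>e. upair (t e) (u e))"
  by (rule fot_sub2) (rule fot_set, rule mem_upair, intro fo_intros)

lemma fot_Union [fo_intros]: "fot mem t ==> fot mem (\<lambda>e. Union (t e))"
  by (rule fot_sub1) (rule fot_set, rule mem_Union, intro fo_intros)

lemma fot_Pow [fo_intros]: "fot mem t ==> fot mem (\<lambda>e. Pow (t e))"
  by (rule fot_sub1) (rule fot_set, rule mem_Pow, intro fo_intros)

lemma fot_opair [fo_intros]: "fot mem t ==> fot mem u ==> fot mem (\<lambda>e. opair (t e) (u e))"
  unfolding opair_def by (intro fo_intros)

lemma upair_eq: "upair a b = upair c d <-> (a = c \<and> b = d) \<or> (a = d \<and> b = c)"
  by (auto simp: set_eq_iff)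

lemma opair_eq [simp]: "opair a b = opair c d <-> a = c \<and> b = d"
  unfolding opair_def upair_eq by auto

definition union2 :: "'v => 'v => 'v" where
  "union2 a b = Union (upair a b)"

lemma mem_union2 [simp]: "x \<epsilon> union2 a b <-> x \<epsilon> a \<or> x \<epsilon> b"
  by (auto simp: union2_def)

lemma fot_union2 [fo_intros]: "fot mem t ==> fot mem u ==> fot mem (\<lambda>e. union2 (t e) (u e))"
  unfolding union2_def by (intro fo_intros)

lemma mem_inter [simp]: "x \<epsilon> inter a b <-> x \<epsilon> a \<and> x \<epsilon> b"
  unfolding inter_def by (rule mem_sep) (intro fo_intros)

lemma mem_diff [simp]: "x \<epsilon> diff a b <-> x \<epsilon> a \<and> \<not> x \<epsilon> b"
  unfolding diff_def by (rule mem_sep) (intro fo_intros)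

lemma mem_succ [simp]: "x \<epsilon> succ a <-> x \<epsilon> a \<or> x = a"
  unfolding succ_def by (rule bounded_coll[where a = "union2 a (upair a a)"]) (intro fo_intros, auto)

lemma fot_inter [fo_intros]: "fot mem t ==> fot mem u ==> fot mem (\<lambda>e. inter (t e) (u e))"
  by (rule fot_sub2) (rule fot_set, rule mem_inter, intro fo_intros)

lemma fot_diff [fo_intros]: "fot mem t ==> fot mem u ==> fot mem (\<lambda>e. diff (t e) (u e))"
  by (rule fot_sub2) (rule fot_set, rule mem_diff, intro fo_intros)

lemma fot_succ [fo_intros]: "fot mem t ==> fot mem (\<lambda>e. succ (t e))"
  by (rule fot_sub1) (rule fot_set, rule mem_succ, intro fo_intros)

lemma not_mem_self [simp]: "\<not> x \<epsilon> x"
  using foundation[of x "upair x x"] by auto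

lemma mem_asym: "x \<epsilon> y ==> \<not> y \<epsilon> x"
  using foundation[of x "upair x y"] by auto

lemma opair_mem_Union2: "opair x y \<epsilon> f ==> x \<epsilon> Union (Union f) \<and> y \<epsilon> Union (Union f)"
  unfolding opair_def by (fastforce simp: opair_def)

definition dom :: "'v => 'v" where
  "dom f = (SET x. \<exists>y. opair x y \<epsilon> f)"

definition ran :: "'v => 'v" where
  "ran f = (SET y. \<exists>x. opair x y \<epsilon> f)"

definition prod :: "'v => 'v => 'v" where
  "prod a b = (SET p. \<exists>x y. x \<epsilon> a \<and> y \<epsilon> b \<and> p = opair x y)"

text \<open>Equals \<open>app f x\<close> for \<open>x\<close> in the domain of a function \<open>f\<close>, but is definable for all arguments.\<close>

definition val :: "'v => 'v => 'v" where
  "val f x = (SET z. \<exists>y. opair x y \<epsilon> f \<and> z \<epsilon> y)"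

lemma mem_dom [simp]: "x \<epsilon> dom f <-> (\<exists>y. opair x y \<epsilon> f)"
  unfolding dom_def by (rule bounded_coll[where a = "Union (Union f)"])
    (intro fo_intros, use opair_mem_Union2 in blast)

lemma mem_ran [simp]: "y \<epsilon> ran f <-> (\<exists>x. opair x y \<epsilon> f)"
  unfolding ran_def by (rule bounded_coll[where a = "Union (Union f)"])
    (intro fo_intros, use opair_mem_Union2 in blast)

lemma mem_val: "z \<epsilon> val f x <-> (\<exists>y. opair x y \<epsilon> f \<and> z \<epsilon> y)"
  unfolding val_def by (rule bounded_coll[where a = "Union (Union (Union f))"])
    (intro fo_intros, use opair_mem_Union2 mem_Union in blast)

lemma mem_prod_iff: "p \<epsilon> prod a b <-> (\<exists>x y. x \<epsilon> a \<and> y \<epsilon> b \<and> p = opair x y)"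
  unfolding prod_def by (rule bounded_coll[where a = "Pow (Pow (union2 a b))"])
    (intro fo_intros, auto simp: opair_def subset_def)

lemma opair_mem_prod [simp]: "opair x y \<epsilon> prod a b <-> x \<epsilon> a \<and> y \<epsilon> b"
  by (auto simp: mem_prod_iff)

lemma fot_dom [fo_intros]: "fot mem t ==> fot mem (\<lambda>e. dom (t e))"
  by (rule fot_sub1) (rule fot_set, rule mem_dom, intro fo_intros)

lemma fot_ran [fo_intros]: "fot mem t ==> fot mem (\<lambda>e. ran (t e))"
  by (rule fot_sub1) (rule fot_set, rule mem_ran, intro fo_intros)

lemma fot_prod [fo_intros]: "fot mem t ==> fot mem u ==> fot mem (\<lambda>e. prod (t e) (u e))"
  by (rule fot_sub2) (rule fot_set, rule mem_prod_iff, intro fo_intros)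

lemma fot_val [fo_intros]: "fot mem t ==> fot mem u ==> fot mem (\<lambda>e. val (t e) (u e))"
  by (rule fot_sub2) (rule fot_set, rule mem_val, intro fo_intros)

subsection \<open>Functions\<close>

lemma fo_partial_fun [fo_intros]: "fot mem t ==> fo mem (\<lambda>e. partial_fun (t e))"
  by (rule fo_sub1) (unfold partial_fun_def, intro fo_intros)

lemma fo_function_on [fo_intros]: "fot mem t ==> fot mem u ==> fo mem (\<lambda>e. function_on (t e) (u e))"
  by (rule fo_sub2) (unfold function_on_def, intro fo_intros)

lemma partial_funD: "partial_fun f ==> opair x y \<epsilon> f ==> opair x z \<epsilon> f ==> y = z"
  unfolding partial_fun_def by blast

lemma app_eq: "partial_fun f ==> opair x y \<epsilon> f ==> app f x = y"
  unfolding app_def by (rule the_equality) (auto dest: partial_funD)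

lemma val_eq: "partial_fun f ==> opair x y \<epsilon> f ==> val f x = y"
  by (rule set_eqI) (auto simp: mem_val dest: partial_funD)

lemma function_on_dom: "function_on f a ==> dom f = a"
  by (auto simp: function_on_def set_eq_iff)

lemma function_on_partial: "function_on f a ==> partial_fun f"
  by (simp add: function_on_def)

lemma function_on_val: "function_on f a ==> x \<epsilon> a ==> opair x (val f x) \<epsilon> f"
  unfolding function_on_def using val_eq by metis

lemma function_on_app: "function_on f a ==> x \<epsilon> a ==> app f x = val f x"
  by (rule app_eq) (auto intro: function_on_partial function_on_val)

lemma function_on_mem_dom: "function_on f a ==> opair x y \<epsilon> f ==> x \<epsilon> a"
  unfolding function_on_def by blast

lemma function_on_opair_iff: "function_on f a ==> opair x y \<epsilon> f <-> x \<epsilon> a \<and> y = val f x"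
  using function_on_val val_eq function_on_partial function_on_mem_dom by metis

lemma function_on_mem: "function_on f a ==> p \<epsilon> f <-> (\<exists>x. x \<epsilon> a \<and> p = opair x (val f x))"
proof -
  assume f: "function_on f a"
  have "\<forall>p. p \<epsilon> f --> (\<exists>x y. p = opair x y)"
    using f unfolding function_on_def partial_fun_def by (elim conjE)
  then show ?thesis
    using function_on_opair_iff[OF f] by auto
qed

lemma function_eqI:
  assumes "function_on f a" "function_on g a" "\<And>x. x \<epsilon> a ==> val f x = val g x"
  shows "f = g"
  by (rule set_eqI) (use assms in \<open>auto simp: function_on_mem[OF assms(1)] function_on_mem[OF assms(2)]\<close>)

lemma maps_iff: "maps f a b <-> function_on f a \<and> (\<forall>x y. opair x y \<epsilon> f --> y \<epsilon> b)"
  unfolding maps_def using function_on_app function_on_opair_iff by metis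

lemma injection_iff: "injection f a b <-> function_on f a \<and> (\<forall>x y. opair x y \<epsilon> f --> y \<epsilon> b) \<and>
    (\<forall>x y z. opair x z \<epsilon> f \<and> opair y z \<epsilon> f --> x = y)"
proof (cases "function_on f a")
  case True
  note eqs = function_on_opair_iff[OF True] function_on_app[OF True]
  show ?thesis unfolding injection_def maps_iff using True eqs by (simp cong: conj_cong, blast?)
next
  case False
  then show ?thesis by (simp add: injection_def maps_iff)
qed

lemma bijection_iff: "bijection f a b <-> injection f a b \<and> (\<forall>y. y \<epsilon> b --> (\<exists>x. opair x y \<epsilon> f))"
proof (cases "function_on f a")
  case True
  note eqs = function_on_opair_iff[OF True] function_on_app[OF True]
  show ?thesis unfolding bijection_def using eqs by (simp cong: conj_cong, blast?)
next
  case False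
  then show ?thesis by (simp add: bijection_def injection_iff)
qed

lemma fo_maps [fo_intros]: "fot mem t ==> fot mem u ==> fot mem w ==> fo mem (\<lambda>e. maps (t e) (u e) (w e))"
  by (rule fo_sub3) (unfold maps_iff, intro fo_intros)

lemma fo_injection [fo_intros]:
  "fot mem t ==> fot mem u ==> fot mem w ==> fo mem (\<lambda>e. injection (t e) (u e) (w e))"
  by (rule fo_sub3) (unfold injection_iff, intro fo_intros)

lemma fo_bijection [fo_intros]:
  "fot mem t ==> fot mem u ==> fot mem w ==> fo mem (\<lambda>e. bijection (t e) (u e) (w e))"
  by (rule fo_sub3) (unfold bijection_iff, intro fo_intros)

lemma fo_lepoll [fo_intros]: "fot mem t ==> fot mem u ==> fo mem (\<lambda>e. lepoll (t e) (u e))"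
  by (rule fo_sub2) (unfold lepoll_def, intro fo_intros)

lemma fo_eqpoll [fo_intros]: "fot mem t ==> fot mem u ==> fo mem (\<lambda>e. eqpoll (t e) (u e))"
  by (rule fo_sub2) (unfold eqpoll_def, intro fo_intros)

definition lam :: "'v => ('v => 'v) => 'v" where
  "lam a F = (SET p. \<exists>x. x \<epsilon> a \<and> p = opair x (F x))"

lemma mem_lam: "fot1 F ==> p \<epsilon> lam a F <-> (\<exists>x. x \<epsilon> a \<and> p = opair x (F x))"
  unfolding lam_def by (rule mem_image) (intro fo_intros)

lemma opair_mem_lam: "fot1 F ==> opair x y \<epsilon> lam a F <-> x \<epsilon> a \<and> y = F x"
  by (auto simp: mem_lam)

lemma function_on_lam: "fot1 F ==> function_on (lam a F) a"
  unfolding function_on_def partial_fun_def by (auto simp: mem_lam)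

lemma val_lam: "fot1 F ==> x \<epsilon> a ==> val (lam a F) x = F x"
  by (rule val_eq[OF function_on_partial[OF function_on_lam]]) (auto simp: opair_mem_lam)

subsection \<open>Ordinals\<close>

lemma fo_transitive [fo_intros]: "fot mem t ==> fo mem (\<lambda>e. transitive (t e))"
  by (rule fo_sub1) (unfold transitive_def, intro fo_intros)

lemma fo_ordinal [fo_intros]: "fot mem t ==> fo mem (\<lambda>e. ordinal (t e))"
  by (rule fo_sub1) (unfold ordinal_def, intro fo_intros)

lemma transitiveD: "transitive a ==> x \<epsilon> a ==> y \<epsilon> x ==> y \<epsilon> a"
  unfolding transitive_def subset_def by blast

lemma ordinal_transitive: "ordinal a ==> transitive a"
  by (simp add: ordinal_def)

lemma ordinal_mem: "ordinal a ==> x \<epsilon> a ==> ordinal x"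
  unfolding ordinal_def by (meson transitiveD)

lemma ordinal_trans: "ordinal a ==> x \<epsilon> a ==> y \<epsilon> x ==> y \<epsilon> a"
  using ordinal_transitive transitiveD by blast

lemma ordinal_subset: "ordinal a ==> x \<epsilon> a ==> x \<sqsubseteq> a"
  using ordinal_trans subset_def by blast

lemma ordinal_induct:
  assumes "fo1 P" "ordinal \<alpha>"
    "\<And>\<alpha>. ordinal \<alpha> ==> (\<And>\<beta>. \<beta> \<epsilon> \<alpha> ==> P \<beta>) ==> P \<alpha>"
  shows "P \<alpha>"
proof (rule ccontr)
  assume "\<not> P \<alpha>"
  have "fo mem (\<lambda>e. \<not> P (e 0))" by (intro fo_intros assms)
  from least_on[OF this, of \<alpha> "succ \<alpha>"] \<open>\<not> P \<alpha>\<close>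
  obtain y where y: "y \<epsilon> succ \<alpha>" "\<not> P y" "\<And>z. z \<epsilon> y ==> z \<epsilon> succ \<alpha> ==> P z" by auto
  then have "ordinal y" using assms(2) ordinal_mem by auto
  moreover have "z \<epsilon> succ \<alpha>" if "z \<epsilon> y" for z using that y(1) assms(2) ordinal_trans by auto
  ultimately show False using assms(3)[of y] y by blast
qed

lemma ordinal_least:
  assumes "fo1 P" "ordinal \<alpha>" "P \<alpha>"
  obtains \<beta> where "ordinal \<beta>" "P \<beta>" "\<And>\<gamma>. \<gamma> \<epsilon> \<beta> ==> \<not> P \<gamma>"
proof -
  have "fo mem (\<lambda>e. \<not> P (e 0))" by (intro fo_intros assms)
  from ordinal_induct[OF this assms(2)] assms(3) that show thesis by blast
qed

lemma ordinal_linear: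
  assumes "ordinal \<alpha>" "ordinal \<beta>"
  shows "\<alpha> \<epsilon> \<beta> \<or> \<alpha> = \<beta> \<or> \<beta> \<epsilon> \<alpha>"
proof -
  have "\<forall>\<beta>. ordinal \<beta> --> \<alpha> \<epsilon> \<beta> \<or> \<alpha> = \<beta> \<or> \<beta> \<epsilon> \<alpha>"
  proof (rule ordinal_induct[where P = "\<lambda>\<alpha>. \<forall>\<beta>. ordinal \<beta> --> \<alpha> \<epsilon> \<beta> \<or> \<alpha> = \<beta> \<or> \<beta> \<epsilon> \<alpha>", OF _ assms(1)])
    show "fo mem (\<lambda>e. \<forall>\<beta>. ordinal \<beta> --> e 0 \<epsilon> \<beta> \<or> e 0 = \<beta> \<or> \<beta> \<epsilon> e 0)"
      by (intro fo_intros)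
    fix \<alpha> assume \<alpha>: "ordinal \<alpha>" and IH: "\<And>\<alpha>'. \<alpha>' \<epsilon> \<alpha> ==> \<forall>\<beta>. ordinal \<beta> --> \<alpha>' \<epsilon> \<beta> \<or> \<alpha>' = \<beta> \<or> \<beta> \<epsilon> \<alpha>'"
    show "\<forall>\<beta>. ordinal \<beta> --> \<alpha> \<epsilon> \<beta> \<or> \<alpha> = \<beta> \<or> \<beta> \<epsilon> \<alpha>"
    proof (intro allI impI)
      fix \<beta> assume "ordinal \<beta>"
      then show "\<alpha> \<epsilon> \<beta> \<or> \<alpha> = \<beta> \<or> \<beta> \<epsilon> \<alpha>"
      proof (rule ordinal_induct[where P = "\<lambda>\<beta>. \<alpha> \<epsilon> \<beta> \<or> \<alpha> = \<beta> \<or> \<beta> \<epsilon> \<alpha>", rotated])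
        show "fo mem (\<lambda>e. \<alpha> \<epsilon> e 0 \<or> \<alpha> = e 0 \<or> e 0 \<epsilon> \<alpha>)" by (intro fo_intros)
        fix \<beta> assume \<beta>: "ordinal \<beta>" and IH': "\<And>\<beta>'. \<beta>' \<epsilon> \<beta> ==> \<alpha> \<epsilon> \<beta>' \<or> \<alpha> = \<beta>' \<or> \<beta>' \<epsilon> \<alpha>"
        show "\<alpha> \<epsilon> \<beta> \<or> \<alpha> = \<beta> \<or> \<beta> \<epsilon> \<alpha>"
        proof (cases "(\<forall>\<beta>'. \<beta>' \<epsilon> \<beta> --> \<beta>' \<epsilon> \<alpha>) \<and> (\<forall>\<alpha>'. \<alpha>' \<epsilon> \<alpha> --> \<alpha>' \<epsilon> \<beta>)")
          case True
          then show ?thesis by (simp add: set_eq_iff) blast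
        next
          case False
          then show ?thesis using IH IH' \<alpha> \<beta> ordinal_trans by blast
        qed
      qed
    qed
  qed
  with assms(2) show ?thesis by blast
qed

lemma ordinal_subset_iff:
  assumes "ordinal \<alpha>" "ordinal \<beta>"
  shows "\<alpha> \<sqsubseteq> \<beta> <-> \<alpha> \<epsilon> \<beta> \<or> \<alpha> = \<beta>"
  using ordinal_linear[OF assms] ordinal_subset[OF assms(2), of \<alpha>] subsetD[of \<alpha> \<beta> \<beta>] by auto

lemma ordinal_not_mem: "ordinal \<alpha> ==> ordinal \<beta> ==> \<not> \<alpha> \<epsilon> \<beta> ==> \<beta> \<sqsubseteq> \<alpha>"
  using ordinal_linear[of \<alpha> \<beta>] ordinal_subset[of \<alpha> \<beta>] subset_refl by blast

lemma ordinalI: "(\<And>x y. x \<epsilon> a ==> y \<epsilon> x ==> y \<epsilon> a) ==> (\<And>x. x \<epsilon> a ==> ordinal x) ==> ordinal a"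
  unfolding ordinal_def transitive_def subset_def by blast

lemma ordinal_empty [simp]: "ordinal empty"
  by (rule ordinalI) auto

lemma ordinal_succ: "ordinal a ==> ordinal (succ a)"
  by (rule ordinalI) (auto intro: ordinal_trans ordinal_mem)

lemma ordinal_Union: "(\<And>x. x \<epsilon> a ==> ordinal x) ==> ordinal (Union a)"
proof (rule ordinalI)
  assume *: "\<And>x. x \<epsilon> a ==> ordinal x"
  fix x assume "x \<epsilon> Union a"
  then obtain z where z: "z \<epsilon> a" "x \<epsilon> z" by auto
  then show "ordinal x" using * ordinal_mem by blast
  fix y assume "y \<epsilon> x"
  then show "y \<epsilon> Union a" using ordinal_trans[OF *[OF z(1)] z(2)] z(1) by auto
qed

lemma succ_mem_or_eq: "ordinal \<beta> ==> \<alpha> \<epsilon> \<beta> ==> succ \<alpha> \<epsilon> \<beta> \<or> succ \<alpha> = \<beta>"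
  using ordinal_linear[OF ordinal_succ[OF ordinal_mem], of \<beta> \<alpha> \<beta>] mem_asym by auto

lemma succ_inject [simp]: "succ a = succ b <-> a = b"
proof
  assume "succ a = succ b"
  then have "a \<epsilon> succ b" "b \<epsilon> succ a" by (metis mem_succ)+
  then show "a = b" using mem_asym[of a b] by auto
qed simp

lemma succ_not_empty [simp]: "succ a \<noteq> empty" "empty \<noteq> succ a"
  using mem_succ mem_empty by metis+

lemma Union_succ: "ordinal a ==> Union (succ a) = a"
  by (rule set_eqI) (auto intro: ordinal_trans)

lemma no_set_of_all_ordinals: "\<exists>\<alpha>. ordinal \<alpha> \<and> \<not> \<alpha> \<epsilon> a"
proof (rule ccontr)
  assume *: "\<not> ?thesis"
  have f: "fo1 ordinal" by (intro fo_intros)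
  let ?o = "SET x. x \<epsilon> a \<and> ordinal x"
  have "ordinal ?o"
    by (rule ordinalI) (use * ordinal_mem in \<open>auto simp: mem_sep[OF f]\<close>)
  then have "?o \<epsilon> ?o" using * mem_sep[OF f] by blast
  then show False by simp
qed

subsection \<open>Natural numbers\<close>

lemma fo_natural [fo_intros]: "fot mem t ==> fo mem (\<lambda>e. natural (t e))"
  by (rule fo_sub1) (unfold natural_def, intro fo_intros)

lemma natural_ordinal: "natural n ==> ordinal n"
  by (simp add: natural_def)

lemma natural_empty [simp]: "natural empty"
  by (auto simp: natural_def)

lemma natural_succ: "natural n ==> natural (succ n)"
  by (auto simp: natural_def intro: ordinal_succ)

lemma natural_mem: "natural n ==> m \<epsilon> n ==> natural m"
  unfolding natural_def using ordinal_mem ordinal_trans by auto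

lemma natural_cases: "natural n ==> n = empty \<or> (\<exists>k. natural k \<and> n = succ k)"
proof -
  assume n: "natural n"
  then consider "n = empty" | k where "n = succ k" unfolding natural_def by auto
  then show ?thesis using n natural_mem[of n] by cases auto
qed

lemma natural_induct:
  assumes "fo1 P" "natural n" "P empty" "\<And>n. natural n ==> P n ==> P (succ n)"
  shows "P n"
proof -
  have "natural n --> P n"
  proof (rule ordinal_induct[where P = "\<lambda>n. natural n --> P n"])
    show "fo mem (\<lambda>e. natural (e 0) --> P (e 0))" by (intro fo_intros assms)
    fix \<alpha> assume "\<And>\<beta>. \<beta> \<epsilon> \<alpha> ==> natural \<beta> --> P \<beta>"
    then show "natural \<alpha> --> P \<alpha>" using natural_cases[of \<alpha>] assms(3,4) by auto
  qed (use assms natural_ordinal in auto)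
  with assms(2) show ?thesis by simp
qed

lemma mem_omega [simp]: "n \<epsilon> omega <-> natural n"
proof -
  have "\<exists>w. (\<exists>z. z \<epsilon> w \<and> (\<forall>x. \<not> x \<epsilon> z)) \<and> (\<forall>x. x \<epsilon> w --> (\<exists>y. y \<epsilon> w \<and> (\<forall>z. z \<epsilon> y <-> z \<epsilon> x \<or> z = x)))"
    using zfc unfolding ZFC_def ZF_minus_def by simp
  then obtain w z where "z \<epsilon> w" "\<forall>x. \<not> x \<epsilon> z"
    and w: "\<forall>x. x \<epsilon> w --> (\<exists>y. y \<epsilon> w \<and> (\<forall>z. z \<epsilon> y <-> z \<epsilon> x \<or> z = x))" by blast
  then have 0: "empty \<epsilon> w" by (metis mem_empty set_eq_iff)
  have S: "succ x \<epsilon> w" if "x \<epsilon> w" for x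
    using w that by (metis mem_succ set_eq_iff)
  have "n \<epsilon> w" if "natural n" for n
    by (rule natural_induct[where P = "\<lambda>n. n \<epsilon> w", OF _ that]) (intro fo_intros, auto intro: 0 S)
  then show ?thesis unfolding omega_def
    by (intro bounded_coll[where a = w]) (intro fo_intros)
qed

lemma ordinal_omega [simp]: "ordinal omega"
  by (rule ordinalI) (auto intro: natural_mem natural_ordinal)

lemma natural_num [simp]: "natural (num k)"
  by (induction k) (auto intro: natural_succ)

lemma num_inject [simp]: "num j = num k <-> j = k"
proof (induction j arbitrary: k)
  case 0
  then show ?case by (cases k) auto
next
  case (Suc j)
  then show ?case by (cases k) auto
qed

subsection \<open>Transfinite recursion\<close>

definition restrict :: "'v => 'v => 'v" where
  "restrict f a = (SET p. p \<epsilon> f \<and> (\<exists>x y. x \<epsilon> a \<and> p = opair x y))"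

lemma mem_restrict: "p \<epsilon> restrict f a <-> p \<epsilon> f \<and> (\<exists>x y. x \<epsilon> a \<and> p = opair x y)"
  unfolding restrict_def by (rule mem_sep) (intro fo_intros)

lemma fot_restrict [fo_intros]: "fot mem t ==> fot mem u ==> fot mem (\<lambda>e. restrict (t e) (u e))"
  by (rule fot_sub2) (rule fot_set, rule mem_restrict, intro fo_intros)

lemma function_on_restrict: "function_on f a ==> b \<sqsubseteq> a ==> function_on (restrict f b) b"
  unfolding function_on_def partial_fun_def mem_restrict subset_def by simp metis

lemma val_restrict: "x \<epsilon> b ==> val (restrict f b) x = val f x"
  by (rule set_eqI) (auto simp: mem_val mem_restrict)

definition recursive_on :: "('v => 'v) => 'v => 'v => bool" where
  "recursive_on G f \<alpha> <-> ordinal \<alpha> \<and> function_on f \<alpha> \<and> (\<forall>\<beta>. \<beta> \<epsilon> \<alpha> --> val f \<beta> = G (restrict f \<beta>))"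

definition rec :: "('v => 'v) => 'v => 'v" where
  "rec G \<alpha> = G (SET p. \<exists>f. recursive_on G f \<alpha> \<and> p \<epsilon> f)"

context
  fixes G assumes G: "fot1 G"
begin

lemma fo_recursive_on: "fo mem (\<lambda>e. recursive_on G (e 0) (e (Suc 0)))"
  unfolding recursive_on_def by (intro fo_intros fot_sub1[OF G])

lemma recursive_on_restrict:
  assumes "recursive_on G f \<alpha>" "\<beta> \<epsilon> \<alpha>"
  shows "recursive_on G (restrict f \<beta>) \<beta>"
proof -
  have \<alpha>: "ordinal \<alpha>" using assms unfolding recursive_on_def by simp
  have "restrict (restrict f \<beta>) \<gamma> = restrict f \<gamma>" if "\<gamma> \<epsilon> \<beta>" for \<gamma>
    by (rule set_eqI) (use that ordinal_trans[OF ordinal_mem[OF \<alpha> assms(2)]] in \<open>auto simp: mem_restrict\<close>)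
  moreover have "val f \<gamma> = G (restrict f \<gamma>)" if "\<gamma> \<epsilon> \<beta>" for \<gamma>
    using assms ordinal_trans[OF \<alpha> assms(2) that] unfolding recursive_on_def by blast
  moreover have "function_on (restrict f \<beta>) \<beta>"
    by (rule function_on_restrict[OF _ ordinal_subset[OF \<alpha> assms(2)]]) (use assms in \<open>simp add: recursive_on_def\<close>)
  ultimately show ?thesis unfolding recursive_on_def
    using ordinal_mem[OF \<alpha> assms(2)] by (simp add: val_restrict)
qed

lemma recursive_on_unique:
  assumes "recursive_on G f \<alpha>" "recursive_on G g \<alpha>"
  shows "f = g"
proof -
  have \<alpha>: "ordinal \<alpha>" using assms unfolding recursive_on_def by simp
  have "\<forall>f g. recursive_on G f \<alpha> --> recursive_on G g \<alpha> --> f = g"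
  proof (rule ordinal_induct[where P = "\<lambda>\<alpha>. \<forall>f g. recursive_on G f \<alpha> --> recursive_on G g \<alpha> --> f = g", OF _ \<alpha>])
    show "fo mem (\<lambda>e. \<forall>f g. recursive_on G f (e 0) --> recursive_on G g (e 0) --> f = g)"
      by (intro fo_intros fo_sub2[OF fo_recursive_on])
    fix \<alpha> assume IH: "\<And>\<beta>. \<beta> \<epsilon> \<alpha> ==> \<forall>f g. recursive_on G f \<beta> --> recursive_on G g \<beta> --> f = g"
    show "\<forall>f g. recursive_on G f \<alpha> --> recursive_on G g \<alpha> --> f = g"
    proof (intro allI impI)
      fix f g assume f: "recursive_on G f \<alpha>" and g: "recursive_on G g \<alpha>"
      show "f = g"
      proof (rule function_eqI[of _ \<alpha>])
        fix \<beta> assume "\<beta> \<epsilon> \<alpha>"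
        then have "restrict f \<beta> = restrict g \<beta>"
          using IH recursive_on_restrict[OF f] recursive_on_restrict[OF g] by simp
        moreover have "val f \<beta> = G (restrict f \<beta>)" "val g \<beta> = G (restrict g \<beta>)"
          using f g \<open>\<beta> \<epsilon> \<alpha>\<close> by (simp_all add: recursive_on_def)
        ultimately show "val f \<beta> = val g \<beta>" by simp
      qed (use f g in \<open>auto simp: recursive_on_def\<close>)
    qed
  qed
  with assms show ?thesis by blast
qed

lemma mem_rec_approx: "recursive_on G f \<alpha> ==> (SET p. \<exists>f. recursive_on G f \<alpha> \<and> p \<epsilon> f) = f"
proof -
  assume f: "recursive_on G f \<alpha>"
  then have "(\<lambda>p. \<exists>f. recursive_on G f \<alpha> \<and> p \<epsilon> f) = (\<lambda>p. p \<epsilon> f)"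
    using recursive_on_unique by blast
  moreover have "x \<epsilon> (SET p. p \<epsilon> f) <-> x \<epsilon> f" for x by (rule mem_coll) blast
  ultimately show ?thesis by (simp add: set_eqI)
qed

lemma rec_eq_if: "recursive_on G f \<alpha> ==> rec G \<alpha> = G f"
  unfolding rec_def by (simp add: mem_rec_approx)

lemma fot_rec0: "fot mem (\<lambda>e. rec G (e 0))"
  unfolding rec_def
proof (rule fot_sub1[OF G])
  have "p \<epsilon> (SET p. \<exists>f. recursive_on G f \<alpha> \<and> p \<epsilon> f) <-> (\<exists>f. recursive_on G f \<alpha> \<and> p \<epsilon> f)" for p \<alpha>
  proof (cases "\<exists>f. recursive_on G f \<alpha>")
    case True
    then show ?thesis using mem_rec_approx recursive_on_unique by metis
  next
    case False
    then have "\<exists>a. \<forall>p. p \<epsilon> a <-> (\<exists>f. recursive_on G f \<alpha> \<and> p \<epsilon> f)" by (intro exI[of _ empty]) simp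
    then show ?thesis by (rule mem_coll)
  qed
  then show "fot mem (\<lambda>e. SET p. \<exists>f. recursive_on G f (e 0) \<and> p \<epsilon> f)"
    by (rule fot_set) (intro fo_intros fo_sub2[OF fo_recursive_on])
qed

lemmas fot_rec = fot_sub1[OF fot_rec0]

lemma recursive_on_lam: "ordinal \<alpha> ==> recursive_on G (lam \<alpha> (rec G)) \<alpha>"
proof (rule ordinal_induct[where P = "\<lambda>\<alpha>. recursive_on G (lam \<alpha> (rec G)) \<alpha>"])
  have "p \<epsilon> lam \<alpha> (rec G) <-> (\<exists>x. x \<epsilon> \<alpha> \<and> p = opair x (rec G x))" for p \<alpha>
    by (rule mem_lam[OF fot_rec0])
  then have "fot mem (\<lambda>e. lam (e 0) (rec G))"
    by (rule fot_set) (intro fo_intros fot_rec)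
  then show "fo mem (\<lambda>e. recursive_on G (lam (e 0) (rec G)) (e 0))"
    by (intro fo_sub2[OF fo_recursive_on] fot_var)
  fix \<alpha> assume \<alpha>: "ordinal \<alpha>" and IH: "\<And>\<beta>. \<beta> \<epsilon> \<alpha> ==> recursive_on G (lam \<beta> (rec G)) \<beta>"
  have "restrict (lam \<alpha> (rec G)) \<beta> = lam \<beta> (rec G)" if "\<beta> \<epsilon> \<alpha>" for \<beta>
    by (rule set_eqI) (use ordinal_trans[OF \<alpha> that] in \<open>auto simp: mem_restrict mem_lam[OF fot_rec0]\<close>)
  then show "recursive_on G (lam \<alpha> (rec G)) \<alpha>"
    unfolding recursive_on_def using \<alpha> rec_eq_if[OF IH] function_on_lam[OF fot_rec0] val_lam[OF fot_rec0]
    by simp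
qed

lemma rec_eq: "ordinal \<alpha> ==> rec G \<alpha> = G (lam \<alpha> (rec G))"
  by (rule rec_eq_if[OF recursive_on_lam])

end

end

context zfc_universe
begin

subsection \<open>Choice\<close>

lemma choice: "\<exists>f. \<forall>x. x \<epsilon> a --> (\<exists>y. y \<epsilon> x) --> val f x \<epsilon> x"
proof -
  define P where "P x <-> (\<exists>y. y \<epsilon> x)" for x
  have foP: "fo1 P" unfolding P_def by (intro fo_intros)
  define a0 where "a0 = (SET x. x \<epsilon> a \<and> P x)"
  define b where "b = (SET y. \<exists>x. x \<epsilon> a0 \<and> y = prod (upair x x) x)"
  have b: "y \<epsilon> b <-> (\<exists>x. x \<epsilon> a \<and> P x \<and> y = prod (upair x x) x)" for y
    unfolding b_def a0_def by (subst mem_image) (intro fo_intros, auto simp: mem_sep[OF foP])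
  have AC: "(\<forall>x. x \<epsilon> b --> (\<exists>y. y \<epsilon> x)) \<and>
          (\<forall>x y z. x \<epsilon> b \<and> y \<epsilon> b \<and> z \<epsilon> x \<and> z \<epsilon> y --> x = y) -->
          (\<exists>c. \<forall>x. x \<epsilon> b --> (\<exists>!y. y \<epsilon> x \<and> y \<epsilon> c))" for b
    using zfc unfolding ZFC_def by (elim conjE) (erule spec)
  have "\<exists>c. \<forall>x. x \<epsilon> b --> (\<exists>!y. y \<epsilon> x \<and> y \<epsilon> c)"
  proof (rule AC[THEN mp], intro conjI allI impI)
    fix x assume "x \<epsilon> b" then show "\<exists>y. y \<epsilon> x" unfolding b P_def by (force simp: mem_prod_iff)
  next
    fix x y z assume "x \<epsilon> b \<and> y \<epsilon> b \<and> z \<epsilon> x \<and> z \<epsilon> y"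
    then show "x = y" unfolding b by (auto simp: mem_prod_iff)
  qed
  then obtain c where c: "\<And>x. x \<epsilon> b ==> \<exists>!y. y \<epsilon> x \<and> y \<epsilon> c" by blast
  let ?f = "inter c (Union b)"
  have "val ?f x \<epsilon> x" if x: "x \<epsilon> a" "P x" for x
  proof -
    have "prod (upair x x) x \<epsilon> b" using x b by blast
    from c[OF this] obtain p where p: "p \<epsilon> prod (upair x x) x" "p \<epsilon> c"
      and u: "\<And>q. q \<epsilon> prod (upair x x) x ==> q \<epsilon> c ==> q = p" by blast
    from p obtain y where y: "p = opair x y" "y \<epsilon> x" by (auto simp: mem_prod_iff)
    have "opair x z \<epsilon> ?f <-> z = y" for z
    proof
      assume "opair x z \<epsilon> ?f"
      then obtain w where "w \<epsilon> b" "opair x z \<epsilon> w" "opair x z \<epsilon> c" by auto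
      then have "opair x z \<epsilon> prod (upair x x) x" unfolding b by (auto simp: mem_prod_iff)
      then show "z = y" using u[of "opair x z"] \<open>opair x z \<epsilon> c\<close> y by auto
    next
      assume "z = y" then show "opair x z \<epsilon> ?f" using p y \<open>prod (upair x x) x \<epsilon> b\<close> by auto
    qed
    then have "val ?f x = y" by (intro set_eqI) (simp only: mem_val, simp)
    with y show ?thesis by simp
  qed
  then show ?thesis unfolding P_def by blast
qed

lemma choose_function:
  assumes R: "fo2 R" and ex: "\<And>x. x \<epsilon> a ==> \<exists>y. y \<epsilon> b \<and> R x y"
  obtains f where "function_on f a" "\<And>x. x \<epsilon> a ==> val f x \<epsilon> b" "\<And>x. x \<epsilon> a ==> R x (val f x)"
proof -
  define F where "F x = (SET y. y \<epsilon> b \<and> R x y)" for x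
  have F: "y \<epsilon> F x <-> y \<epsilon> b \<and> R x y" for x y
    unfolding F_def by (rule mem_sep) (rule fo_sub2[OF R]; intro fo_intros)
  have fF: "fot1 F"
    by (rule fot_set, rule F) (intro fo_intros fo_sub2[OF R])
  define A where "A = (SET y. \<exists>x. x \<epsilon> a \<and> y = F x)"
  have A: "y \<epsilon> A <-> (\<exists>x. x \<epsilon> a \<and> y = F x)" for y
    unfolding A_def by (rule mem_image[OF fF])
  obtain g where g: "\<And>x. x \<epsilon> A ==> \<exists>y. y \<epsilon> x ==> val g x \<epsilon> x" using choice[of A] by blast
  have "fot mem (\<lambda>e. val g (F (e 0)))" by (intro fo_intros fF)
  note l = function_on_lam[OF this] val_lam[OF this]
  have "val g (F x) \<epsilon> F x" if "x \<epsilon> a" for x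
    by (rule g) (use that A F ex in auto)
  then show thesis by (intro that[of "lam a (\<lambda>x. val g (F x))"]) (use F l in auto)
qed

subsection \<open>Comparison of cardinalities\<close>

lemma lepoll_rel:
  assumes R: "fo2 R" and ex: "\<And>x. x \<epsilon> a ==> \<exists>y. y \<epsilon> b \<and> R x y"
    and inj: "\<And>x x' y. x \<epsilon> a ==> x' \<epsilon> a ==> y \<epsilon> b ==> R x y ==> R x' y ==> x = x'"
  shows "lepoll a b"
proof -
  obtain f where f: "function_on f a" "\<And>x. x \<epsilon> a ==> val f x \<epsilon> b" "\<And>x. x \<epsilon> a ==> R x (val f x)"
    using choose_function[OF R, of a b] ex by blast
  have "injection f a b"
    unfolding injection_iff function_on_opair_iff[OF f(1)] using f inj by metis
  then show ?thesis unfolding lepoll_def by blast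
qed

lemma lepollI:
  assumes F: "fot1 F" and "\<And>x. x \<epsilon> a ==> F x \<epsilon> b"
    and "\<And>x x'. x \<epsilon> a ==> x' \<epsilon> a ==> F x = F x' ==> x = x'"
  shows "lepoll a b"
  by (rule lepoll_rel[where R = "\<lambda>x y. y = F x"]) (intro fo_intros fot_sub1[OF F], use assms in auto)

lemma injection_opair:
  assumes "injection f a b"
  shows "x \<epsilon> a ==> \<exists>y. y \<epsilon> b \<and> opair x y \<epsilon> f" "opair x y \<epsilon> f ==> x \<epsilon> a \<and> y \<epsilon> b"
    "opair x y \<epsilon> f ==> opair x z \<epsilon> f ==> y = z" "opair x z \<epsilon> f ==> opair y z \<epsilon> f ==> x = y"
proof -
  have f: "function_on f a" "\<And>x y. opair x y \<epsilon> f ==> y \<epsilon> b"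
    "\<And>x y z. opair x z \<epsilon> f ==> opair y z \<epsilon> f ==> x = y"
    using assms unfolding injection_iff by blast+
  show "x \<epsilon> a ==> \<exists>y. y \<epsilon> b \<and> opair x y \<epsilon> f" using f(2) function_on_val[OF f(1)] by blast
  show "opair x y \<epsilon> f ==> x \<epsilon> a \<and> y \<epsilon> b" using f(2) function_on_mem_dom[OF f(1)] by blast
  show "opair x y \<epsilon> f ==> opair x z \<epsilon> f ==> y = z" using partial_funD[OF function_on_partial[OF f(1)]] .
  show "opair x z \<epsilon> f ==> opair y z \<epsilon> f ==> x = y" using f(3) .
qed

lemma subset_lepoll: "a \<sqsubseteq> b ==> lepoll a b"
  by (rule lepollI[where F = "\<lambda>x. x"]) (intro fo_intros, auto simp: subset_def)

lemma lepoll_refl [simp]: "lepoll a a"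
  by (simp add: subset_lepoll)

lemma lepoll_trans:
  assumes "lepoll a b" "lepoll b c" shows "lepoll a c"
proof -
  obtain f g where f: "injection f a b" and g: "injection g b c"
    using assms unfolding lepoll_def by blast
  show ?thesis
  proof (rule lepoll_rel[where R = "\<lambda>x z. \<exists>y. opair x y \<epsilon> f \<and> opair y z \<epsilon> g"])
    fix x assume "x \<epsilon> a"
    then show "\<exists>y. y \<epsilon> c \<and> (\<exists>ya. opair x ya \<epsilon> f \<and> opair ya y \<epsilon> g)"
      using injection_opair(1)[OF f] injection_opair(1)[OF g] by meson
  qed (intro fo_intros, use injection_opair(4)[OF f] injection_opair(4)[OF g] in blast)
qed

lemma eqpoll_lepoll: "eqpoll a b ==> lepoll a b"
  unfolding eqpoll_def lepoll_def bijection_def by blast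

lemma eqpoll_rel:
  assumes R: "fo2 R"
    and 1: "\<And>x. x \<epsilon> a ==> \<exists>!y. y \<epsilon> b \<and> R x y" and 2: "\<And>y. y \<epsilon> b ==> \<exists>!x. x \<epsilon> a \<and> R x y"
  shows "eqpoll a b"
proof -
  obtain f where f: "function_on f a" "\<And>x. x \<epsilon> a ==> val f x \<epsilon> b" "\<And>x. x \<epsilon> a ==> R x (val f x)"
    using choose_function[OF R, of a b] 1 by metis
  have "injection f a b"
    unfolding injection_iff function_on_opair_iff[OF f(1)] using f 2 by metis
  moreover have "\<exists>x. opair x y \<epsilon> f" if "y \<epsilon> b" for y
    unfolding function_on_opair_iff[OF f(1)] using f that 1 2 by metis
  ultimately have "bijection f a b" unfolding bijection_iff by blast
  then show ?thesis unfolding eqpoll_def by blast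
qed

lemma bijection_injection: "bijection f a b ==> injection f a b"
  by (simp add: bijection_def)

lemma eqpoll_sym: "eqpoll a b ==> eqpoll b a"
proof -
  assume "eqpoll a b"
  then obtain f where f: "bijection f a b" unfolding eqpoll_def by blast
  note i = injection_opair[OF bijection_injection[OF f]]
  have s: "\<And>y. y \<epsilon> b ==> \<exists>x. opair x y \<epsilon> f" using f unfolding bijection_iff by blast
  show ?thesis
    by (rule eqpoll_rel[where R = "\<lambda>y x. opair x y \<epsilon> f"]) (intro fo_intros, use i s in metis, use i s in metis)
qed

lemma schroeder_bernstein:
  assumes "lepoll a b" "lepoll b a" shows "eqpoll a b"
proof -
  obtain f g where f: "injection f a b" and g: "injection g b a"
    using assms unfolding lepoll_def by blast
  note f = injection_opair[OF f] and g = injection_opair[OF g]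
  define cl where "cl X <-> (\<forall>x. x \<epsilon> a --> (\<forall>y. \<not> opair y x \<epsilon> g) --> x \<epsilon> X) \<and>
     (\<forall>x y z. x \<epsilon> X \<and> opair x y \<epsilon> f \<and> opair y z \<epsilon> g --> z \<epsilon> X)" for X
  define C where "C = (SET x. x \<epsilon> a \<and> (\<forall>X. cl X --> x \<epsilon> X))"
  have C: "x \<epsilon> C <-> x \<epsilon> a \<and> (\<forall>X. cl X --> x \<epsilon> X)" for x
    unfolding C_def cl_def by (rule mem_sep) (intro fo_intros)
  have clC: "cl C" unfolding cl_def
  proof (intro conjI allI impI)
    fix x assume "x \<epsilon> a" "\<forall>y. \<not> opair y x \<epsilon> g" then show "x \<epsilon> C" unfolding C cl_def by blast
  next
    fix x y z assume *: "x \<epsilon> C \<and> opair x y \<epsilon> f \<and> opair y z \<epsilon> g"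
    then show "z \<epsilon> C" using g(2)[of y z] unfolding C cl_def by blast
  qed
  have backward: "\<exists>y. opair y x \<epsilon> g" if "x \<epsilon> a" "\<not> x \<epsilon> C" for x
    using that clC unfolding cl_def by blast
  have inv: "\<exists>x y. x \<epsilon> C \<and> opair x y \<epsilon> f \<and> opair y z \<epsilon> g" if z: "z \<epsilon> C" "opair w z \<epsilon> g" for z w
  proof (rule ccontr)
    assume no: "\<not> ?thesis"
    have d: "x \<epsilon> diff C (upair z z) <-> x \<epsilon> C \<and> x \<noteq> z" for x by simp
    have "cl (diff C (upair z z))" unfolding cl_def d
    proof (intro conjI allI impI)
      fix x assume "x \<epsilon> a" "\<forall>y. \<not> opair y x \<epsilon> g" then show "x \<epsilon> C" using clC unfolding cl_def by blast
    next
      fix x assume "x \<epsilon> a" "\<forall>y. \<not> opair y x \<epsilon> g" then show "x \<noteq> z" using z by blast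
    next
      fix x y z' assume "(x \<epsilon> C \<and> x \<noteq> z) \<and> opair x y \<epsilon> f \<and> opair y z' \<epsilon> g"
      then show "z' \<epsilon> C" using clC unfolding cl_def by blast
    next
      fix x y z' assume "(x \<epsilon> C \<and> x \<noteq> z) \<and> opair x y \<epsilon> f \<and> opair y z' \<epsilon> g"
      then show "z' \<noteq> z" using no by blast
    qed
    then show False using z unfolding C by auto
  qed
  define R where "R x y <-> (x \<epsilon> C \<and> opair x y \<epsilon> f) \<or> (x \<epsilon> a \<and> \<not> x \<epsilon> C \<and> opair y x \<epsilon> g)" for x y
  show ?thesis
  proof (rule eqpoll_rel[where R = R])
    show "fo2 R" unfolding R_def by (intro fo_intros)
    fix x assume x: "x \<epsilon> a"
    show "\<exists>!y. y \<epsilon> b \<and> R x y"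
    proof (cases "x \<epsilon> C")
      case True
      then show ?thesis using f(1)[OF x] f(3)[of x] unfolding R_def by blast
    next
      case False
      then show ?thesis using backward[OF x False] g(2)[of _ x] g(4)[of _ x] x unfolding R_def by blast
    qed
  next
    fix y assume y: "y \<epsilon> b"
    then obtain z where z: "opair y z \<epsilon> g" "z \<epsilon> a" using g(1) by blast
    show "\<exists>!x. x \<epsilon> a \<and> R x y"
    proof (cases "z \<epsilon> C")
      case True
      then obtain x y' where x: "x \<epsilon> C" "opair x y' \<epsilon> f" "opair y' z \<epsilon> g" using inv z by blast
      then have "y' = y" using g(4) z by blast
      with x have "R x y" "x \<epsilon> a" unfolding R_def C by blast+
      moreover have "x' = x" if "R x' y" for x'
        using that x \<open>y' = y\<close> f(4) z True g(3) unfolding R_def by blast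
      ultimately show ?thesis by blast
    next
      case False
      then have "R z y" using z unfolding R_def by blast
      moreover have "x' = z" if "R x' y" for x'
      proof -
        have "\<not> x' \<epsilon> C \<or> \<not> opair x' y \<epsilon> f" using False clC z unfolding cl_def by blast
        then show ?thesis using that z g(3) unfolding R_def by blast
      qed
      ultimately show ?thesis using z by blast
    qed
  qed
qed

lemma well_ordering: "\<exists>\<alpha>. ordinal \<alpha> \<and> eqpoll x \<alpha>"
proof -
  obtain ch where ch: "\<And>y. y \<epsilon> Pow x ==> \<exists>z. z \<epsilon> y ==> val ch y \<epsilon> y" using choice by blast
  define G where "G f = val ch (diff x (ran f))" for f
  have G: "fot1 G" unfolding G_def by (intro fo_intros)
  define F where "F = rec G"
  have fF: "fot1 F" unfolding F_def by (rule fot_rec0[OF G])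
  have foF: "fot mem t ==> fot mem (\<lambda>e. F (t e))" for t by (rule fot_sub1[OF fF])
  define im where "im \<alpha> = (SET y. \<exists>\<beta>. \<beta> \<epsilon> \<alpha> \<and> y = F \<beta>)" for \<alpha>
  have im: "y \<epsilon> im \<alpha> <-> (\<exists>\<beta>. \<beta> \<epsilon> \<alpha> \<and> y = F \<beta>)" for y \<alpha>
    unfolding im_def by (rule mem_image[OF fF])
  have fim: "fot1 im" by (rule fot_set, rule im) (intro fo_intros foF)
  have F: "F \<alpha> = val ch (diff x (im \<alpha>))" if "ordinal \<alpha>" for \<alpha>
  proof -
    have "ran (lam \<alpha> F) = im \<alpha>" by (rule set_eqI) (auto simp: im mem_lam[OF fF])
    then show ?thesis using rec_eq[OF G that] unfolding F_def G_def by simp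
  qed
  have new: "F \<alpha> \<epsilon> x \<and> \<not> F \<alpha> \<epsilon> im \<alpha>" if "ordinal \<alpha>" "\<not> x \<sqsubseteq> im \<alpha>" for \<alpha>
    using F[OF that(1)] ch[of "diff x (im \<alpha>)"] that(2) by (auto simp: subset_def)
  have "\<exists>\<alpha>. ordinal \<alpha> \<and> x \<sqsubseteq> im \<alpha>"
  proof (rule ccontr)
    assume *: "\<not> ?thesis"
    define R where "R y \<alpha> <-> ordinal \<alpha> \<and> F \<alpha> = y" for y \<alpha>
    have inj: "\<alpha> = \<beta>" if "R y \<alpha>" "R y \<beta>" for y \<alpha> \<beta>
      using new[of \<alpha>] new[of \<beta>] * that ordinal_linear[of \<alpha> \<beta>] unfolding R_def im by metis
    have foR: "fo2 R" unfolding R_def by (intro fo_intros foF)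
    define D where "D = (SET y. y \<epsilon> x \<and> (\<exists>\<alpha>. R y \<alpha>))"
    have D: "y \<epsilon> D <-> y \<epsilon> x \<and> (\<exists>\<alpha>. R y \<alpha>)" for y
      unfolding D_def by (rule mem_sep) (intro fo_ex; rule fo_sub2[OF foR]; intro fo_intros)
    have "\<exists>b. \<forall>\<alpha>. \<alpha> \<epsilon> b <-> (\<exists>y. y \<epsilon> D \<and> R y \<alpha>)"
      by (rule replacement[OF foR]) (use D inj in blast)
    then obtain b where b: "\<And>\<alpha>. \<alpha> \<epsilon> b <-> (\<exists>y. y \<epsilon> D \<and> R y \<alpha>)" by blast
    obtain \<alpha> where \<alpha>: "ordinal \<alpha>" "\<not> \<alpha> \<epsilon> b" using no_set_of_all_ordinals by blast
    then have "R (F \<alpha>) \<alpha>" unfolding R_def by simp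
    moreover have "F \<alpha> \<epsilon> x" using new \<alpha> * by blast
    ultimately show False using \<alpha> b D by blast
  qed
  then obtain \<alpha>0 where a0: "ordinal \<alpha>0" "x \<sqsubseteq> im \<alpha>0" by blast
  have f1: "fo mem (\<lambda>e. x \<sqsubseteq> im (e 0))" by (intro fo_intros fot_sub1[OF fim])
  from ordinal_least[where P = "\<lambda>\<alpha>. x \<sqsubseteq> im \<alpha>", OF f1 a0] obtain \<alpha> where \<alpha>: "ordinal \<alpha>" "x \<sqsubseteq> im \<alpha>" "\<And>\<beta>. \<beta> \<epsilon> \<alpha> ==> \<not> x \<sqsubseteq> im \<beta>"
    by blast
  have n: "F \<beta> \<epsilon> x \<and> \<not> F \<beta> \<epsilon> im \<beta>" if "\<beta> \<epsilon> \<alpha>" for \<beta>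
    using new that \<alpha> ordinal_mem by blast
  have "eqpoll \<alpha> x"
  proof (rule eqpoll_rel[where R = "\<lambda>\<beta> y. y = F \<beta>"])
    show "fo mem (\<lambda>e. e (Suc 0) = F (e 0))" by (intro fo_intros foF)
    fix y assume "y \<epsilon> x"
    then obtain \<beta> where \<beta>: "\<beta> \<epsilon> \<alpha>" "y = F \<beta>" using \<alpha>(2) im by (auto simp: subset_def)
    moreover have "\<gamma> = \<beta>" if "\<gamma> \<epsilon> \<alpha>" "y = F \<gamma>" for \<gamma>
      using n[OF \<beta>(1)] n[OF that(1)] that \<beta> ordinal_linear[of \<gamma> \<beta>] ordinal_mem[OF \<alpha>(1)] unfolding im by metis
    ultimately show "\<exists>!\<beta>. \<beta> \<epsilon> \<alpha> \<and> y = F \<beta>" by blast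
  qed (use n in auto)
  then show ?thesis using \<alpha> eqpoll_sym by blast
qed

lemma fo_cardinal [fo_intros]: "fot mem t ==> fo mem (\<lambda>e. cardinal (t e))"
  by (rule fo_sub1) (unfold cardinal_def, intro fo_intros)

lemma fo_card_less [fo_intros]: "fot mem t ==> fot mem u ==> fo mem (\<lambda>e. card_less (t e) (u e))"
  by (rule fo_sub2) (unfold card_less_def, intro fo_intros)

lemma card_lessD: "card_less a \<kappa> ==> \<exists>\<alpha>. \<alpha> \<epsilon> \<kappa> \<and> lepoll a \<alpha>"
  unfolding card_less_def using eqpoll_lepoll by blast

lemma card_lessI:
  assumes "cardinal \<kappa>" "\<beta> \<epsilon> \<kappa>" "lepoll a \<beta>" shows "card_less a \<kappa>"
proof -
  obtain \<alpha> where \<alpha>: "ordinal \<alpha>" "eqpoll a \<alpha>" using well_ordering by blast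
  have k: "ordinal \<kappa>" using assms cardinal_def by blast
  have "\<alpha> \<epsilon> \<kappa>"
  proof (rule ccontr)
    assume "\<not> \<alpha> \<epsilon> \<kappa>"
    then have "lepoll \<kappa> \<beta>"
      using \<alpha> k assms(3) by (meson eqpoll_lepoll eqpoll_sym lepoll_trans ordinal_not_mem subset_lepoll)
    then have "eqpoll \<beta> \<kappa>" using k assms(2) ordinal_subset schroeder_bernstein subset_lepoll by blast
    then show False using assms unfolding cardinal_def by blast
  qed
  with \<alpha> show ?thesis unfolding card_less_def by blast
qed

lemma card_less_mono: "cardinal \<kappa> ==> card_less b \<kappa> ==> lepoll a b ==> card_less a \<kappa>"
  by (meson card_lessD card_lessI lepoll_trans)

lemma lepoll_image:
  assumes "fot1 F" "\<And>y. y \<epsilon> b ==> \<exists>x. x \<epsilon> a \<and> y = F x"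
  shows "lepoll b a"
  by (rule lepoll_rel[where R = "\<lambda>y x. y = F x"]) (intro fo_intros fot_sub1[OF assms(1)], use assms in auto)

subsection \<open>The cumulative hierarchy\<close>

definition Vlev :: "'v => 'v" where
  "Vlev = rec (\<lambda>f. SET x. \<exists>y. y \<epsilon> ran f \<and> x \<sqsubseteq> y)"

lemma mem_hull: "x \<epsilon> (SET x. \<exists>y. y \<epsilon> a \<and> x \<sqsubseteq> y) <-> (\<exists>y. y \<epsilon> a \<and> x \<sqsubseteq> y)"
  by (rule bounded_coll[where a = "Pow (Union a)"]) (intro fo_intros, auto simp: subset_def)

lemma fot_hull: "fot mem (\<lambda>e. SET x. \<exists>y. y \<epsilon> ran (e 0) \<and> x \<sqsubseteq> y)"
  by (rule fot_set, rule mem_hull) (intro fo_intros)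

lemmas fot_Vlev0 = fot_rec0[OF fot_hull, folded Vlev_def]

lemma fot_Vlev [fo_intros]: "fot mem t ==> fot mem (\<lambda>e. Vlev (t e))"
  by (rule fot_sub1[OF fot_Vlev0])

lemma mem_Vlev: "ordinal \<alpha> ==> x \<epsilon> Vlev \<alpha> <-> (\<exists>\<beta>. \<beta> \<epsilon> \<alpha> \<and> x \<sqsubseteq> Vlev \<beta>)"
  by (subst rec_eq[OF fot_hull, of \<alpha>, folded Vlev_def], assumption, subst mem_hull)
    (auto simp: opair_mem_lam[OF fot_Vlev0])

lemma Vlev_subset: "ordinal \<beta> ==> \<alpha> \<epsilon> \<beta> ==> Vlev \<alpha> \<sqsubseteq> Vlev \<beta>"
  unfolding subset_def[of "Vlev \<alpha>"] using mem_Vlev[of \<alpha>] mem_Vlev[of \<beta>] ordinal_mem[of \<beta> \<alpha>] ordinal_trans[of \<beta> \<alpha>]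
  by blast

lemma Vlev_mem: "ordinal \<beta> ==> \<alpha> \<epsilon> \<beta> ==> Vlev \<alpha> \<epsilon> Vlev \<beta>"
  using mem_Vlev by auto

lemma Vlev_closed: "ordinal \<alpha> ==> x \<epsilon> Vlev \<alpha> ==> y \<epsilon> x ==> y \<epsilon> Vlev \<alpha>"
  using mem_Vlev Vlev_subset by (meson subsetD)

lemma transitive_Vlev: "ordinal \<alpha> ==> transitive (Vlev \<alpha>)"
  unfolding transitive_def subset_def using Vlev_closed by blast

lemma Vlev_subset_closed: "ordinal \<alpha> ==> x \<epsilon> Vlev \<alpha> ==> y \<sqsubseteq> x ==> y \<epsilon> Vlev \<alpha>"
  using mem_Vlev subset_trans by meson

lemma ordinal_subset_Vlev: "ordinal \<alpha> ==> \<alpha> \<sqsubseteq> Vlev \<alpha>"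
proof (rule ordinal_induct[where P = "\<lambda>\<alpha>. \<alpha> \<sqsubseteq> Vlev \<alpha>"])
  show "fo mem (\<lambda>e. e 0 \<sqsubseteq> Vlev (e 0))" by (intro fo_intros)
  fix \<alpha> assume "ordinal \<alpha>" "\<And>\<beta>. \<beta> \<epsilon> \<alpha> ==> \<beta> \<sqsubseteq> Vlev \<beta>"
  then show "\<alpha> \<sqsubseteq> Vlev \<alpha>" using mem_Vlev unfolding subset_def[of \<alpha>] by blast
qed

lemma Vset_eq: "ordinal \<alpha> ==> Vset \<alpha> = Vlev \<alpha>"
proof -
  assume \<alpha>: "ordinal \<alpha>"
  have c: "(SET x. \<exists>\<gamma>. \<gamma> \<epsilon> \<beta> \<and> x \<sqsubseteq> app f \<gamma>) = Vlev \<beta>"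
    if "ordinal \<beta>" "\<And>\<gamma>. \<gamma> \<epsilon> \<beta> ==> app f \<gamma> = Vlev \<gamma>" for f \<beta>
  proof (rule set_eqI, subst mem_coll)
    have *: "x \<epsilon> Vlev \<beta> <-> (\<exists>\<gamma>. \<gamma> \<epsilon> \<beta> \<and> x \<sqsubseteq> app f \<gamma>)" for x
      using mem_Vlev[OF that(1), of x] that(2) by (simp cong: conj_cong)
    then show "\<exists>a. \<forall>x. x \<epsilon> a <-> (\<exists>\<gamma>. \<gamma> \<epsilon> \<beta> \<and> x \<sqsubseteq> app f \<gamma>)" by blast
    fix x show "(\<exists>\<gamma>. \<gamma> \<epsilon> \<beta> \<and> x \<sqsubseteq> app f \<gamma>) <-> x \<epsilon> Vlev \<beta>" using * by blast
  qed
  let ?f = "lam (succ \<alpha>) Vlev"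
  have f: "function_on ?f (succ \<alpha>)" "\<And>\<beta>. \<beta> \<epsilon> succ \<alpha> ==> app ?f \<beta> = Vlev \<beta>"
    using function_on_lam[OF fot_Vlev0] val_lam[OF fot_Vlev0] function_on_app by metis+
  have sub: "ordinal \<beta> \<and> (\<forall>\<gamma>. \<gamma> \<epsilon> \<beta> --> \<gamma> \<epsilon> succ \<alpha>)" if "\<beta> \<epsilon> succ \<alpha>" for \<beta>
    using that ordinal_succ[OF \<alpha>] ordinal_mem ordinal_trans by blast
  have "cumulative ?f \<alpha>" unfolding cumulative_def
  proof (intro conjI allI impI f(1))
    fix \<beta> assume "\<beta> \<epsilon> succ \<alpha>"
    then show "app ?f \<beta> = (SET x. \<exists>\<gamma>. \<gamma> \<epsilon> \<beta> \<and> x \<sqsubseteq> app ?f \<gamma>)"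
      using c[of \<beta> ?f] sub[of \<beta>] f(2) by simp
  qed
  moreover have "app g \<alpha> = Vlev \<alpha>" if g: "cumulative g \<alpha>" for g
  proof -
    have fg: "function_on g (succ \<alpha>)" using g unfolding cumulative_def by blast
    have "\<beta> \<epsilon> succ \<alpha> --> val g \<beta> = Vlev \<beta>" if "ordinal \<beta>" for \<beta>
    proof (rule ordinal_induct[where P = "\<lambda>\<beta>. \<beta> \<epsilon> succ \<alpha> --> val g \<beta> = Vlev \<beta>", OF _ that])
      show "fo mem (\<lambda>e. e 0 \<epsilon> succ \<alpha> --> val g (e 0) = Vlev (e 0))" by (intro fo_intros)
      fix \<beta> assume o: "ordinal \<beta>" and IH: "\<And>\<gamma>. \<gamma> \<epsilon> \<beta> ==> \<gamma> \<epsilon> succ \<alpha> --> val g \<gamma> = Vlev \<gamma>"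
      show "\<beta> \<epsilon> succ \<alpha> --> val g \<beta> = Vlev \<beta>"
      proof
        assume b: "\<beta> \<epsilon> succ \<alpha>"
        have "app g \<beta> = (SET x. \<exists>\<gamma>. \<gamma> \<epsilon> \<beta> \<and> x \<sqsubseteq> app g \<gamma>)" using g b unfolding cumulative_def by blast
        also have "\<dots> = Vlev \<beta>" by (rule c[OF o]) (use IH sub[OF b] function_on_app[OF fg] in auto)
        finally show "val g \<beta> = Vlev \<beta>" using function_on_app[OF fg b] by simp
      qed
    qed
    then have "val g \<alpha> = Vlev \<alpha>" using \<alpha> by simp
    then show ?thesis using function_on_app[OF fg, of \<alpha>] by simp
  qed
  ultimately show ?thesis unfolding Vset_def by (intro the_equality) metis+
qed

subsection \<open>Transitive closure\<close>

lemma transitive_superset: "\<exists>t. transitive t \<and> a \<sqsubseteq> t"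
proof -
  define G where "G f = union2 a (Union (Union (ran f)))" for f
  have G: "fot1 G" unfolding G_def by (intro fo_intros)
  define T where "T = rec G"
  have fT: "fot1 T" unfolding T_def by (rule fot_rec0[OF G])
  have T: "x \<epsilon> T \<alpha> <-> x \<epsilon> a \<or> (\<exists>\<beta> y. \<beta> \<epsilon> \<alpha> \<and> y \<epsilon> T \<beta> \<and> x \<epsilon> y)" if "ordinal \<alpha>" for x \<alpha>
  proof -
    have "T \<alpha> = G (lam \<alpha> T)" using rec_eq[OF G that] unfolding T_def .
    then show ?thesis by (auto simp: G_def opair_mem_lam[OF fT])
  qed
  let ?t = "Union (SET y. \<exists>n. n \<epsilon> omega \<and> y = T n)"
  have t: "x \<epsilon> ?t <-> (\<exists>n. natural n \<and> x \<epsilon> T n)" for x 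
    unfolding mem_Union mem_image[OF fT] by auto
  have "transitive ?t" unfolding transitive_def subset_def t
    using T natural_succ natural_ordinal by (metis mem_succ)
  moreover have "a \<sqsubseteq> ?t" unfolding subset_def t using T[of empty] by (metis natural_empty ordinal_empty)
  ultimately show ?thesis by blast
qed

lemma mem_trcl: "x \<epsilon> trcl a <-> (\<forall>t. transitive t \<and> a \<sqsubseteq> t --> x \<epsilon> t)"
proof -
  obtain t where "transitive t" "a \<sqsubseteq> t" using transitive_superset by blast
  then show ?thesis unfolding trcl_def by (intro bounded_coll[where a = t]) (intro fo_intros, auto)
qed

lemma fot_trcl [fo_intros]: "fot mem t ==> fot mem (\<lambda>e. trcl (t e))"
  by (rule fot_sub1) (rule fot_set, rule mem_trcl, intro fo_intros)

lemma transitive_trcl: "transitive (trcl a)"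
  unfolding transitive_def subset_def mem_trcl by blast

lemma subset_trcl: "a \<sqsubseteq> trcl a"
  unfolding subset_def mem_trcl by blast

lemma trcl_least: "transitive t ==> a \<sqsubseteq> t ==> trcl a \<sqsubseteq> t"
  unfolding subset_def[of "trcl a"] mem_trcl by blast

lemma trcl_mem: "y \<epsilon> x ==> trcl y \<sqsubseteq> trcl x"
  by (rule trcl_least[OF transitive_trcl]) (use transitive_trcl subset_trcl transitive_def subsetD in blast)

lemma trcl_transitive: "transitive a ==> trcl a = a"
  by (intro subset_antisym trcl_least subset_trcl) auto

lemma trcl_mono: "a \<sqsubseteq> b ==> trcl a \<sqsubseteq> trcl b"
  by (rule trcl_least[OF transitive_trcl]) (use subset_trcl subset_trans in blast)

lemma mem_induct:
  assumes "fo1 P" "\<And>x. (\<And>y. y \<epsilon> x ==> P y) ==> P x"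
  shows "P x"
proof (rule ccontr)
  assume "\<not> P x"
  have "fo mem (\<lambda>e. \<not> P (e 0))" by (intro fo_intros assms)
  moreover have "transitive (union2 (trcl x) (upair x x))"
    unfolding transitive_def by (auto simp: subset_def dest: transitiveD[OF transitive_trcl] subsetD[OF subset_trcl])
  ultimately show False
    using least_on[of "\<lambda>x. \<not> P x" x "union2 (trcl x) (upair x x)"] assms(2) \<open>\<not> P x\<close> transitiveD
    by (metis mem_union2 mem_upair)
qed

subsection \<open>Dependent choice and countable sets\<close>

lemma dependent_choice:
  assumes R: "fo2 R" and ex: "\<And>x. x \<epsilon> a ==> \<exists>y. y \<epsilon> a \<and> R x y"
    and x0: "x0 \<epsilon> a"
  obtains f where "function_on f omega" "val f empty = x0" "\<And>n. natural n ==> val f n \<epsilon> a"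
    "\<And>n. natural n ==> R (val f n) (val f (succ n))"
proof -
  obtain N where N: "function_on N a" "\<And>x. x \<epsilon> a ==> val N x \<epsilon> a" "\<And>x. x \<epsilon> a ==> R x (val N x)"
    using choose_function[OF R, of a a] ex by blast
  define G where "G f = (if dom f = empty then x0 else val N (val f (Union (dom f))))" for f
  have G: "fot1 G" unfolding G_def by (intro fo_intros fot_if)
  define F where "F = rec G"
  have fF: "fot1 F" unfolding F_def by (rule fot_rec0[OF G])
  have dom: "dom (lam \<alpha> F) = \<alpha>" for \<alpha> by (rule function_on_dom[OF function_on_lam[OF fF]])
  have F0: "F empty = x0" using rec_eq[OF G, of empty] dom[of empty] unfolding F_def G_def by simp
  have FS: "F (succ n) = val N (F n)" if "natural n" for n
    using rec_eq[OF G, of "succ n"] dom[of "succ n"] val_lam[OF fF, of n "succ n"]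
      natural_ordinal[OF that] ordinal_succ Union_succ
    unfolding F_def G_def by simp
  have Fa: "F n \<epsilon> a" if "natural n" for n
    by (rule natural_induct[where P = "\<lambda>n. F n \<epsilon> a", OF _ that]) (intro fo_intros fot_sub1[OF fF], auto simp: F0 FS x0 N)
  note l = function_on_lam[OF fF, of omega] val_lam[OF fF, of _ omega]
  show thesis
    by (rule that[of "lam omega F"]) (use l F0 FS Fa N natural_succ in auto)
qed

lemma omega_sum: "lepoll (union2 (prod (upair empty empty) omega) (prod (upair (num 1) (num 1)) omega)) omega"
  (is "lepoll (union2 ?A ?B) omega")
proof -
  define R where "R x y <-> y = succ (succ x)" for x y
  have foR: "fo2 R" unfolding R_def by (intro fo_intros)
  obtain d where d: "function_on d omega" "val d empty = empty" "\<And>n. natural n ==> val d n \<epsilon> omega"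
    "\<And>n. natural n ==> R (val d n) (val d (succ n))"
    by (rule dependent_choice[OF foR, of omega empty]) (auto simp: R_def natural_succ)
  have dS: "val d (succ n) = succ (succ (val d n))" if "natural n" for n using d(4)[OF that] R_def by simp
  have main: "natural n --> (\<forall>m. natural m --> (val d n = val d m --> n = m) \<and> val d n \<noteq> succ (val d m))" for n
  proof
    assume "natural n"
    then show "\<forall>m. natural m --> (val d n = val d m --> n = m) \<and> val d n \<noteq> succ (val d m)"
    proof (rule natural_induct[where P = "\<lambda>n. \<forall>m. natural m --> (val d n = val d m --> n = m) \<and> val d n \<noteq> succ (val d m)", rotated])
      show "fo mem (\<lambda>e. \<forall>m. natural m --> (val d (e 0) = val d m --> e 0 = m) \<and> val d (e 0) \<noteq> succ (val d m))"
        by (intro fo_intros)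
      show "\<forall>m. natural m --> (val d empty = val d m --> empty = m) \<and> val d empty \<noteq> succ (val d m)"
        using d(2) dS natural_cases by (metis succ_not_empty(2))
      fix n assume n: "natural n" and IH: "\<forall>m. natural m --> (val d n = val d m --> n = m) \<and> val d n \<noteq> succ (val d m)"
      show "\<forall>m. natural m --> (val d (succ n) = val d m --> succ n = m) \<and> val d (succ n) \<noteq> succ (val d m)"
      proof (intro allI impI)
        fix m assume "natural m"
        then consider "m = empty" | k where "natural k" "m = succ k" using natural_cases by blast
        then show "(val d (succ n) = val d m --> succ n = m) \<and> val d (succ n) \<noteq> succ (val d m)"
          by cases (use IH in \<open>auto simp: dS[OF n] d(2) dS\<close>)
      qed
    qed
  qed
  show ?thesis
  proof (rule lepoll_rel[where R = "\<lambda>p y. \<exists>n. (p = opair empty n \<and> y = val d n) \<or> (p = opair (num 1) n \<and> y = succ (val d n))"])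
    show "fo mem (\<lambda>e. \<exists>n. (e 0 = opair empty n \<and> e (Suc 0) = val d n) \<or> (e 0 = opair (num 1) n \<and> e (Suc 0) = succ (val d n)))"
      by (intro fo_intros)
    fix x assume "x \<epsilon> union2 ?A ?B"
    then show "\<exists>y. y \<epsilon> omega \<and> (\<exists>n. x = opair empty n \<and> y = val d n \<or> x = opair (num 1) n \<and> y = succ (val d n))"
      using d(3) natural_succ by (fastforce simp: mem_prod_iff)
  next
    fix x x' y assume "x \<epsilon> union2 ?A ?B" "x' \<epsilon> union2 ?A ?B"
      "\<exists>n. x = opair empty n \<and> y = val d n \<or> x = opair (num 1) n \<and> y = succ (val d n)"
      "\<exists>n. x' = opair empty n \<and> y = val d n \<or> x' = opair (num 1) n \<and> y = succ (val d n)"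
    then show "x = x'" using main by (auto simp: mem_prod_iff) metis+
  qed
qed

lemma omega_times_omega: "lepoll (prod omega omega) omega"
proof -
  obtain s where s: "injection s (union2 (prod (upair empty empty) omega) (prod (upair (num 1) (num 1)) omega)) omega"
    using omega_sum lepoll_def by blast
  note s = injection_opair[OF s]
  define R where "R f g <-> (\<forall>m. natural m --> opair (opair (num 1) (val f m)) (val g m) \<epsilon> s)" for f g
  define A where "A = (SET f. f \<epsilon> Pow (prod omega omega) \<and> (function_on f omega \<and>
    (\<forall>x y. opair x y \<epsilon> f --> y \<epsilon> omega)))"
  have A: "f \<epsilon> A <-> function_on f omega \<and> (\<forall>x y. opair x y \<epsilon> f --> y \<epsilon> omega)" for f
  proof -
    have "f \<epsilon> A <-> f \<epsilon> Pow (prod omega omega) \<and> function_on f omega \<and> (\<forall>x y. opair x y \<epsilon> f --> y \<epsilon> omega)"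
      unfolding A_def by (rule mem_sep) (intro fo_intros)
    moreover have "f \<epsilon> Pow (prod omega omega)" if "function_on f omega" "\<forall>x y. opair x y \<epsilon> f --> y \<epsilon> omega"
      using that function_on_mem[OF that(1)] by (auto simp: subset_def)
    ultimately show ?thesis by blast
  qed
  have step: "\<exists>g. g \<epsilon> A \<and> R f g" if "f \<epsilon> A" for f
  proof -
    have f: "function_on f omega" "\<And>m. natural m ==> natural (val f m)"
      using that unfolding A using function_on_val[of f omega] by auto
    have fo: "fo mem (\<lambda>e. opair (opair (num 1) (val f (e 0))) (e (Suc 0)) \<epsilon> s)" by (intro fo_intros)
    have ex: "\<exists>y. y \<epsilon> omega \<and> opair (opair (num 1) (val f m)) y \<epsilon> s" if "m \<epsilon> omega" for m
      by (rule s(1)) (use f that in auto)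
    obtain g where "function_on g omega" "\<And>x. x \<epsilon> omega ==> val g x \<epsilon> omega"
      "\<And>x. x \<epsilon> omega ==> opair (opair (num 1) (val f x)) (val g x) \<epsilon> s"
      using choose_function[OF fo, of omega omega] ex by blast
    then show ?thesis using A R_def function_on_opair_iff by (intro exI[of _ g]) auto
  qed
  have fo: "fo mem (\<lambda>e. opair (opair empty (e 0)) (e (Suc 0)) \<epsilon> s)" by (intro fo_intros)
  have ex: "\<exists>y. y \<epsilon> omega \<and> opair (opair empty m) y \<epsilon> s" if "m \<epsilon> omega" for m
    by (rule s(1)) (use that in auto)
  obtain f0 where f0: "function_on f0 omega" "\<And>x. x \<epsilon> omega ==> val f0 x \<epsilon> omega"
    "\<And>x. x \<epsilon> omega ==> opair (opair empty x) (val f0 x) \<epsilon> s"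
    using choose_function[OF fo, of omega omega] ex by blast
  have "f0 \<epsilon> A" using f0 A function_on_opair_iff by auto
  have foR: "fo2 R" unfolding R_def by (intro fo_intros)
  obtain h where h: "function_on h omega" "val h empty = f0" "\<And>n. natural n ==> val h n \<epsilon> A"
    "\<And>n. natural n ==> R (val h n) (val h (succ n))"
    by (rule dependent_choice[OF foR step \<open>f0 \<epsilon> A\<close>]) auto
  have hN: "natural (val (val h n) m)" if "natural n" "natural m" for n m
    using h(3)[OF that(1)] function_on_val[of "val h n" omega m] that(2) unfolding A by auto
  have main: "\<forall>m n' m'. natural m --> natural m' --> natural n' --> val (val h n) m = val (val h n') m' --> n = n' \<and> m = m'"
    if "natural n" for n
  proof (rule natural_induct[where P = "\<lambda>n. \<forall>m n' m'. natural m --> natural m' --> natural n' --> val (val h n) m = val (val h n') m' --> n = n' \<and> m = m'", OF _ that])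
    show "fo mem (\<lambda>e. \<forall>m n' m'. natural m --> natural m' --> natural n' --> val (val h (e 0)) m = val (val h n') m' --> e 0 = n' \<and> m = m')"
      by (intro fo_intros)
    have neq: "opair empty x \<noteq> opair (num 1) y" for x y by simp
    have zero: "opair (opair empty m) (val (val h empty) m) \<epsilon> s" if "natural m" for m
      using f0(3) h(2) that by simp
    have suc: "opair (opair (num 1) (val (val h n) m)) (val (val h (succ n)) m) \<epsilon> s" if "natural n" "natural m" for n m
      using h(4)[OF that(1)] that(2) unfolding R_def by blast
    show "\<forall>m n' m'. natural m --> natural m' --> natural n' --> val (val h empty) m = val (val h n') m' --> empty = n' \<and> m = m'"
    proof (intro allI impI)
      fix m n' m' assume a: "natural m" "natural m'" "natural n'" "val (val h empty) m = val (val h n') m'"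
      from natural_cases[OF a(3)] show "empty = n' \<and> m = m'"
      proof
        assume "n' = empty"
        then show ?thesis using s(4)[OF zero[OF a(1)]] zero[OF a(2)] a(4) by fastforce
      next
        assume "\<exists>k. natural k \<and> n' = succ k"
        then obtain k where "natural k" "n' = succ k" by blast
        then show ?thesis using s(4)[OF zero[OF a(1)]] suc[of k m'] a by fastforce
      qed
    qed
    fix n assume n: "natural n" and IH: "\<forall>m n' m'. natural m --> natural m' --> natural n' --> val (val h n) m = val (val h n') m' --> n = n' \<and> m = m'"
    show "\<forall>m n' m'. natural m --> natural m' --> natural n' --> val (val h (succ n)) m = val (val h n') m' --> succ n = n' \<and> m = m'"
    proof (intro allI impI)
      fix m n' m' assume a: "natural m" "natural m'" "natural n'" "val (val h (succ n)) m = val (val h n') m'"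
      from natural_cases[OF a(3)] show "succ n = n' \<and> m = m'"
      proof
        assume "n' = empty"
        then show ?thesis using s(4)[OF suc[OF n a(1)]] zero[OF a(2)] a(4) by fastforce
      next
        assume "\<exists>k. natural k \<and> n' = succ k"
        then obtain k where k: "natural k" "n' = succ k" by blast
        then have "opair (num 1) (val (val h n) m) = opair (num 1) (val (val h k) m')"
          using s(4)[OF suc[OF n a(1)]] suc[OF k(1) a(2)] a(4) by metis
        then show ?thesis using IH a k by auto
      qed
    qed
  qed
  show ?thesis
  proof (rule lepoll_rel[where R = "\<lambda>p y. \<exists>n m. p = opair n m \<and> y = val (val h n) m"])
    show "fo mem (\<lambda>e. \<exists>n m. e 0 = opair n m \<and> e (Suc 0) = val (val h n) m)" by (intro fo_intros)
    fix x assume "x \<epsilon> prod omega omega"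
    then show "\<exists>y. y \<epsilon> omega \<and> (\<exists>n m. x = opair n m \<and> y = val (val h n) m)"
      using hN by (auto simp: mem_prod_iff)
  next
    fix x x' y assume "x \<epsilon> prod omega omega" "x' \<epsilon> prod omega omega"
      "\<exists>n m. x = opair n m \<and> y = val (val h n) m" "\<exists>n m. x' = opair n m \<and> y = val (val h n) m"
    then show "x = x'" using main by (auto simp: mem_prod_iff)
  qed
qed

lemma prod_lepoll_mono:
  assumes "lepoll a c" "lepoll b d" shows "lepoll (prod a b) (prod c d)"
proof -
  obtain f g where f: "injection f a c" and g: "injection g b d" using assms unfolding lepoll_def by blast
  note f = injection_opair[OF f] and g = injection_opair[OF g]
  show ?thesis
  proof (rule lepoll_rel[where R = "\<lambda>p q. \<exists>x y x' y'. p = opair x y \<and> q = opair x' y' \<and> opair x x' \<epsilon> f \<and> opair y y' \<epsilon> g"])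
    show "fo mem (\<lambda>e. \<exists>x y x' y'. e 0 = opair x y \<and> e (Suc 0) = opair x' y' \<and> opair x x' \<epsilon> f \<and> opair y y' \<epsilon> g)"
      by (intro fo_intros)
    fix p assume "p \<epsilon> prod a b"
    then obtain x y where p: "p = opair x y" "x \<epsilon> a" "y \<epsilon> b" by (auto simp: mem_prod_iff)
    moreover obtain x' y' where "x' \<epsilon> c" "opair x x' \<epsilon> f" "y' \<epsilon> d" "opair y y' \<epsilon> g"
      using f(1)[OF p(2)] g(1)[OF p(3)] by blast
    ultimately show "\<exists>q. q \<epsilon> prod c d \<and> (\<exists>x y x' y'. p = opair x y \<and> q = opair x' y' \<and> opair x x' \<epsilon> f \<and> opair y y' \<epsilon> g)"
      by (intro exI[of _ "opair x' y'"]) auto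
  next
    fix p p' q assume "\<exists>x y x' y'. p = opair x y \<and> q = opair x' y' \<and> opair x x' \<epsilon> f \<and> opair y y' \<epsilon> g"
      "\<exists>x y x' y'. p' = opair x y \<and> q = opair x' y' \<and> opair x x' \<epsilon> f \<and> opair y y' \<epsilon> g"
    then show "p = p'" using f(4) g(4) by auto
  qed
qed

lemma Union_lepoll_prod:
  assumes a: "lepoll a c" and el: "\<And>x. x \<epsilon> a ==> lepoll x c"
  shows "lepoll (Union a) (prod c c)"
proof -
  have fo: "fo mem (\<lambda>e. injection (e (Suc 0)) (e 0) c)" by (intro fo_intros)
  have ex: "\<exists>f. f \<epsilon> Pow (prod (Union a) c) \<and> injection f x c" if x: "x \<epsilon> a" for x
  proof -
    obtain f where f: "injection f x c" using el[OF x] lepoll_def by blast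
    have "f \<sqsubseteq> prod (Union a) c"
    proof -
      have "function_on f x" using f unfolding injection_iff by blast
      then show ?thesis
        using function_on_mem injection_opair(2)[OF f] x by (fastforce simp: subset_def)
    qed
    with f show ?thesis by auto
  qed
  obtain F where F: "\<And>x. x \<epsilon> a ==> injection (val F x) x c"
    using choose_function[OF fo, of a "Pow (prod (Union a) c)"] ex by metis
  obtain g where g: "injection g a c" using a lepoll_def by blast
  show ?thesis
  proof (rule lepoll_rel[where R = "\<lambda>y q. \<exists>x u v. y \<epsilon> x \<and> opair x u \<epsilon> g \<and> opair y v \<epsilon> val F x \<and> q = opair u v"])
    show "fo mem (\<lambda>e. \<exists>x u v. e 0 \<epsilon> x \<and> opair x u \<epsilon> g \<and> opair (e 0) v \<epsilon> val F x \<and> e (Suc 0) = opair u v)"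
      by (intro fo_intros)
    fix y assume "y \<epsilon> Union a"
    then obtain x where x: "x \<epsilon> a" "y \<epsilon> x" by auto
    obtain u v where "u \<epsilon> c" "opair x u \<epsilon> g" "v \<epsilon> c" "opair y v \<epsilon> val F x"
      using injection_opair(1)[OF g x(1)] injection_opair(1)[OF F[OF x(1)] x(2)] by blast
    with x show "\<exists>q. q \<epsilon> prod c c \<and> (\<exists>x u v. y \<epsilon> x \<and> opair x u \<epsilon> g \<and> opair y v \<epsilon> val F x \<and> q = opair u v)"
      by (intro exI[of _ "opair u v"]) auto
  next
    fix y y' q assume "\<exists>x u v. y \<epsilon> x \<and> opair x u \<epsilon> g \<and> opair y v \<epsilon> val F x \<and> q = opair u v"
      "\<exists>x u v. y' \<epsilon> x \<and> opair x u \<epsilon> g \<and> opair y' v \<epsilon> val F x \<and> q = opair u v"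
    then obtain x u v x' where *: "opair x u \<epsilon> g" "opair x' u \<epsilon> g" "opair y v \<epsilon> val F x" "opair y' v \<epsilon> val F x'" by auto
    then have "x' = x" "x \<epsilon> a" using injection_opair(4)[OF g] injection_opair(2)[OF g] by blast+
    with * show "y = y'" using injection_opair(4)[OF F] by blast
  qed
qed

lemma Union_lepoll:
  "lepoll (prod c c) c ==> lepoll a c ==> (\<And>x. x \<epsilon> a ==> lepoll x c) ==> lepoll (Union a) c"
  using Union_lepoll_prod lepoll_trans by blast

lemma upair_lepoll_omega: "lepoll (upair x y) omega"
  by (rule lepollI[where F = "\<lambda>z. if z = x then empty else num 1"])
    (intro fo_intros fot_if, auto split: if_splits intro: natural_succ)

lemma cantor: "\<not> lepoll (Pow a) a"
proof
  assume "lepoll (Pow a) a"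
  then obtain f where f: "injection f (Pow a) a" unfolding lepoll_def by blast
  note f = injection_opair[OF f]
  define D where "D = (SET y. y \<epsilon> a \<and> (\<exists>x. opair x y \<epsilon> f \<and> \<not> y \<epsilon> x))"
  have D: "y \<epsilon> D <-> y \<epsilon> a \<and> (\<exists>x. opair x y \<epsilon> f \<and> \<not> y \<epsilon> x)" for y
    unfolding D_def by (rule mem_sep) (intro fo_intros)
  have "D \<epsilon> Pow a" using D by (simp add: subset_def)
  then obtain y where "y \<epsilon> a" "opair D y \<epsilon> f" using f(1) by blast
  then show False using D[of y] f(4) by blast
qed

lemma Pow_lepoll_mono: "lepoll a b ==> lepoll (Pow a) (Pow b)"
proof -
  assume "lepoll a b"
  then obtain f where f: "injection f a b" unfolding lepoll_def by blast
  note f = injection_opair[OF f]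
  define F where "F x = (SET y. y \<epsilon> b \<and> (\<exists>z. z \<epsilon> x \<and> opair z y \<epsilon> f))" for x
  have F: "y \<epsilon> F x <-> y \<epsilon> b \<and> (\<exists>z. z \<epsilon> x \<and> opair z y \<epsilon> f)" for x y
    unfolding F_def by (rule mem_sep) (intro fo_intros)
  show ?thesis
  proof (rule lepollI[where F = F])
    show "fot1 F" by (rule fot_set, rule F) (intro fo_intros)
    fix x assume "x \<epsilon> Pow a" then show "F x \<epsilon> Pow b" by (simp add: subset_def F)
    fix x' assume *: "x \<epsilon> Pow a" "x' \<epsilon> Pow a" "F x = F x'"
    have "z \<epsilon> v" if "u \<sqsubseteq> a" "F u = F v" "z \<epsilon> u" for u v z
    proof -
      have "z \<epsilon> a" using that subsetD by blast
      then obtain y where "y \<epsilon> b" "opair z y \<epsilon> f" using f(1) by blast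
      then have "y \<epsilon> F u" using that(3) F[of y u] by blast
      then have "y \<epsilon> F v" using that(2) by simp
      then show ?thesis using F[of y v] f(4) \<open>opair z y \<epsilon> f\<close> by blast
    qed
    note sub = this
    show "x = x'"
    proof (rule set_eqI)
      fix z show "z \<epsilon> x <-> z \<epsilon> x'" using sub[of x x' z] sub[of x' x z] * by auto
    qed
  qed
qed

lemma prod_subset_Pow: "prod a b \<sqsubseteq> Pow (Pow (union2 a b))"
  by (auto simp: subset_def mem_prod_iff opair_def)

definition hartogs :: "'v => 'v" where
  "hartogs Y = (SET \<alpha>. ordinal \<alpha> \<and> lepoll \<alpha> Y)"

lemma omega1_eq: "omega1 = hartogs omega" and omega2_eq: "omega2 = hartogs omega1"
  by (simp_all add: hartogs_def omega1_def omega2_def)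

end

subsection \<open>Below an inaccessible cardinal\<close>

context zfc_universe
begin

lemma fo_regular [fo_intros]: "fot mem t ==> fo mem (\<lambda>e. regular (t e))"
proof -
  have "regular \<kappa> <-> cardinal \<kappa> \<and> omega \<sqsubseteq> \<kappa> \<and>
     (\<forall>\<alpha> f. \<alpha> \<epsilon> \<kappa> \<and> maps f \<alpha> \<kappa> --> (\<exists>\<beta>. \<beta> \<epsilon> \<kappa> \<and> (\<forall>\<xi>. \<xi> \<epsilon> \<alpha> --> val f \<xi> \<epsilon> \<beta>)))" for \<kappa>
  proof -
    have "(\<forall>\<xi>. \<xi> \<epsilon> \<alpha> --> app f \<xi> \<epsilon> \<beta>) <-> (\<forall>\<xi>. \<xi> \<epsilon> \<alpha> --> val f \<xi> \<epsilon> \<beta>)" if "maps f \<alpha> \<kappa>" for f \<alpha> \<beta>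
      using that function_on_app unfolding maps_def by auto
    then show ?thesis unfolding regular_def by blast
  qed
  moreover have "fo mem (\<lambda>e. cardinal (e 0) \<and> omega \<sqsubseteq> e 0 \<and>
     (\<forall>\<alpha> f. \<alpha> \<epsilon> e 0 \<and> maps f \<alpha> (e 0) --> (\<exists>\<beta>. \<beta> \<epsilon> e 0 \<and> (\<forall>\<xi>. \<xi> \<epsilon> \<alpha> --> val f \<xi> \<epsilon> \<beta>))))"
    by (intro fo_intros)
  ultimately have "fo1 regular" by simp
  then show "fot mem t ==> ?thesis" by (rule fo_sub1)
qed

lemma regular_cardinal: "regular \<kappa> ==> cardinal \<kappa>"
  and regular_ordinal: "regular \<kappa> ==> ordinal \<kappa>"
  unfolding regular_def cardinal_def by blast+

lemma regular_bound:
  assumes \<kappa>: "regular \<kappa>" and a: "card_less a \<kappa>" and R: "fo2 R"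
    and ex: "\<And>x. x \<epsilon> a ==> \<exists>y. y \<epsilon> \<kappa> \<and> R x y"
  shows "\<exists>\<beta>. \<beta> \<epsilon> \<kappa> \<and> (\<forall>x. x \<epsilon> a --> (\<exists>y. y \<epsilon> \<beta> \<and> R x y))"
proof -
  obtain \<alpha> g where \<alpha>: "\<alpha> \<epsilon> \<kappa>" and g: "bijection g a \<alpha>" using a unfolding card_less_def eqpoll_def by blast
  note gi = injection_opair[OF bijection_injection[OF g]]
  have gs: "\<exists>x. opair x \<xi> \<epsilon> g" if "\<xi> \<epsilon> \<alpha>" for \<xi> using g that unfolding bijection_iff by blast
  have fo: "fo mem (\<lambda>e. \<exists>x. opair x (e 0) \<epsilon> g \<and> R x (e (Suc 0)))"
    by (intro fo_ex fo_conj fo_mem fot_opair fot_var fot_const fo_sub2[OF R])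
  have ex': "\<exists>y. y \<epsilon> \<kappa> \<and> (\<exists>x. opair x \<xi> \<epsilon> g \<and> R x y)" if "\<xi> \<epsilon> \<alpha>" for \<xi>
    using gs[OF that] gi(2) ex by blast
  obtain f where f: "function_on f \<alpha>" "\<And>\<xi>. \<xi> \<epsilon> \<alpha> ==> val f \<xi> \<epsilon> \<kappa>"
    "\<And>\<xi>. \<xi> \<epsilon> \<alpha> ==> \<exists>x. opair x \<xi> \<epsilon> g \<and> R x (val f \<xi>)"
    using choose_function[OF fo, of \<alpha> \<kappa>] ex' by blast
  have "maps f \<alpha> \<kappa>" unfolding maps_def using f function_on_app by simp
  then obtain \<beta> where \<beta>: "\<beta> \<epsilon> \<kappa>" "\<And>\<xi>. \<xi> \<epsilon> \<alpha> ==> app f \<xi> \<epsilon> \<beta>"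
    using \<kappa> \<alpha> unfolding regular_def by blast
  have "\<exists>y. y \<epsilon> \<beta> \<and> R x y" if x: "x \<epsilon> a" for x
  proof -
    obtain \<xi> where \<xi>: "opair x \<xi> \<epsilon> g" "\<xi> \<epsilon> \<alpha>" using gi(1)[OF x] by blast
    then have "R x (val f \<xi>)" using f(3)[OF \<xi>(2)] gi(4) by blast
    moreover have "val f \<xi> \<epsilon> \<beta>" using \<beta>(2)[OF \<xi>(2)] function_on_app[OF f(1) \<xi>(2)] by simp
    ultimately show ?thesis by blast
  qed
  with \<beta>(1) show ?thesis by blast
qed

lemma small_subset_Vlev:
  assumes \<kappa>: "regular \<kappa>" and x: "x \<sqsubseteq> Vlev \<kappa>" "card_less x \<kappa>"
  shows "x \<epsilon> Vlev \<kappa>"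
proof -
  have o: "ordinal \<kappa>" using \<kappa> regular_ordinal by blast
  have fo: "fo mem (\<lambda>e. e 0 \<sqsubseteq> Vlev (e (Suc 0)))" by (intro fo_intros)
  have "\<exists>\<beta>. \<beta> \<epsilon> \<kappa> \<and> (\<forall>y. y \<epsilon> x --> (\<exists>\<gamma>. \<gamma> \<epsilon> \<beta> \<and> y \<sqsubseteq> Vlev \<gamma>))"
    by (rule regular_bound[OF \<kappa> x(2) fo]) (use x mem_Vlev[OF o] subsetD in blast)
  then obtain \<beta> where \<beta>: "\<beta> \<epsilon> \<kappa>" "\<And>y. y \<epsilon> x ==> \<exists>\<gamma>. \<gamma> \<epsilon> \<beta> \<and> y \<sqsubseteq> Vlev \<gamma>" by blast
  then have "x \<sqsubseteq> Vlev \<beta>" unfolding subset_def[of x] using mem_Vlev[OF ordinal_mem[OF o]] by blast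
  with \<beta> show ?thesis using mem_Vlev[OF o] by blast
qed

lemma small_trcl_Vlev:
  assumes \<kappa>: "regular \<kappa>" and x: "card_less (trcl x) \<kappa>"
  shows "x \<epsilon> Vlev \<kappa>"
proof -
  have sub: "card_less y \<kappa>" if "y \<sqsubseteq> trcl x" for y
    using card_less_mono[OF regular_cardinal[OF \<kappa>] x] subset_lepoll[OF that] by blast
  have "y \<epsilon> trcl x --> y \<epsilon> Vlev \<kappa>" for y
  proof (rule mem_induct[where P = "\<lambda>y. y \<epsilon> trcl x --> y \<epsilon> Vlev \<kappa>"])
    show "fo mem (\<lambda>e. e 0 \<epsilon> trcl x --> e 0 \<epsilon> Vlev \<kappa>)" by (intro fo_intros)
    fix y assume IH: "\<And>z. z \<epsilon> y ==> z \<epsilon> trcl x --> z \<epsilon> Vlev \<kappa>"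
    show "y \<epsilon> trcl x --> y \<epsilon> Vlev \<kappa>"
    proof
      assume "y \<epsilon> trcl x"
      then have "y \<sqsubseteq> trcl x" using transitive_trcl transitive_def by blast
      then show "y \<epsilon> Vlev \<kappa>"
        by (intro small_subset_Vlev[OF \<kappa> _ sub]) (use IH in \<open>auto simp: subset_def\<close>)
    qed
  qed
  then show ?thesis
    by (intro small_subset_Vlev[OF \<kappa> _ sub]) (use subset_trcl[of x] in \<open>auto simp: subset_def\<close>)
qed

end

locale inaccessible_universe = zfc_universe mem for mem :: "'v => 'v => bool" (infix "\<epsilon>" 50) +
  fixes \<delta> :: 'v
  assumes inaccessible: "inaccessible \<delta>"
begin

lemma regular_delta: "regular \<delta>" and omega_delta: "omega \<epsilon> \<delta>"
  and Pow_delta: "\<alpha> \<epsilon> \<delta> ==> card_less (Pow \<alpha>) \<delta>"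
  using inaccessible unfolding inaccessible_def by blast+

lemma cardinal_delta: "cardinal \<delta>" and ordinal_delta: "ordinal \<delta>"
  using regular_delta regular_cardinal regular_ordinal by blast+

definition small :: "'v => bool" where
  "small a <-> card_less a \<delta>"

lemma small_iff: "small a <-> (\<exists>\<beta>. \<beta> \<epsilon> \<delta> \<and> lepoll a \<beta>)"
  unfolding small_def using card_lessD card_lessI[OF cardinal_delta] by blast

lemma small_mono: "small b ==> lepoll a b ==> small a"
  using small_iff lepoll_trans by meson

lemma small_subset: "small b ==> a \<sqsubseteq> b ==> small a"
  using small_mono subset_lepoll by blast

lemma small_ordinal: "\<alpha> \<epsilon> \<delta> ==> small \<alpha>"
  using small_iff lepoll_refl by blast

lemma not_small_delta: "\<not> small \<delta>"
proof
  assume "small \<delta>"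
  then obtain \<beta> where "\<beta> \<epsilon> \<delta>" "lepoll \<delta> \<beta>" using small_iff by blast
  then have "eqpoll \<beta> \<delta>" using schroeder_bernstein subset_lepoll ordinal_subset ordinal_delta by blast
  with \<open>\<beta> \<epsilon> \<delta>\<close> show False using cardinal_delta cardinal_def by blast
qed

lemma small_ordinal_mem: "ordinal \<alpha> ==> small \<alpha> ==> \<alpha> \<epsilon> \<delta>"
  using not_small_delta small_subset ordinal_not_mem ordinal_delta by blast

lemma small_Pow: "small a ==> small (Pow a)"
proof -
  assume "small a"
  then obtain \<beta> where "\<beta> \<epsilon> \<delta>" "lepoll a \<beta>" using small_iff by blast
  then show ?thesis using Pow_lepoll_mono Pow_delta small_mono small_def by blast
qed

lemma small_omega: "small omega"
  using omega_delta small_ordinal by blast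

lemma delta_bound:
  assumes "small a" "fo2 R" "\<And>x. x \<epsilon> a ==> \<exists>y. y \<epsilon> \<delta> \<and> R x y"
  shows "\<exists>\<beta>. \<beta> \<epsilon> \<delta> \<and> (\<forall>x. x \<epsilon> a --> (\<exists>y. y \<epsilon> \<beta> \<and> R x y))"
  using regular_bound[OF regular_delta, of a R] assms small_def by blast

lemma small_prod_self: "\<beta> \<epsilon> \<delta> ==> small (prod \<beta> \<beta>)"
proof -
  assume "\<beta> \<epsilon> \<delta>"
  have "union2 \<beta> \<beta> = \<beta>" by (rule set_eqI) auto
  then show ?thesis using small_subset[OF small_Pow[OF small_Pow[OF small_ordinal[OF \<open>\<beta> \<epsilon> \<delta>\<close>]]]] prod_subset_Pow[of \<beta> \<beta>] by simp
qed

lemma delta_max: "\<alpha> \<epsilon> \<delta> ==> \<beta> \<epsilon> \<delta> ==> \<exists>\<gamma>. \<gamma> \<epsilon> \<delta> \<and> \<alpha> \<sqsubseteq> \<gamma> \<and> \<beta> \<sqsubseteq> \<gamma>"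
  using ordinal_not_mem[of \<alpha> \<beta>] ordinal_subset[of \<beta> \<alpha>] ordinal_mem[OF ordinal_delta] subset_refl by blast

lemma small_Union:
  assumes a: "small a" and el: "\<And>x. x \<epsilon> a ==> small x"
  shows "small (Union a)"
proof -
  obtain \<beta> where \<beta>: "\<beta> \<epsilon> \<delta>" "lepoll a \<beta>" using a small_iff by blast
  have fo: "fo2 lepoll" by (intro fo_intros)
  have ex: "\<exists>y. y \<epsilon> \<delta> \<and> lepoll x y" if "x \<epsilon> a" for x using el[OF that] small_iff by blast
  obtain \<gamma> where \<gamma>: "\<gamma> \<epsilon> \<delta>" "\<And>x. x \<epsilon> a ==> \<exists>y. y \<epsilon> \<gamma> \<and> lepoll x y"
    using delta_bound[OF a fo] ex by blast
  obtain \<mu> where \<mu>: "\<mu> \<epsilon> \<delta>" "\<beta> \<sqsubseteq> \<mu>" "\<gamma> \<sqsubseteq> \<mu>" using delta_max[OF \<beta>(1) \<gamma>(1)] by blast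
  have "lepoll x \<mu>" if "x \<epsilon> a" for x
    using \<gamma>(2)[OF that] \<mu> ordinal_subset ordinal_mem[OF ordinal_delta] subsetD subset_lepoll lepoll_trans by meson
  moreover have "lepoll a \<mu>" using \<beta>(2) \<mu>(2) subset_lepoll lepoll_trans by blast
  ultimately have "lepoll (Union a) (prod \<mu> \<mu>)" by (intro Union_lepoll_prod)
  then show ?thesis using small_prod_self[OF \<mu>(1)] small_mono by blast
qed

lemma small_upair: "small (upair x y)"
  using small_mono[OF small_omega upair_lepoll_omega] .

lemma small_union2: "small a ==> small b ==> small (union2 a b)"
  unfolding union2_def by (rule small_Union[OF small_upair]) auto

lemma small_prod: "small a ==> small b ==> small (prod a b)"
  using small_subset[OF small_Pow[OF small_Pow[OF small_union2]] prod_subset_Pow] .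

lemma small_image:
  assumes "fot1 F" "small a" "\<And>y. y \<epsilon> b ==> \<exists>x. x \<epsilon> a \<and> y = F x"
  shows "small b"
  using small_mono[OF assms(2) lepoll_image[OF assms(1,3)]] by blast

lemma small_Vlev: "\<alpha> \<epsilon> \<delta> ==> small (Vlev \<alpha>)"
proof -
  assume "\<alpha> \<epsilon> \<delta>"
  have fo: "fo mem (\<lambda>e. e 0 \<epsilon> \<delta> --> small (Vlev (e 0)))" unfolding small_def by (intro fo_intros)
  have "\<alpha> \<epsilon> \<delta> --> small (Vlev \<alpha>)"
  proof (rule ordinal_induct[where P = "\<lambda>\<alpha>. \<alpha> \<epsilon> \<delta> --> small (Vlev \<alpha>)", OF fo])
    fix \<alpha> assume \<alpha>: "ordinal \<alpha>" and IH: "\<And>\<beta>. \<beta> \<epsilon> \<alpha> ==> \<beta> \<epsilon> \<delta> --> small (Vlev \<beta>)"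
    show "\<alpha> \<epsilon> \<delta> --> small (Vlev \<alpha>)"
    proof
      assume d: "\<alpha> \<epsilon> \<delta>"
      have f: "fot mem (\<lambda>e. Pow (Vlev (e 0)))" by (intro fo_intros)
      let ?A = "SET y. \<exists>\<beta>. \<beta> \<epsilon> \<alpha> \<and> y = Pow (Vlev \<beta>)"
      have A1: "small ?A" by (rule small_image[OF f small_ordinal[OF d]]) (simp add: mem_image[OF f])
      have A2: "small x" if "x \<epsilon> ?A" for x
        using that IH ordinal_trans[OF ordinal_delta d] small_Pow by (auto simp: mem_image[OF f])
      have A3: "Vlev \<alpha> = Union ?A"
        by (rule set_eqI) (simp add: mem_image[OF f] mem_Vlev[OF \<alpha>], auto)
      have "small (Union ?A)" by (rule small_Union[OF A1]) (rule A2)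
      then show "small (Vlev \<alpha>)" unfolding A3 .
    qed
  qed (use \<open>\<alpha> \<epsilon> \<delta>\<close> ordinal_mem ordinal_delta in blast)
  with \<open>\<alpha> \<epsilon> \<delta>\<close> show ?thesis by blast
qed

abbreviation Vd :: 'v where "Vd \<equiv> Vlev \<delta>"

lemma transitive_Vd: "transitive Vd"
  using transitive_Vlev ordinal_delta by blast

lemma mem_Vd: "x \<epsilon> Vd <-> (\<exists>\<beta>. \<beta> \<epsilon> \<delta> \<and> x \<sqsubseteq> Vlev \<beta>)"
  using mem_Vlev[OF ordinal_delta] .

lemma Vd_mem: "x \<epsilon> Vd ==> y \<epsilon> x ==> y \<epsilon> Vd"
  using Vlev_closed ordinal_delta by blast

lemma Vd_subset: "x \<epsilon> Vd ==> y \<sqsubseteq> x ==> y \<epsilon> Vd"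
  using Vlev_subset_closed ordinal_delta by blast

lemma VdI: "x \<sqsubseteq> Vd ==> small x ==> x \<epsilon> Vd"
  using small_subset_Vlev[OF regular_delta] small_def by blast

lemma small_Vd: "x \<epsilon> Vd ==> small x"
  using mem_Vd small_Vlev small_subset by blast

lemma delta_subset_Vd: "\<alpha> \<epsilon> \<delta> ==> \<alpha> \<epsilon> Vd"
  using ordinal_subset_Vlev[OF ordinal_delta] subsetD by blast

lemma Vlev_Vd: "\<alpha> \<epsilon> \<delta> ==> Vlev \<alpha> \<epsilon> Vd"
  using Vlev_mem ordinal_delta by blast

lemma Vd_upair: "x \<epsilon> Vd ==> y \<epsilon> Vd ==> upair x y \<epsilon> Vd"
  by (rule VdI[OF _ small_upair]) (auto simp: subset_def)

lemma Vd_opair: "x \<epsilon> Vd ==> y \<epsilon> Vd ==> opair x y \<epsilon> Vd"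
  unfolding opair_def by (intro Vd_upair)

lemma Vd_Pow: "x \<epsilon> Vd ==> Pow x \<epsilon> Vd"
  by (rule VdI) (auto simp: subset_def small_Vd small_Pow intro: Vd_subset)

lemma Vd_prod: "x \<epsilon> Vd ==> y \<epsilon> Vd ==> prod x y \<epsilon> Vd"
  by (rule VdI) (auto simp: subset_def mem_prod_iff small_Vd intro: Vd_mem Vd_opair small_prod)

lemma omega_Vd: "omega \<epsilon> Vd"
  using delta_subset_Vd omega_delta by blast

lemma empty_Vd: "empty \<epsilon> Vd"
  using Vd_subset[OF omega_Vd] by simp

subsubsection \<open>Hartogs numbers\<close>

lemma mem_hartogs: "small Y ==> \<alpha> \<epsilon> hartogs Y <-> ordinal \<alpha> \<and> lepoll \<alpha> Y"
  unfolding hartogs_def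
  by (rule bounded_coll[where a = \<delta>]) (intro fo_intros, use small_ordinal_mem small_mono in blast)

lemma ordinal_hartogs: "small Y ==> ordinal (hartogs Y)"
  by (rule ordinalI) (auto simp: mem_hartogs intro: ordinal_mem dest: ordinal_subset subset_lepoll lepoll_trans)

lemma cardinal_hartogs: "small Y ==> cardinal (hartogs Y)"
proof -
  assume Y: "small Y"
  have "False" if "\<alpha> \<epsilon> hartogs Y" "eqpoll \<alpha> (hartogs Y)" for \<alpha>
  proof -
    have "lepoll (hartogs Y) Y" using that mem_hartogs[OF Y] eqpoll_sym eqpoll_lepoll lepoll_trans by blast
    then have "hartogs Y \<epsilon> hartogs Y" using mem_hartogs[OF Y] ordinal_hartogs[OF Y] by blast
    then show False by simp
  qed
  then show ?thesis unfolding cardinal_def using ordinal_hartogs[OF Y] by blast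
qed

lemma hartogs_delta: "small Y ==> hartogs Y \<epsilon> \<delta>"
proof (rule ccontr)
  assume Y: "small Y" and "\<not> hartogs Y \<epsilon> \<delta>"
  then have d: "\<delta> \<sqsubseteq> hartogs Y" using ordinal_not_mem ordinal_hartogs ordinal_delta by blast
  obtain \<beta> where "\<beta> \<epsilon> \<delta>" "lepoll (Pow Y) \<beta>" using small_Pow[OF Y] small_iff by blast
  then have "lepoll (Pow Y) Y" using d mem_hartogs[OF Y] lepoll_trans subsetD by blast
  then show False using cantor by blast
qed

lemma small_hartogs: "small Y ==> small (hartogs Y)"
  using hartogs_delta small_ordinal by blast

lemma card_less_hartogs: "small Y ==> card_less a (hartogs Y) <-> lepoll a Y"
proof
  assume "small Y" "card_less a (hartogs Y)"
  then show "lepoll a Y" using card_lessD mem_hartogs lepoll_trans by blast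
next
  assume Y: "small Y" "lepoll a Y"
  obtain \<alpha> where \<alpha>: "ordinal \<alpha>" "eqpoll a \<alpha>" using well_ordering by blast
  then have "\<alpha> \<epsilon> hartogs Y" using mem_hartogs[OF Y(1)] Y(2) eqpoll_sym eqpoll_lepoll lepoll_trans by blast
  with \<alpha> show "card_less a (hartogs Y)" unfolding card_less_def by blast
qed

lemma regular_hartogs:
  assumes Y: "small Y" and sq: "lepoll (prod Y Y) Y" and inf: "lepoll omega Y"
  shows "regular (hartogs Y)"
  unfolding regular_def
proof (intro conjI allI impI cardinal_hartogs Y)
  show "omega \<sqsubseteq> hartogs Y"
    unfolding subset_def mem_hartogs[OF Y]
    using natural_ordinal subset_lepoll[OF ordinal_subset[OF ordinal_omega]] inf lepoll_trans by (metis mem_omega)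
  fix \<alpha> f assume *: "\<alpha> \<epsilon> hartogs Y \<and> maps f \<alpha> (hartogs Y)"
  then have f: "function_on f \<alpha>" "\<And>x y. opair x y \<epsilon> f ==> y \<epsilon> hartogs Y" unfolding maps_iff by auto
  let ?s = "Union (ran f)"
  have "lepoll (ran f) \<alpha>"
    by (rule lepoll_image[where F = "val f"]) (intro fo_intros, use function_on_opair_iff[OF f(1)] in auto)
  then have "lepoll (ran f) Y" using * mem_hartogs[OF Y] lepoll_trans by blast
  then have s: "lepoll ?s Y"
    by (rule Union_lepoll[OF sq]) (use f(2) mem_hartogs[OF Y] mem_ran in blast)
  have os: "ordinal ?s" by (rule ordinal_Union) (use f(2) mem_hartogs[OF Y] mem_ran in blast)
  have "succ s = Union (upair s (upair s s))" for s by (rule set_eqI) auto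
  note succ_s = this[of ?s]
  have up: "lepoll (upair u v) Y" for u v using upair_lepoll_omega inf lepoll_trans by blast
  have "lepoll x Y" if "x \<epsilon> upair ?s (upair ?s ?s)" for x
    using that s up unfolding mem_upair by blast
  then have "lepoll (succ ?s) Y" unfolding succ_s by (rule Union_lepoll[OF sq up])
  then have "succ ?s \<epsilon> hartogs Y" unfolding mem_hartogs[OF Y] using ordinal_succ[OF os] by blast
  moreover have "app f \<xi> \<epsilon> succ ?s" if "\<xi> \<epsilon> \<alpha>" for \<xi>
  proof -
    have v: "opair \<xi> (val f \<xi>) \<epsilon> f" using function_on_val[OF f(1) that] .
    then have "val f \<xi> \<sqsubseteq> ?s" by (auto simp: subset_def)
    moreover have "ordinal (val f \<xi>)" using f(2)[OF v] mem_hartogs[OF Y] by blast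
    ultimately show ?thesis using ordinal_subset_iff[OF _ os] function_on_app[OF f(1) that] by auto
  qed
  ultimately show "\<exists>\<beta>. \<beta> \<epsilon> hartogs Y \<and> (\<forall>\<xi>. \<xi> \<epsilon> \<alpha> --> app f \<xi> \<epsilon> \<beta>)" by blast
qed

lemma small_omega1: "small omega1" and omega1_delta: "omega1 \<epsilon> \<delta>"
  and omega2_delta: "omega2 \<epsilon> \<delta>"
  using small_hartogs hartogs_delta small_omega unfolding omega1_eq omega2_eq by blast+

lemma mem_omega1: "\<alpha> \<epsilon> omega1 <-> ordinal \<alpha> \<and> lepoll \<alpha> omega"
  unfolding omega1_eq by (rule mem_hartogs[OF small_omega])

lemma omega_subset_omega1: "omega \<sqsubseteq> omega1"
  unfolding subset_def mem_omega1
  using natural_ordinal subset_lepoll[OF ordinal_subset[OF ordinal_omega]] by (metis mem_omega)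

lemma mem_omega2: "\<alpha> \<epsilon> omega2 <-> ordinal \<alpha> \<and> lepoll \<alpha> omega1"
  unfolding omega2_eq by (rule mem_hartogs[OF small_omega1])

lemma card_less_omega2: "card_less a omega2 <-> lepoll a omega1"
  unfolding omega2_eq by (rule card_less_hartogs[OF small_omega1])

subsubsection \<open>The sets \<open>H\<^sub>\<kappa>\<close> and \<open>Z\<^sub>\<kappa>\<close>\<close>

definition Hl :: "'v => 'v" where
  "Hl \<kappa> = (SET x. x \<epsilon> Vd \<and> card_less (trcl x) \<kappa>)"

definition Zl :: "'v => 'v" where
  "Zl \<kappa> = (SET M. M \<sqsubseteq> Hl \<kappa> \<and> lepoll M omega1)"

lemma mem_Hl: "x \<epsilon> Hl \<kappa> <-> x \<epsilon> Vd \<and> card_less (trcl x) \<kappa>"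
  unfolding Hl_def by (rule mem_sep) (intro fo_intros)

lemma fot_Hl [fo_intros]: "fot mem t ==> fot mem (\<lambda>e. Hl (t e))"
  by (rule fot_sub1) (rule fot_set, rule mem_Hl, intro fo_intros)

lemma mem_Zl: "M \<epsilon> Zl \<kappa> <-> M \<sqsubseteq> Hl \<kappa> \<and> lepoll M omega1"
  unfolding Zl_def by (rule bounded_coll[where a = "Pow (Hl \<kappa>)"]) (intro fo_intros, simp)

lemma fot_Zl [fo_intros]: "fot mem t ==> fot mem (\<lambda>e. Zl (t e))"
  by (rule fot_sub1) (rule fot_set, rule mem_Zl, intro fo_intros)

definition Ix :: 'v where "Ix = index \<delta>"

lemma mem_Ix: "\<kappa> \<epsilon> Ix <-> regular \<kappa> \<and> omega2 \<sqsubseteq> \<kappa> \<and> \<kappa> \<epsilon> \<delta>"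
  unfolding Ix_def index_def by (rule bounded_coll[where a = \<delta>]) (intro fo_intros, simp)

lemma Ix_ordinal: "\<kappa> \<epsilon> Ix ==> ordinal \<kappa>"
  using mem_Ix regular_ordinal by blast

lemma H_Vlev: "\<kappa> \<epsilon> Ix ==> card_less (trcl x) \<kappa> ==> x \<epsilon> Vlev \<kappa>"
  using mem_Ix small_trcl_Vlev by blast

lemma H_eq: "\<kappa> \<epsilon> Ix ==> H \<kappa> = Hl \<kappa>"
proof -
  assume \<kappa>: "\<kappa> \<epsilon> Ix"
  have "Vlev \<kappa> \<sqsubseteq> Vd" using Vlev_subset ordinal_delta mem_Ix \<kappa> by blast
  then have V: "card_less (trcl x) \<kappa> ==> x \<epsilon> Vd" for x
    using H_Vlev[OF \<kappa>] subsetD by blast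
  then have "x \<epsilon> H \<kappa> <-> card_less (trcl x) \<kappa>" for x
    unfolding H_def by (intro bounded_coll[where a = Vd]) (intro fo_intros)
  with V show ?thesis by (intro set_eqI) (auto simp: mem_Hl)
qed

lemma Zset_eq: "\<kappa> \<epsilon> Ix ==> Zset \<kappa> = Zl \<kappa>"
  by (simp add: Zset_def Zl_def H_eq card_less_omega2)

lemma Hl_subset_Vlev: "\<kappa> \<epsilon> Ix ==> Hl \<kappa> \<sqsubseteq> Vlev \<kappa>"
  using H_Vlev by (simp add: subset_def mem_Hl)

lemma Hl_Vd: "\<kappa> \<epsilon> Ix ==> Hl \<kappa> \<epsilon> Vd"
  using Hl_subset_Vlev mem_Vd mem_Ix by blast

lemma Zl_Vd: "\<kappa> \<epsilon> Ix ==> Zl \<kappa> \<epsilon> Vd"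
  by (rule Vd_subset[OF Vd_Pow[OF Hl_Vd]]) (auto simp: subset_def mem_Zl)

lemma Hl_mono: "\<kappa> \<sqsubseteq> \<kappa>' ==> Hl \<kappa> \<sqsubseteq> Hl \<kappa>'"
  by (auto simp: subset_def mem_Hl card_less_def)

lemma Hl_trans: "\<kappa> \<epsilon> Ix ==> x \<epsilon> Hl \<kappa> ==> y \<epsilon> x ==> y \<epsilon> Hl \<kappa>"
  unfolding mem_Hl mem_Ix
  using Vd_mem card_less_mono[OF regular_cardinal] subset_lepoll[OF trcl_mem] by blast

lemma Hl_subset: "\<kappa> \<epsilon> Ix ==> x \<epsilon> Hl \<kappa> ==> y \<sqsubseteq> x ==> y \<epsilon> Hl \<kappa>"
  unfolding mem_Hl mem_Ix
  using Vd_subset card_less_mono[OF regular_cardinal] subset_lepoll[OF trcl_mono] by blast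

lemma Union_Zl: "\<kappa> \<epsilon> Ix ==> Union (Zl \<kappa>) = Hl \<kappa>"
proof (rule set_eqI)
  fix x
  have "lepoll (upair x x) omega1" using upair_lepoll_omega subset_lepoll[OF omega_subset_omega1] lepoll_trans by blast
  then have "x \<epsilon> Hl \<kappa> ==> upair x x \<epsilon> Zl \<kappa>" by (simp add: mem_Zl subset_def)
  then show "x \<epsilon> Union (Zl \<kappa>) <-> x \<epsilon> Hl \<kappa>" by (auto simp: mem_Zl subset_def intro: exI[of _ "upair x x"])
qed

lemma Zl_inter: "M \<epsilon> Zl \<kappa>' ==> inter M (Hl \<kappa>) \<epsilon> Zl \<kappa>"
  unfolding mem_Zl using subset_lepoll[of "inter M (Hl \<kappa>)" M] lepoll_trans by (auto simp: subset_def)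

lemma Ix_linear: "\<kappa> \<epsilon> Ix ==> \<kappa>' \<epsilon> Ix ==> \<kappa> \<sqsubseteq> \<kappa>' \<or> \<kappa>' \<sqsubseteq> \<kappa>"
  using Ix_ordinal ordinal_not_mem ordinal_subset by meson

subsubsection \<open>Special levels\<close>

definition limit :: "'v => bool" where
  "limit \<beta> <-> ordinal \<beta> \<and> (\<forall>\<gamma>. \<gamma> \<epsilon> \<beta> --> succ \<gamma> \<epsilon> \<beta>)"

lemma succ_delta: "\<alpha> \<epsilon> \<delta> ==> succ \<alpha> \<epsilon> \<delta>"
proof (rule small_ordinal_mem)
  assume \<alpha>: "\<alpha> \<epsilon> \<delta>"
  then show "ordinal (succ \<alpha>)" using ordinal_succ ordinal_mem ordinal_delta by blast
  have "succ \<alpha> \<sqsubseteq> Pow \<alpha>" using ordinal_subset ordinal_mem[OF ordinal_delta \<alpha>] by (auto simp: subset_def)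
  then show "small (succ \<alpha>)" using small_subset small_Pow small_ordinal \<alpha> by blast
qed

lemma limit_above: "\<alpha> \<epsilon> \<delta> ==> \<exists>\<beta>. \<beta> \<epsilon> \<delta> \<and> \<alpha> \<epsilon> \<beta> \<and> limit \<beta>"
proof -
  assume \<alpha>: "\<alpha> \<epsilon> \<delta>"
  have fo: "fo mem (\<lambda>e. e (Suc 0) = succ (e 0))" by (intro fo_intros)
  obtain f where f: "function_on f omega" "val f empty = succ \<alpha>" "\<And>n. natural n ==> val f n \<epsilon> \<delta>"
    "\<And>n. natural n ==> val f (succ n) = succ (val f n)"
    using dependent_choice[OF fo, of \<delta> "succ \<alpha>"] succ_delta \<alpha> by metis
  have r: "x \<epsilon> ran f <-> (\<exists>n. natural n \<and> x = val f n)" for x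
    using function_on_opair_iff[OF f(1)] by auto
  let ?b = "Union (ran f)"
  have o: "ordinal ?b" by (rule ordinal_Union) (use r f(3) ordinal_mem[OF ordinal_delta] in auto)
  have "small (ran f)"
    by (rule small_image[where F = "val f", OF _ small_omega]) (intro fo_intros, use r in auto)
  then have "small ?b" by (rule small_Union) (use r f(3) small_ordinal in auto)
  then have "?b \<epsilon> \<delta>" using small_ordinal_mem o by blast
  moreover have "\<alpha> \<epsilon> ?b" 
  proof -
    have "succ \<alpha> \<epsilon> ran f" unfolding r using f(2) natural_empty by metis
    then show ?thesis unfolding mem_Union by (intro exI[of _ "succ \<alpha>"]) simp
  qed
  moreover have "succ \<gamma> \<epsilon> ?b" if "\<gamma> \<epsilon> ?b" for \<gamma>
  proof -
    from that obtain n where n: "natural n" "\<gamma> \<epsilon> val f n" unfolding mem_Union r by blast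
    have "succ \<gamma> \<epsilon> val f (succ n)"
      using succ_mem_or_eq[OF ordinal_mem[OF ordinal_delta f(3)[OF n(1)]] n(2)] f(4)[OF n(1)] by auto
    then show ?thesis unfolding mem_Union r using natural_succ[OF n(1)] by blast
  qed
  ultimately show ?thesis using o unfolding limit_def by blast
qed

definition good_height :: "'v => bool" where
  "good_height \<beta> <-> limit \<beta> \<and> omega1 \<epsilon> \<beta> \<and> \<beta> \<epsilon> \<delta>"

definition lev :: "'v => 'v" where
  "lev \<beta> = hartogs (Vlev \<beta>)"

definition Sp :: "'v => bool" where
  "Sp \<kappa> <-> (\<exists>\<beta>. good_height \<beta> \<and> \<kappa> = lev \<beta>)"

lemma limit_Vlev_opair:
  assumes "limit \<beta>" "x \<epsilon> Vlev \<beta>" "y \<epsilon> Vlev \<beta>"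
  shows "upair x y \<epsilon> Vlev \<beta>" "opair x y \<epsilon> Vlev \<beta>"
proof -
  have o: "ordinal \<beta>" and s: "\<And>\<gamma>. \<gamma> \<epsilon> \<beta> ==> succ \<gamma> \<epsilon> \<beta>" using assms(1) unfolding limit_def by blast+
  have *: "upair x y \<epsilon> Vlev \<beta>" if xy: "x \<epsilon> Vlev \<beta>" "y \<epsilon> Vlev \<beta>" for x y
  proof -
    obtain \<gamma> \<gamma>' where \<gamma>: "\<gamma> \<epsilon> \<beta>" "x \<sqsubseteq> Vlev \<gamma>" "\<gamma>' \<epsilon> \<beta>" "y \<sqsubseteq> Vlev \<gamma>'"
      using xy mem_Vlev[OF o, of x] mem_Vlev[OF o, of y] by blast
    have o': "ordinal \<gamma>" "ordinal \<gamma>'" using \<gamma> ordinal_mem o by blast+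
    obtain \<mu> where \<mu>: "\<mu> \<epsilon> \<beta>" "\<gamma> \<epsilon> \<mu>" "\<gamma>' \<epsilon> \<mu>"
    proof (cases "\<gamma> \<epsilon> \<gamma>'")
      case True then show thesis using that[of "succ \<gamma>'"] s \<gamma> by simp
    next
      case False
      then have "\<gamma>' \<epsilon> succ \<gamma>" using ordinal_linear[OF o'] by auto
      then show thesis using that[of "succ \<gamma>"] s \<gamma> by simp
    qed
    then have "x \<epsilon> Vlev \<mu>" "y \<epsilon> Vlev \<mu>" using \<gamma> mem_Vlev[OF ordinal_mem[OF o \<mu>(1)]] by blast+
    then have "upair x y \<sqsubseteq> Vlev \<mu>" by (auto simp: subset_def)
    then show ?thesis using \<mu>(1) mem_Vlev[OF o] by blast
  qed
  show "upair x y \<epsilon> Vlev \<beta>" "opair x y \<epsilon> Vlev \<beta>" unfolding opair_def using * assms by blast+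
qed

lemma good_height_facts:
  assumes "good_height \<beta>"
  shows "ordinal \<beta>" "small (Vlev \<beta>)" "lepoll (prod (Vlev \<beta>) (Vlev \<beta>)) (Vlev \<beta>)"
    "lepoll omega (Vlev \<beta>)" "lepoll omega1 (Vlev \<beta>)" "omega \<epsilon> Vlev \<beta>"
proof -
  have b: "limit \<beta>" "omega1 \<epsilon> \<beta>" "\<beta> \<epsilon> \<delta>" using assms unfolding good_height_def by blast+
  show o: "ordinal \<beta>" using b unfolding limit_def by blast
  show "small (Vlev \<beta>)" using b small_Vlev by blast
  show "lepoll (prod (Vlev \<beta>) (Vlev \<beta>)) (Vlev \<beta>)"
    by (rule subset_lepoll) (auto simp: subset_def mem_prod_iff intro: limit_Vlev_opair[OF b(1)])
  have "omega1 \<sqsubseteq> Vlev \<beta>" using ordinal_subset_Vlev[OF o] ordinal_subset[OF o b(2)] subset_trans by blast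
  then show "lepoll omega1 (Vlev \<beta>)" "lepoll omega (Vlev \<beta>)"
    using omega_subset_omega1 subset_trans subset_lepoll by blast+
  have "omega1 \<epsilon> Vlev \<beta>" using ordinal_subset_Vlev[OF o] b(2) subsetD by blast
  then show "omega \<epsilon> Vlev \<beta>" using Vlev_subset_closed[OF o] omega_subset_omega1 by blast
qed

lemma lev_Ix: "good_height \<beta> ==> lev \<beta> \<epsilon> Ix"
proof -
  assume b: "good_height \<beta>"
  note f = good_height_facts[OF b]
  have "omega2 \<sqsubseteq> lev \<beta>" unfolding subset_def lev_def mem_hartogs[OF f(2)] mem_omega2
    using f(5) lepoll_trans by blast
  then show ?thesis unfolding mem_Ix lev_def using regular_hartogs[OF f(2-4)] hartogs_delta[OF f(2)] by blast
qed

lemma Sp_Ix: "Sp \<kappa> ==> \<kappa> \<epsilon> Ix"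
  unfolding Sp_def using lev_Ix by blast

lemma mem_Hl_lev: "good_height \<beta> ==> x \<epsilon> Hl (lev \<beta>) <-> lepoll (trcl x) (Vlev \<beta>)"
proof -
  assume b: "good_height \<beta>"
  have "card_less (trcl x) (lev \<beta>) ==> x \<epsilon> Vd"
    using H_Vlev[OF lev_Ix[OF b]] Vlev_subset[OF ordinal_delta] lev_Ix[OF b] mem_Ix subsetD by blast
  then show ?thesis unfolding mem_Hl lev_def[symmetric]
    using card_less_hartogs[OF good_height_facts(2)[OF b]] unfolding lev_def by blast
qed

lemma Hl_levI:
  assumes b: "good_height \<beta>" and x: "x \<sqsubseteq> Hl (lev \<beta>)" "lepoll x (Vlev \<beta>)"
  shows "x \<epsilon> Hl (lev \<beta>)"
proof -
  note f = good_height_facts[OF b]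
  have ft: "fot1 trcl" by (intro fo_intros)
  define A where "A = (SET y. \<exists>z. z \<epsilon> x \<and> y = trcl z)"
  have A: "y \<epsilon> A <-> (\<exists>z. z \<epsilon> x \<and> y = trcl z)" for y unfolding A_def by (rule mem_image[OF ft])
  let ?T = "Union (upair x (Union A))"
  have "lepoll A x" by (rule lepoll_image[OF ft]) (simp add: A)
  then have "lepoll A (Vlev \<beta>)" using x lepoll_trans by blast
  then have UA: "lepoll (Union A) (Vlev \<beta>)"
  proof (rule Union_lepoll[OF f(3)])
    fix y assume "y \<epsilon> A"
    then obtain z where "z \<epsilon> x" "y = trcl z" unfolding A by blast
    then show "lepoll y (Vlev \<beta>)" using mem_Hl_lev[OF b] subsetD[OF x(1)] by blast
  qed
  have T: "lepoll ?T (Vlev \<beta>)"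
  proof (rule Union_lepoll[OF f(3) lepoll_trans[OF upair_lepoll_omega f(4)]])
    fix y assume "y \<epsilon> upair x (Union A)"
    then show "lepoll y (Vlev \<beta>)" unfolding mem_upair using x(2) UA by blast
  qed
  have T_iff: "y \<epsilon> ?T <-> y \<epsilon> x \<or> (\<exists>z. z \<epsilon> x \<and> y \<epsilon> trcl z)" for y
  proof -
    have "y \<epsilon> Union A <-> (\<exists>z. z \<epsilon> x \<and> y \<epsilon> trcl z)" by (auto simp: A)
    then show ?thesis unfolding mem_Union[of y "upair x (Union A)"] mem_upair by blast
  qed
  have "z \<epsilon> ?T" if "y \<epsilon> ?T" "z \<epsilon> y" for y z
    using that subsetD[OF subset_trcl, of z y] transitiveD[OF transitive_trcl, of y _ z] unfolding T_iff by blast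
  then have "transitive ?T" unfolding transitive_def subset_def by blast
  moreover have "x \<sqsubseteq> ?T" by (auto simp: subset_def)
  ultimately have "lepoll (trcl x) (Vlev \<beta>)" using T trcl_least subset_lepoll lepoll_trans by blast
  then show ?thesis using mem_Hl_lev[OF b] by blast
qed

lemma Vlev_subset_Hl: "good_height \<beta> ==> Vlev \<beta> \<sqsubseteq> Hl (lev \<beta>)"
  unfolding subset_def mem_Hl_lev
  using trcl_least[OF transitive_Vlev[OF good_height_facts(1)]] subset_lepoll
    transitive_Vlev[OF good_height_facts(1)] transitive_def by blast

lemma Sp_subsetI: "Sp \<kappa> ==> x \<sqsubseteq> Hl \<kappa> ==> lepoll x omega1 ==> x \<epsilon> Hl \<kappa>"
  unfolding Sp_def using Hl_levI good_height_facts(5) lepoll_trans by blast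

lemma omega_lepoll_omega1: "lepoll omega omega1"
  using omega_subset_omega1 subset_lepoll by blast

lemma Sp_upair: "Sp \<kappa> ==> x \<epsilon> Hl \<kappa> ==> y \<epsilon> Hl \<kappa> ==> upair x y \<epsilon> Hl \<kappa>"
  by (rule Sp_subsetI) (use lepoll_trans[OF upair_lepoll_omega omega_lepoll_omega1] in \<open>auto simp: subset_def\<close>)

lemma Sp_opair: "Sp \<kappa> ==> x \<epsilon> Hl \<kappa> ==> y \<epsilon> Hl \<kappa> ==> opair x y \<epsilon> Hl \<kappa>"
  unfolding opair_def by (intro Sp_upair)

lemma Sp_omega: "Sp \<kappa> ==> omega \<epsilon> Hl \<kappa>"
  unfolding Sp_def using Vlev_subset_Hl good_height_facts(6) subsetD by blast

lemma Sp_above: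
  assumes "x \<epsilon> Vd" "\<mu> \<epsilon> \<delta>"
  shows "\<exists>\<kappa>. Sp \<kappa> \<and> x \<epsilon> Hl \<kappa> \<and> \<mu> \<sqsubseteq> \<kappa>"
proof -
  obtain \<alpha> where \<alpha>: "\<alpha> \<epsilon> \<delta>" "x \<sqsubseteq> Vlev \<alpha>" using assms mem_Vd by blast
  obtain \<gamma> where \<gamma>: "\<gamma> \<epsilon> \<delta>" "\<alpha> \<sqsubseteq> \<gamma>" "\<mu> \<sqsubseteq> \<gamma>" using delta_max[OF \<alpha>(1) assms(2)] by blast
  obtain \<gamma>' where \<gamma>': "\<gamma>' \<epsilon> \<delta>" "omega1 \<sqsubseteq> \<gamma>'" "\<gamma> \<sqsubseteq> \<gamma>'" using delta_max[OF omega1_delta \<gamma>(1)] by blast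
  obtain \<beta> where \<beta>: "\<beta> \<epsilon> \<delta>" "\<gamma>' \<epsilon> \<beta>" "limit \<beta>" using limit_above[OF \<gamma>'(1)] by blast
  have o: "ordinal \<beta>" using \<beta> limit_def by blast
  have mem: "\<xi> \<epsilon> \<beta>" if "\<xi> \<epsilon> \<delta>" "\<xi> \<sqsubseteq> \<gamma>'" for \<xi>
    using ordinal_subset_iff[of \<xi> \<gamma>'] that \<gamma>'(1) ordinal_mem[OF ordinal_delta] ordinal_trans[OF o \<beta>(2)] \<beta>(2) by blast
  have g: "good_height \<beta>" unfolding good_height_def using \<beta> mem omega1_delta \<gamma>'(2) by blast
  have "\<alpha> \<epsilon> \<beta>" "\<mu> \<epsilon> \<beta>" using mem \<alpha>(1) assms(2) \<gamma> \<gamma>'(3) subset_trans by blast+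
  then have "x \<epsilon> Vlev \<beta>" using \<alpha>(2) mem_Vlev[OF o] by blast
  then have "x \<epsilon> Hl (lev \<beta>)" using Vlev_subset_Hl[OF g] subsetD by blast
  moreover have "\<xi> \<epsilon> lev \<beta>" if "\<xi> \<epsilon> \<beta>" for \<xi>
    unfolding lev_def mem_hartogs[OF good_height_facts(2)[OF g]]
    using that ordinal_mem[OF o] ordinal_subset[OF o] ordinal_subset_Vlev[OF o] subset_trans subset_lepoll by blast
  then have "\<mu> \<epsilon> lev \<beta>" using \<open>\<mu> \<epsilon> \<beta>\<close> by blast
  then have "\<mu> \<sqsubseteq> lev \<beta>" using ordinal_subset Ix_ordinal lev_Ix g by blast
  ultimately show ?thesis unfolding Sp_def using g by blast
qed

lemma fo_Sp [fo_intros]: "fot mem t ==> fo mem (\<lambda>e. Sp (t e))"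
proof (rule fo_sub1)
  have l: "\<kappa> = lev \<beta> <-> (\<forall>\<alpha>. \<alpha> \<epsilon> \<kappa> <-> ordinal \<alpha> \<and> lepoll \<alpha> (Vlev \<beta>))" if "good_height \<beta>" for \<kappa> \<beta>
    unfolding set_eq_iff lev_def mem_hartogs[OF good_height_facts(2)[OF that]] ..
  have "Sp \<kappa> <-> (\<exists>\<beta>. good_height \<beta> \<and> (\<forall>\<alpha>. \<alpha> \<epsilon> \<kappa> <-> ordinal \<alpha> \<and> lepoll \<alpha> (Vlev \<beta>)))" for \<kappa>
    unfolding Sp_def using l by blast
  moreover have "fo mem (\<lambda>e. \<exists>\<beta>. good_height \<beta> \<and> (\<forall>\<alpha>. \<alpha> \<epsilon> e 0 <-> ordinal \<alpha> \<and> lepoll \<alpha> (Vlev \<beta>)))"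
    unfolding good_height_def limit_def by (intro fo_intros)
  ultimately show "fo1 Sp" by simp
qed

end

section \<open>Towers of ideals\<close>

locale tower_universe = inaccessible_universe mem \<delta> for mem :: "'v => 'v => bool" (infix "\<epsilon>" 50) and \<delta> :: 'v +
  fixes I :: 'v
  assumes tower: "tower \<delta> I"
begin

definition null :: "'v => 'v => bool" where
  "null \<kappa> A <-> A \<epsilon> val I \<kappa>"

definition pos :: "'v => 'v => bool" where
  "pos \<kappa> S <-> S \<sqsubseteq> Zl \<kappa> \<and> \<not> null \<kappa> S"

definition ae :: "'v => ('v => bool) => bool" where
  "ae \<kappa> P <-> (\<exists>N. null \<kappa> N \<and> (\<forall>M. M \<epsilon> Zl \<kappa> --> \<not> M \<epsilon> N --> P M))"

definition lift :: "'v => 'v => 'v => 'v" where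
  "lift \<kappa> \<kappa>' S = (SET M. M \<epsilon> Zl \<kappa>' \<and> inter M (Hl \<kappa>) \<epsilon> S)"

lemma fo_null [fo_intros]: "fot mem t ==> fot mem u ==> fo mem (\<lambda>e. null (t e) (u e))"
  unfolding null_def by (intro fo_intros)

lemma mem_lift [simp]: "M \<epsilon> lift \<kappa> \<kappa>' S <-> M \<epsilon> Zl \<kappa>' \<and> inter M (Hl \<kappa>) \<epsilon> S"
  unfolding lift_def by (rule mem_sep) (intro fo_intros)

lemma app_I: "\<kappa> \<epsilon> Ix ==> app I \<kappa> = val I \<kappa>"
  using tower function_on_app unfolding tower_def Ix_def by blast

lemma ideal_I: "\<kappa> \<epsilon> Ix ==> ideal (Zl \<kappa>) (val I \<kappa>)"
  using tower Zset_eq app_I unfolding tower_def Ix_def by metis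

lemma null_subset_Zl: "\<kappa> \<epsilon> Ix ==> null \<kappa> A ==> A \<sqsubseteq> Zl \<kappa>"
  using ideal_I[of \<kappa>] subsetD[of "val I \<kappa>" "Pow (Zl \<kappa>)" A] unfolding ideal_def null_def by simp

lemma null_mono: "\<kappa> \<epsilon> Ix ==> null \<kappa> A ==> B \<sqsubseteq> A ==> null \<kappa> B"
  using ideal_I unfolding ideal_def null_def by blast

lemma not_null_Zl: "\<kappa> \<epsilon> Ix ==> \<not> null \<kappa> (Zl \<kappa>)"
  using ideal_I unfolding ideal_def null_def by blast

lemma null_union2: "\<kappa> \<epsilon> Ix ==> null \<kappa> A ==> null \<kappa> B ==> null \<kappa> (union2 A B)"
proof -
  assume \<kappa>: "\<kappa> \<epsilon> Ix" and AB: "null \<kappa> A" "null \<kappa> B"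
  have "\<forall>D. D \<sqsubseteq> val I \<kappa> \<and> countable D --> Union D \<epsilon> val I \<kappa>"
    using ideal_I[OF \<kappa>] unfolding ideal_def by blast
  moreover have "upair A B \<sqsubseteq> val I \<kappa>" using AB by (auto simp: subset_def null_def)
  ultimately show ?thesis unfolding null_def union2_def countable_def using upair_lepoll_omega by blast
qed

lemma null_fine: "\<kappa> \<epsilon> Ix ==> b \<epsilon> Hl \<kappa> ==> null \<kappa> (SET M. M \<epsilon> Zl \<kappa> \<and> \<not> b \<epsilon> M)"
  using ideal_I Union_Zl unfolding ideal_def null_def by simp

lemma null_lift:
  assumes "\<kappa> \<epsilon> Ix" "\<kappa>' \<epsilon> Ix" "\<kappa> \<sqsubseteq> \<kappa>'"
  shows "null \<kappa> A <-> A \<sqsubseteq> Zl \<kappa> \<and> null \<kappa>' (lift \<kappa> \<kappa>' A)"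
proof -
  have "canonical_projection (Zl \<kappa>) (val I \<kappa>) (Zl \<kappa>') (val I \<kappa>')"
    using tower assms Zset_eq app_I unfolding tower_def Ix_def by metis
  then have I: "val I \<kappa> = (SET A. A \<sqsubseteq> Zl \<kappa> \<and> null \<kappa>' (lift \<kappa> \<kappa>' A))"
    unfolding canonical_projection_def Union_Zl[OF assms(1)] lift_def null_def by blast
  have fl: "fot mem (\<lambda>e. lift \<kappa> \<kappa>' (e 0))" by (rule fot_set, rule mem_lift) (intro fo_intros)
  show ?thesis unfolding null_def[of \<kappa>] I
    by (rule bounded_coll[where a = "Pow (Zl \<kappa>)"]) (intro fo_intros fl, simp)
qed

lemma ae_mono: "ae \<kappa> P ==> (\<And>M. M \<epsilon> Zl \<kappa> ==> P M ==> Q M) ==> ae \<kappa> Q"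
  unfolding ae_def by blast

lemma ae_conj: "\<kappa> \<epsilon> Ix ==> ae \<kappa> P ==> ae \<kappa> Q ==> ae \<kappa> (\<lambda>M. P M \<and> Q M)"
  unfolding ae_def using null_union2 mem_union2 by metis

lemma null_empty: "\<kappa> \<epsilon> Ix ==> null \<kappa> empty"
proof -
  assume \<kappa>: "\<kappa> \<epsilon> Ix"
  have "\<forall>D. D \<sqsubseteq> val I \<kappa> \<and> countable D --> Union D \<epsilon> val I \<kappa>"
    using ideal_I[OF \<kappa>] unfolding ideal_def by blast
  moreover have "Union empty = empty" by (rule set_eqI) auto
  ultimately show ?thesis unfolding null_def countable_def using subset_lepoll[OF empty_subset] empty_subset by metis
qed

lemma pos_nonempty: "\<kappa> \<epsilon> Ix ==> pos \<kappa> S ==> \<exists>M. M \<epsilon> S"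
proof (rule ccontr)
  assume "\<kappa> \<epsilon> Ix" "pos \<kappa> S" "\<nexists>M. M \<epsilon> S"
  then have "S = empty" by (simp add: set_eq_iff)
  then show False using \<open>\<kappa> \<epsilon> Ix\<close> \<open>pos \<kappa> S\<close> null_empty unfolding pos_def by blast
qed

lemma pos_subset_Zl: "pos \<kappa> S ==> M \<epsilon> S ==> M \<epsilon> Zl \<kappa>"
  unfolding pos_def subset_def by blast

lemma pos_Zl: "\<kappa> \<epsilon> Ix ==> pos \<kappa> (Zl \<kappa>)"
  unfolding pos_def using not_null_Zl by simp

lemma pos_mono: "\<kappa> \<epsilon> Ix ==> pos \<kappa> S ==> S \<sqsubseteq> T ==> T \<sqsubseteq> Zl \<kappa> ==> pos \<kappa> T"
  unfolding pos_def using null_mono by blast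

lemma pos_ae:
  assumes \<kappa>: "\<kappa> \<epsilon> Ix" and S: "pos \<kappa> S" and P: "ae \<kappa> P"
  shows "\<exists>S'. pos \<kappa> S' \<and> S' \<sqsubseteq> S \<and> (\<forall>M. M \<epsilon> S' --> P M)"
proof -
  obtain N where N: "null \<kappa> N" "\<And>M. M \<epsilon> Zl \<kappa> ==> \<not> M \<epsilon> N ==> P M" using P unfolding ae_def by blast
  have "\<not> null \<kappa> (diff S N)"
  proof
    assume "null \<kappa> (diff S N)"
    then have "null \<kappa> (union2 (diff S N) N)" using null_union2 \<kappa> N by blast
    then have "null \<kappa> S" by (rule null_mono[OF \<kappa>]) (auto simp: subset_def)
    then show False using S unfolding pos_def by blast
  qed
  then have "pos \<kappa> (diff S N)" using S unfolding pos_def by (auto simp: subset_def)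
  moreover have "diff S N \<sqsubseteq> S" by (simp add: subset_def)
  moreover have "P M" if "M \<epsilon> diff S N" for M
    using that N(2) pos_subset_Zl[OF S] by simp
  ultimately show ?thesis by blast
qed

lemma aeI:
  assumes P: "fo1 P"
    and no: "\<And>S. pos \<kappa> S ==> (\<And>M. M \<epsilon> S ==> \<not> P M) ==> False"
  shows "ae \<kappa> P"
proof -
  have f: "fo mem (\<lambda>e. \<not> P (e 0))" by (intro fo_intros P)
  let ?S = "SET M. M \<epsilon> Zl \<kappa> \<and> \<not> P M"
  have "?S \<sqsubseteq> Zl \<kappa>" by (simp add: subset_def mem_sep[OF f])
  moreover have "\<not> P M" if "M \<epsilon> ?S" for M using that unfolding mem_sep[OF f] by blast
  ultimately have "null \<kappa> ?S" using no[of ?S] unfolding pos_def by blast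
  moreover have "P M" if "M \<epsilon> Zl \<kappa>" "\<not> M \<epsilon> ?S" for M using that unfolding mem_sep[OF f] by blast
  ultimately show ?thesis unfolding ae_def by blast
qed

lemma pos_split:
  assumes \<kappa>: "\<kappa> \<epsilon> Ix" and S: "pos \<kappa> S" and P: "fo1 P"
  shows "\<exists>S'. pos \<kappa> S' \<and> S' \<sqsubseteq> S \<and> ((\<forall>M. M \<epsilon> S' --> P M) \<or> (\<forall>M. M \<epsilon> S' --> \<not> P M))"
proof (cases "ae \<kappa> (\<lambda>M. M \<epsilon> S --> P M)")
  case True
  from pos_ae[OF \<kappa> S True] show ?thesis using subsetD by blast
next
  case False
  have "fo mem (\<lambda>e. e 0 \<epsilon> S --> P (e 0))" by (intro fo_intros P)
  from aeI[OF this, of \<kappa>] False obtain T where T: "pos \<kappa> T" "\<And>M. M \<epsilon> T ==> M \<epsilon> S \<and> \<not> P M" by blast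
  then show ?thesis unfolding subset_def by blast
qed

lemma ae_fine: "\<kappa> \<epsilon> Ix ==> b \<epsilon> Hl \<kappa> ==> ae \<kappa> (\<lambda>M. b \<epsilon> M)"
proof -
  assume "\<kappa> \<epsilon> Ix" "b \<epsilon> Hl \<kappa>"
  have f: "fo mem (\<lambda>e. \<not> b \<epsilon> e 0)" by (intro fo_intros)
  show ?thesis unfolding ae_def
    by (rule exI, rule conjI, rule null_fine) (use \<open>\<kappa> \<epsilon> Ix\<close> \<open>b \<epsilon> Hl \<kappa>\<close> in \<open>auto simp: mem_sep[OF f]\<close>)
qed

lemma press_down:
  assumes \<kappa>: "\<kappa> \<epsilon> Ix" and S: "pos \<kappa> S" and R: "fo2 R"
    and ex: "\<And>M. M \<epsilon> S ==> \<exists>x. x \<epsilon> M \<and> R M x"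
  shows "\<exists>x S'. pos \<kappa> S' \<and> S' \<sqsubseteq> S \<and> x \<epsilon> Hl \<kappa> \<and> (\<forall>M. M \<epsilon> S' --> x \<epsilon> M \<and> R M x)"
proof -
  have f: "fo mem (\<lambda>e. e (Suc 0) \<epsilon> e 0 \<and> R (e 0) (e (Suc 0)))" by (intro fo_intros R)
  have "\<exists>y. y \<epsilon> Hl \<kappa> \<and> y \<epsilon> M \<and> R M y" if M: "M \<epsilon> S" for M
    using ex[OF M] pos_subset_Zl[OF S M] subsetD unfolding mem_Zl by blast
  then obtain g where g: "function_on g S" "\<And>M. M \<epsilon> S ==> val g M \<epsilon> Hl \<kappa>"
    "\<And>M. M \<epsilon> S ==> val g M \<epsilon> M \<and> R M (val g M)"
    using choose_function[OF f, of S "Hl \<kappa>"] by blast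
  have "\<forall>S g. S \<sqsubseteq> Zl \<kappa> \<and> \<not> S \<epsilon> val I \<kappa> \<and> function_on g S \<and> (\<forall>M. M \<epsilon> S --> app g M \<epsilon> M) -->
        (\<exists>S' c. S' \<sqsubseteq> S \<and> \<not> S' \<epsilon> val I \<kappa> \<and> (\<forall>M. M \<epsilon> S' --> app g M = c))"
    using ideal_I[OF \<kappa>] unfolding ideal_def by blast
  moreover have "app g M = val g M" if "M \<epsilon> S" for M using function_on_app[OF g(1) that] .
  then have "S \<sqsubseteq> Zl \<kappa> \<and> \<not> S \<epsilon> val I \<kappa> \<and> function_on g S \<and> (\<forall>M. M \<epsilon> S --> app g M \<epsilon> M)"
    using S g unfolding pos_def null_def by simp
  ultimately obtain S' c where S': "S' \<sqsubseteq> S" "\<not> S' \<epsilon> val I \<kappa>" "\<And>M. M \<epsilon> S' ==> app g M = c"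
    by blast
  have c: "val g M = c" if "M \<epsilon> S'" for M
    using S'(3)[OF that] function_on_app[OF g(1) subsetD[OF S'(1) that]] by simp
  have p: "pos \<kappa> S'" using S' S subset_trans unfolding pos_def null_def by blast
  obtain M where "M \<epsilon> S'" using pos_nonempty[OF \<kappa> p] by blast
  then have "c \<epsilon> Hl \<kappa>" using g(2)[of M] c[of M] subsetD[OF S'(1), of M] by simp
  moreover have "c \<epsilon> M \<and> R M c" if "M \<epsilon> S'" for M
    using g(3)[of M] c[OF that] subsetD[OF S'(1) that] by simp
  ultimately show ?thesis using p S'(1) by blast
qed

lemma lift_subset_Zl: "lift \<kappa> \<kappa>' S \<sqsubseteq> Zl \<kappa>'"
  by (simp add: subset_def)

lemma pos_lift:
  assumes "\<kappa> \<epsilon> Ix" "\<kappa>' \<epsilon> Ix" "\<kappa> \<sqsubseteq> \<kappa>'" "pos \<kappa> S"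
  shows "pos \<kappa>' (lift \<kappa> \<kappa>' S)"
  using assms null_lift[OF assms(1-3), of S] lift_subset_Zl unfolding pos_def by blast

definition skolem :: "'v => ('v => 'v => 'v => bool) => 'v => bool" where
  "skolem \<kappa> R M <-> (\<forall>x x' y. x \<epsilon> M \<and> x' \<epsilon> M \<and> y \<epsilon> Hl \<kappa> \<and> R x x' y --> (\<exists>y. y \<epsilon> M \<and> R x x' y))"

lemma ae_skolem:
  assumes \<kappa>: "\<kappa> \<epsilon> Ix" and R: "fo mem (\<lambda>e. R (e 0) (e (Suc 0)) (e (Suc (Suc 0))))"
  shows "ae \<kappa> (skolem \<kappa> R)"
proof (rule aeI)
  show "fo mem (\<lambda>e. skolem \<kappa> R (e 0))" unfolding skolem_def by (intro fo_intros fo_sub3[OF R])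
  fix S assume S: "pos \<kappa> S" "\<And>M. M \<epsilon> S ==> \<not> skolem \<kappa> R M"
  define Q where "Q M x x' <-> x' \<epsilon> M \<and> (\<exists>y. y \<epsilon> Hl \<kappa> \<and> R x x' y) \<and> \<not> (\<exists>y. y \<epsilon> M \<and> R x x' y)" for M x x'
  have Q: "fo mem (\<lambda>e. \<exists>x'. Q (e 0) (e (Suc 0)) x')" unfolding Q_def by (intro fo_intros fo_sub3[OF R])
  have "\<exists>x. x \<epsilon> M \<and> (\<exists>x'. Q M x x')" if M: "M \<epsilon> S" for M
    using S(2)[OF M] unfolding skolem_def Q_def by blast
  then obtain x S1 where S1: "pos \<kappa> S1" "S1 \<sqsubseteq> S" "x \<epsilon> Hl \<kappa>" "\<And>M. M \<epsilon> S1 ==> x \<epsilon> M \<and> (\<exists>x'. Q M x x')"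
    using press_down[where R = "\<lambda>M x. \<exists>x'. Q M x x'", OF \<kappa> S(1) Q] by blast
  have Q': "fo mem (\<lambda>e. Q (e 0) x (e (Suc 0)))" unfolding Q_def by (intro fo_intros fo_sub3[OF R])
  have "\<exists>x'. x' \<epsilon> M \<and> Q M x x'" if "M \<epsilon> S1" for M using S1(4)[OF that] unfolding Q_def by blast
  then obtain x' S2 where S2: "pos \<kappa> S2" "S2 \<sqsubseteq> S1" "x' \<epsilon> Hl \<kappa>" "\<And>M. M \<epsilon> S2 ==> x' \<epsilon> M \<and> Q M x x'"
    using press_down[where R = "\<lambda>M x'. Q M x x'", OF \<kappa> S1(1) Q'] by blast
  obtain M where "M \<epsilon> S2" using pos_nonempty[OF \<kappa> S2(1)] by blast
  then have "\<exists>y. y \<epsilon> Hl \<kappa> \<and> R x x' y" using S2(4)[of M] unfolding Q_def by blast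
  then obtain y where y: "y \<epsilon> Hl \<kappa>" "R x x' y" by blast
  obtain S3 where S3: "pos \<kappa> S3" "S3 \<sqsubseteq> S2" "\<And>M. M \<epsilon> S3 ==> y \<epsilon> M"
    using pos_ae[OF \<kappa> S2(1) ae_fine[OF \<kappa> y(1)]] by blast
  obtain M where M: "M \<epsilon> S3" using pos_nonempty[OF \<kappa> S3(1)] by blast
  have "Q M x x'" using S2(4)[OF subsetD[OF S3(2) M]] by blast
  then show False using S3(3)[OF M] y(2) unfolding Q_def by blast
qed

lemma skolemD: "skolem \<kappa> R M ==> x \<epsilon> M ==> x' \<epsilon> M ==> y \<epsilon> Hl \<kappa> ==> R x x' y ==> \<exists>y. y \<epsilon> M \<and> R x x' y"
  unfolding skolem_def by blast

end

section \<open>Transitive collapses\<close>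

context zfc_universe
begin

definition collapse :: "'v => 'v => bool" where
  "collapse M \<pi> <-> function_on \<pi> M \<and>
     (\<forall>x t. x \<epsilon> M --> (t \<epsilon> val \<pi> x <-> (\<exists>y. y \<epsilon> M \<and> y \<epsilon> x \<and> t = val \<pi> y))) \<and>
     (\<forall>x y. x \<epsilon> M \<and> y \<epsilon> M \<and> val \<pi> x = val \<pi> y --> x = y)"

lemma fo_collapse [fo_intros]: "fot mem t ==> fot mem u ==> fo mem (\<lambda>e. collapse (t e) (u e))"
  by (rule fo_sub2) (unfold collapse_def, intro fo_intros)

lemma transitive_collapse_collapse:
  assumes "transitive_collapse M N"
  obtains \<pi> where "collapse M \<pi>" "ran \<pi> = N"
proof -
  obtain \<pi> where N: "transitive N" and b: "bijection \<pi> M N"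
    and e: "\<And>x y. x \<epsilon> M ==> y \<epsilon> M ==> x \<epsilon> y <-> app \<pi> x \<epsilon> app \<pi> y"
    using assms unfolding transitive_collapse_def by blast
  have f: "function_on \<pi> M" using b unfolding bijection_def injection_def maps_def by blast
  note i = injection_opair[OF bijection_injection[OF b]] and v = function_on_opair_iff[OF f]
  have onto: "\<exists>x. x \<epsilon> M \<and> t = val \<pi> x" if "t \<epsilon> N" for t
    using b that v unfolding bijection_iff by blast
  have inN: "val \<pi> x \<epsilon> N" if "x \<epsilon> M" for x using i(2)[of x "val \<pi> x"] v that by blast
  have e': "x \<epsilon> y <-> val \<pi> x \<epsilon> val \<pi> y" if "x \<epsilon> M" "y \<epsilon> M" for x y
    using e[OF that] function_on_app[OF f] that by simp
  have "t \<epsilon> val \<pi> x <-> (\<exists>y. y \<epsilon> M \<and> y \<epsilon> x \<and> t = val \<pi> y)" if "x \<epsilon> M" for x t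
    using onto[of t] transitiveD[OF N inN[OF that], of t] e'[OF _ that] by blast
  moreover have "x = y" if "x \<epsilon> M" "y \<epsilon> M" "val \<pi> x = val \<pi> y" for x y
    using i(4)[of x "val \<pi> x" y] v that by metis
  ultimately have "collapse M \<pi>" unfolding collapse_def using f by blast
  moreover have "ran \<pi> = N" by (rule set_eqI) (use onto inN v in auto)
  ultimately show thesis by (rule that)
qed

context
  fixes M \<pi> assumes c: "collapse M \<pi>"
begin

lemma collapse_function: "function_on \<pi> M"
  using c unfolding collapse_def by blast

lemma collapse_mem: "x \<epsilon> M ==> t \<epsilon> val \<pi> x <-> (\<exists>y. y \<epsilon> M \<and> y \<epsilon> x \<and> t = val \<pi> y)"
  using c unfolding collapse_def by blast

lemma collapse_inj: "x \<epsilon> M ==> y \<epsilon> M ==> val \<pi> x = val \<pi> y ==> x = y"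
  using c unfolding collapse_def by blast

lemma collapse_mem_iff: "x \<epsilon> M ==> y \<epsilon> M ==> val \<pi> x \<epsilon> val \<pi> y <-> x \<epsilon> y"
  using collapse_mem collapse_inj by blast

lemma collapse_opair: "opair x t \<epsilon> \<pi> <-> x \<epsilon> M \<and> t = val \<pi> x"
  using function_on_opair_iff[OF collapse_function] .

lemma collapse_ran: "t \<epsilon> ran \<pi> <-> (\<exists>x. x \<epsilon> M \<and> t = val \<pi> x)"
  by (simp add: collapse_opair)

lemma collapse_ran_mem: "x \<epsilon> M ==> val \<pi> x \<epsilon> ran \<pi>"
  unfolding collapse_ran by blast

end

lemma collapse_restrict_eq:
  assumes c: "collapse M \<pi>" "collapse M' \<pi>'" and M: "M = inter M' h" and h: "\<And>x y. x \<epsilon> h ==> y \<epsilon> x ==> y \<epsilon> h"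
    and x: "x \<epsilon> M"
  shows "val \<pi> x = val \<pi>' x"
proof (rule ccontr)
  assume "val \<pi> x \<noteq> val \<pi>' x"
  have "fo mem (\<lambda>e. val \<pi> (e 0) \<noteq> val \<pi>' (e 0))" by (intro fo_intros)
  then obtain y where
    y: "y \<epsilon> M" "val \<pi> y \<noteq> val \<pi>' y" "\<And>z. z \<epsilon> y ==> z \<epsilon> M ==> \<not> val \<pi> z \<noteq> val \<pi>' z"
    using least_on_ex[where P = "\<lambda>y. val \<pi> y \<noteq> val \<pi>' y", OF _ x \<open>val \<pi> x \<noteq> val \<pi>' x\<close>] by blast
  have y': "y \<epsilon> M'" "y \<epsilon> h" using y(1) M by auto
  have "val \<pi> y = val \<pi>' y"
  proof (rule set_eqI)
    fix t
    have "t \<epsilon> val \<pi>' y <-> (\<exists>z. z \<epsilon> M \<and> z \<epsilon> y \<and> t = val \<pi>' z)"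
      unfolding collapse_mem[OF c(2) y'(1)] using M h[OF y'(2)] by auto
    then show "t \<epsilon> val \<pi> y <-> t \<epsilon> val \<pi>' y"
      unfolding collapse_mem[OF c(1) y(1)] using y(3) by auto
  qed
  with y(2) show False by blast
qed

lemma collapse_unique:
  assumes "collapse M \<pi>" "collapse M \<pi>'" shows "\<pi> = \<pi>'"
proof (rule function_eqI[of _ M])
  fix x assume "x \<epsilon> M"
  then show "val \<pi> x = val \<pi>' x"
    by (rule collapse_restrict_eq[OF assms, of "trcl M", rotated 2])
      (use subset_trcl[of M] transitiveD[OF transitive_trcl] in \<open>auto simp: subset_def intro!: set_eqI\<close>)
qed (use assms collapse_function in blast)+

end

section \<open>Comparing guessing, internally club sets\<close>

context zfc_universe
begin

abbreviation ctbl :: "'v => bool" where "ctbl a \<equiv> lepoll a omega"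

lemma ctbl_subset: "ctbl a ==> b \<sqsubseteq> a ==> ctbl b"
  using subset_lepoll lepoll_trans by blast

lemma ctbl_union2: "ctbl a ==> ctbl b ==> ctbl (union2 a b)"
  unfolding union2_def by (rule Union_lepoll[OF omega_times_omega upair_lepoll_omega]) auto

lemma ctbl_prod: "ctbl a ==> ctbl b ==> ctbl (prod a b)"
  using prod_lepoll_mono omega_times_omega lepoll_trans by blast

definition approx :: "'v => bool" where
  "approx N <-> (\<forall>\<eta> A. \<eta> \<epsilon> N \<and> A \<sqsubseteq> \<eta> \<and> (\<forall>z. z \<epsilon> N \<and> ctbl z --> inter z A \<epsilon> N) --> A \<epsilon> N)"

definition club_in :: "'v => 'v => bool" where
  "club_in C M <-> (\<forall>c. c \<epsilon> C --> c \<sqsubseteq> M \<and> ctbl c) \<and>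
     (\<forall>x. x \<sqsubseteq> M \<and> ctbl x --> (\<exists>c. c \<epsilon> C \<and> x \<sqsubseteq> c)) \<and>
     (\<forall>D. D \<sqsubseteq> C \<and> ctbl D \<and> (\<exists>c. c \<epsilon> D) \<and> (\<forall>c d. c \<epsilon> D \<and> d \<epsilon> D --> c \<sqsubseteq> d \<or> d \<sqsubseteq> c) --> Union D \<epsilon> C)"

lemma club_club_in: "club C M ==> club_in C M"
proof -
  assume c: "club C M"
  have m: "x \<epsilon> countable_subsets M <-> x \<sqsubseteq> M \<and> ctbl x" for x
    unfolding countable_subsets_def countable_def
    by (rule bounded_coll[where a = "Pow M"]) (intro fo_intros, simp)
  have "C \<sqsubseteq> countable_subsets M" using c unfolding club_def by blast
  then have "\<forall>x. x \<epsilon> C --> x \<sqsubseteq> M \<and> ctbl x" unfolding subset_def[of C] m .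
  with c show ?thesis unfolding club_in_def club_def m countable_def by blast
qed

lemma club_in_subset: "club_in C M ==> c \<epsilon> C ==> c \<sqsubseteq> M \<and> ctbl c"
  and club_in_cofinal: "club_in C M ==> x \<sqsubseteq> M ==> ctbl x ==> \<exists>c. c \<epsilon> C \<and> x \<sqsubseteq> c"
  and club_in_Union: "club_in C M ==> D \<sqsubseteq> C ==> ctbl D ==> \<exists>c. c \<epsilon> D ==>
     (\<And>c d. c \<epsilon> D ==> d \<epsilon> D ==> c \<sqsubseteq> d \<or> d \<sqsubseteq> c) ==> Union D \<epsilon> C"
  unfolding club_in_def by blast+

text \<open>
  \<open>r\<close> codes the isomorphism type of the countable structure \<open>(y, \<in>, u)\<close> by a structure on a subset
  of \<open>\<omega>\<close>.
\<close>

definition code_by :: "'v => 'v => 'v => 'v => bool" where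
  "code_by j y u r <-> injection j y omega \<and> (\<exists>A B. r = opair A B \<and>
     (\<forall>p. p \<epsilon> A <-> (\<exists>s t m n. p = opair m n \<and> opair s m \<epsilon> j \<and> opair t n \<epsilon> j \<and> (s \<epsilon> t \<or> s = t))) \<and>
     (\<forall>m. m \<epsilon> B <-> (\<exists>s. s \<epsilon> u \<and> opair s m \<epsilon> j)))"

lemma fo_code_by [fo_intros]:
  "fot mem t ==> fot mem u ==> fot mem v ==> fot mem w ==> fo mem (\<lambda>e. code_by (t e) (u e) (v e) (w e))"
  by (rule fo_sub4) (unfold code_by_def, intro fo_intros)

lemma code_by_same:
  assumes c1: "code_by j1 y1 u1 r" and c2: "code_by j2 y2 u2 r"
  shows "s \<epsilon> y1 ==> \<exists>s' m. opair s m \<epsilon> j1 \<and> opair s' m \<epsilon> j2"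
    and "opair s m \<epsilon> j1 ==> opair s' m \<epsilon> j2 ==> opair t n \<epsilon> j1 ==> opair t' n \<epsilon> j2 ==> s \<epsilon> t ==> s' \<epsilon> t'"
    and "opair s m \<epsilon> j1 ==> opair s' m \<epsilon> j2 ==> s \<epsilon> u1 ==> s' \<epsilon> u2"
proof -
  obtain A B where A: "\<And>m n. opair m n \<epsilon> A <-> (\<exists>s t. opair s m \<epsilon> j1 \<and> opair t n \<epsilon> j1 \<and> (s \<epsilon> t \<or> s = t))"
    and B: "\<And>m. m \<epsilon> B <-> (\<exists>s. s \<epsilon> u1 \<and> opair s m \<epsilon> j1)"
    and A': "\<And>m n. opair m n \<epsilon> A <-> (\<exists>s t. opair s m \<epsilon> j2 \<and> opair t n \<epsilon> j2 \<and> (s \<epsilon> t \<or> s = t))"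
    and B': "\<And>m. m \<epsilon> B <-> (\<exists>s. s \<epsilon> u2 \<and> opair s m \<epsilon> j2)"
  proof -
    obtain A B where r: "r = opair A B"
      and A: "\<forall>p. p \<epsilon> A <-> (\<exists>s t m n. p = opair m n \<and> opair s m \<epsilon> j1 \<and> opair t n \<epsilon> j1 \<and> (s \<epsilon> t \<or> s = t))"
      and B: "\<forall>m. m \<epsilon> B <-> (\<exists>s. s \<epsilon> u1 \<and> opair s m \<epsilon> j1)"
      using c1 unfolding code_by_def by blast
    obtain A' B' where r': "r = opair A' B'"
      and A': "\<forall>p. p \<epsilon> A' <-> (\<exists>s t m n. p = opair m n \<and> opair s m \<epsilon> j2 \<and> opair t n \<epsilon> j2 \<and> (s \<epsilon> t \<or> s = t))"
      and B': "\<forall>m. m \<epsilon> B' <-> (\<exists>s. s \<epsilon> u2 \<and> opair s m \<epsilon> j2)"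
      using c2 unfolding code_by_def by blast
    have eq: "A' = A" "B' = B" using r r' by simp_all
    have 1: "opair m n \<epsilon> A <-> (\<exists>s t. opair s m \<epsilon> j1 \<and> opair t n \<epsilon> j1 \<and> (s \<epsilon> t \<or> s = t))" for m n
      using spec[OF A, of "opair m n"] by auto
    have 2: "opair m n \<epsilon> A <-> (\<exists>s t. opair s m \<epsilon> j2 \<and> opair t n \<epsilon> j2 \<and> (s \<epsilon> t \<or> s = t))" for m n
      using spec[OF A', of "opair m n"] unfolding eq by auto
    show thesis by (rule that[OF 1 _ 2]) (use B B' eq in blast)+
  qed
  have i1: "injection j1 y1 omega" and i2: "injection j2 y2 omega"
    using c1 c2 unfolding code_by_def by blast+
  note i1 = injection_opair[OF i1] and i2 = injection_opair[OF i2]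
  show "\<exists>s' m. opair s m \<epsilon> j1 \<and> opair s' m \<epsilon> j2" if s: "s \<epsilon> y1"
  proof -
    obtain m where m: "opair s m \<epsilon> j1" using i1(1)[OF s] by blast
    then have "opair m m \<epsilon> A" unfolding A by blast
    then show ?thesis unfolding A' using m by blast
  qed
  show "s' \<epsilon> t'" if "opair s m \<epsilon> j1" "opair s' m \<epsilon> j2" "opair t n \<epsilon> j1" "opair t' n \<epsilon> j2" "s \<epsilon> t"
  proof -
    have "opair m n \<epsilon> A" unfolding A using that by blast
    then obtain v w where vw: "opair v m \<epsilon> j2" "opair w n \<epsilon> j2" "v \<epsilon> w \<or> v = w" unfolding A' by blast
    then have "v = s'" "w = t'" using i2(4) that by blast+
    moreover have "s' \<noteq> t'"
    proof
      assume "s' = t'"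
      then have "m = n" using i2(3) that by blast
      then have "s = t" using i1(4) that by blast
      then show False using that(5) by simp
    qed
    ultimately show ?thesis using vw by blast
  qed
  show "s' \<epsilon> u2" if "opair s m \<epsilon> j1" "opair s' m \<epsilon> j2" "s \<epsilon> u1"
  proof -
    have "m \<epsilon> B" unfolding B using that by blast
    then obtain v where "v \<epsilon> u2" "opair v m \<epsilon> j2" unfolding B' by blast
    then show ?thesis using i2(4) that by blast
  qed
qed

definition extensional :: "'v => bool" where
  "extensional y <-> (\<forall>s t. s \<epsilon> y \<and> t \<epsilon> y \<and> s \<noteq> t --> (\<exists>w. w \<epsilon> y \<and> (w \<epsilon> s <-> \<not> w \<epsilon> t)))"

text \<open>Isomorphisms between extensional sets are unique, so equal codes are matched by the collapses.\<close>

lemma code_by_rigid: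
  assumes p1: "collapse M1 \<pi>1" and p2: "collapse M2 \<pi>2"
    and y1: "y1 \<sqsubseteq> M1" and y2: "y2 \<sqsubseteq> M2" and ext: "extensional y1"
    and same1: "\<And>s. s \<epsilon> y1 ==> \<exists>s'. s' \<epsilon> y2 \<and> val \<pi>1 s = val \<pi>2 s'"
    and same2: "\<And>s'. s' \<epsilon> y2 ==> \<exists>s. s \<epsilon> y1 \<and> val \<pi>1 s = val \<pi>2 s'"
    and c1: "code_by j1 y1 u1 r" and c2: "code_by j2 y2 u2 r"
    and s: "opair s m \<epsilon> j1" "opair s' m \<epsilon> j2"
  shows "val \<pi>1 s = val \<pi>2 s'"
proof (rule ccontr)
  have i1: "injection j1 y1 omega" and i2: "injection j2 y2 omega"
    using c1 c2 unfolding code_by_def by blast+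
  note i1 = injection_opair[OF i1] and i2 = injection_opair[OF i2]
  note P1 = collapse_mem_iff[OF p1 subsetD[OF y1] subsetD[OF y1]]
    and P2 = collapse_mem_iff[OF p2 subsetD[OF y2] subsetD[OF y2]]
  have ext2: "t = t'" if "t \<epsilon> y2" "t' \<epsilon> y2" "\<And>w. w \<epsilon> y2 ==> w \<epsilon> t <-> w \<epsilon> t'" for t t'
  proof (rule ccontr)
    assume "t \<noteq> t'"
    obtain v v' where v: "v \<epsilon> y1" "val \<pi>1 v = val \<pi>2 t" "v' \<epsilon> y1" "val \<pi>1 v' = val \<pi>2 t'"
      using same2 \<open>t \<epsilon> y2\<close> \<open>t' \<epsilon> y2\<close> by meson
    have "v \<noteq> v'" using v collapse_inj[OF p2 subsetD[OF y2] subsetD[OF y2]] \<open>t \<noteq> t'\<close> that by metis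
    then obtain w where w: "w \<epsilon> y1" "w \<epsilon> v <-> \<not> w \<epsilon> v'" using ext v unfolding extensional_def by blast
    obtain w' where w': "w' \<epsilon> y2" "val \<pi>1 w = val \<pi>2 w'" using same1 w by blast
    have "w' \<epsilon> t <-> w \<epsilon> v" using P1[OF w(1) v(1)] P2[OF w'(1) that(1)] w' v by simp
    moreover have "w' \<epsilon> t' <-> w \<epsilon> v'" using P1[OF w(1) v(3)] P2[OF w'(1) that(2)] w' v by simp
    ultimately show False using that(3)[OF w'(1)] w(2) by blast
  qed
  assume neq: "val \<pi>1 s \<noteq> val \<pi>2 s'"
  define Q where "Q s <-> (\<exists>s' m. opair s m \<epsilon> j1 \<and> opair s' m \<epsilon> j2 \<and> val \<pi>1 s \<noteq> val \<pi>2 s')" for s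
  have foQ: "fo1 Q" unfolding Q_def by (intro fo_intros)
  have "s \<epsilon> y1" "Q s" unfolding Q_def using s neq i1(2) by blast+
  from least_on_ex[of Q, OF foQ this] obtain s where
    sQ: "s \<epsilon> y1" "Q s" "\<And>z. z \<epsilon> s ==> z \<epsilon> y1 ==> \<not> Q z" by blast
  then obtain s' m where s: "opair s m \<epsilon> j1" "opair s' m \<epsilon> j2" "val \<pi>1 s \<noteq> val \<pi>2 s'" unfolding Q_def by blast
  have s'y: "s' \<epsilon> y2" using i2(2) s by blast
  obtain s1 where s1: "s1 \<epsilon> y2" "val \<pi>1 s = val \<pi>2 s1" using same1 sQ(1) by blast
  have "s' = s1"
  proof (rule ext2[OF s'y s1(1)])
    fix w' assume w': "w' \<epsilon> y2"
    obtain w n where w: "opair w n \<epsilon> j1" "opair w' n \<epsilon> j2" using code_by_same(1)[OF c2 c1 w'] by blast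
    have wy: "w \<epsilon> y1" using i1(2) w by blast
    have a: "w' \<epsilon> s' <-> w \<epsilon> s"
      using code_by_same(2)[OF c1 c2 w s(1,2)] code_by_same(2)[OF c2 c1 w(2,1) s(2,1)] by blast
    have e: "val \<pi>1 v = val \<pi>2 v'" if "v \<epsilon> s" "opair v k \<epsilon> j1" "opair v' k \<epsilon> j2" for v v' k
      using sQ(3)[OF that(1)] i1(2) that unfolding Q_def by blast
    show "w' \<epsilon> s' <-> w' \<epsilon> s1"
    proof
      assume "w' \<epsilon> s'"
      then have "w \<epsilon> s" using a by blast
      then have "val \<pi>2 w' \<epsilon> val \<pi>2 s1" using e w P1[OF wy sQ(1)] s1 by metis
      then show "w' \<epsilon> s1" using P2[OF w' s1(1)] by blast
    next
      assume "w' \<epsilon> s1"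
      obtain v where v: "v \<epsilon> y1" "val \<pi>1 v = val \<pi>2 w'" using same2 w' by blast
      then have "v \<epsilon> s" using P1[OF v(1) sQ(1)] P2[OF w' s1(1)] s1 \<open>w' \<epsilon> s1\<close> by simp
      obtain v' k where v': "opair v k \<epsilon> j1" "opair v' k \<epsilon> j2" using code_by_same(1)[OF c1 c2 v(1)] by blast
      have "v' \<epsilon> y2" using i2(2) v' by blast
      then have "v' = w'" using e[OF \<open>v \<epsilon> s\<close> v'] v(2) collapse_inj[OF p2 subsetD[OF y2] subsetD[OF y2 w']] by metis
      then have "k = n" using i2(3) v' w by blast
      then have "v = w" using i1(4) v' w by blast
      then show "w' \<epsilon> s'" using a \<open>v \<epsilon> s\<close> by blast
    qed
  qed
  with s(3) s1(2) show False by simp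
qed

text \<open>Interleaves two clubs, closing off under witnesses for extensionality.\<close>

lemma common_club_trace:
  assumes p1: "collapse M1 \<pi>1" and p2: "collapse M2 \<pi>2"
    and C1: "club_in C1 M1" and C2: "club_in C2 M2"
    and d1: "d1 \<epsilon> M1" and d2: "d2 \<epsilon> M2" and D: "val \<pi>1 d1 = val \<pi>2 d2"
    and wit: "\<And>s t. s \<epsilon> M1 ==> t \<epsilon> M1 ==> s \<noteq> t ==> \<exists>w. w \<epsilon> M1 \<and> (w \<epsilon> s <-> \<not> w \<epsilon> t)"
    and Y: "Y \<sqsubseteq> val \<pi>1 d1" "ctbl Y"
  obtains c c' where "c \<epsilon> C1" "c' \<epsilon> C2" "extensional c"
    "\<And>x. x \<epsilon> c ==> x \<epsilon> d1 ==> \<exists>x'. x' \<epsilon> c' \<and> x' \<epsilon> d2 \<and> val \<pi>1 x = val \<pi>2 x'"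
    "\<And>x'. x' \<epsilon> c' ==> x' \<epsilon> d2 ==> \<exists>x. x \<epsilon> c \<and> x \<epsilon> d1 \<and> val \<pi>1 x = val \<pi>2 x'"
    "\<And>t. t \<epsilon> Y ==> \<exists>x. x \<epsilon> c \<and> x \<epsilon> d1 \<and> t = val \<pi>1 x"
proof -
  define R where "R q q' <-> (\<exists>c c' k k'. q = opair c c' \<and> q' = opair k k' \<and> c \<sqsubseteq> k \<and> c' \<sqsubseteq> k' \<and>
    (\<forall>x. x \<epsilon> c \<and> x \<epsilon> d1 --> (\<exists>x'. x' \<epsilon> k' \<and> x' \<epsilon> d2 \<and> val \<pi>1 x = val \<pi>2 x')) \<and>
    (\<forall>x'. x' \<epsilon> c' \<and> x' \<epsilon> d2 --> (\<exists>x. x \<epsilon> k \<and> x \<epsilon> d1 \<and> val \<pi>1 x = val \<pi>2 x')) \<and>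
    (\<forall>s t. s \<epsilon> c \<and> t \<epsilon> c \<and> s \<noteq> t --> (\<exists>w. w \<epsilon> k \<and> (w \<epsilon> s <-> \<not> w \<epsilon> t))))" for q q'
  have foR: "fo2 R" unfolding R_def by (intro fo_intros)
  have ext_union: "union2 a b \<sqsubseteq> c <-> a \<sqsubseteq> c \<and> b \<sqsubseteq> c" for a b c by (auto simp: subset_def)
  have step: "\<exists>q'. q' \<epsilon> prod C1 C2 \<and> R q q'" if q: "q \<epsilon> prod C1 C2" for q
  proof -
    obtain c c' where c: "q = opair c c'" "c \<epsilon> C1" "c' \<epsilon> C2" using q unfolding mem_prod_iff by blast
    have cM: "c \<sqsubseteq> M1" "ctbl c" "c' \<sqsubseteq> M2" "ctbl c'"
      using club_in_subset[OF C1 c(2)] club_in_subset[OF C2 c(3)] by blast+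
    define X' where "X' = (SET x'. x' \<epsilon> M2 \<and> (x' \<epsilon> d2 \<and> (\<exists>x. x \<epsilon> c \<and> val \<pi>1 x = val \<pi>2 x')))"
    have X': "x' \<epsilon> X' <-> x' \<epsilon> M2 \<and> x' \<epsilon> d2 \<and> (\<exists>x. x \<epsilon> c \<and> val \<pi>1 x = val \<pi>2 x')" for x'
      unfolding X'_def by (rule mem_sep) (intro fo_intros)
    define X where "X = (SET x. x \<epsilon> M1 \<and> (x \<epsilon> d1 \<and> (\<exists>x'. x' \<epsilon> c' \<and> val \<pi>1 x = val \<pi>2 x')))"
    have X: "x \<epsilon> X <-> x \<epsilon> M1 \<and> x \<epsilon> d1 \<and> (\<exists>x'. x' \<epsilon> c' \<and> val \<pi>1 x = val \<pi>2 x')" for x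
      unfolding X_def by (rule mem_sep) (intro fo_intros)
    have "lepoll X' c"
    proof (rule lepoll_rel[where R = "\<lambda>x' x. val \<pi>1 x = val \<pi>2 x'"])
      fix x x' y assume "x \<epsilon> X'" "x' \<epsilon> X'" "val \<pi>1 y = val \<pi>2 x" "val \<pi>1 y = val \<pi>2 x'"
      then show "x = x'" using collapse_inj[OF p2] X' by metis
    qed (intro fo_intros, use X' in blast)
    then have cX': "ctbl X'" using cM lepoll_trans by blast
    have "lepoll X c'"
    proof (rule lepoll_rel[where R = "\<lambda>x x'. val \<pi>1 x = val \<pi>2 x'"])
      fix x x' y assume "x \<epsilon> X" "x' \<epsilon> X" "val \<pi>1 x = val \<pi>2 y" "val \<pi>1 x' = val \<pi>2 y"
      then show "x = x'" using collapse_inj[OF p1] X by metis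
    qed (intro fo_intros, use X in blast)
    then have cX: "ctbl X" using cM lepoll_trans by blast
    have fow: "fo mem (\<lambda>e. \<forall>s t. e 0 = opair s t \<and> s \<noteq> t --> (e (Suc 0) \<epsilon> s <-> \<not> e (Suc 0) \<epsilon> t))"
      by (intro fo_intros)
    have exw: "\<exists>w. w \<epsilon> M1 \<and> (\<forall>s t. p = opair s t \<and> s \<noteq> t --> (w \<epsilon> s <-> \<not> w \<epsilon> t))" if p: "p \<epsilon> prod c c" for p
    proof -
      obtain s t where st: "p = opair s t" "s \<epsilon> c" "t \<epsilon> c" using p unfolding mem_prod_iff by blast
      then have "s \<epsilon> M1" "t \<epsilon> M1" using cM subsetD by blast+
      then show ?thesis using wit[of s t] st(1) by (cases "s = t") auto
    qed
    obtain f where f: "function_on f (prod c c)" "\<And>p. p \<epsilon> prod c c ==> val f p \<epsilon> M1"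
      "\<And>p. p \<epsilon> prod c c ==> (\<forall>s t. p = opair s t \<and> s \<noteq> t --> (val f p \<epsilon> s <-> \<not> val f p \<epsilon> t))"
      using choose_function[OF fow, of "prod c c" M1] exw by blast
    have "lepoll (ran f) (prod c c)"
      by (rule lepoll_image[where F = "val f"]) (intro fo_intros, use function_on_opair_iff[OF f(1)] mem_ran in blast)
    then have cf: "ctbl (ran f)" using ctbl_prod[OF cM(2,2)] lepoll_trans by blast
    have "ran f \<sqsubseteq> M1" unfolding subset_def mem_ran function_on_opair_iff[OF f(1)] using f(2) by blast
    moreover have "X \<sqsubseteq> M1" unfolding subset_def X by blast
    ultimately obtain k where k: "k \<epsilon> C1" "union2 c (union2 X (ran f)) \<sqsubseteq> k"
      using club_in_cofinal[OF C1, of "union2 c (union2 X (ran f))"] ctbl_union2 cf cX cM ext_union by meson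
    have "X' \<sqsubseteq> M2" unfolding subset_def X' by blast
    then obtain k' where k': "k' \<epsilon> C2" "union2 c' X' \<sqsubseteq> k'"
      using club_in_cofinal[OF C2, of "union2 c' X'"] ctbl_union2 cX' cM ext_union by meson
    have "\<exists>x'. x' \<epsilon> k' \<and> x' \<epsilon> d2 \<and> val \<pi>1 x = val \<pi>2 x'" if x: "x \<epsilon> c" "x \<epsilon> d1" for x
    proof -
      have xM: "x \<epsilon> M1" using x cM subsetD by blast
      have "val \<pi>1 x \<epsilon> val \<pi>2 d2" using collapse_mem_iff[OF p1 xM d1] x D by simp
      then obtain x' where x': "x' \<epsilon> M2" "x' \<epsilon> d2" "val \<pi>1 x = val \<pi>2 x'" unfolding collapse_mem[OF p2 d2] by blast
      then have "x' \<epsilon> X'" using X' x by blast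
      then show ?thesis using k'(2) x' subsetD[of X' k' x'] ext_union by blast
    qed
    moreover have "\<exists>x. x \<epsilon> k \<and> x \<epsilon> d1 \<and> val \<pi>1 x = val \<pi>2 x'" if x': "x' \<epsilon> c'" "x' \<epsilon> d2" for x'
    proof -
      have xM: "x' \<epsilon> M2" using x' cM subsetD by blast
      have "val \<pi>2 x' \<epsilon> val \<pi>1 d1" using collapse_mem_iff[OF p2 xM d2] x' D by simp
      then obtain x where x: "x \<epsilon> M1" "x \<epsilon> d1" "val \<pi>2 x' = val \<pi>1 x" unfolding collapse_mem[OF p1 d1] by blast
      then have "x \<epsilon> X" using X x' by metis
      then show ?thesis using k(2) x subsetD[of X k x] ext_union by metis
    qed
    moreover have "\<exists>w. w \<epsilon> k \<and> (w \<epsilon> s <-> \<not> w \<epsilon> t)" if st: "s \<epsilon> c" "t \<epsilon> c" "s \<noteq> t" for s t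
    proof -
      have p: "opair s t \<epsilon> prod c c" using st by simp
      have "val f (opair s t) \<epsilon> ran f" unfolding mem_ran function_on_opair_iff[OF f(1)] using p by blast
      then have "val f (opair s t) \<epsilon> k" using k(2) subsetD[of "ran f" k] ext_union by blast
      then show ?thesis using f(3)[OF p] st(3) by blast
    qed
    moreover have "c \<sqsubseteq> k" "c' \<sqsubseteq> k'" using k(2) k'(2) ext_union by blast+
    ultimately have "R q (opair k k')" unfolding R_def using c(1) by blast
    then show ?thesis using k(1) k'(1) opair_mem_prod by blast
  qed
  define X0 where "X0 = (SET x. x \<epsilon> M1 \<and> (x \<epsilon> d1 \<and> val \<pi>1 x \<epsilon> Y))"
  have X0: "x \<epsilon> X0 <-> x \<epsilon> M1 \<and> x \<epsilon> d1 \<and> val \<pi>1 x \<epsilon> Y" for x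
    unfolding X0_def by (rule mem_sep) (intro fo_intros)
  have "lepoll X0 Y"
    by (rule lepollI[where F = "val \<pi>1"]) (intro fo_intros, use X0 collapse_inj[OF p1] in auto)
  then have "ctbl X0" using Y lepoll_trans by blast
  moreover have "X0 \<sqsubseteq> M1" unfolding subset_def X0 by blast
  ultimately obtain c0 where c0: "c0 \<epsilon> C1" "X0 \<sqsubseteq> c0" using club_in_cofinal[OF C1] by blast
  have "ctbl empty" "empty \<sqsubseteq> M2" by (simp_all add: subset_lepoll)
  then obtain c0' where c0': "c0' \<epsilon> C2" using club_in_cofinal[OF C2] by blast
  obtain f where f: "function_on f omega" "val f empty = opair c0 c0'" "\<And>n. natural n ==> val f n \<epsilon> prod C1 C2"
    "\<And>n. natural n ==> R (val f n) (val f (succ n))"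
    by (rule dependent_choice[OF foR step, of "opair c0 c0'"]) (use c0 c0' in auto)
  define D1 where "D1 = (SET c. c \<epsilon> C1 \<and> (\<exists>n c'. natural n \<and> val f n = opair c c'))"
  have D1: "c \<epsilon> D1 <-> c \<epsilon> C1 \<and> (\<exists>n c'. natural n \<and> val f n = opair c c')" for c
    unfolding D1_def by (rule mem_sep) (intro fo_intros)
  define D2 where "D2 = (SET c'. c' \<epsilon> C2 \<and> (\<exists>n c. natural n \<and> val f n = opair c c'))"
  have D2: "c' \<epsilon> D2 <-> c' \<epsilon> C2 \<and> (\<exists>n c. natural n \<and> val f n = opair c c')" for c'
    unfolding D2_def by (rule mem_sep) (intro fo_intros)
  have pair: "\<exists>c c'. val f n = opair c c' \<and> c \<epsilon> D1 \<and> c' \<epsilon> D2" if "natural n" for n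
    using f(3)[OF that] that unfolding D1 D2 mem_prod_iff by blast
  have mono: "natural m --> (\<forall>n. natural n --> n \<sqsubseteq> m --> (\<forall>c c' k k'. val f n = opair c c' --> val f m = opair k k' --> c \<sqsubseteq> k \<and> c' \<sqsubseteq> k'))" for m
  proof
    assume "natural m"
    then show "\<forall>n. natural n --> n \<sqsubseteq> m --> (\<forall>c c' k k'. val f n = opair c c' --> val f m = opair k k' --> c \<sqsubseteq> k \<and> c' \<sqsubseteq> k')"
    proof (rule natural_induct[where P = "\<lambda>m. \<forall>n. natural n --> n \<sqsubseteq> m --> (\<forall>c c' k k'. val f n = opair c c' --> val f m = opair k k' --> c \<sqsubseteq> k \<and> c' \<sqsubseteq> k')", rotated])
      show "fo mem (\<lambda>e. \<forall>n. natural n --> n \<sqsubseteq> e 0 --> (\<forall>c c' k k'. val f n = opair c c' --> val f (e 0) = opair k k' --> c \<sqsubseteq> k \<and> c' \<sqsubseteq> k'))"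
        by (intro fo_intros)
      have "n = empty" if "n \<sqsubseteq> empty" for n using that by (intro set_eqI) (auto simp: subset_def)
      then show "\<forall>n. natural n --> n \<sqsubseteq> empty --> (\<forall>c c' k k'. val f n = opair c c' --> val f empty = opair k k' --> c \<sqsubseteq> k \<and> c' \<sqsubseteq> k')"
        by force
      fix m assume m: "natural m" and IH: "\<forall>n. natural n --> n \<sqsubseteq> m --> (\<forall>c c' k k'. val f n = opair c c' --> val f m = opair k k' --> c \<sqsubseteq> k \<and> c' \<sqsubseteq> k')"
      show "\<forall>n. natural n --> n \<sqsubseteq> succ m --> (\<forall>c c' k k'. val f n = opair c c' --> val f (succ m) = opair k k' --> c \<sqsubseteq> k \<and> c' \<sqsubseteq> k')"
      proof (intro allI impI)
        fix n c c' k k' assume n: "natural n" "n \<sqsubseteq> succ m" "val f n = opair c c'" "val f (succ m) = opair k k'"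
        have om: "ordinal m" "ordinal n" using m n(1) natural_ordinal by blast+
        consider "n = succ m" | "n \<sqsubseteq> m"
          using ordinal_subset_iff[OF om(2) ordinal_succ[OF om(1)]] n(2) ordinal_subset[OF om(1)] by auto
        then show "c \<sqsubseteq> k \<and> c' \<sqsubseteq> k'"
        proof cases
          case 1 then show ?thesis using n by simp
        next
          case 2
          obtain l l' where l: "val f m = opair l l'" using pair[OF m] by blast
          have "c \<sqsubseteq> l \<and> c' \<sqsubseteq> l'" using IH n(1,3) 2 l by blast
          moreover have "l \<sqsubseteq> k \<and> l' \<sqsubseteq> k'" using f(4)[OF m] unfolding R_def l n(4) opair_eq by blast
          ultimately show ?thesis using subset_trans by blast
        qed
      qed
    qed
  qed
  have lin: "n \<sqsubseteq> m \<or> m \<sqsubseteq> n" if "natural n" "natural m" for n m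
    using that natural_ordinal ordinal_not_mem ordinal_subset by meson
  have c1: "lepoll D1 omega"
  proof (rule lepoll_rel[where R = "\<lambda>c n. \<exists>c'. val f n = opair c c'"])
    fix c assume "c \<epsilon> D1" then show "\<exists>n. n \<epsilon> omega \<and> (\<exists>c'. val f n = opair c c')" unfolding D1 mem_omega by blast
  qed (intro fo_intros, auto)
  have c2: "lepoll D2 omega"
  proof (rule lepoll_rel[where R = "\<lambda>c' n. \<exists>c. val f n = opair c c'"])
    fix c' assume "c' \<epsilon> D2" then show "\<exists>n. n \<epsilon> omega \<and> (\<exists>c. val f n = opair c c')" unfolding D2 mem_omega by blast
  qed (intro fo_intros, auto)
  obtain e e' where e: "val f empty = opair e e'" "e \<epsilon> D1" "e' \<epsilon> D2" using pair[OF natural_empty] by blast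
  have U1: "Union D1 \<epsilon> C1"
  proof (rule club_in_Union[OF C1 _ c1])
    show "D1 \<sqsubseteq> C1" unfolding subset_def D1 by blast
    fix c d assume "c \<epsilon> D1" "d \<epsilon> D1"
    then obtain n c' m d' where "natural n" "val f n = opair c c'" "natural m" "val f m = opair d d'" unfolding D1 by blast
    then show "c \<sqsubseteq> d \<or> d \<sqsubseteq> c" using mono lin by metis
  qed (use e in blast)
  have U2: "Union D2 \<epsilon> C2"
  proof (rule club_in_Union[OF C2 _ c2])
    show "D2 \<sqsubseteq> C2" unfolding subset_def D2 by blast
    fix c' d' assume "c' \<epsilon> D2" "d' \<epsilon> D2"
    then obtain n c m d where "natural n" "val f n = opair c c'" "natural m" "val f m = opair d d'" unfolding D2 by blast
    then show "c' \<sqsubseteq> d' \<or> d' \<sqsubseteq> c'" using mono lin by metis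
  qed (use e in blast)
  have in1: "x \<epsilon> Union D1 <-> (\<exists>n c c'. natural n \<and> val f n = opair c c' \<and> x \<epsilon> c)" for x
    using pair unfolding mem_Union D1 by (metis opair_eq)
  have in2: "x \<epsilon> Union D2 <-> (\<exists>n c c'. natural n \<and> val f n = opair c c' \<and> x \<epsilon> c')" for x
    using pair unfolding mem_Union D2 by (metis opair_eq)
  have nxt: "\<exists>k k'. val f (succ n) = opair k k' \<and> c \<sqsubseteq> k \<and> c' \<sqsubseteq> k' \<and>
    (\<forall>x. x \<epsilon> c \<and> x \<epsilon> d1 --> (\<exists>x'. x' \<epsilon> k' \<and> x' \<epsilon> d2 \<and> val \<pi>1 x = val \<pi>2 x')) \<and>
    (\<forall>x'. x' \<epsilon> c' \<and> x' \<epsilon> d2 --> (\<exists>x. x \<epsilon> k \<and> x \<epsilon> d1 \<and> val \<pi>1 x = val \<pi>2 x')) \<and>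
    (\<forall>s t. s \<epsilon> c \<and> t \<epsilon> c \<and> s \<noteq> t --> (\<exists>w. w \<epsilon> k \<and> (w \<epsilon> s <-> \<not> w \<epsilon> t)))"
    if "natural n" "val f n = opair c c'" for n c c'
    using f(4)[OF that(1)] unfolding R_def that(2) opair_eq by blast
  show thesis
  proof (rule that[OF U1 U2])
    show "extensional (Union D1)" unfolding extensional_def
    proof (intro allI impI)
      fix s t assume st: "s \<epsilon> Union D1 \<and> t \<epsilon> Union D1 \<and> s \<noteq> t"
      then obtain n c c' m d d' where nm: "natural n" "val f n = opair c c'" "s \<epsilon> c" "natural m" "val f m = opair d d'" "t \<epsilon> d"
        unfolding in1 by blast
      obtain l b b' where l: "natural l" "val f l = opair b b'" "s \<epsilon> b" "t \<epsilon> b"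
      proof (cases "n \<sqsubseteq> m")
        case True
        then have "c \<sqsubseteq> d" using mono nm by blast
        then show thesis using that[of m d d'] nm subsetD by blast
      next
        case False
        then have "m \<sqsubseteq> n" using lin nm by blast
        then have "d \<sqsubseteq> c" using mono nm by blast
        then show thesis using that[of n c c'] nm subsetD by blast
      qed
      then show "\<exists>w. w \<epsilon> Union D1 \<and> (w \<epsilon> s <-> \<not> w \<epsilon> t)"
        using nxt[OF l(1,2)] st natural_succ[OF l(1)] unfolding in1 by blast
    qed
    fix x assume x: "x \<epsilon> Union D1" "x \<epsilon> d1"
    then obtain n c c' where n: "natural n" "val f n = opair c c'" "x \<epsilon> c" unfolding in1 by blast
    show "\<exists>x'. x' \<epsilon> Union D2 \<and> x' \<epsilon> d2 \<and> val \<pi>1 x = val \<pi>2 x'"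
      using nxt[OF n(1,2)] n(3) x natural_succ[OF n(1)] unfolding in2 by blast
  next
    fix x' assume x: "x' \<epsilon> Union D2" "x' \<epsilon> d2"
    then obtain n c c' where n: "natural n" "val f n = opair c c'" "x' \<epsilon> c'" unfolding in2 by blast
    show "\<exists>x. x \<epsilon> Union D1 \<and> x \<epsilon> d1 \<and> val \<pi>1 x = val \<pi>2 x'"
      using nxt[OF n(1,2)] n(3) x natural_succ[OF n(1)] unfolding in1 by blast
  next
    fix t assume "t \<epsilon> Y"
    moreover then obtain x where x: "x \<epsilon> M1" "x \<epsilon> d1" "t = val \<pi>1 x"
      using Y(1) subsetD unfolding collapse_mem[OF p1 d1, symmetric] by (metis collapse_mem[OF p1 d1])
    ultimately have "x \<epsilon> c0" using X0 c0(2) subsetD by blast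
    then have "x \<epsilon> Union D1" unfolding in1 using f(2) natural_empty by blast
    then show "\<exists>x. x \<epsilon> Union D1 \<and> x \<epsilon> d1 \<and> t = val \<pi>1 x" using x by blast
  qed
qed

end

locale concentrating_tower = tower_universe mem \<delta> I
  for mem :: "'v => 'v => bool" (infix "\<epsilon>" 50) and \<delta> I :: 'v +
  fixes \<kappa>0 :: 'v
  assumes concentrates: "tower_concentrates \<delta> I GIC_omega1" and Sp0: "Sp \<kappa>0"
begin

text \<open>Good sets will be closed, within \<open>H\<^sub>\<kappa>\<close>, under values \<open>y\<close> of the following relations \<open>R x x' y\<close>.\<close>

definition rel_up :: "'v => 'v => 'v => bool" where "rel_up x x' y <-> y = upair x x'"
definition rel_int :: "'v => 'v => 'v => bool" where "rel_int x x' y <-> y = inter x x'"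
definition rel_app :: "'v => 'v => 'v => bool" where "rel_app b k v <-> partial_fun b \<and> opair k v \<epsilon> b"
definition rel_code :: "'v => 'v => 'v => bool" where
  "rel_code y u r <-> r \<epsilon> Hl \<kappa>0 \<and> u \<sqsubseteq> y \<and> (\<exists>j. code_by j y u r)"
definition rel_dec :: "'v => 'v => 'v => bool" where
  "rel_dec y r u <-> u \<sqsubseteq> y \<and> (\<exists>j. code_by j y u r)"
definition rel_rank :: "'v => 'v => 'v => bool" where
  "rel_rank \<xi> y \<eta> <-> \<eta> \<epsilon> \<xi> \<and> y \<sqsubseteq> Vlev \<eta>"
definition rel_V :: "'v => 'v => 'v => bool" where "rel_V \<eta> x' v <-> v = Vlev \<eta>"
definition rel_wit :: "'v => 'v => 'v => bool" where "rel_wit y v t <-> t \<epsilon> y \<and> \<not> t \<epsilon> v"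

lemmas rel_defs = rel_up_def rel_int_def rel_app_def rel_code_def rel_dec_def rel_rank_def rel_V_def rel_wit_def

definition good :: "'v => 'v => 'v => bool" where
  "good \<kappa> M \<pi> <-> (Sp \<kappa> \<and> \<kappa>0 \<sqsubseteq> \<kappa> \<and> M \<epsilon> Zl \<kappa>) \<and>
     (omega1 \<sqsubseteq> M \<and> collapse M \<pi> \<and> approx (ran \<pi>) \<and> (\<exists>C. C \<sqsubseteq> M \<and> club_in C M)) \<and>
     (skolem \<kappa> rel_up M \<and> skolem \<kappa> rel_int M \<and> skolem \<kappa> rel_app M \<and> skolem \<kappa> rel_code M \<and>
     skolem \<kappa> rel_dec M \<and> skolem \<kappa> rel_rank M \<and> skolem \<kappa> rel_V M \<and> skolem \<kappa> rel_wit M)"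

lemma fo_good [fo_intros]: "fot mem t ==> fot mem u ==> fot mem v ==> fo mem (\<lambda>e. good (t e) (u e) (v e))"
  by (rule fo_sub3) (unfold good_def skolem_def rel_defs approx_def club_in_def, intro fo_intros)

lemma ae_GIC:
  assumes "\<kappa> \<epsilon> Ix"
  shows "ae \<kappa> (\<lambda>M. \<exists>\<pi>. omega1 \<sqsubseteq> M \<and> collapse M \<pi> \<and> approx (ran \<pi>) \<and> (\<exists>C. C \<sqsubseteq> M \<and> club_in C M))"
proof -
  have "ideal_concentrates (Zl \<kappa>) (val I \<kappa>) GIC_omega1"
    using concentrates assms Zset_eq app_I unfolding tower_concentrates_def Ix_def by metis
  then obtain A where A: "\<And>M. M \<epsilon> A ==> GIC_omega1 M" "null \<kappa> (diff (Zl \<kappa>) A)"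
    unfolding ideal_concentrates_def null_def by blast
  have "\<exists>\<pi>. omega1 \<sqsubseteq> M \<and> collapse M \<pi> \<and> approx (ran \<pi>) \<and> (\<exists>C. C \<sqsubseteq> M \<and> club_in C M)" if "GIC_omega1 M" for M
  proof -
    have g: "guessing M" and ic: "IC_omega1 M" using that unfolding GIC_omega1_def G_omega1_def by blast+
    obtain N where N: "transitive_collapse M N" "approximation_property N" using g unfolding guessing_def by blast
    obtain \<pi> where \<pi>: "collapse M \<pi>" "ran \<pi> = N" by (rule transitive_collapse_collapse[OF N(1)])
    have "approx N" unfolding approx_def
    proof (intro allI impI)
      fix \<eta> A assume *: "\<eta> \<epsilon> N \<and> A \<sqsubseteq> \<eta> \<and> (\<forall>z. z \<epsilon> N \<and> ctbl z --> inter z A \<epsilon> N)"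
      have "\<forall>z. z \<epsilon> N \<and> (\<exists>f. f \<epsilon> N \<and> injection f z omega) --> inter z A \<epsilon> N"
        using * unfolding lepoll_def by blast
      then show "A \<epsilon> N" using N(2) * unfolding approximation_property_def by blast
    qed
    moreover obtain C where C: "club C M" "C \<sqsubseteq> inter M (countable_subsets M)" using ic unfolding IC_omega1_def by blast
    moreover have "C \<sqsubseteq> M" using C(2) unfolding subset_def mem_inter by blast
    ultimately show ?thesis using g \<pi> club_club_in unfolding guessing_def by blast
  qed
  then show ?thesis unfolding ae_def using A by (intro exI[of _ "diff (Zl \<kappa>) A"]) auto
qed

lemma ae_good:
  assumes \<kappa>: "Sp \<kappa>" "\<kappa>0 \<sqsubseteq> \<kappa>"
  shows "ae \<kappa> (\<lambda>M. \<exists>\<pi>. good \<kappa> M \<pi>)"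
proof -
  have i: "\<kappa> \<epsilon> Ix" using Sp_Ix \<kappa> by blast
  note sk = ae_skolem[OF i]
  have "ae \<kappa> (\<lambda>M. (\<exists>\<pi>. omega1 \<sqsubseteq> M \<and> collapse M \<pi> \<and> approx (ran \<pi>) \<and> (\<exists>C. C \<sqsubseteq> M \<and> club_in C M)) \<and>
     (skolem \<kappa> rel_up M \<and> skolem \<kappa> rel_int M \<and> skolem \<kappa> rel_app M \<and> skolem \<kappa> rel_code M \<and>
     skolem \<kappa> rel_dec M \<and> skolem \<kappa> rel_rank M \<and> skolem \<kappa> rel_V M \<and> skolem \<kappa> rel_wit M))"
    by (intro ae_conj[OF i] ae_GIC[OF i] sk; unfold rel_defs; intro fo_intros)
  then show ?thesis by (rule ae_mono) (use \<kappa> in \<open>unfold good_def, blast\<close>)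
qed

context
  fixes \<kappa> M \<pi> assumes g: "good \<kappa> M \<pi>"
begin

lemma good_Sp: "Sp \<kappa>" and good_Ix: "\<kappa> \<epsilon> Ix" and good_ge: "\<kappa>0 \<sqsubseteq> \<kappa>" and good_Zl: "M \<epsilon> Zl \<kappa>" and good_collapse: "collapse M \<pi>"
  and good_omega1: "omega1 \<sqsubseteq> M" and good_approx: "approx (ran \<pi>)"
  using g Sp_Ix unfolding good_def by blast+

lemma good_club: "\<exists>C. C \<sqsubseteq> M \<and> club_in C M"
  using g unfolding good_def by blast

lemma good_skolem: "skolem \<kappa> rel_up M" "skolem \<kappa> rel_int M" "skolem \<kappa> rel_app M" "skolem \<kappa> rel_code M"
    "skolem \<kappa> rel_dec M" "skolem \<kappa> rel_rank M" "skolem \<kappa> rel_V M" "skolem \<kappa> rel_wit M"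
  using g unfolding good_def by blast+

lemma good_Hl: "x \<epsilon> M ==> x \<epsilon> Hl \<kappa>"
  using good_Zl mem_Zl subsetD by blast

lemma good_Hl0: "x \<epsilon> Hl \<kappa>0 ==> x \<epsilon> Hl \<kappa>"
  using Hl_mono[OF good_ge] subsetD by blast

lemma good_natural: "natural n ==> n \<epsilon> M"
  using omega_subset_omega1 good_omega1 subsetD by (metis mem_omega)

lemma good_upair: "x \<epsilon> M ==> y \<epsilon> M ==> upair x y \<epsilon> M"
  using skolemD[OF good_skolem(1), of x y "upair x y"] Sp_upair[OF good_Sp] good_Hl unfolding rel_up_def by blast

lemma good_opair: "x \<epsilon> M ==> y \<epsilon> M ==> opair x y \<epsilon> M"
  unfolding opair_def by (intro good_upair)

lemma good_inter: "x \<epsilon> M ==> y \<epsilon> M ==> inter x y \<epsilon> M"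
  using skolemD[OF good_skolem(2), of x y "inter x y"] Hl_subset[OF good_Ix good_Hl, of x "inter x y"]
  unfolding rel_int_def by (simp add: subset_def)

lemma good_val: "b \<epsilon> M ==> partial_fun b ==> k \<epsilon> M ==> opair k v \<epsilon> b ==> v \<epsilon> M"
proof -
  assume *: "b \<epsilon> M" "partial_fun b" "k \<epsilon> M" "opair k v \<epsilon> b"
  have "opair k v \<epsilon> Hl \<kappa>" using Hl_trans[OF good_Ix good_Hl[OF *(1)] *(4)] .
  moreover have "v \<epsilon> upair k v" "upair k v \<epsilon> opair k v" by (simp_all add: opair_def)
  ultimately have "v \<epsilon> Hl \<kappa>" using Hl_trans[OF good_Ix] by blast
  then obtain w where "w \<epsilon> M" "opair k w \<epsilon> b"
    using skolemD[OF good_skolem(3), of b k v] * unfolding rel_app_def by blast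
  then show ?thesis using partial_funD[OF *(2,4)] by blast
qed

lemma good_wit: "x \<epsilon> M ==> y \<epsilon> M ==> \<not> x \<sqsubseteq> y ==> \<exists>t. t \<epsilon> M \<and> t \<epsilon> x \<and> \<not> t \<epsilon> y"
  using skolemD[OF good_skolem(8), of x y] Hl_trans[OF good_Ix good_Hl] unfolding rel_wit_def subset_def by blast

lemma good_V: "\<eta> \<epsilon> M ==> Vlev \<eta> \<epsilon> Hl \<kappa> ==> Vlev \<eta> \<epsilon> M"
  using skolemD[OF good_skolem(7), of \<eta> \<eta> "Vlev \<eta>"] unfolding rel_V_def by blast

lemma good_rank:
  assumes "ordinal \<xi>" "\<xi> \<epsilon> M" "Vlev \<xi> \<epsilon> M" "y \<epsilon> M" "y \<epsilon> Vlev \<xi>"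
  shows "\<exists>\<eta>. \<eta> \<epsilon> M \<and> \<eta> \<epsilon> \<xi> \<and> y \<sqsubseteq> Vlev \<eta>"
proof -
  obtain \<eta> where \<eta>: "\<eta> \<epsilon> \<xi>" "y \<sqsubseteq> Vlev \<eta>" using assms mem_Vlev by blast
  then have "\<eta> \<epsilon> Hl \<kappa>" using Hl_trans[OF good_Ix good_Hl[OF assms(2)]] by blast
  then show ?thesis using skolemD[OF good_skolem(6), of \<xi> y \<eta>] \<eta> assms unfolding rel_rank_def by blast
qed

lemma good_V_mem: "ordinal \<xi> ==> Vlev \<xi> \<epsilon> M ==> \<eta> \<epsilon> M ==> \<eta> \<epsilon> \<xi> ==> Vlev \<eta> \<epsilon> M"
  by (rule good_V, assumption, rule Hl_subset[OF good_Ix good_Hl[of "Vlev \<xi>"]]) (use Vlev_subset in blast)+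

lemma good_subset: "x \<epsilon> M ==> y \<epsilon> M ==> val \<pi> x \<sqsubseteq> val \<pi> y ==> x \<sqsubseteq> y"
  using good_wit[of x y] collapse_mem_iff[OF good_collapse] subsetD by blast

lemma ordinal_collapse: "ordinal \<xi> ==> \<xi> \<epsilon> M ==> ordinal (val \<pi> \<xi>)"
proof -
  have t: "transitive (val \<pi> \<xi>)" if "ordinal \<xi>" "\<xi> \<epsilon> M" for \<xi>
    unfolding transitive_def subset_def using collapse_mem[OF good_collapse] that ordinal_trans[OF that(1)] by metis
  assume "ordinal \<xi>" "\<xi> \<epsilon> M"
  then show ?thesis unfolding ordinal_def[of "val \<pi> \<xi>"] using t ordinal_mem collapse_mem[OF good_collapse] by metis
qed

lemma collapse_natural: "natural n ==> val \<pi> n = n"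
proof -
  assume n: "natural n"
  have "natural n --> val \<pi> n = n"
  proof (rule ordinal_induct[where P = "\<lambda>n. natural n --> val \<pi> n = n", OF _ natural_ordinal[OF n]])
    show "fo mem (\<lambda>e. natural (e 0) --> val \<pi> (e 0) = e 0)" by (intro fo_intros)
    fix n assume IH: "\<And>m. m \<epsilon> n ==> natural m --> val \<pi> m = m"
    show "natural n --> val \<pi> n = n"
    proof
      assume n: "natural n"
      show "val \<pi> n = n"
      proof (rule set_eqI)
        fix t show "t \<epsilon> val \<pi> n <-> t \<epsilon> n"
          unfolding collapse_mem[OF good_collapse good_natural[OF n]] using IH natural_mem[OF n] good_natural by metis
      qed
    qed
  qed
  with n show ?thesis by blast
qed

lemma collapse_upair: "x \<epsilon> M ==> y \<epsilon> M ==> val \<pi> (upair x y) = upair (val \<pi> x) (val \<pi> y)"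
  by (rule set_eqI) (use collapse_mem[OF good_collapse good_upair] in auto)

lemma collapse_opair_eq: "x \<epsilon> M ==> y \<epsilon> M ==> val \<pi> (opair x y) = opair (val \<pi> x) (val \<pi> y)"
  unfolding opair_def by (simp add: collapse_upair good_upair)

lemma collapse_transitive: "transitive x ==> x \<epsilon> M ==> transitive (val \<pi> x)"
  unfolding transitive_def[of "val \<pi> x"] subset_def using collapse_mem[OF good_collapse] transitiveD by metis

lemma val_lepoll: "x \<epsilon> M ==> lepoll (val \<pi> x) omega1"
proof -
  assume x: "x \<epsilon> M"
  have "lepoll (val \<pi> x) M"
    by (rule lepoll_image[where F = "val \<pi>"]) (intro fo_intros, use collapse_mem[OF good_collapse x] in blast)
  then show ?thesis using good_Zl lepoll_trans unfolding mem_Zl by blast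
qed

end

context
  fixes \<kappa>1 M1 \<pi>1 \<kappa>2 M2 \<pi>2
  assumes g1: "good \<kappa>1 M1 \<pi>1" and g2: "good \<kappa>2 M2 \<pi>2"
    and same: "inter M1 (Hl \<kappa>0) = inter M2 (Hl \<kappa>0)"
begin

text \<open>
  A countable subset has a code in \<open>H\<^sub>\<kappa>\<^sub>0\<close>, hence in the common trace, from which the other set can decode it.
\<close>

lemma transfer_countable:
  assumes y1: "y1 \<epsilon> M1" "y1 \<sqsubseteq> M1" "ctbl y1" "extensional y1" and y2: "y2 \<epsilon> M2" "y2 \<sqsubseteq> M2"
    and same1: "\<And>s. s \<epsilon> y1 ==> \<exists>s'. s' \<epsilon> y2 \<and> val \<pi>1 s = val \<pi>2 s'"
    and same2: "\<And>s'. s' \<epsilon> y2 ==> \<exists>s. s \<epsilon> y1 \<and> val \<pi>1 s = val \<pi>2 s'"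
    and u1: "u1 \<epsilon> M1" "u1 \<sqsubseteq> y1"
  shows "\<exists>u2. u2 \<epsilon> M2 \<and> u2 \<sqsubseteq> y2 \<and> val \<pi>2 u2 = val \<pi>1 u1"
proof -
  note c1 = good_collapse[OF g1] and c2 = good_collapse[OF g2]
  obtain j where j: "injection j y1 omega" using y1(3) unfolding lepoll_def by blast
  note ji = injection_opair[OF j]
  define A where "A = (SET p. p \<epsilon> prod omega omega \<and>
    (\<exists>s t m n. p = opair m n \<and> opair s m \<epsilon> j \<and> opair t n \<epsilon> j \<and> (s \<epsilon> t \<or> s = t)))"
  have A: "p \<epsilon> A <-> (\<exists>s t m n. p = opair m n \<and> opair s m \<epsilon> j \<and> opair t n \<epsilon> j \<and> (s \<epsilon> t \<or> s = t))" for p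
  proof -
    have "p \<epsilon> A <-> p \<epsilon> prod omega omega \<and>
      (\<exists>s t m n. p = opair m n \<and> opair s m \<epsilon> j \<and> opair t n \<epsilon> j \<and> (s \<epsilon> t \<or> s = t))"
      unfolding A_def by (rule mem_sep) (intro fo_intros)
    then show ?thesis using ji(2) opair_mem_prod by blast
  qed
  define B where "B = (SET m. m \<epsilon> omega \<and> (\<exists>s. s \<epsilon> u1 \<and> opair s m \<epsilon> j))"
  have B: "m \<epsilon> B <-> (\<exists>s. s \<epsilon> u1 \<and> opair s m \<epsilon> j)" for m
  proof -
    have "m \<epsilon> B <-> m \<epsilon> omega \<and> (\<exists>s. s \<epsilon> u1 \<and> opair s m \<epsilon> j)"
      unfolding B_def by (rule mem_sep) (intro fo_intros)
    then show ?thesis using ji(2) by blast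
  qed
  let ?r = "opair A B"
  have code1: "code_by j y1 u1 ?r" unfolding code_by_def using j A B by blast
  have om: "n \<epsilon> Hl \<kappa>0" if "n \<epsilon> omega" for n
    using Hl_trans[OF Sp_Ix[OF Sp0] Sp_omega[OF Sp0] that] .
  have Asub: "A \<sqsubseteq> prod omega omega" unfolding subset_def A using ji(2) opair_mem_prod by blast
  then have "A \<sqsubseteq> Hl \<kappa>0" unfolding subset_def mem_prod_iff using om Sp_opair[OF Sp0] by blast
  moreover have "lepoll A omega1"
    using subset_lepoll[OF Asub] omega_times_omega omega_lepoll_omega1 lepoll_trans by blast
  ultimately have AH: "A \<epsilon> Hl \<kappa>0" using Sp_subsetI[OF Sp0] by blast
  have "B \<sqsubseteq> omega" unfolding subset_def B using ji(2) by blast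
  then have BH: "B \<epsilon> Hl \<kappa>0" using Hl_subset[OF Sp_Ix[OF Sp0] Sp_omega[OF Sp0]] by blast
  have rH: "?r \<epsilon> Hl \<kappa>0" using Sp_opair[OF Sp0 AH BH] .
  have "rel_code y1 u1 ?r" unfolding rel_code_def using rH u1 code1 by blast
  then obtain r where r: "r \<epsilon> M1" "rel_code y1 u1 r"
    using skolemD[OF good_skolem(4)[OF g1] y1(1) u1(1) good_Hl0[OF g1 rH]] by blast
  obtain j1 where j1: "code_by j1 y1 u1 r" using r unfolding rel_code_def by blast
  have "r \<epsilon> inter M1 (Hl \<kappa>0)" using r unfolding rel_code_def by simp
  then have r2: "r \<epsilon> M2" unfolding same by simp
  define u where "u = (SET t. t \<epsilon> y2 \<and> (\<exists>s. s \<epsilon> u1 \<and> val \<pi>1 s = val \<pi>2 t))"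
  have u: "t \<epsilon> u <-> t \<epsilon> y2 \<and> (\<exists>s. s \<epsilon> u1 \<and> val \<pi>1 s = val \<pi>2 t)" for t
    unfolding u_def by (rule mem_sep) (intro fo_intros)
  define j2 where "j2 = (SET p. p \<epsilon> prod y2 omega \<and> (\<exists>t m s. p = opair t m \<and> s \<epsilon> y1 \<and> val \<pi>1 s = val \<pi>2 t \<and> opair s m \<epsilon> j1))"
  have inj1: "injection j1 y1 omega" using j1 unfolding code_by_def by blast
  note j1i = injection_opair[OF inj1]
  have j2: "p \<epsilon> j2 <-> p \<epsilon> prod y2 omega \<and> (\<exists>t m s. p = opair t m \<and> s \<epsilon> y1 \<and> val \<pi>1 s = val \<pi>2 t \<and> opair s m \<epsilon> j1)" for p
    unfolding j2_def by (rule mem_sep) (intro fo_intros)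
  have j2o: "opair t m \<epsilon> j2 <-> t \<epsilon> y2 \<and> (\<exists>s. s \<epsilon> y1 \<and> val \<pi>1 s = val \<pi>2 t \<and> opair s m \<epsilon> j1)" for t m
    unfolding j2 using j1i(2) by auto
  have inj\<pi>1: "s = s'" if "s \<epsilon> y1" "s' \<epsilon> y1" "val \<pi>1 s = val \<pi>1 s'" for s s'
    using collapse_inj[OF c1] that subsetD[OF y1(2)] by blast
  have inj\<pi>2: "s = s'" if "s \<epsilon> y2" "s' \<epsilon> y2" "val \<pi>2 s = val \<pi>2 s'" for s s'
    using collapse_inj[OF c2] that subsetD[OF y2(2)] by blast
  have e: "s \<epsilon> s' <-> t \<epsilon> t'" if "s \<epsilon> y1" "s' \<epsilon> y1" "t \<epsilon> y2" "t' \<epsilon> y2" "val \<pi>1 s = val \<pi>2 t" "val \<pi>1 s' = val \<pi>2 t'" for s s' t t'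
    using collapse_mem_iff[OF c1, of s s'] collapse_mem_iff[OF c2, of t t'] that subsetD[OF y1(2)] subsetD[OF y2(2)] by simp
  have "injection j2 y2 omega" unfolding injection_iff function_on_def partial_fun_def
  proof (intro conjI allI impI)
    fix p assume "p \<epsilon> j2" then show "\<exists>x y. p = opair x y" unfolding j2 by blast
  next
    fix t m n assume "opair t m \<epsilon> j2 \<and> opair t n \<epsilon> j2"
    then show "m = n" unfolding j2o using inj\<pi>1 j1i(3) by metis
  next
    fix t show "t \<epsilon> y2 <-> (\<exists>m. opair t m \<epsilon> j2)"
      unfolding j2o using same2[of t] j1i(1) by blast
  next
    fix t m assume "opair t m \<epsilon> j2" then show "m \<epsilon> omega" unfolding j2o using j1i(2) by blast
  next
    fix t t' m assume "opair t m \<epsilon> j2 \<and> opair t' m \<epsilon> j2"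
    then show "t = t'" unfolding j2o using inj\<pi>2 j1i(4) by metis
  qed
  moreover obtain A1 B1 where r1: "r = opair A1 B1"
     "\<And>p. p \<epsilon> A1 <-> (\<exists>s t m n. p = opair m n \<and> opair s m \<epsilon> j1 \<and> opair t n \<epsilon> j1 \<and> (s \<epsilon> t \<or> s = t))"
     "\<And>m. m \<epsilon> B1 <-> (\<exists>s. s \<epsilon> u1 \<and> opair s m \<epsilon> j1)"
    using j1 unfolding code_by_def by blast
  moreover have "p \<epsilon> A1 <-> (\<exists>s t m n. p = opair m n \<and> opair s m \<epsilon> j2 \<and> opair t n \<epsilon> j2 \<and> (s \<epsilon> t \<or> s = t))" for p
  proof
    assume "p \<epsilon> A1"
    then obtain s t m n where *: "p = opair m n" "opair s m \<epsilon> j1" "opair t n \<epsilon> j1" "s \<epsilon> t \<or> s = t" unfolding r1 by blast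
    then have st: "s \<epsilon> y1" "t \<epsilon> y1" using j1i(2) by blast+
    obtain s' t' where s': "s' \<epsilon> y2" "val \<pi>1 s = val \<pi>2 s'" and t': "t' \<epsilon> y2" "val \<pi>1 t = val \<pi>2 t'"
      using same1 st by meson
    have "s' \<epsilon> t' \<or> s' = t'" using *(4) e[OF st s'(1) t'(1) s'(2) t'(2)] inj\<pi>2[OF s'(1) t'(1)] s' t' by auto
    moreover have "opair s' m \<epsilon> j2" "opair t' n \<epsilon> j2" unfolding j2o using * st s' t' by blast+
    ultimately show "\<exists>s t m n. p = opair m n \<and> opair s m \<epsilon> j2 \<and> opair t n \<epsilon> j2 \<and> (s \<epsilon> t \<or> s = t)" using *(1) by blast
  next
    assume "\<exists>s t m n. p = opair m n \<and> opair s m \<epsilon> j2 \<and> opair t n \<epsilon> j2 \<and> (s \<epsilon> t \<or> s = t)"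
    then obtain s' t' m n where *: "p = opair m n" "opair s' m \<epsilon> j2" "opair t' n \<epsilon> j2" "s' \<epsilon> t' \<or> s' = t'" by blast
    then obtain s t where s: "s' \<epsilon> y2" "s \<epsilon> y1" "val \<pi>1 s = val \<pi>2 s'" "opair s m \<epsilon> j1"
      and t: "t' \<epsilon> y2" "t \<epsilon> y1" "val \<pi>1 t = val \<pi>2 t'" "opair t n \<epsilon> j1" unfolding j2o by blast
    have "s \<epsilon> t \<or> s = t" using *(4) e[OF s(2) t(2) s(1) t(1) s(3) t(3)] inj\<pi>1[OF s(2) t(2)] s t by auto
    then show "p \<epsilon> A1" unfolding r1 using *(1) s t by blast
  qed
  moreover have "m \<epsilon> B1 <-> (\<exists>s. s \<epsilon> u \<and> opair s m \<epsilon> j2)" for m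
  proof
    assume "m \<epsilon> B1"
    then obtain s where s: "s \<epsilon> u1" "opair s m \<epsilon> j1" unfolding r1 by blast
    then have sy: "s \<epsilon> y1" using j1i(2) by blast
    then obtain s' where "s' \<epsilon> y2" "val \<pi>1 s = val \<pi>2 s'" using same1 by blast
    then show "\<exists>s. s \<epsilon> u \<and> opair s m \<epsilon> j2" unfolding u j2o using s sy by blast
  next
    assume "\<exists>s. s \<epsilon> u \<and> opair s m \<epsilon> j2"
    then obtain s' where "s' \<epsilon> u" "opair s' m \<epsilon> j2" by blast
    then obtain s v where *: "s \<epsilon> u1" "val \<pi>1 s = val \<pi>2 s'" "v \<epsilon> y1" "val \<pi>1 v = val \<pi>2 s'" "opair v m \<epsilon> j1"
      unfolding u j2o by blast
    then have "v = s" using inj\<pi>1[of v s] subsetD[OF u1(2)] by simp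
    then show "m \<epsilon> B1" unfolding r1 using * by blast
  qed
  ultimately have "code_by j2 y2 u r" unfolding code_by_def by blast
  moreover have "u \<sqsubseteq> y2" unfolding subset_def u by blast
  ultimately have "rel_dec y2 r u" unfolding rel_dec_def by blast
  moreover have "u \<epsilon> Hl \<kappa>2" by (rule Hl_subset[OF good_Ix[OF g2] good_Hl[OF g2 y2(1)] \<open>u \<sqsubseteq> y2\<close>])
  ultimately obtain u2 where u2: "u2 \<epsilon> M2" "rel_dec y2 r u2"
    using skolemD[OF good_skolem(5)[OF g2] y2(1) r2] by blast
  then obtain j3 where j3: "u2 \<sqsubseteq> y2" "code_by j3 y2 u2 r" unfolding rel_dec_def by blast
  have i3: "injection j3 y2 omega" using j3 unfolding code_by_def by blast
  note j3i = injection_opair[OF i3]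
  note rigid = code_by_rigid[OF c1 c2 y1(2) y2(2) y1(4) same1 same2 j1 j3(2)]
  have "val \<pi>2 u2 = val \<pi>1 u1"
  proof (rule set_eqI)
    fix t
    show "t \<epsilon> val \<pi>2 u2 <-> t \<epsilon> val \<pi>1 u1"
    proof
      assume "t \<epsilon> val \<pi>2 u2"
      then obtain s' where s': "s' \<epsilon> u2" "t = val \<pi>2 s'" unfolding collapse_mem[OF c2 u2(1)] by blast
      then obtain s m where m: "opair s' m \<epsilon> j3" "opair s m \<epsilon> j1"
        using code_by_same(1)[OF j3(2) j1] subsetD[OF j3(1)] by blast
      have "s \<epsilon> u1" using code_by_same(3)[OF j3(2) j1 m s'(1)] .
      moreover have "val \<pi>1 s = val \<pi>2 s'" using rigid[OF _ _ m(2,1)] by blast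
      ultimately show "t \<epsilon> val \<pi>1 u1" unfolding collapse_mem[OF c1 u1(1)]
        using s' subsetD[OF y1(2) subsetD[OF u1(2)]] by metis
    next
      assume "t \<epsilon> val \<pi>1 u1"
      then obtain s where s: "s \<epsilon> u1" "t = val \<pi>1 s" unfolding collapse_mem[OF c1 u1(1)] by blast
      then obtain s' m where m: "opair s m \<epsilon> j1" "opair s' m \<epsilon> j3"
        using code_by_same(1)[OF j1 j3(2)] subsetD[OF u1(2)] by blast
      have "s' \<epsilon> u2" using code_by_same(3)[OF j1 j3(2) m s(1)] .
      moreover have "val \<pi>1 s = val \<pi>2 s'" using rigid[OF _ _ m] by blast
      ultimately show "t \<epsilon> val \<pi>2 u2" unfolding collapse_mem[OF c2 u2(1)]
        using s subsetD[OF y2(2) subsetD[OF j3(1)]] by metis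
    qed
  qed
  with u2(1) j3(1) show ?thesis by blast
qed

text \<open>
  Internal clubness provides countable \<open>y1 \<in> M1\<close>, \<open>y2 \<in> M2\<close> with the same collapse that cover any
  given countable part; so the countable pieces of \<open>t\<close> are transferred, and guessing yields \<open>t\<close> itself.
\<close>

lemma transfer_subset:
  assumes d1: "d1 \<epsilon> M1" "transitive d1" and d2: "d2 \<epsilon> M2" and D: "val \<pi>1 d1 = val \<pi>2 d2"
    and t: "t \<epsilon> ran \<pi>1" "t \<sqsubseteq> val \<pi>1 d1"
  shows "t \<epsilon> ran \<pi>2"
proof -
  note c1 = good_collapse[OF g1] and c2 = good_collapse[OF g2]
  obtain t1 where t1: "t1 \<epsilon> M1" "t = val \<pi>1 t1" using t(1) unfolding collapse_ran[OF c1] by blast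
  obtain C1 where C1: "C1 \<sqsubseteq> M1" "club_in C1 M1" using good_club[OF g1] by blast
  obtain C2 where C2: "C2 \<sqsubseteq> M2" "club_in C2 M2" using good_club[OF g2] by blast
  have wit: "\<exists>w. w \<epsilon> M1 \<and> (w \<epsilon> s <-> \<not> w \<epsilon> v)" if "s \<epsilon> M1" "v \<epsilon> M1" "s \<noteq> v" for s v
    using good_wit[OF g1 that(1,2)] good_wit[OF g1 that(2,1)] subset_antisym[of s v] that(3) by blast
  have "inter z t \<epsilon> ran \<pi>2" if z: "z \<epsilon> ran \<pi>2" "ctbl z" for z
  proof -
    obtain z2 where z2: "z2 \<epsilon> M2" "z = val \<pi>2 z2" using z(1) unfolding collapse_ran[OF c2] by blast
    have Y: "inter z (val \<pi>1 d1) \<sqsubseteq> val \<pi>1 d1" "ctbl (inter z (val \<pi>1 d1))"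
      using ctbl_subset[OF z(2)] by (simp_all add: subset_def)
    obtain c c' where c: "c \<epsilon> C1" "c' \<epsilon> C2" "extensional c"
      and m1: "\<And>x. x \<epsilon> c ==> x \<epsilon> d1 ==> \<exists>x'. x' \<epsilon> c' \<and> x' \<epsilon> d2 \<and> val \<pi>1 x = val \<pi>2 x'"
      and m2: "\<And>x'. x' \<epsilon> c' ==> x' \<epsilon> d2 ==> \<exists>x. x \<epsilon> c \<and> x \<epsilon> d1 \<and> val \<pi>1 x = val \<pi>2 x'"
      and m3: "\<And>t. t \<epsilon> inter z (val \<pi>1 d1) ==> \<exists>x. x \<epsilon> c \<and> x \<epsilon> d1 \<and> t = val \<pi>1 x"
      by (rule common_club_trace[OF c1 c2 C1(2) C2(2) d1(1) d2 D wit Y]) auto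
    let ?y1 = "inter c d1" and ?y2 = "inter c' d2"
    have cM: "c \<sqsubseteq> M1" "ctbl c" "c' \<sqsubseteq> M2" using club_in_subset[OF C1(2) c(1)] club_in_subset[OF C2(2) c(2)] by blast+
    have y1: "?y1 \<epsilon> M1" "?y1 \<sqsubseteq> M1" "ctbl ?y1"
      using good_inter[OF g1 subsetD[OF C1(1) c(1)] d1(1)] cM ctbl_subset[OF cM(2), of ?y1] by (auto simp: subset_def)
    have ext: "extensional ?y1" unfolding extensional_def mem_inter
    proof (intro allI impI)
      fix s v assume sv: "(s \<epsilon> c \<and> s \<epsilon> d1) \<and> (v \<epsilon> c \<and> v \<epsilon> d1) \<and> s \<noteq> v"
      then obtain w where w: "w \<epsilon> c" "w \<epsilon> s <-> \<not> w \<epsilon> v" using c(3) unfolding extensional_def by blast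
      then have "w \<epsilon> d1" using transitiveD[OF d1(2)] sv by blast
      with w show "\<exists>w. (w \<epsilon> c \<and> w \<epsilon> d1) \<and> (w \<epsilon> s <-> \<not> w \<epsilon> v)" by blast
    qed
    have y2: "?y2 \<epsilon> M2" "?y2 \<sqsubseteq> M2"
      using good_inter[OF g2 subsetD[OF C2(1) c(2)] d2] cM by (auto simp: subset_def)
    have u1: "inter t1 ?y1 \<epsilon> M1" "inter t1 ?y1 \<sqsubseteq> ?y1" using good_inter[OF g1 t1(1) y1(1)] by (auto simp: subset_def)
    obtain u2 where u2: "u2 \<epsilon> M2" "u2 \<sqsubseteq> ?y2" "val \<pi>2 u2 = val \<pi>1 (inter t1 ?y1)"
      using transfer_countable[OF y1 ext y2 _ _ u1] m1 m2 by (metis mem_inter)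
    have "inter z t = val \<pi>2 (inter z2 u2)"
    proof (rule set_eqI)
      fix x
      have iz: "inter z2 u2 \<epsilon> M2" using good_inter[OF g2 z2(1) u2(1)] .
      show "x \<epsilon> inter z t <-> x \<epsilon> val \<pi>2 (inter z2 u2)"
      proof
        assume x: "x \<epsilon> inter z t"
        then have "x \<epsilon> inter z (val \<pi>1 d1)" using subsetD[OF t(2)] by simp
        then obtain v where v: "v \<epsilon> c" "v \<epsilon> d1" "x = val \<pi>1 v" using m3 by blast
        have vM: "v \<epsilon> M1" using subsetD[OF cM(1) v(1)] .
        have "v \<epsilon> t1" using x v t1 collapse_mem_iff[OF c1 vM t1(1)] by simp
        then have "x \<epsilon> val \<pi>1 (inter t1 ?y1)" unfolding collapse_mem[OF c1 u1(1)] using v vM by auto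
        then have "x \<epsilon> val \<pi>2 u2" using u2(3) by simp
        then obtain w where w: "w \<epsilon> M2" "w \<epsilon> u2" "x = val \<pi>2 w" unfolding collapse_mem[OF c2 u2(1)] by blast
        have "w \<epsilon> z2" using x w z2 collapse_mem_iff[OF c2 w(1) z2(1)] by simp
        then show "x \<epsilon> val \<pi>2 (inter z2 u2)" unfolding collapse_mem[OF c2 iz] using w by auto
      next
        assume "x \<epsilon> val \<pi>2 (inter z2 u2)"
        then obtain w where w: "w \<epsilon> M2" "w \<epsilon> z2" "w \<epsilon> u2" "x = val \<pi>2 w" unfolding collapse_mem[OF c2 iz] by auto
        have "x \<epsilon> val \<pi>2 u2" unfolding collapse_mem[OF c2 u2(1)] using w by blast
        then have "x \<epsilon> val \<pi>1 (inter t1 ?y1)" using u2(3) by simp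
        then have "x \<epsilon> t" unfolding collapse_mem[OF c1 u1(1)] t1(2) collapse_mem[OF c1 t1(1)] by auto
        moreover have "x \<epsilon> z" unfolding z2(2) collapse_mem[OF c2 z2(1)] using w by blast
        ultimately show "x \<epsilon> inter z t" by simp
      qed
    qed
    then show ?thesis using collapse_ran_mem[OF c2 good_inter[OF g2 z2(1) u2(1)]] by simp
  qed
  moreover have "val \<pi>2 d2 \<epsilon> ran \<pi>2" by (rule collapse_ran_mem[OF c2 d2])
  ultimately show ?thesis using good_approx[OF g2] t(2) D unfolding approx_def by metis
qed

lemma collapse_Vlev_half:
  assumes \<xi>1: "ordinal \<xi>1" "\<xi>1 \<epsilon> M1" "Vlev \<xi>1 \<epsilon> M1" and \<xi>2: "ordinal \<xi>2" "\<xi>2 \<epsilon> M2" "Vlev \<xi>2 \<epsilon> M2"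
    and eq: "val \<pi>1 \<xi>1 = val \<pi>2 \<xi>2"
    and IH: "\<And>\<eta> \<eta>'. \<eta> \<epsilon> \<xi>1 ==> \<eta> \<epsilon> M1 ==> \<eta>' \<epsilon> \<xi>2 ==> \<eta>' \<epsilon> M2 ==> val \<pi>1 \<eta> = val \<pi>2 \<eta>' ==>
      val \<pi>1 (Vlev \<eta>) = val \<pi>2 (Vlev \<eta>')"
  shows "val \<pi>1 (Vlev \<xi>1) \<sqsubseteq> val \<pi>2 (Vlev \<xi>2)"
  unfolding subset_def
proof (intro allI impI)
  note c1 = good_collapse[OF g1] and c2 = good_collapse[OF g2]
  fix t assume "t \<epsilon> val \<pi>1 (Vlev \<xi>1)"
  then obtain y where y: "y \<epsilon> M1" "y \<epsilon> Vlev \<xi>1" "t = val \<pi>1 y" unfolding collapse_mem[OF c1 \<xi>1(3)] by blast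
  obtain \<eta> where \<eta>: "\<eta> \<epsilon> M1" "\<eta> \<epsilon> \<xi>1" "y \<sqsubseteq> Vlev \<eta>" using good_rank[OF g1 \<xi>1 y(1,2)] by blast
  have "val \<pi>1 \<eta> \<epsilon> val \<pi>2 \<xi>2" using collapse_mem_iff[OF c1 \<eta>(1) \<xi>1(2)] \<eta>(2) eq by simp
  then obtain \<eta>' where \<eta>': "\<eta>' \<epsilon> M2" "\<eta>' \<epsilon> \<xi>2" "val \<pi>1 \<eta> = val \<pi>2 \<eta>'" unfolding collapse_mem[OF c2 \<xi>2(2)] by blast
  have V: "Vlev \<eta> \<epsilon> M1" using good_V_mem[OF g1 \<xi>1(1,3) \<eta>(1,2)] .
  have V': "Vlev \<eta>' \<epsilon> M2" using good_V_mem[OF g2 \<xi>2(1,3) \<eta>'(1,2)] .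
  have e: "val \<pi>1 (Vlev \<eta>) = val \<pi>2 (Vlev \<eta>')" using IH \<eta> \<eta>' by blast
  have ts: "t \<sqsubseteq> val \<pi>1 (Vlev \<eta>)"
    unfolding subset_def y(3) collapse_mem[OF c1 y(1)] collapse_mem[OF c1 V] using subsetD[OF \<eta>(3)] by blast
  have "t \<epsilon> ran \<pi>2"
    by (rule transfer_subset[OF V transitive_Vlev[OF ordinal_mem[OF \<xi>1(1) \<eta>(2)]] V' e _ ts])
      (use y collapse_ran_mem[OF c1] in blast)
  then obtain y' where y': "y' \<epsilon> M2" "t = val \<pi>2 y'" unfolding collapse_ran[OF c2] by blast
  have "y' \<sqsubseteq> Vlev \<eta>'" by (rule good_subset[OF g2 y'(1) V']) (use ts e y' in simp)
  then have "y' \<epsilon> Vlev \<xi>2" using \<eta>'(2) mem_Vlev[OF \<xi>2(1)] by blast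
  then show "t \<epsilon> val \<pi>2 (Vlev \<xi>2)" unfolding collapse_mem[OF c2 \<xi>2(3)] using y' by blast
qed

end

lemma collapse_Vlev_eq:
  assumes g1: "good \<kappa>1 M1 \<pi>1" and g2: "good \<kappa>2 M2 \<pi>2" and same: "inter M1 (Hl \<kappa>0) = inter M2 (Hl \<kappa>0)"
    and \<xi>1: "ordinal \<xi>1" "\<xi>1 \<epsilon> M1" "Vlev \<xi>1 \<epsilon> M1" and \<xi>2: "ordinal \<xi>2" "\<xi>2 \<epsilon> M2" "Vlev \<xi>2 \<epsilon> M2"
    and eq: "val \<pi>1 \<xi>1 = val \<pi>2 \<xi>2"
  shows "val \<pi>1 (Vlev \<xi>1) = val \<pi>2 (Vlev \<xi>2)"
proof -
  define P where "P \<xi>1 <-> (\<forall>\<xi>2. \<xi>1 \<epsilon> M1 --> Vlev \<xi>1 \<epsilon> M1 --> ordinal \<xi>2 --> \<xi>2 \<epsilon> M2 --> Vlev \<xi>2 \<epsilon> M2 -->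
    val \<pi>1 \<xi>1 = val \<pi>2 \<xi>2 --> val \<pi>1 (Vlev \<xi>1) = val \<pi>2 (Vlev \<xi>2))" for \<xi>1
  have "P \<xi>1"
  proof (rule ordinal_induct[where P = P, OF _ \<xi>1(1)])
    show "fo1 P" unfolding P_def by (intro fo_intros)
    fix \<alpha> assume \<alpha>: "ordinal \<alpha>" and IH: "\<And>\<beta>. \<beta> \<epsilon> \<alpha> ==> P \<beta>"
    show "P \<alpha>" unfolding P_def
    proof (intro allI impI)
      fix \<xi> assume a: "\<alpha> \<epsilon> M1" "Vlev \<alpha> \<epsilon> M1" and x: "ordinal \<xi>" "\<xi> \<epsilon> M2" "Vlev \<xi> \<epsilon> M2" "val \<pi>1 \<alpha> = val \<pi>2 \<xi>"
      have IH': "val \<pi>1 (Vlev \<eta>) = val \<pi>2 (Vlev \<eta>')"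
        if "\<eta> \<epsilon> \<alpha>" "\<eta> \<epsilon> M1" "\<eta>' \<epsilon> \<xi>" "\<eta>' \<epsilon> M2" "val \<pi>1 \<eta> = val \<pi>2 \<eta>'" for \<eta> \<eta>'
        using IH[OF that(1)] that ordinal_mem[OF x(1) that(3)] good_V_mem[OF g1 \<alpha> a(2) that(2,1)]
          good_V_mem[OF g2 x(1,3) that(4,3)] unfolding P_def by blast
      show "val \<pi>1 (Vlev \<alpha>) = val \<pi>2 (Vlev \<xi>)"
      proof (rule subset_antisym)
        show "val \<pi>1 (Vlev \<alpha>) \<sqsubseteq> val \<pi>2 (Vlev \<xi>)"
          by (rule collapse_Vlev_half[OF g1 g2 same \<alpha> a x IH'])
        show "val \<pi>2 (Vlev \<xi>) \<sqsubseteq> val \<pi>1 (Vlev \<alpha>)"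
          by (rule collapse_Vlev_half[OF g2 g1 same[symmetric] x(1-3) \<alpha> a x(4)[symmetric]]) (metis IH')
      qed
    qed
  qed
  then show ?thesis unfolding P_def using assms by blast
qed

definition levels :: "'v => 'v" where
  "levels M0 = (SET D. D \<epsilon> Hl \<kappa>0 \<and> (\<exists>\<kappa> M \<pi> \<xi>. good \<kappa> M \<pi> \<and> inter M (Hl \<kappa>0) = M0 \<and>
     ordinal \<xi> \<and> \<xi> \<epsilon> M \<and> Vlev \<xi> \<epsilon> M \<and> D = val \<pi> (Vlev \<xi>)))"

lemma transitive_small_Hl0: "transitive D ==> lepoll D omega1 ==> D \<epsilon> Hl \<kappa>0"
  using Sp0 mem_Hl_lev good_height_facts(5) lepoll_trans unfolding Sp_def by (metis trcl_transitive)

lemma mem_levels: "D \<epsilon> levels M0 <-> (\<exists>\<kappa> M \<pi> \<xi>. good \<kappa> M \<pi> \<and> inter M (Hl \<kappa>0) = M0 \<and>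
     ordinal \<xi> \<and> \<xi> \<epsilon> M \<and> Vlev \<xi> \<epsilon> M \<and> D = val \<pi> (Vlev \<xi>))"
proof -
  have "D \<epsilon> levels M0 <-> D \<epsilon> Hl \<kappa>0 \<and> (\<exists>\<kappa> M \<pi> \<xi>. good \<kappa> M \<pi> \<and> inter M (Hl \<kappa>0) = M0 \<and>
     ordinal \<xi> \<and> \<xi> \<epsilon> M \<and> Vlev \<xi> \<epsilon> M \<and> D = val \<pi> (Vlev \<xi>))"
    unfolding levels_def by (rule mem_sep) (intro fo_intros)
  moreover have "val \<pi> (Vlev \<xi>) \<epsilon> Hl \<kappa>0" if "good \<kappa> M \<pi>" "ordinal \<xi>" "Vlev \<xi> \<epsilon> M" for \<kappa> M \<pi> \<xi>
    using transitive_small_Hl0[OF collapse_transitive[OF that(1) transitive_Vlev[OF that(2)] that(3)] val_lepoll[OF that(1,3)]] .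
  ultimately show ?thesis by blast
qed

lemma fot_levels [fo_intros]: "fot mem t ==> fot mem (\<lambda>e. levels (t e))"
  by (rule fot_sub1) (rule fot_set, rule mem_levels, intro fo_intros)

lemma levels_Hl0: "levels M0 \<sqsubseteq> Hl \<kappa>0"
proof -
  have "D \<epsilon> levels M0 <-> D \<epsilon> Hl \<kappa>0 \<and> (\<exists>\<kappa> M \<pi> \<xi>. good \<kappa> M \<pi> \<and> inter M (Hl \<kappa>0) = M0 \<and>
     ordinal \<xi> \<and> \<xi> \<epsilon> M \<and> Vlev \<xi> \<epsilon> M \<and> D = val \<pi> (Vlev \<xi>))" for D
    unfolding levels_def by (rule mem_sep) (intro fo_intros)
  then show ?thesis unfolding subset_def by blast
qed

lemma transitive_levels: "D \<epsilon> levels M0 ==> transitive D"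
  unfolding mem_levels using collapse_transitive transitive_Vlev by blast

lemma levels_comparable:
  assumes "D \<epsilon> levels M0" "D' \<epsilon> levels M0"
  shows "D \<epsilon> D' \<or> D' \<sqsubseteq> D"
proof -
  obtain \<kappa>1 M1 \<pi>1 \<xi>1 where A: "good \<kappa>1 M1 \<pi>1" "inter M1 (Hl \<kappa>0) = M0" "ordinal \<xi>1" "\<xi>1 \<epsilon> M1" "Vlev \<xi>1 \<epsilon> M1" "D = val \<pi>1 (Vlev \<xi>1)"
    using assms(1) unfolding mem_levels by blast
  obtain \<kappa>2 M2 \<pi>2 \<xi>2 where B: "good \<kappa>2 M2 \<pi>2" "inter M2 (Hl \<kappa>0) = M0" "ordinal \<xi>2" "\<xi>2 \<epsilon> M2" "Vlev \<xi>2 \<epsilon> M2" "D' = val \<pi>2 (Vlev \<xi>2)"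
    using assms(2) unfolding mem_levels by blast
  have less: "val \<pi>1 (Vlev \<xi>1) \<epsilon> val \<pi>2 (Vlev \<xi>2)"
    if A: "good \<kappa>1 M1 \<pi>1" "inter M1 (Hl \<kappa>0) = M0" "ordinal \<xi>1" "\<xi>1 \<epsilon> M1" "Vlev \<xi>1 \<epsilon> M1"
    and B: "good \<kappa>2 M2 \<pi>2" "inter M2 (Hl \<kappa>0) = M0" "ordinal \<xi>2" "\<xi>2 \<epsilon> M2" "Vlev \<xi>2 \<epsilon> M2"
    and l: "val \<pi>1 \<xi>1 \<epsilon> val \<pi>2 \<xi>2" for \<kappa>1 M1 \<pi>1 \<xi>1 \<kappa>2 M2 \<pi>2 \<xi>2
  proof -
    obtain \<eta> where \<eta>: "\<eta> \<epsilon> M2" "\<eta> \<epsilon> \<xi>2" "val \<pi>1 \<xi>1 = val \<pi>2 \<eta>"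
      using l unfolding collapse_mem[OF good_collapse[OF B(1)] B(4)] by blast
    have V: "Vlev \<eta> \<epsilon> M2" using good_V_mem[OF B(1,3,5) \<eta>(1,2)] .
    have "val \<pi>1 (Vlev \<xi>1) = val \<pi>2 (Vlev \<eta>)"
      by (rule collapse_Vlev_eq[OF A(1) B(1) _ A(3-5) ordinal_mem[OF B(3) \<eta>(2)] \<eta>(1) V \<eta>(3)]) (use A B in simp)
    then show ?thesis using collapse_mem_iff[OF good_collapse[OF B(1)] V B(5)] Vlev_mem[OF B(3) \<eta>(2)] by simp
  qed
  have o: "ordinal (val \<pi>1 \<xi>1)" "ordinal (val \<pi>2 \<xi>2)"
    using ordinal_collapse[OF A(1,3,4)] ordinal_collapse[OF B(1,3,4)] by blast+
  consider "val \<pi>1 \<xi>1 \<epsilon> val \<pi>2 \<xi>2" | "val \<pi>1 \<xi>1 = val \<pi>2 \<xi>2" | "val \<pi>2 \<xi>2 \<epsilon> val \<pi>1 \<xi>1"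
    using ordinal_linear[OF o] by blast
  then show ?thesis
  proof cases
    case 1 then show ?thesis using less[OF A(1-5) B(1-5)] A(6) B(6) by blast
  next
    case 2
    have "D = D'" unfolding A(6) B(6)
      by (rule collapse_Vlev_eq[OF A(1) B(1) _ A(3-5) B(3-5) 2]) (use A B in simp)
    then show ?thesis by simp
  next
    case 3 then have "D' \<epsilon> D" using less[OF B(1-5) A(1-5)] A(6) B(6) by blast
    then show ?thesis using transitive_levels[OF assms(1)] transitive_def by blast
  qed
qed

end

section \<open>A minimal bound for the levels\<close>

context tower_universe
begin

lemma tower_condition_iff: "tower_condition \<delta> I p <-> (\<exists>\<kappa> S. p = opair \<kappa> S \<and> \<kappa> \<epsilon> Ix \<and> pos \<kappa> S)"
  unfolding tower_condition_def pos_def null_def Ix_def[symmetric] using Zset_eq app_I by metis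

lemma tower_le_iff: "(q, p) \<in> tower_le \<delta> I <-> (\<exists>\<kappa> S \<kappa>' S'. q = opair \<kappa>' S' \<and> p = opair \<kappa> S \<and>
     \<kappa> \<epsilon> Ix \<and> \<kappa>' \<epsilon> Ix \<and> pos \<kappa> S \<and> pos \<kappa>' S' \<and> \<kappa> \<sqsubseteq> \<kappa>' \<and> S' \<sqsubseteq> lift \<kappa> \<kappa>' S)"
proof -
  have l: "(SET M'. M' \<epsilon> Zset \<kappa>' \<and> inter M' (H \<kappa>) \<epsilon> S) = lift \<kappa> \<kappa>' S" if "\<kappa> \<epsilon> Ix" "\<kappa>' \<epsilon> Ix" for \<kappa> \<kappa>' S
    unfolding lift_def by (simp add: Zset_eq[OF that(2)] H_eq[OF that(1)])
  show ?thesis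
  proof
    assume "(q, p) \<in> tower_le \<delta> I"
    then obtain \<kappa> S \<kappa>' S' where 1: "tower_condition \<delta> I q" "tower_condition \<delta> I p" "q = opair \<kappa>' S'" "p = opair \<kappa> S"
       "\<kappa> \<sqsubseteq> \<kappa>'" "S' \<sqsubseteq> (SET M'. M' \<epsilon> Zset \<kappa>' \<and> inter M' (H \<kappa>) \<epsilon> S)"
      unfolding tower_le_def by blast
    then have "\<kappa> \<epsilon> Ix" "\<kappa>' \<epsilon> Ix" "pos \<kappa> S" "pos \<kappa>' S'" unfolding tower_condition_iff by auto
    with 1 l show "\<exists>\<kappa> S \<kappa>' S'. q = opair \<kappa>' S' \<and> p = opair \<kappa> S \<and>
     \<kappa> \<epsilon> Ix \<and> \<kappa>' \<epsilon> Ix \<and> pos \<kappa> S \<and> pos \<kappa>' S' \<and> \<kappa> \<sqsubseteq> \<kappa>' \<and> S' \<sqsubseteq> lift \<kappa> \<kappa>' S" by metis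
  next
    assume "\<exists>\<kappa> S \<kappa>' S'. q = opair \<kappa>' S' \<and> p = opair \<kappa> S \<and>
     \<kappa> \<epsilon> Ix \<and> \<kappa>' \<epsilon> Ix \<and> pos \<kappa> S \<and> pos \<kappa>' S' \<and> \<kappa> \<sqsubseteq> \<kappa>' \<and> S' \<sqsubseteq> lift \<kappa> \<kappa>' S"
    then obtain \<kappa> S \<kappa>' S' where "q = opair \<kappa>' S'" "p = opair \<kappa> S" "\<kappa> \<epsilon> Ix" "\<kappa>' \<epsilon> Ix" "pos \<kappa> S" "pos \<kappa>' S'"
      "\<kappa> \<sqsubseteq> \<kappa>'" "S' \<sqsubseteq> lift \<kappa> \<kappa>' S" by blast
    moreover from this have "tower_condition \<delta> I q" "tower_condition \<delta> I p" unfolding tower_condition_iff by blast+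
    ultimately show "(q, p) \<in> tower_le \<delta> I" unfolding tower_le_def using l by auto
  qed
qed

lemma inter_inter_Hl: "\<kappa> \<sqsubseteq> \<kappa>' ==> inter (inter M (Hl \<kappa>')) (Hl \<kappa>) = inter M (Hl \<kappa>)"
  by (rule set_eqI) (use subsetD[OF Hl_mono[of \<kappa> \<kappa>']] in auto)

lemma inter_Hl_self: "M \<epsilon> Zl \<kappa> ==> inter M (Hl \<kappa>) = M"
  unfolding mem_Zl by (rule set_eqI) (use subsetD[of M "Hl \<kappa>"] in auto)

lemma lift_lift: "\<kappa> \<sqsubseteq> \<kappa>' ==> S' \<sqsubseteq> lift \<kappa> \<kappa>' S ==> lift \<kappa>' \<kappa>'' S' \<sqsubseteq> lift \<kappa> \<kappa>'' S"
proof -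
  assume *: "\<kappa> \<sqsubseteq> \<kappa>'" "S' \<sqsubseteq> lift \<kappa> \<kappa>' S"
  have "inter M (Hl \<kappa>) \<epsilon> S" if "inter M (Hl \<kappa>') \<epsilon> S'" for M
    using subsetD[OF *(2) that] inter_inter_Hl[OF *(1), of M] by simp
  then show ?thesis unfolding subset_def[of "lift \<kappa>' \<kappa>'' S'"] mem_lift by blast
qed

lemma tower_le_refl: "\<kappa> \<epsilon> Ix ==> pos \<kappa> S ==> (opair \<kappa> S, opair \<kappa> S) \<in> tower_le \<delta> I"
  unfolding tower_le_iff by (intro exI conjI, (rule refl)+, assumption+, rule subset_refl)
    (use inter_Hl_self pos_subset_Zl in \<open>auto simp: subset_def\<close>)

lemma tower_le_trans: "(r, q) \<in> tower_le \<delta> I ==> (q, p) \<in> tower_le \<delta> I ==> (r, p) \<in> tower_le \<delta> I"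
proof -
  assume "(r, q) \<in> tower_le \<delta> I"
  then obtain \<kappa>' S' \<kappa>'' S'' where r: "r = opair \<kappa>'' S''" "q = opair \<kappa>' S'" "\<kappa>' \<epsilon> Ix" "\<kappa>'' \<epsilon> Ix"
    "pos \<kappa>'' S''" "\<kappa>' \<sqsubseteq> \<kappa>''" "S'' \<sqsubseteq> lift \<kappa>' \<kappa>'' S'" unfolding tower_le_iff by blast
  assume "(q, p) \<in> tower_le \<delta> I"
  then obtain \<kappa> S where p: "p = opair \<kappa> S" "\<kappa> \<epsilon> Ix" "pos \<kappa> S" "\<kappa> \<sqsubseteq> \<kappa>'" "S' \<sqsubseteq> lift \<kappa> \<kappa>' S"
    unfolding tower_le_iff r(2) by auto
  have "S'' \<sqsubseteq> lift \<kappa> \<kappa>'' S" using r(7) lift_lift[OF p(4,5)] subset_trans by blast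
  then show ?thesis unfolding tower_le_iff using r p subset_trans by blast
qed

lemma tower_le_lift:
  assumes "\<kappa> \<epsilon> Ix" "\<kappa>' \<epsilon> Ix" "\<kappa> \<sqsubseteq> \<kappa>'" "pos \<kappa> S"
  shows "(opair \<kappa>' (lift \<kappa> \<kappa>' S), opair \<kappa> S) \<in> tower_le \<delta> I"
  unfolding tower_le_iff using assms pos_lift[OF assms] subset_refl by blast

definition supp :: "'v => 'v => bool" where
  "supp \<kappa> f <-> (\<forall>x x'. x \<epsilon> Vd \<and> x' \<epsilon> Vd \<and> inter x (Hl \<kappa>) = inter x' (Hl \<kappa>) -->
     (\<forall>y. opair x y \<epsilon> f <-> opair x' y \<epsilon> f))"

lemma fo_supp [fo_intros]: "fot mem t ==> fot mem u ==> fo mem (\<lambda>e. supp (t e) (u e))"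
  by (rule fo_sub2) (unfold supp_def, intro fo_intros)

lemma supp_mono: "\<kappa> \<sqsubseteq> \<kappa>' ==> supp \<kappa> f ==> supp \<kappa>' f"
  unfolding supp_def using inter_inter_Hl by metis

lemma Zl_mem_Vd: "\<kappa> \<epsilon> Ix ==> M \<epsilon> Zl \<kappa> ==> M \<epsilon> Vd"
  using Vd_mem Zl_Vd by blast

lemma inter_Vd: "x \<epsilon> Vd ==> inter x y \<epsilon> Vd"
  by (erule Vd_subset) (simp add: subset_def)

lemma suppD: "supp \<kappa> f ==> x \<epsilon> Vd ==> opair (inter x (Hl \<kappa>)) y \<epsilon> f <-> opair x y \<epsilon> f"
  unfolding supp_def using inter_Vd inter_inter_Hl[OF subset_refl] by blast

lemma supp_val: "supp \<kappa> f ==> x \<epsilon> Vd ==> val f (inter x (Hl \<kappa>)) = val f x"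
  by (rule set_eqI) (simp add: mem_val suppD)

lemma supp_bounded:
  assumes "partial_fun f" "f \<sqsubseteq> prod Vd Vd" "\<kappa> \<epsilon> Ix" "supp \<kappa> f"
  shows "bounded_support \<delta> f"
  unfolding bounded_support_def Vset_eq[OF ordinal_delta] Ix_def[symmetric]
  using assms H_eq[OF assms(3)] subsetD[OF assms(2)] opair_mem_prod unfolding supp_def by metis

lemma generic_member:
  assumes \<theta>: "\<theta> \<epsilon> Ix" "pos \<theta> S" and f: "supp \<theta> f" "supp \<theta> g"
    and S: "\<And>M. M \<epsilon> S ==> \<exists>u v. opair M u \<epsilon> g \<and> opair M v \<epsilon> f \<and> u \<epsilon> v"
    and v: "(v, opair \<theta> S) \<in> tower_le \<delta> I" and \<kappa>: "\<kappa> \<epsilon> Ix" "\<theta> \<sqsubseteq> \<kappa>"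
  shows "fgeneric (tower_le \<delta> I) (opair \<kappa> (SET M. M \<epsilon> Zset \<kappa> \<and> (\<exists>u v. opair M u \<epsilon> g \<and> opair M v \<epsilon> f \<and> u \<epsilon> v))) v"
  unfolding fgeneric_def
proof (intro allI impI)
  let ?S = "SET M. M \<epsilon> Zset \<kappa> \<and> (\<exists>u v. opair M u \<epsilon> g \<and> opair M v \<epsilon> f \<and> u \<epsilon> v)"
  have Sk: "M \<epsilon> ?S <-> M \<epsilon> Zl \<kappa> \<and> (\<exists>u v. opair M u \<epsilon> g \<and> opair M v \<epsilon> f \<and> u \<epsilon> v)" for M
    unfolding Zset_eq[OF \<kappa>(1)] by (rule mem_sep) (intro fo_intros)
  fix q assume "(q, v) \<in> tower_le \<delta> I"
  then have "(q, opair \<theta> S) \<in> tower_le \<delta> I" using tower_le_trans v by blast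
  then obtain \<mu> T where q: "q = opair \<mu> T" "\<mu> \<epsilon> Ix" "pos \<mu> T" "\<theta> \<sqsubseteq> \<mu>" "T \<sqsubseteq> lift \<theta> \<mu> S"
    unfolding tower_le_iff by auto
  obtain \<nu> where \<nu>: "\<nu> \<epsilon> Ix" "\<mu> \<sqsubseteq> \<nu>" "\<kappa> \<sqsubseteq> \<nu>" using Ix_linear[OF q(2) \<kappa>(1)] q(2) \<kappa>(1) subset_refl by blast
  let ?r = "opair \<nu> (lift \<mu> \<nu> T)"
  have r: "(?r, q) \<in> tower_le \<delta> I" unfolding q(1) by (rule tower_le_lift[OF q(2) \<nu>(1,2) q(3)])
  have sub: "lift \<mu> \<nu> T \<sqsubseteq> lift \<kappa> \<nu> ?S" unfolding subset_def mem_lift Sk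
  proof (intro allI impI, elim conjE, intro conjI)
    fix M assume M: "M \<epsilon> Zl \<nu>" "inter M (Hl \<mu>) \<epsilon> T"
    then show "M \<epsilon> Zl \<nu>" "inter M (Hl \<kappa>) \<epsilon> Zl \<kappa>" using Zl_inter by blast+
    have "inter (inter M (Hl \<mu>)) (Hl \<theta>) \<epsilon> S" using subsetD[OF q(5) M(2)] by simp
    then have "inter M (Hl \<theta>) \<epsilon> S" using inter_inter_Hl[OF q(4)] by simp
    then obtain u w where "opair (inter M (Hl \<theta>)) u \<epsilon> g" "opair (inter M (Hl \<theta>)) w \<epsilon> f" "u \<epsilon> w" using S by blast
    moreover have "M \<epsilon> Vd" using Zl_mem_Vd[OF \<nu>(1) M(1)] .
    ultimately have "opair M u \<epsilon> g" "opair M w \<epsilon> f" "u \<epsilon> w" using suppD f by blast+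
    then show "\<exists>u v. opair (inter M (Hl \<kappa>)) u \<epsilon> g \<and> opair (inter M (Hl \<kappa>)) v \<epsilon> f \<and> u \<epsilon> v"
      using suppD[OF supp_mono[OF \<kappa>(2)] \<open>M \<epsilon> Vd\<close>] f by blast
  qed
  have p\<nu>: "pos \<nu> (lift \<mu> \<nu> T)" using pos_lift[OF q(2) \<nu>(1,2) q(3)] .
  have "pos \<nu> (lift \<kappa> \<nu> ?S)" by (rule pos_mono[OF \<nu>(1) p\<nu> sub lift_subset_Zl])
  then have "pos \<kappa> ?S" using null_lift[OF \<kappa>(1) \<nu>(1,3)] Sk unfolding pos_def subset_def by blast
  then have "(?r, opair \<kappa> ?S) \<in> tower_le \<delta> I" unfolding tower_le_iff using \<kappa>(1) \<nu> p\<nu> sub by blast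
  with r show "\<exists>r. (r, q) \<in> tower_le \<delta> I \<and> (r, opair \<kappa> ?S) \<in> tower_le \<delta> I" by blast
qed

lemma ult_mem_if:
  assumes \<theta>: "\<theta> \<epsilon> Ix" "pos \<theta> S" and f: "supp \<theta> f" "supp \<theta> g"
    and S: "\<And>M. M \<epsilon> S ==> \<exists>u v. opair M u \<epsilon> g \<and> opair M v \<epsilon> f \<and> u \<epsilon> v"
    and u: "(u, opair \<theta> S) \<in> tower_le \<delta> I"
  shows "ult_mem \<delta> I g f u"
  unfolding ult_mem_def Let_def fex_def fneg_def fall_def fconj_def fground_def fimp_def
proof (intro allI impI notI)
  let ?L = "tower_le \<delta> I"
  fix q assume q: "(q, u) \<in> ?L"
  assume *: "\<forall>x qa. (qa, q) \<in> ?L --> \<not> (x \<epsilon> index \<delta> \<and> (\<forall>xa qb. (qb, qa) \<in> ?L -->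
      \<not> ((xa \<epsilon> index \<delta> \<and> x \<sqsubseteq> xa) \<and> (\<forall>qc. (qc, qb) \<in> ?L --> \<not> fgeneric ?L (opair xa
          (SET M. M \<epsilon> Zset xa \<and> (\<exists>u v. opair M u \<epsilon> g \<and> opair M v \<epsilon> f \<and> u \<epsilon> v))) qc))))"
  have qS: "(q, opair \<theta> S) \<in> ?L" using tower_le_trans q u by blast
  have refl: "(x, x) \<in> ?L" if "(x, y) \<in> ?L" for x y
    using that tower_le_refl unfolding tower_le_iff by blast
  have "\<not> (\<theta> \<epsilon> index \<delta> \<and> (\<forall>xa qb. (qb, q) \<in> ?L -->
      \<not> ((xa \<epsilon> index \<delta> \<and> \<theta> \<sqsubseteq> xa) \<and> (\<forall>qc. (qc, qb) \<in> ?L --> \<not> fgeneric ?L (opair xa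
          (SET M. M \<epsilon> Zset xa \<and> (\<exists>u v. opair M u \<epsilon> g \<and> opair M v \<epsilon> f \<and> u \<epsilon> v))) qc))))"
    using *[THEN spec, of \<theta>, THEN spec, of q] refl[OF qS] by blast
  then obtain \<kappa> v where "(v, q) \<in> ?L" "\<kappa> \<epsilon> Ix" "\<theta> \<sqsubseteq> \<kappa>"
    and no: "\<forall>w. (w, v) \<in> ?L --> \<not> fgeneric ?L (opair \<kappa>
          (SET M. M \<epsilon> Zset \<kappa> \<and> (\<exists>u v. opair M u \<epsilon> g \<and> opair M v \<epsilon> f \<and> u \<epsilon> v))) w"
    using \<theta>(1) unfolding Ix_def by blast
  moreover have "(v, opair \<theta> S) \<in> ?L" using tower_le_trans \<open>(v, q) \<in> ?L\<close> qS by blast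
  ultimately show False using generic_member[OF \<theta> f S, of v \<kappa>] refl[OF \<open>(v, q) \<in> ?L\<close>] by blast
qed

lemma fallD: "fall \<phi> p ==> \<phi> x p"
  by (simp add: fall_def)

text \<open>Wellfoundedness of the generic ultrapower, applied to a set \<open>X\<close> of functions in the ground model.\<close>

lemma precipitous_minimal:
  assumes prec: "precipitous \<delta> I" and f0: "f0 \<epsilon> X" and X: "\<And>f. f \<epsilon> X ==> bounded_support \<delta> f"
    and \<kappa>1: "\<kappa>1 \<epsilon> Ix"
  obtains f \<kappa> S where "f \<epsilon> X" "\<kappa> \<epsilon> Ix" "pos \<kappa> S"
    "\<And>g \<theta> T. g \<epsilon> X ==> \<theta> \<epsilon> Ix ==> pos \<theta> T ==> \<kappa> \<sqsubseteq> \<theta> ==> T \<sqsubseteq> lift \<kappa> \<theta> S ==> supp \<theta> f ==> supp \<theta> g ==>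
      \<exists>M. M \<epsilon> T \<and> \<not> (\<exists>u v. opair M u \<epsilon> g \<and> opair M v \<epsilon> f \<and> u \<epsilon> v)"
proof -
  let ?L = "tower_le \<delta> I"
  define p0 where "p0 = opair \<kappa>1 (Zl \<kappa>1)"
  have p0: "(p0, p0) \<in> ?L" unfolding p0_def by (rule tower_le_refl[OF \<kappa>1 pos_Zl[OF \<kappa>1]])
  define \<tau> where "\<tau> = (SET y. \<exists>d. d \<epsilon> X \<and> y = opair p0 d)"
  have fo: "fot mem (\<lambda>e. opair p0 (e 0))" by (intro fo_intros)
  have \<tau>: "opair q d \<epsilon> \<tau> <-> q = p0 \<and> d \<epsilon> X" for q d unfolding \<tau>_def mem_image[OF fo] by auto
  have refl: "(x, x) \<in> ?L" if "(x, y) \<in> ?L" for x y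
    using that tower_le_refl unfolding tower_le_iff by blast
  have gen0: "fgeneric ?L p0 p" for p unfolding fgeneric_def
  proof (intro allI impI)
    fix q assume "(q, p) \<in> ?L"
    then obtain \<mu> T where q: "q = opair \<mu> T" "\<mu> \<epsilon> Ix" "pos \<mu> T" unfolding tower_le_iff by blast
    obtain \<nu> where \<nu>: "\<nu> \<epsilon> Ix" "\<mu> \<sqsubseteq> \<nu>" "\<kappa>1 \<sqsubseteq> \<nu>" using Ix_linear[OF q(2) \<kappa>1] q(2) \<kappa>1 subset_refl by blast
    have "pos \<nu> (lift \<mu> \<nu> T)" using pos_lift[OF q(2) \<nu>(1,2) q(3)] .
    moreover have "lift \<mu> \<nu> T \<sqsubseteq> lift \<kappa>1 \<nu> (Zl \<kappa>1)" unfolding subset_def mem_lift using Zl_inter by blast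
    ultimately have "(opair \<nu> (lift \<mu> \<nu> T), p0) \<in> ?L" unfolding tower_le_iff p0_def using \<nu> \<kappa>1 pos_Zl[OF \<kappa>1] by blast
    then show "\<exists>r. (r, q) \<in> ?L \<and> (r, p0) \<in> ?L" using tower_le_lift[OF q(2) \<nu>(1,2) q(3)] q(1) by blast
  qed
  define rep where "rep f = fconj (fground (bounded_support \<delta> f)) (in_name \<delta> I f \<tau>)" for f
  have rep: "rep f p" if "f \<epsilon> X" for f p
    unfolding rep_def fconj_def fground_def in_name_def Let_def fex_def fneg_def fall_def
    using X[OF that] gen0 \<tau> that refl by blast
  have repD: "f \<epsilon> X" if "rep f p" "(p, p') \<in> ?L" for f p p'
  proof -
    have "in_name \<delta> I f \<tau> p" using that unfolding rep_def fconj_def by blast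
    then have "\<exists>x q. (q, p) \<in> ?L \<and> opair x f \<epsilon> \<tau>"
      using refl[OF that(2)] unfolding in_name_def Let_def fex_def fneg_def fall_def fconj_def fground_def by blast
    then show ?thesis using \<tau> by blast
  qed
  have "tower_condition \<delta> I p0" unfolding tower_condition_iff p0_def using \<kappa>1 pos_Zl[OF \<kappa>1] by blast
  then have "ult_wellfounded \<delta> I p0" using prec unfolding precipitous_def by blast
  then have "fimp ?L (fex ?L rep) (fex ?L (\<lambda>f. fconj (rep f) (fall (\<lambda>g. fimp ?L (rep g) (fneg ?L (ult_mem \<delta> I g f)))))) p0"
    unfolding ult_wellfounded_def Let_def rep_def[abs_def] by (rule fallD)
  moreover have "fex ?L rep p0"
    unfolding fex_def fneg_def fall_def using rep[OF f0] refl by blast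
  ultimately obtain r where r: "(r, p0) \<in> ?L"
    and "fex ?L (\<lambda>f. fconj (rep f) (fall (\<lambda>g. fimp ?L (rep g) (fneg ?L (ult_mem \<delta> I g f))))) r"
    using p0 unfolding fimp_def fneg_def fconj_def by blast
  then obtain f q where q: "(q, r) \<in> ?L" "rep f q"
    and m: "\<And>g. fimp ?L (rep g) (fneg ?L (ult_mem \<delta> I g f)) q"
    using refl[OF r] unfolding fex_def fneg_def[of _ "fall _"] fall_def fneg_def[of _ "fconj _ _"] fconj_def by blast
  obtain \<kappa> S where \<kappa>: "q = opair \<kappa> S" "\<kappa> \<epsilon> Ix" "pos \<kappa> S" using q(1) unfolding tower_le_iff by blast
  show thesis
  proof (rule that[OF repD[OF q(2,1)] \<kappa>(2,3)], rule ccontr)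
    fix g \<theta> T assume g: "g \<epsilon> X" and \<theta>: "\<theta> \<epsilon> Ix" "pos \<theta> T" "\<kappa> \<sqsubseteq> \<theta>" "T \<sqsubseteq> lift \<kappa> \<theta> S" and s: "supp \<theta> f" "supp \<theta> g"
      and no: "\<not> (\<exists>M. M \<epsilon> T \<and> \<not> (\<exists>u v. opair M u \<epsilon> g \<and> opair M v \<epsilon> f \<and> u \<epsilon> v))"
    have le: "(opair \<theta> T, q) \<in> ?L" unfolding tower_le_iff \<kappa>(1) using \<kappa>(2,3) \<theta> by blast
    have all: "ult_mem \<delta> I g f u" if "(u, opair \<theta> T) \<in> ?L" for u
      by (rule ult_mem_if[OF \<theta>(1,2) s _ that]) (use no in blast)
    have "\<not> (rep g (opair \<theta> T) \<and> (\<forall>t. (t, opair \<theta> T) \<in> ?L --> \<not> fneg ?L (ult_mem \<delta> I g f) t))"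
      using m[of g] le unfolding fimp_def fneg_def[of _ "fconj _ _"] fconj_def fneg_def[of _ "fneg _ _"] by blast
    then obtain t where t: "(t, opair \<theta> T) \<in> ?L" "fneg ?L (ult_mem \<delta> I g f) t" using rep[OF g] by blast
    then show False using all[OF t(1)] refl[OF t(1)] unfolding fneg_def by blast
  qed
qed

end

locale precipitous_tower = concentrating_tower mem \<delta> I \<kappa>0
  for mem :: "'v => 'v => bool" (infix "\<epsilon>" 50) and \<delta> I \<kappa>0 :: 'v +
  assumes precipitous: "precipitous \<delta> I"
begin

text \<open>
  A function in \<open>BB\<close> represents a member of the ultrapower that contains the images of all \<open>V\<^sub>\<xi>\<close>, \<open>\<xi> < \<delta>\<close>.
  A minimal one represents exactly the set of the levels of the image of \<open>V\<^sub>\<delta>\<close>.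
\<close>

definition bounds_at :: "'v => 'v => 'v => 'v => bool" where
  "bounds_at d \<xi> \<kappa> M <-> (\<exists>\<pi> y. good \<kappa> M \<pi> \<and> \<xi> \<epsilon> M \<and> Vlev \<xi> \<epsilon> M \<and> opair M y \<epsilon> d \<and> val \<pi> (Vlev \<xi>) \<epsilon> y)"

definition bounds :: "'v => bool" where
  "bounds d <-> (\<exists>\<kappa>. \<kappa> \<epsilon> Ix \<and> \<kappa>0 \<sqsubseteq> \<kappa> \<and> supp \<kappa> d \<and>
    (\<forall>\<xi> \<kappa>'. \<xi> \<epsilon> \<delta> \<and> Sp \<kappa>' \<and> \<kappa> \<sqsubseteq> \<kappa>' \<and> Vlev \<xi> \<epsilon> Hl \<kappa>' --> ae \<kappa>' (bounds_at d \<xi> \<kappa>')))"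

definition BB :: 'v where
  "BB = (SET d. d \<epsilon> Pow (prod Vd Vd) \<and> (partial_fun d \<and> bounds d))"

lemma mem_BB: "d \<epsilon> BB <-> d \<sqsubseteq> prod Vd Vd \<and> partial_fun d \<and> bounds d"
proof -
  have "d \<epsilon> BB <-> d \<epsilon> Pow (prod Vd Vd) \<and> (partial_fun d \<and> bounds d)"
    unfolding BB_def by (rule mem_sep) (unfold bounds_def ae_def bounds_at_def, intro fo_intros)
  then show ?thesis by simp
qed

lemma index_Hl: "ordinal \<xi> ==> \<kappa> \<epsilon> Ix ==> Vlev \<xi> \<epsilon> Hl \<kappa> ==> \<xi> \<epsilon> Hl \<kappa>"
  using Hl_subset ordinal_subset_Vlev by blast

lemma ae_good_Vlev:
  assumes "\<xi> \<epsilon> \<delta>" "Sp \<kappa>" "\<kappa>0 \<sqsubseteq> \<kappa>" "Vlev \<xi> \<epsilon> Hl \<kappa>"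
  shows "ae \<kappa> (\<lambda>M. (\<exists>\<pi>. good \<kappa> M \<pi>) \<and> \<xi> \<epsilon> M \<and> Vlev \<xi> \<epsilon> M)"
proof -
  have i: "\<kappa> \<epsilon> Ix" using Sp_Ix assms by blast
  have "\<xi> \<epsilon> Hl \<kappa>" using index_Hl[OF ordinal_mem[OF ordinal_delta assms(1)] i assms(4)] .
  then show ?thesis by (intro ae_conj[OF i] ae_good assms ae_fine i)
qed

definition top_bound :: 'v where
  "top_bound = lam Vd (\<lambda>x. levels (inter x (Hl \<kappa>0)))"

lemma levels_Vd: "levels M \<epsilon> Vd"
  using Vd_subset[OF Hl_Vd[OF Sp_Ix[OF Sp0]] levels_Hl0] .

lemma levels_good:
  "good \<kappa> M \<pi> ==> ordinal \<xi> ==> \<xi> \<epsilon> M ==> Vlev \<xi> \<epsilon> M ==> val \<pi> (Vlev \<xi>) \<epsilon> levels (inter M (Hl \<kappa>0))"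
  unfolding mem_levels by blast

lemma top_bound_BB: "top_bound \<epsilon> BB"
proof -
  have f: "fot mem (\<lambda>e. levels (inter (e 0) (Hl \<kappa>0)))" by (intro fo_intros)
  note m = opair_mem_lam[OF f, of _ _ Vd, folded top_bound_def]
  have "top_bound \<sqsubseteq> prod Vd Vd" unfolding top_bound_def subset_def mem_lam[OF f] using levels_Vd by auto
  moreover have "partial_fun top_bound" unfolding top_bound_def by (rule function_on_partial[OF function_on_lam[OF f]])
  moreover have "supp \<kappa>0 top_bound" unfolding supp_def m by auto
  moreover have "ae \<kappa> (bounds_at top_bound \<xi> \<kappa>)" if *: "\<xi> \<epsilon> \<delta> \<and> Sp \<kappa> \<and> \<kappa>0 \<sqsubseteq> \<kappa> \<and> Vlev \<xi> \<epsilon> Hl \<kappa>" for \<xi> \<kappa>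
  proof -
    have "ae \<kappa> (\<lambda>M. (\<exists>\<pi>. good \<kappa> M \<pi>) \<and> \<xi> \<epsilon> M \<and> Vlev \<xi> \<epsilon> M)" using ae_good_Vlev * by blast
    then show ?thesis
    proof (rule ae_mono)
      fix M assume M: "M \<epsilon> Zl \<kappa>" "(\<exists>\<pi>. good \<kappa> M \<pi>) \<and> \<xi> \<epsilon> M \<and> Vlev \<xi> \<epsilon> M"
      then obtain \<pi> where \<pi>: "good \<kappa> M \<pi>" by blast
      have "M \<epsilon> Vd" using Zl_mem_Vd[OF Sp_Ix] * M by blast
      then have "opair M (levels (inter M (Hl \<kappa>0))) \<epsilon> top_bound" unfolding m by simp
      moreover have "val \<pi> (Vlev \<xi>) \<epsilon> levels (inter M (Hl \<kappa>0))"
        using levels_good[OF \<pi> ordinal_mem[OF ordinal_delta]] * M by blast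
      ultimately show "bounds_at top_bound \<xi> \<kappa> M" unfolding bounds_at_def using \<pi> M by blast
    qed
  qed
  ultimately have "bounds top_bound" unfolding bounds_def using Sp_Ix[OF Sp0] subset_refl by blast
  then show ?thesis unfolding mem_BB using \<open>top_bound \<sqsubseteq> prod Vd Vd\<close> \<open>partial_fun top_bound\<close> by blast
qed

definition minimal_bound :: "'v => 'v => 'v => bool" where
  "minimal_bound f \<kappa> S <-> f \<epsilon> BB \<and> \<kappa> \<epsilon> Ix \<and> pos \<kappa> S \<and>
    (\<forall>g \<theta> T. g \<epsilon> BB \<and> \<theta> \<epsilon> Ix \<and> pos \<theta> T \<and> \<kappa> \<sqsubseteq> \<theta> \<and> T \<sqsubseteq> lift \<kappa> \<theta> S \<and> supp \<theta> f \<and> supp \<theta> g -->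
      (\<exists>M. M \<epsilon> T \<and> \<not> (\<exists>u v. opair M u \<epsilon> g \<and> opair M v \<epsilon> f \<and> u \<epsilon> v)))"

lemma minimal_bound_exists: "\<exists>f \<kappa> S. minimal_bound f \<kappa> S"
proof -
  have "bounded_support \<delta> f" if "f \<epsilon> BB" for f
    using that supp_bounded unfolding mem_BB bounds_def by blast
  from precipitous_minimal[OF precipitous top_bound_BB this Sp_Ix[OF Sp0]]
  show ?thesis unfolding minimal_bound_def by metis
qed

end

locale minimal_tower = precipitous_tower mem \<delta> I \<kappa>0
  for mem :: "'v => 'v => bool" (infix "\<epsilon>" 50) and \<delta> I \<kappa>0 :: 'v +
  fixes f0 \<kappa>1 S1 \<kappa>h :: 'v
  assumes minimal: "minimal_bound f0 \<kappa>1 S1"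
    and h: "Sp \<kappa>h" "\<kappa>0 \<sqsubseteq> \<kappa>h" "\<kappa>1 \<sqsubseteq> \<kappa>h" "supp \<kappa>h f0"
    and f0_ae: "\<And>\<xi> \<kappa>. \<xi> \<epsilon> \<delta> ==> Sp \<kappa> ==> \<kappa>h \<sqsubseteq> \<kappa> ==> Vlev \<xi> \<epsilon> Hl \<kappa> ==> ae \<kappa> (bounds_at f0 \<xi> \<kappa>)"
begin

text \<open>The function \<open>AA\<close> represents \<open>V\<^sub>\<delta>\<close> in the generic ultrapower, by the next two theorems.\<close>

definition AA :: "'v => 'v" where
  "AA M = (SET t. \<exists>D. D \<epsilon> levels (inter M (Hl \<kappa>0)) \<and> D \<epsilon> val f0 M \<and> t \<epsilon> D)"

lemma mem_AA: "t \<epsilon> AA M <-> (\<exists>D. D \<epsilon> levels (inter M (Hl \<kappa>0)) \<and> D \<epsilon> val f0 M \<and> t \<epsilon> D)"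
  unfolding AA_def by (rule bounded_coll[where a = "Union (levels (inter M (Hl \<kappa>0)))"]) (intro fo_intros, auto)

lemma fot_AA [fo_intros]: "fot mem t ==> fot mem (\<lambda>e. AA (t e))"
  by (rule fot_sub1) (rule fot_set, rule mem_AA, intro fo_intros)

lemma transitive_AA: "transitive (AA M)"
  unfolding transitive_def subset_def mem_AA using transitive_levels transitiveD by blast

lemma AA_Hl0: "AA M \<sqsubseteq> Hl \<kappa>0"
  unfolding subset_def mem_AA
  using levels_Hl0 subsetD Hl_trans[OF Sp_Ix[OF Sp0]] by blast

lemma AA_Vd: "AA M \<epsilon> Vd"
  using Vd_subset[OF Hl_Vd[OF Sp_Ix[OF Sp0]] AA_Hl0] .

lemma AA_inter: "\<kappa>h \<sqsubseteq> \<kappa> ==> M \<epsilon> Vd ==> AA (inter M (Hl \<kappa>)) = AA M"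
proof -
  assume *: "\<kappa>h \<sqsubseteq> \<kappa>" "M \<epsilon> Vd"
  have "val f0 (inter M (Hl \<kappa>)) = val f0 M" using supp_val[OF supp_mono[OF *(1) h(4)] *(2)] .
  moreover have "inter (inter M (Hl \<kappa>)) (Hl \<kappa>0) = inter M (Hl \<kappa>0)"
    using inter_inter_Hl[OF subset_trans[OF h(2) *(1)]] .
  ultimately show ?thesis by (intro set_eqI) (simp add: mem_AA)
qed

lemma good_restrict_val:
  assumes "good \<kappa> M \<pi>" "good \<kappa>' M' \<pi>'" "M = inter M' (Hl \<kappa>)" "x \<epsilon> M"
  shows "val \<pi> x = val \<pi>' x"
  using collapse_restrict_eq[OF good_collapse[OF assms(1)] good_collapse[OF assms(2)] assms(3) _ assms(4)]
    Hl_trans[OF good_Ix[OF assms(1)]] by blast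

theorem ae_collapse_AA:
  assumes \<kappa>: "Sp \<kappa>" "\<kappa>h \<sqsubseteq> \<kappa>"
  shows "ae \<kappa> (\<lambda>M. \<forall>\<pi> x. good \<kappa> M \<pi> \<and> x \<epsilon> M --> val \<pi> x \<epsilon> AA M)"
proof (rule aeI)
  show "fo mem (\<lambda>e. \<forall>\<pi> x. good \<kappa> (e 0) \<pi> \<and> x \<epsilon> e 0 --> val \<pi> x \<epsilon> AA (e 0))" by (intro fo_intros)
  have i: "\<kappa> \<epsilon> Ix" using Sp_Ix \<kappa> by blast
  fix S assume S: "pos \<kappa> S" and no: "\<And>M. M \<epsilon> S ==> \<not> (\<forall>\<pi> x. good \<kappa> M \<pi> \<and> x \<epsilon> M --> val \<pi> x \<epsilon> AA M)"
  have fo: "fo mem (\<lambda>e. \<exists>\<pi>. good \<kappa> (e 0) \<pi> \<and> \<not> val \<pi> (e (Suc 0)) \<epsilon> AA (e 0))" by (intro fo_intros)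
  have "\<exists>x. x \<epsilon> M \<and> (\<exists>\<pi>. good \<kappa> M \<pi> \<and> \<not> val \<pi> x \<epsilon> AA M)" if "M \<epsilon> S" for M using no[OF that] by blast
  then obtain x S' where S': "pos \<kappa> S'" "x \<epsilon> Hl \<kappa>" "\<And>M. M \<epsilon> S' ==> x \<epsilon> M \<and> (\<exists>\<pi>. good \<kappa> M \<pi> \<and> \<not> val \<pi> x \<epsilon> AA M)"
    using press_down[OF i S, where R = "\<lambda>M x. \<exists>\<pi>. good \<kappa> M \<pi> \<and> \<not> val \<pi> x \<epsilon> AA M", OF fo] by blast
  have "x \<epsilon> Vd" using Vd_mem[OF Hl_Vd[OF i] S'(2)] .
  then obtain \<xi>0 where \<xi>0: "\<xi>0 \<epsilon> \<delta>" "x \<sqsubseteq> Vlev \<xi>0" using mem_Vd by blast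
  let ?\<xi> = "succ \<xi>0"
  have \<xi>: "?\<xi> \<epsilon> \<delta>" "ordinal ?\<xi>" using succ_delta[OF \<xi>0(1)] ordinal_mem[OF ordinal_delta] by blast+
  have x\<xi>: "x \<epsilon> Vlev ?\<xi>" using \<xi>0(2) mem_Vlev[OF \<xi>(2)] mem_succ by blast
  obtain \<kappa>' where \<kappa>': "Sp \<kappa>'" "Vlev ?\<xi> \<epsilon> Hl \<kappa>'" "\<kappa> \<sqsubseteq> \<kappa>'"
    using Sp_above[OF Vlev_Vd[OF \<xi>(1)], of \<kappa>] i mem_Ix by blast
  have i': "\<kappa>' \<epsilon> Ix" using Sp_Ix \<kappa>' by blast
  have b: "ae \<kappa>' (bounds_at f0 ?\<xi> \<kappa>')" by (rule f0_ae[OF \<xi>(1) \<kappa>'(1) subset_trans[OF \<kappa>(2) \<kappa>'(3)] \<kappa>'(2)])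
  obtain T where T: "pos \<kappa>' T" "T \<sqsubseteq> lift \<kappa> \<kappa>' S'" "\<And>M. M \<epsilon> T ==> bounds_at f0 ?\<xi> \<kappa>' M"
    using pos_ae[OF i' pos_lift[OF i i' \<kappa>'(3) S'(1)] b] by blast
  obtain M where M: "M \<epsilon> T" using pos_nonempty[OF i' T(1)] by blast
  then have M0: "inter M (Hl \<kappa>) \<epsilon> S'" "M \<epsilon> Zl \<kappa>'" using subsetD[OF T(2)] by auto
  obtain \<pi>0 where \<pi>0: "x \<epsilon> inter M (Hl \<kappa>)" "good \<kappa> (inter M (Hl \<kappa>)) \<pi>0" "\<not> val \<pi>0 x \<epsilon> AA (inter M (Hl \<kappa>))"
    using S'(3)[OF M0(1)] by blast
  obtain \<pi> y where \<pi>: "good \<kappa>' M \<pi>" "?\<xi> \<epsilon> M" "Vlev ?\<xi> \<epsilon> M" "opair M y \<epsilon> f0" "val \<pi> (Vlev ?\<xi>) \<epsilon> y"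
    using T(3)[OF M] unfolding bounds_at_def by blast
  have "val \<pi> (Vlev ?\<xi>) \<epsilon> val f0 M" using \<pi> mem_val by blast
  moreover have "val \<pi> (Vlev ?\<xi>) \<epsilon> levels (inter M (Hl \<kappa>0))" using levels_good[OF \<pi>(1) \<xi>(2) \<pi>(2,3)] .
  moreover have "val \<pi> x \<epsilon> val \<pi> (Vlev ?\<xi>)" using collapse_mem_iff[OF good_collapse[OF \<pi>(1)] _ \<pi>(3)] \<pi>0(1) x\<xi> by simp
  ultimately have "val \<pi> x \<epsilon> AA M" unfolding mem_AA by blast
  moreover have "val \<pi>0 x = val \<pi> x" using good_restrict_val[OF \<pi>0(2) \<pi>(1) _ \<pi>0(1)] by simp
  moreover have "AA (inter M (Hl \<kappa>)) = AA M" using AA_inter[OF \<kappa>(2) Zl_mem_Vd[OF i' M0(2)]] .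
  ultimately show False using \<pi>0(3) by simp
qed

theorem AA_surjective:
  assumes \<theta>: "Sp \<theta>" "\<kappa>h \<sqsubseteq> \<theta>" and S: "pos \<theta> S" "S \<sqsubseteq> lift \<kappa>1 \<theta> S1"
    and Q: "fo2 Q" and ex: "\<And>M. M \<epsilon> S ==> \<exists>y. y \<epsilon> AA M \<and> Q M y"
  obtains \<theta>' S' x where "Sp \<theta>'" "\<theta> \<sqsubseteq> \<theta>'" "pos \<theta>' S'" "S' \<sqsubseteq> lift \<theta> \<theta>' S" "x \<epsilon> Hl \<theta>'"
    "\<And>M. M \<epsilon> S' ==> x \<epsilon> M \<and> (\<exists>\<pi>. good \<theta>' M \<pi> \<and> Q (inter M (Hl \<theta>)) (val \<pi> x))"
proof -
  have i: "\<theta> \<epsilon> Ix" using Sp_Ix \<theta> by blast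
  have mb: "f0 \<epsilon> BB" "\<kappa>1 \<epsilon> Ix"
    "\<And>g \<mu> T. g \<epsilon> BB ==> \<mu> \<epsilon> Ix ==> pos \<mu> T ==> \<kappa>1 \<sqsubseteq> \<mu> ==> T \<sqsubseteq> lift \<kappa>1 \<mu> S1 ==> supp \<mu> f0 ==> supp \<mu> g ==>
      \<exists>M. M \<epsilon> T \<and> \<not> (\<exists>u v. opair M u \<epsilon> g \<and> opair M v \<epsilon> f0 \<and> u \<epsilon> v)"
    using minimal unfolding minimal_bound_def by blast+
  define R where "R M D <-> D \<epsilon> levels (inter M (Hl \<kappa>0)) \<and> D \<epsilon> val f0 M \<and> (\<exists>y. y \<epsilon> D \<and> Q M y)" for M D
  have foR: "fo2 R" unfolding R_def by (intro fo_intros fo_sub2[OF Q])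
  have "\<exists>D. D \<epsilon> Hl \<kappa>0 \<and> R M D" if "M \<epsilon> S" for M
    using ex[OF that] levels_Hl0 subsetD unfolding mem_AA R_def by blast
  then obtain g where g: "function_on g S" "\<And>M. M \<epsilon> S ==> val g M \<epsilon> Hl \<kappa>0" "\<And>M. M \<epsilon> S ==> R M (val g M)"
    using choose_function[OF foR, of S "Hl \<kappa>0"] by blast
  define dv where "dv x = (if inter x (Hl \<theta>) \<epsilon> S then val g (inter x (Hl \<theta>)) else levels (inter x (Hl \<kappa>0)))" for x
  have fd: "fot1 dv" unfolding dv_def by (intro fo_intros fot_if)
  define d where "d = lam Vd dv"
  have d: "opair x y \<epsilon> d <-> x \<epsilon> Vd \<and> y = dv x" for x y unfolding d_def by (rule opair_mem_lam[OF fd])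
  have "dv x \<epsilon> Vd" for x
    unfolding dv_def using levels_Vd g(2) Vd_mem[OF Hl_Vd[OF Sp_Ix[OF Sp0]]] by auto
  then have d1: "d \<sqsubseteq> prod Vd Vd" unfolding d_def subset_def mem_lam[OF fd] by auto
  have d2: "partial_fun d" unfolding d_def by (rule function_on_partial[OF function_on_lam[OF fd]])
  have k0: "\<kappa>0 \<sqsubseteq> \<theta>" using subset_trans[OF h(2) \<theta>(2)] .
  have "dv x = dv x'" if "inter x (Hl \<theta>) = inter x' (Hl \<theta>)" for x x'
    unfolding dv_def using that inter_inter_Hl[OF k0, of x] inter_inter_Hl[OF k0, of x'] by simp
  note dv_same = this
  have d3: "supp \<theta> d" unfolding supp_def d
  proof (intro allI impI, elim conjE)
    fix x x' y assume "x \<epsilon> Vd" "x' \<epsilon> Vd" "inter x (Hl \<theta>) = inter x' (Hl \<theta>)"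
    then show "x \<epsilon> Vd \<and> y = dv x <-> x' \<epsilon> Vd \<and> y = dv x'" using dv_same[of x x'] by simp
  qed
  have "\<not> d \<epsilon> BB"
  proof
    assume "d \<epsilon> BB"
    have "\<exists>M. M \<epsilon> S \<and> \<not> (\<exists>u v. opair M u \<epsilon> d \<and> opair M v \<epsilon> f0 \<and> u \<epsilon> v)"
      by (rule mb(3)[OF \<open>d \<epsilon> BB\<close> i S(1) subset_trans[OF h(3) \<theta>(2)] S(2) supp_mono[OF \<theta>(2) h(4)] d3])
    then obtain M where M: "M \<epsilon> S" "\<not> (\<exists>u v. opair M u \<epsilon> d \<and> opair M v \<epsilon> f0 \<and> u \<epsilon> v)" by blast
    have MZ: "M \<epsilon> Zl \<theta>" using pos_subset_Zl[OF S(1) M(1)] .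
    have "opair M (val g M) \<epsilon> d" unfolding d dv_def using inter_Hl_self[OF MZ] Zl_mem_Vd[OF i MZ] M(1) by simp
    moreover obtain v where "opair M v \<epsilon> f0" "val g M \<epsilon> v" using g(3)[OF M(1)] unfolding R_def mem_val by blast
    ultimately show False using M(2) by blast
  qed
  then have "\<not> bounds d" unfolding mem_BB using d1 d2 by blast
  then obtain \<xi> \<theta>' where \<xi>: "\<xi> \<epsilon> \<delta>" "Sp \<theta>'" "\<theta> \<sqsubseteq> \<theta>'" "Vlev \<xi> \<epsilon> Hl \<theta>'" "\<not> ae \<theta>' (bounds_at d \<xi> \<theta>')"
    unfolding bounds_def using i k0 d3 by blast
  have i': "\<theta>' \<epsilon> Ix" using Sp_Ix \<xi> by blast
  have "fo mem (\<lambda>e. bounds_at d \<xi> \<theta>' (e 0))" unfolding bounds_at_def by (intro fo_intros)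
  from aeI[OF this] \<xi>(5) obtain T where T: "pos \<theta>' T" "\<And>M. M \<epsilon> T ==> \<not> bounds_at d \<xi> \<theta>' M" by blast
  have "ae \<theta>' (\<lambda>M. (\<exists>\<pi>. good \<theta>' M \<pi>) \<and> \<xi> \<epsilon> M \<and> Vlev \<xi> \<epsilon> M)"
    by (rule ae_good_Vlev[OF \<xi>(1,2) subset_trans[OF k0 \<xi>(3)] \<xi>(4)])
  from pos_ae[OF i' T(1) this] obtain T' where T': "pos \<theta>' T'" "T' \<sqsubseteq> T"
    "\<And>M. M \<epsilon> T' ==> (\<exists>\<pi>. good \<theta>' M \<pi>) \<and> \<xi> \<epsilon> M \<and> Vlev \<xi> \<epsilon> M" by blast
  have o: "ordinal \<xi>" using \<xi>(1) ordinal_mem ordinal_delta by blast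
  have key: "M \<epsilon> lift \<theta> \<theta>' S \<and> (\<exists>x. x \<epsilon> M \<and> (\<exists>\<pi>. good \<theta>' M \<pi> \<and> Q (inter M (Hl \<theta>)) (val \<pi> x)))" if M: "M \<epsilon> T'" for M
  proof -
    obtain \<pi> where \<pi>: "good \<theta>' M \<pi>" "\<xi> \<epsilon> M" "Vlev \<xi> \<epsilon> M" using T'(3)[OF M] by blast
    have MZ: "M \<epsilon> Zl \<theta>'" using good_Zl[OF \<pi>(1)] .
    have nb: "\<not> val \<pi> (Vlev \<xi>) \<epsilon> dv M"
      using T(2)[OF subsetD[OF T'(2) M]] \<pi> Zl_mem_Vd[OF i' MZ] d unfolding bounds_at_def by blast
    have lv: "val \<pi> (Vlev \<xi>) \<epsilon> levels (inter M (Hl \<kappa>0))" using levels_good[OF \<pi>(1) o \<pi>(2,3)] .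
    have inS: "inter M (Hl \<theta>) \<epsilon> S"
    proof (rule ccontr)
      assume "\<not> inter M (Hl \<theta>) \<epsilon> S"
      then have "dv M = levels (inter M (Hl \<kappa>0))" unfolding dv_def by simp
      with nb lv show False by simp
    qed
    let ?D = "val g (inter M (Hl \<theta>))"
    have "dv M = ?D" unfolding dv_def using inS by simp
    moreover have RD: "R (inter M (Hl \<theta>)) ?D" using g(3)[OF inS] .
    moreover have "?D \<epsilon> levels (inter M (Hl \<kappa>0))" using RD inter_inter_Hl[OF k0] unfolding R_def by simp
    ultimately have "?D \<sqsubseteq> val \<pi> (Vlev \<xi>)" using levels_comparable[OF lv, of ?D] nb by metis
    moreover obtain y where y: "y \<epsilon> ?D" "Q (inter M (Hl \<theta>)) y" using RD unfolding R_def by blast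
    ultimately have "y \<epsilon> val \<pi> (Vlev \<xi>)" using subsetD by blast
    then obtain x where "x \<epsilon> M" "y = val \<pi> x" unfolding collapse_mem[OF good_collapse[OF \<pi>(1)] \<pi>(3)] by blast
    then show ?thesis using inS MZ \<pi>(1) y(2) mem_lift by blast
  qed
  have fo: "fo mem (\<lambda>e. \<exists>\<pi>. good \<theta>' (e 0) \<pi> \<and> Q (inter (e 0) (Hl \<theta>)) (val \<pi> (e (Suc 0))))"
    by (intro fo_ex fo_conj fo_good fo_sub2[OF Q] fot_val fot_inter fot_const fot_var)
  have "\<exists>x. x \<epsilon> M \<and> (\<exists>\<pi>. good \<theta>' M \<pi> \<and> Q (inter M (Hl \<theta>)) (val \<pi> x))" if "M \<epsilon> T'" for M
    using key[OF that] by blast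
  then obtain x S' where S': "pos \<theta>' S'" "S' \<sqsubseteq> T'" "x \<epsilon> Hl \<theta>'"
    "\<And>M. M \<epsilon> S' ==> x \<epsilon> M \<and> (\<exists>\<pi>. good \<theta>' M \<pi> \<and> Q (inter M (Hl \<theta>)) (val \<pi> x))"
    using press_down[OF i' T'(1), where R = "\<lambda>M x. \<exists>\<pi>. good \<theta>' M \<pi> \<and> Q (inter M (Hl \<theta>)) (val \<pi> x)", OF fo] by blast
  have "S' \<sqsubseteq> lift \<theta> \<theta>' S" unfolding subset_def using key subsetD[OF S'(2)] by blast
  then show thesis using that[OF \<xi>(2,3) S'(1) _ S'(3)] S'(4) by blast
qed

end

lemma (in precipitous_tower) minimal_tower_exists:
  "\<exists>f0 \<kappa>1 S1 \<kappa>h. minimal_tower mem \<delta> I \<kappa>0 f0 \<kappa>1 S1 \<kappa>h"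
proof -
  obtain f0 \<kappa>1 S1 where m: "minimal_bound f0 \<kappa>1 S1" using minimal_bound_exists by blast
  then have f0: "f0 \<epsilon> BB" and \<kappa>1: "\<kappa>1 \<epsilon> Ix" unfolding minimal_bound_def by blast+
  obtain \<kappa> where \<kappa>: "\<kappa> \<epsilon> Ix" "\<kappa>0 \<sqsubseteq> \<kappa>" "supp \<kappa> f0"
    "\<And>\<xi> \<kappa>'. \<xi> \<epsilon> \<delta> \<and> Sp \<kappa>' \<and> \<kappa> \<sqsubseteq> \<kappa>' \<and> Vlev \<xi> \<epsilon> Hl \<kappa>' ==> ae \<kappa>' (bounds_at f0 \<xi> \<kappa>')"
    using f0 unfolding mem_BB bounds_def by blast
  obtain \<mu> where \<mu>: "\<mu> \<epsilon> \<delta>" "\<kappa> \<sqsubseteq> \<mu>" "\<kappa>1 \<sqsubseteq> \<mu>" using delta_max[of \<kappa> \<kappa>1] \<kappa>(1) \<kappa>1 mem_Ix by blast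
  obtain \<kappa>h where h: "Sp \<kappa>h" "\<mu> \<sqsubseteq> \<kappa>h" using Sp_above[OF empty_Vd \<mu>(1)] by blast
  have "\<kappa> \<sqsubseteq> \<kappa>h" "\<kappa>1 \<sqsubseteq> \<kappa>h" using \<mu> h subset_trans by blast+
  then have "minimal_tower mem \<delta> I \<kappa>0 f0 \<kappa>1 S1 \<kappa>h"
    by unfold_locales (use m h \<kappa> supp_mono subset_trans in blast)+
  then show ?thesis by blast
qed

section \<open>Satisfaction inside the universe\<close>

context zfc_universe
begin

lemma code_eq [simp]:
  "cMem i j = cMem i' j' <-> i = i' \<and> j = j'" "cEq i j = cEq i' j' <-> i = i' \<and> j = j'"
  "cNeg \<phi> = cNeg \<phi>' <-> \<phi> = \<phi>'" "cConj \<phi> \<psi> = cConj \<phi>' \<psi>' <-> \<phi> = \<phi>' \<and> \<psi> = \<psi>'"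
  "cAll i \<phi> = cAll i' \<phi>' <-> i = i' \<and> \<phi> = \<phi>'"
  unfolding cMem_def cEq_def cNeg_def cConj_def cAll_def by auto

lemma code_neq [simp]:
  "cMem i j \<noteq> cEq i' j'" "cMem i j \<noteq> cNeg \<phi>" "cMem i j \<noteq> cConj \<phi> \<psi>" "cMem i j \<noteq> cAll i' \<phi>"
  "cEq i j \<noteq> cMem i' j'" "cEq i j \<noteq> cNeg \<phi>" "cEq i j \<noteq> cConj \<phi> \<psi>" "cEq i j \<noteq> cAll i' \<phi>"
  "cNeg \<phi> \<noteq> cMem i j" "cNeg \<phi> \<noteq> cEq i j" "cNeg \<phi> \<noteq> cConj \<phi>' \<psi>" "cNeg \<phi> \<noteq> cAll i \<phi>'"
  "cConj \<phi> \<psi> \<noteq> cMem i j" "cConj \<phi> \<psi> \<noteq> cEq i j" "cConj \<phi> \<psi> \<noteq> cNeg \<phi>'" "cConj \<phi> \<psi> \<noteq> cAll i \<phi>'"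
  "cAll i \<phi> \<noteq> cMem i' j" "cAll i \<phi> \<noteq> cEq i' j" "cAll i \<phi> \<noteq> cNeg \<phi>'" "cAll i \<phi> \<noteq> cConj \<phi>' \<psi>"
  unfolding cMem_def cEq_def cNeg_def cConj_def cAll_def opair_eq num_inject by simp_all

lemma fot_codes [fo_intros]:
  "fot mem t ==> fot mem u ==> fot mem (\<lambda>e. cMem (t e) (u e))"
  "fot mem t ==> fot mem u ==> fot mem (\<lambda>e. cEq (t e) (u e))"
  "fot mem t ==> fot mem (\<lambda>e. cNeg (t e))"
  "fot mem t ==> fot mem u ==> fot mem (\<lambda>e. cConj (t e) (u e))"
  "fot mem t ==> fot mem u ==> fot mem (\<lambda>e. cAll (t e) (u e))"
  unfolding cMem_def cEq_def cNeg_def cConj_def cAll_def by (intro fo_intros; assumption)+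

lemma fo_fml [fo_intros]: "fot mem t ==> fo mem (\<lambda>e. fml (t e))"
  by (rule fo_sub1) (unfold fml_def fml_closed_def, intro fo_intros)

lemma fml_intros:
  "natural i ==> natural j ==> fml (cMem i j)" "natural i ==> natural j ==> fml (cEq i j)"
  "fml \<phi> ==> fml (cNeg \<phi>)" "fml \<phi> ==> fml \<psi> ==> fml (cConj \<phi> \<psi>)" "natural i ==> fml \<phi> ==> fml (cAll i \<phi>)"
  unfolding fml_def fml_closed_def by auto

definition updv :: "'v => 'v => 'v => 'v" where
  "updv s i x = lam omega (\<lambda>k. if k = i then x else val s k)"

lemma fot_updv0: "fot mem (\<lambda>e. if e 0 = i then x else val s (e 0))"
  by (intro fot_if fo_intros)

lemma function_on_updv: "function_on (updv s i x) omega"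
  unfolding updv_def by (rule function_on_lam[OF fot_updv0])

lemma val_updv: "natural k ==> val (updv s i x) k = (if k = i then x else val s k)"
  unfolding updv_def by (rule val_lam[OF fot_updv0]) simp

lemma fot_updv [fo_intros]:
  assumes "fot mem t" "fot mem u" "fot mem v"
  shows "fot mem (\<lambda>e. updv (t e) (u e) (v e))"
proof (rule fot_sub3[OF _ assms])
  have m: "p \<epsilon> updv s i x <-> (\<exists>k. k \<epsilon> omega \<and> p = opair k (if k = i then x else val s k))" for p s i x
    unfolding updv_def by (rule mem_lam[OF fot_updv0])
  show "fot mem (\<lambda>e. updv (e 0) (e (Suc 0)) (e (Suc (Suc 0))))"
    by (rule fot_set, rule m) (intro fo_intros fot_if)
qed

lemma upd_eq: "function_on s omega ==> upd s i x = updv s i x"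
proof -
  assume s: "function_on s omega"
  have "(\<lambda>p. \<exists>k. k \<epsilon> omega \<and> p = opair k (if k = i then x else app s k)) =
    (\<lambda>p. \<exists>k. k \<epsilon> omega \<and> p = opair k (if k = i then x else val s k))"
    using function_on_app[OF s] by metis
  then show ?thesis unfolding upd_def updv_def lam_def by simp
qed

lemma function_on_omega_eqI:
  "function_on s omega ==> function_on s' omega ==> (\<And>k. natural k ==> val s k = val s' k) ==> s = s'"
  by (rule function_eqI[of _ omega]) auto

definition asn :: "'v => 'v => bool" where
  "asn A s <-> function_on s omega \<and> (\<forall>k. natural k --> val s k \<epsilon> A)"

lemma fo_asn [fo_intros]: "fot mem t ==> fot mem u ==> fo mem (\<lambda>e. asn (t e) (u e))"
  by (rule fo_sub2) (unfold asn_def, intro fo_intros)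

lemma asn_maps: "asn A s <-> maps s omega A"
  unfolding asn_def maps_def using function_on_app by auto

lemma asn_function: "asn A s ==> function_on s omega"
  and asn_val: "asn A s ==> natural k ==> val s k \<epsilon> A"
  unfolding asn_def by blast+

lemma asn_updv: "asn A s ==> x \<epsilon> A ==> asn A (updv s i x)"
  unfolding asn_def using function_on_updv val_updv by simp

lemma truth_set_iff: "truth_set A T <-> (\<forall>s. asn A s -->
     (\<forall>i j. natural i \<and> natural j -->
        (opair (cMem i j) s \<epsilon> T <-> val s i \<epsilon> val s j) \<and>
        (opair (cEq i j) s \<epsilon> T <-> val s i = val s j)) \<and>
     (\<forall>\<phi>. fml \<phi> --> (opair (cNeg \<phi>) s \<epsilon> T <-> \<not> opair \<phi> s \<epsilon> T)) \<and>
     (\<forall>\<phi> \<psi>. fml \<phi> \<and> fml \<psi> -->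
        (opair (cConj \<phi> \<psi>) s \<epsilon> T <-> opair \<phi> s \<epsilon> T \<and> opair \<psi> s \<epsilon> T)) \<and>
     (\<forall>i \<phi>. natural i \<and> fml \<phi> -->
        (opair (cAll i \<phi>) s \<epsilon> T <-> (\<forall>x. x \<epsilon> A --> opair \<phi> (updv s i x) \<epsilon> T))))"
proof -
  have "app s i = val s i" "upd s i x = updv s i x" if "asn A s" "natural i" for s i x
    using that function_on_app upd_eq unfolding asn_def by auto
  then show ?thesis unfolding truth_set_def asn_maps[symmetric] mem_omega by (simp cong: conj_cong imp_cong)
qed

lemma fo_truth_set [fo_intros]: "fot mem t ==> fot mem u ==> fo mem (\<lambda>e. truth_set (t e) (u e))"
  by (rule fo_sub2) (unfold truth_set_iff, intro fo_intros)

lemma fo_Sat [fo_intros]: "fot mem t ==> fot mem u ==> fot mem v ==> fo mem (\<lambda>e. Sat (t e) (u e) (v e))"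
  by (rule fo_sub3) (unfold Sat_def, intro fo_intros)

end

context inaccessible_universe
begin

lemma fml_closed_Vlev: "limit \<beta> ==> omega \<epsilon> \<beta> ==> fml_closed (Vlev \<beta>)"
proof -
  assume l: "limit \<beta>" and o: "omega \<epsilon> \<beta>"
  have "ordinal \<beta>" using l limit_def by blast
  then have n: "n \<epsilon> Vlev \<beta>" if "natural n" for n
    using that ordinal_trans[OF _ o] ordinal_subset_Vlev subsetD mem_omega by blast
  have N: "num k \<epsilon> Vlev \<beta>" for k by (rule n[OF natural_num])
  show ?thesis unfolding fml_closed_def cMem_def cEq_def cNeg_def cConj_def cAll_def mem_omega
    using n N limit_Vlev_opair(2)[OF l] by blast
qed

definition FF :: 'v where
  "FF = (SET \<phi>. fml \<phi>)"

lemma mem_FF: "\<phi> \<epsilon> FF <-> fml \<phi>" and FF_Vd: "FF \<epsilon> Vd"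
proof -
  obtain \<beta> where \<beta>: "\<beta> \<epsilon> \<delta>" "omega \<epsilon> \<beta>" "limit \<beta>" using limit_above[OF omega_delta] by blast
  have sub: "\<phi> \<epsilon> Vlev \<beta>" if "fml \<phi>" for \<phi>
    using that fml_closed_Vlev[OF \<beta>(3,2)] unfolding fml_def by blast
  show m: "\<phi> \<epsilon> FF <-> fml \<phi>" for \<phi>
    unfolding FF_def by (rule bounded_coll[where a = "Vlev \<beta>"]) (intro fo_intros, rule sub)
  have "FF \<sqsubseteq> Vlev \<beta>" unfolding subset_def m using sub by blast
  then show "FF \<epsilon> Vd" using mem_Vd \<beta>(1) by blast
qed

lemma fml_closed_FF: "fml_closed FF"
  unfolding fml_closed_def mem_FF using fml_intros by auto

lemma fml_induct:
  assumes P: "fo1 P" and \<phi>: "fml \<phi>"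
    and "\<And>i j. natural i ==> natural j ==> P (cMem i j)" "\<And>i j. natural i ==> natural j ==> P (cEq i j)"
    and "\<And>\<phi>. fml \<phi> ==> P \<phi> ==> P (cNeg \<phi>)"
    and "\<And>\<phi> \<psi>. fml \<phi> ==> fml \<psi> ==> P \<phi> ==> P \<psi> ==> P (cConj \<phi> \<psi>)"
    and "\<And>i \<phi>. natural i ==> fml \<phi> ==> P \<phi> ==> P (cAll i \<phi>)"
  shows "P \<phi>"
proof -
  have m: "\<psi> \<epsilon> (SET \<psi>. \<psi> \<epsilon> FF \<and> P \<psi>) <-> fml \<psi> \<and> P \<psi>" for \<psi>
    by (subst mem_sep[OF P], subst mem_FF, rule refl)
  have "fml_closed (SET \<psi>. \<psi> \<epsilon> FF \<and> P \<psi>)"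
    unfolding fml_closed_def m mem_omega
    by (intro conjI allI impI; elim conjE; intro conjI fml_intros assms(3-7); assumption)
  then have "\<phi> \<epsilon> (SET \<psi>. \<psi> \<epsilon> FF \<and> P \<psi>)" using \<phi> unfolding fml_def by simp
  then show ?thesis unfolding m by simp
qed

subsection \<open>Truth sets\<close>

text \<open>
  \<open>truth_step A T\<close> applies Tarski's clauses once to \<open>T\<close>; along \<open>\<omega>\<close> iterations the truth value of each
  formula stabilizes, uniformly in the assignment.
\<close>

definition truth_step :: "'v => 'v => 'v" where
  "truth_step A T = (SET p. p \<epsilon> prod FF (Pow (prod omega A)) \<and> (\<exists>\<phi> s. p = opair \<phi> s \<and> asn A s \<and>
     ((\<exists>i j. \<phi> = cMem i j \<and> val s i \<epsilon> val s j) \<or> (\<exists>i j. \<phi> = cEq i j \<and> val s i = val s j) \<or>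
      (\<exists>\<psi>. \<phi> = cNeg \<psi> \<and> \<not> opair \<psi> s \<epsilon> T) \<or>
      (\<exists>\<psi> \<psi>'. \<phi> = cConj \<psi> \<psi>' \<and> opair \<psi> s \<epsilon> T \<and> opair \<psi>' s \<epsilon> T) \<or>
      (\<exists>i \<psi>. \<phi> = cAll i \<psi> \<and> (\<forall>x. x \<epsilon> A --> opair \<psi> (updv s i x) \<epsilon> T)))))"

lemma asn_Pow: "asn A s ==> s \<epsilon> Pow (prod omega A)"
  unfolding asn_def mem_Pow subset_def[of s] using function_on_mem[of s omega] by auto

lemma mem_truth_step: "fml \<phi> ==> asn A s ==> opair \<phi> s \<epsilon> truth_step A T <->
     ((\<exists>i j. \<phi> = cMem i j \<and> val s i \<epsilon> val s j) \<or> (\<exists>i j. \<phi> = cEq i j \<and> val s i = val s j) \<or>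
      (\<exists>\<psi>. \<phi> = cNeg \<psi> \<and> \<not> opair \<psi> s \<epsilon> T) \<or>
      (\<exists>\<psi> \<psi>'. \<phi> = cConj \<psi> \<psi>' \<and> opair \<psi> s \<epsilon> T \<and> opair \<psi>' s \<epsilon> T) \<or>
      (\<exists>i \<psi>. \<phi> = cAll i \<psi> \<and> (\<forall>x. x \<epsilon> A --> opair \<psi> (updv s i x) \<epsilon> T)))"
  unfolding truth_step_def
  by (subst mem_sep, intro fo_intros) (auto simp: mem_FF asn_Pow[unfolded mem_Pow])

lemma fot_truth_step: "fot mem (\<lambda>e. truth_step A (e 0))"
proof (rule fot_set)
  show "p \<epsilon> truth_step A (e 0) <-> p \<epsilon> prod FF (Pow (prod omega A)) \<and> (\<exists>\<phi> s. p = opair \<phi> s \<and> asn A s \<and>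
     ((\<exists>i j. \<phi> = cMem i j \<and> val s i \<epsilon> val s j) \<or> (\<exists>i j. \<phi> = cEq i j \<and> val s i = val s j) \<or>
      (\<exists>\<psi>. \<phi> = cNeg \<psi> \<and> \<not> opair \<psi> s \<epsilon> e 0) \<or>
      (\<exists>\<psi> \<psi>'. \<phi> = cConj \<psi> \<psi>' \<and> opair \<psi> s \<epsilon> e 0 \<and> opair \<psi>' s \<epsilon> e 0) \<or>
      (\<exists>i \<psi>. \<phi> = cAll i \<psi> \<and> (\<forall>x. x \<epsilon> A --> opair \<psi> (updv s i x) \<epsilon> e 0))))" for e p
    unfolding truth_step_def by (rule mem_sep) (intro fo_intros)
qed (intro fo_intros)

lemma truth_set_exists: "\<exists>T. T \<sqsubseteq> prod FF (Pow (prod omega A)) \<and> truth_set A T"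
proof -
  have foR: "fo mem (\<lambda>e. e (Suc 0) = truth_step A (e 0))"
    by (intro fo_eq fot_var fot_sub1[OF fot_truth_step])
  have sub: "truth_step A T \<epsilon> Pow (prod FF (Pow (prod omega A)))" for T
  proof -
    have "p \<epsilon> truth_step A T ==> p \<epsilon> prod FF (Pow (prod omega A))" for p
      unfolding truth_step_def by (subst (asm) mem_sep, intro fo_intros) blast
    then show ?thesis by (simp add: subset_def)
  qed
  obtain f where f: "\<And>n. natural n ==> val f (succ n) = truth_step A (val f n)"
    using dependent_choice[OF foR, of "Pow (prod FF (Pow (prod omega A)))" "truth_step A empty"] sub by metis
  define T where "T = (SET p. p \<epsilon> prod FF (Pow (prod omega A)) \<and> (\<exists>n. natural n \<and> (\<forall>m. natural m \<and> n \<sqsubseteq> m --> p \<epsilon> val f m)))"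
  have T: "opair \<phi> s \<epsilon> T <-> (\<exists>n. natural n \<and> (\<forall>m. natural m \<and> n \<sqsubseteq> m --> opair \<phi> s \<epsilon> val f m))"
    if "fml \<phi>" "asn A s" for \<phi> s
    unfolding T_def by (subst mem_sep, intro fo_intros) (use that mem_FF asn_Pow in auto)
  have shift: "(\<exists>n. natural n \<and> (\<forall>m. natural m \<and> n \<sqsubseteq> m --> P (succ m))) <-> (\<exists>n. natural n \<and> (\<forall>m. natural m \<and> n \<sqsubseteq> m --> P m))" for P
  proof
    assume "\<exists>n. natural n \<and> (\<forall>m. natural m \<and> n \<sqsubseteq> m --> P m)"
    then obtain n where n: "natural n" "\<forall>m. natural m \<and> n \<sqsubseteq> m --> P m" by blast
    have "n \<sqsubseteq> succ m" if "n \<sqsubseteq> m" for m using that by (simp add: subset_def)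
    then show "\<exists>n. natural n \<and> (\<forall>m. natural m \<and> n \<sqsubseteq> m --> P (succ m))" using n natural_succ by blast
  next
    assume "\<exists>n. natural n \<and> (\<forall>m. natural m \<and> n \<sqsubseteq> m --> P (succ m))"
    then obtain n where n: "natural n" "\<forall>m. natural m \<and> n \<sqsubseteq> m --> P (succ m)" by blast
    have "P m" if m: "natural m" "succ n \<sqsubseteq> m" for m
    proof -
      have "m \<noteq> empty" using subsetD[OF m(2), of n] by auto
      then obtain k where k: "natural k" "m = succ k" using natural_cases[OF m(1)] by blast
      have "n \<epsilon> succ k" using subsetD[OF m(2), of n] k by simp
      then have "n \<sqsubseteq> k" using ordinal_subset[OF natural_ordinal[OF k(1)]] by auto
      then show ?thesis using n(2) k by blast
    qed
    then show "\<exists>n. natural n \<and> (\<forall>m. natural m \<and> n \<sqsubseteq> m --> P m)" using natural_succ[OF n(1)] by blast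
  qed
  have T': "opair \<phi> s \<epsilon> T <-> (\<exists>n. natural n \<and> (\<forall>m. natural m \<and> n \<sqsubseteq> m --> opair \<phi> s \<epsilon> truth_step A (val f m)))"
    if "fml \<phi>" "asn A s" for \<phi> s
  proof -
    have "(\<exists>n. natural n \<and> (\<forall>m. natural m \<and> n \<sqsubseteq> m --> opair \<phi> s \<epsilon> truth_step A (val f m))) <->
      (\<exists>n. natural n \<and> (\<forall>m. natural m \<and> n \<sqsubseteq> m --> opair \<phi> s \<epsilon> val f (succ m)))" using f by metis
    then show ?thesis unfolding T[OF that] shift[of "\<lambda>m. opair \<phi> s \<epsilon> val f m"] by simp
  qed
  have max: "\<exists>k. natural k \<and> n \<sqsubseteq> k \<and> m \<sqsubseteq> k" if "natural n" "natural m" for n m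
    using that natural_ordinal ordinal_not_mem ordinal_subset subset_refl by meson
  define stab where "stab \<phi> <-> (\<exists>n. natural n \<and> (\<forall>m s. natural m \<and> n \<sqsubseteq> m \<and> asn A s -->
      (opair \<phi> s \<epsilon> val f m <-> opair \<phi> s \<epsilon> T)))" for \<phi>
  have stabI: "stab \<phi>" if "natural n" "fml \<phi>"
    "\<And>m m' s. natural m ==> natural m' ==> n \<sqsubseteq> m ==> n \<sqsubseteq> m' ==> asn A s ==>
      opair \<phi> s \<epsilon> truth_step A (val f m) ==> opair \<phi> s \<epsilon> truth_step A (val f m')" for n \<phi>
  proof -
    have "opair \<phi> s \<epsilon> val f m <-> opair \<phi> s \<epsilon> T" if m: "natural m" "succ n \<sqsubseteq> m" "asn A s" for m s
    proof -
      have "m \<noteq> empty" using subsetD[OF m(2), of n] by auto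
      then obtain k where k: "natural k" "m = succ k" using natural_cases[OF m(1)] by blast
      have "n \<epsilon> succ k" using subsetD[OF m(2), of n] k by simp
      then have nk: "n \<sqsubseteq> k" using ordinal_subset[OF natural_ordinal[OF k(1)]] by auto
      show ?thesis unfolding T'[OF \<open>fml \<phi>\<close> m(3)] k(2) f[OF k(1)]
        using \<open>\<And>m m' s. natural m ==> natural m' ==> n \<sqsubseteq> m ==> n \<sqsubseteq> m' ==> asn A s ==>
      opair \<phi> s \<epsilon> truth_step A (val f m) ==> opair \<phi> s \<epsilon> truth_step A (val f m')\<close>[OF _ _ _ _ m(3)] k(1) nk \<open>natural n\<close> max subset_refl
        by meson
    qed
    then show ?thesis unfolding stab_def using natural_succ[OF \<open>natural n\<close>] by blast
  qed
  have foS: "fo1 stab" unfolding stab_def by (intro fo_intros)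
  have stab: "stab \<phi>" if "fml \<phi>" for \<phi>
  proof (rule fml_induct[where P = stab, OF foS that])
    fix i j assume "natural i" "natural j"
    then show "stab (cMem i j)" "stab (cEq i j)"
      by (auto intro!: stabI[OF natural_empty] fml_intros simp: mem_truth_step fml_intros)
  next
    fix \<phi> assume \<phi>: "fml \<phi>" "stab \<phi>"
    then obtain n where n: "natural n" "\<And>m s. natural m ==> n \<sqsubseteq> m ==> asn A s ==> opair \<phi> s \<epsilon> val f m <-> opair \<phi> s \<epsilon> T"
      unfolding stab_def by blast
    show "stab (cNeg \<phi>)"
      by (rule stabI[OF n(1) fml_intros(3)[OF \<phi>(1)]]) (simp add: mem_truth_step fml_intros \<phi> n(2))
    show "stab (cAll i \<phi>)" if "natural i" for i
      by (rule stabI[OF n(1) fml_intros(5)[OF that \<phi>(1)]]) (simp add: mem_truth_step fml_intros that \<phi> n(2) asn_updv)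
  next
    fix \<phi> \<psi> assume \<phi>: "fml \<phi>" "fml \<psi>" "stab \<phi>" "stab \<psi>"
    then obtain n n' where n: "natural n" "\<And>m s. natural m ==> n \<sqsubseteq> m ==> asn A s ==> opair \<phi> s \<epsilon> val f m <-> opair \<phi> s \<epsilon> T"
      "natural n'" "\<And>m s. natural m ==> n' \<sqsubseteq> m ==> asn A s ==> opair \<psi> s \<epsilon> val f m <-> opair \<psi> s \<epsilon> T"
      unfolding stab_def by metis
    obtain k where k: "natural k" "n \<sqsubseteq> k" "n' \<sqsubseteq> k" using max n by blast
    show "stab (cConj \<phi> \<psi>)"
      by (rule stabI[OF k(1) fml_intros(4)[OF \<phi>(1,2)]])
        (simp add: mem_truth_step fml_intros \<phi> n(2)[OF _ subset_trans[OF k(2)]] n(4)[OF _ subset_trans[OF k(3)]])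
  qed
  have iff: "opair \<phi> s \<epsilon> T <-> (\<exists>n. natural n \<and> (\<forall>m. natural m \<and> n \<sqsubseteq> m --> Q m))"
    if "fml \<phi>" "asn A s" "\<And>m. natural m ==> opair \<phi> s \<epsilon> truth_step A (val f m) <-> Q m" for \<phi> s Q
    unfolding T'[OF that(1,2)] using that(3) by blast
  have const: "(\<exists>n. natural n \<and> (\<forall>m. natural m \<and> n \<sqsubseteq> m --> Q m)) <-> B"
    if "natural n" "\<And>m. natural m ==> n \<sqsubseteq> m ==> Q m <-> B" for Q B n
    using that max subset_refl by meson
  have "truth_set A T" unfolding truth_set_iff
  proof (intro allI impI conjI)
    fix s i j assume s: "asn A s" and ij: "natural i \<and> natural j"
    show "opair (cMem i j) s \<epsilon> T <-> val s i \<epsilon> val s j"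
      by (subst iff[where Q = "\<lambda>_. val s i \<epsilon> val s j"]) (use s ij in \<open>auto simp: mem_truth_step fml_intros\<close>)
    show "opair (cEq i j) s \<epsilon> T <-> val s i = val s j"
      by (subst iff[where Q = "\<lambda>_. val s i = val s j"]) (use s ij in \<open>auto simp: mem_truth_step fml_intros\<close>)
  next
    fix s \<phi> assume s: "asn A s" and \<phi>: "fml \<phi>"
    obtain n where n: "natural n" "\<And>m s. natural m ==> n \<sqsubseteq> m ==> asn A s ==> opair \<phi> s \<epsilon> val f m <-> opair \<phi> s \<epsilon> T"
      using stab[OF \<phi>] unfolding stab_def by blast
    show "opair (cNeg \<phi>) s \<epsilon> T <-> \<not> opair \<phi> s \<epsilon> T"
      by (subst iff[where Q = "\<lambda>m. \<not> opair \<phi> s \<epsilon> val f m"], use s \<phi> in \<open>simp_all add: mem_truth_step fml_intros\<close>)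
        (rule const[OF n(1)], simp add: n(2) s)
  next
    fix s \<phi> \<psi> assume s: "asn A s" and \<phi>: "fml \<phi> \<and> fml \<psi>"
    obtain n n' where n: "natural n" "\<And>m s. natural m ==> n \<sqsubseteq> m ==> asn A s ==> opair \<phi> s \<epsilon> val f m <-> opair \<phi> s \<epsilon> T"
      "natural n'" "\<And>m s. natural m ==> n' \<sqsubseteq> m ==> asn A s ==> opair \<psi> s \<epsilon> val f m <-> opair \<psi> s \<epsilon> T"
      using stab \<phi> unfolding stab_def by metis
    obtain k where k: "natural k" "n \<sqsubseteq> k" "n' \<sqsubseteq> k" using max n by blast
    show "opair (cConj \<phi> \<psi>) s \<epsilon> T <-> opair \<phi> s \<epsilon> T \<and> opair \<psi> s \<epsilon> T"
      by (subst iff[where Q = "\<lambda>m. opair \<phi> s \<epsilon> val f m \<and> opair \<psi> s \<epsilon> val f m"], use s \<phi> in \<open>simp_all add: mem_truth_step fml_intros\<close>)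
        (rule const[OF k(1)], simp add: n(2)[OF _ subset_trans[OF k(2)]] n(4)[OF _ subset_trans[OF k(3)]] s)
  next
    fix s i \<phi> assume s: "asn A s" and \<phi>: "natural i \<and> fml \<phi>"
    obtain n where n: "natural n" "\<And>m s. natural m ==> n \<sqsubseteq> m ==> asn A s ==> opair \<phi> s \<epsilon> val f m <-> opair \<phi> s \<epsilon> T"
      using stab \<phi> unfolding stab_def by blast
    show "opair (cAll i \<phi>) s \<epsilon> T <-> (\<forall>x. x \<epsilon> A --> opair \<phi> (updv s i x) \<epsilon> T)"
      by (subst iff[where Q = "\<lambda>m. \<forall>x. x \<epsilon> A --> opair \<phi> (updv s i x) \<epsilon> val f m"], use s \<phi> in \<open>simp_all add: mem_truth_step fml_intros\<close>)
        (rule const[OF n(1)], simp add: n(2) s asn_updv)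
  qed
  moreover have "T \<sqsubseteq> prod FF (Pow (prod omega A))"
    unfolding T_def subset_def by (subst mem_sep, intro fo_intros) blast
  ultimately show ?thesis by blast
qed

lemma truth_sets_agree:
  assumes "truth_set A T" "truth_set A T'" "fml \<phi>" "asn A s"
  shows "opair \<phi> s \<epsilon> T <-> opair \<phi> s \<epsilon> T'"
proof -
  define P where "P \<phi> <-> (\<forall>s. asn A s --> (opair \<phi> s \<epsilon> T <-> opair \<phi> s \<epsilon> T'))" for \<phi>
  have "P \<phi>"
  proof (rule fml_induct[where P = P, OF _ assms(3)])
    show "fo1 P" unfolding P_def by (intro fo_intros)
  qed (use assms(1,2) asn_updv in \<open>auto simp: P_def truth_set_iff\<close>)
  then show ?thesis unfolding P_def using assms by blast
qed

lemma Sat_iff: "truth_set A T ==> fml \<phi> ==> asn A s ==> Sat A s \<phi> <-> opair \<phi> s \<epsilon> T"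
  unfolding Sat_def using truth_sets_agree by blast

lemma Sat_simps:
  assumes "asn A s"
  shows "natural i ==> natural j ==> Sat A s (cMem i j) <-> val s i \<epsilon> val s j"
    and "natural i ==> natural j ==> Sat A s (cEq i j) <-> val s i = val s j"
    and "fml \<phi> ==> Sat A s (cNeg \<phi>) <-> \<not> Sat A s \<phi>"
    and "fml \<phi> ==> fml \<psi> ==> Sat A s (cConj \<phi> \<psi>) <-> Sat A s \<phi> \<and> Sat A s \<psi>"
    and "natural i ==> fml \<phi> ==> Sat A s (cAll i \<phi>) <-> (\<forall>x. x \<epsilon> A --> Sat A (updv s i x) \<phi>)"
proof -
  obtain T where T: "truth_set A T" using truth_set_exists by blast
  note t = T[unfolded truth_set_iff, rule_format, OF assms]
  show "natural i ==> natural j ==> Sat A s (cMem i j) <-> val s i \<epsilon> val s j"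
    "natural i ==> natural j ==> Sat A s (cEq i j) <-> val s i = val s j"
    "fml \<phi> ==> Sat A s (cNeg \<phi>) <-> \<not> Sat A s \<phi>"
    "fml \<phi> ==> fml \<psi> ==> Sat A s (cConj \<phi> \<psi>) <-> Sat A s \<phi> \<and> Sat A s \<psi>"
    using t assms fml_intros by (simp_all add: Sat_iff[OF T])
  show "natural i ==> fml \<phi> ==> Sat A s (cAll i \<phi>) <-> (\<forall>x. x \<epsilon> A --> Sat A (updv s i x) \<phi>)"
    using t assms fml_intros asn_updv[OF assms] by (simp add: Sat_iff[OF T] cong: imp_cong)
qed

lemma Sat_local:
  assumes "fml \<phi>"
  shows "\<exists>n. natural n \<and> (\<forall>A s s'. asn A s \<and> asn A s' \<and> (\<forall>k. k \<epsilon> n --> val s k = val s' k) -->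
    (Sat A s \<phi> <-> Sat A s' \<phi>))"
proof -
  define loc where "loc \<phi> n <-> natural n \<and> (\<forall>A s s'. asn A s \<and> asn A s' \<and> (\<forall>k. k \<epsilon> n --> val s k = val s' k) -->
    (Sat A s \<phi> <-> Sat A s' \<phi>))" for \<phi> n
  have mono: "loc \<phi> m" if "loc \<phi> n" "natural m" "n \<sqsubseteq> m" for \<phi> n m
    using that subsetD unfolding loc_def by metis
  have max: "\<exists>k. natural k \<and> n \<sqsubseteq> k \<and> m \<sqsubseteq> k" if "natural n" "natural m" for n m
    using that natural_ordinal ordinal_not_mem ordinal_subset subset_refl by meson
  have "\<exists>n. loc \<phi> n"
  proof (rule fml_induct[where P = "\<lambda>\<phi>. \<exists>n. loc \<phi> n", OF _ assms])
    show "fo mem (\<lambda>e. \<exists>n. loc (e 0) n)" unfolding loc_def by (intro fo_intros)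
    fix i j assume ij: "natural i" "natural j"
    obtain k where k: "natural k" "succ i \<sqsubseteq> k" "succ j \<sqsubseteq> k" using max natural_succ ij by meson
    then have "i \<epsilon> k" "j \<epsilon> k" by (auto simp: subset_def)
    then show "\<exists>n. loc (cMem i j) n" "\<exists>n. loc (cEq i j) n"
      unfolding loc_def using k ij by (auto simp: Sat_simps intro!: exI[of _ k])
  next
    fix \<phi> assume "fml \<phi>" "\<exists>n. loc \<phi> n"
    then show "\<exists>n. loc (cNeg \<phi>) n" unfolding loc_def by (metis Sat_simps(3))
  next
    fix \<phi> \<psi> assume \<phi>: "fml \<phi>" "fml \<psi>" "\<exists>n. loc \<phi> n" "\<exists>n. loc \<psi> n"
    then obtain n m where "loc \<phi> n" "loc \<psi> m" by blast
    moreover obtain k where "natural k" "n \<sqsubseteq> k" "m \<sqsubseteq> k" using max calculation unfolding loc_def by meson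
    ultimately have "loc \<phi> k" "loc \<psi> k" using mono by blast+
    then show "\<exists>n. loc (cConj \<phi> \<psi>) n" unfolding loc_def by (metis Sat_simps(4)[OF _ \<phi>(1,2)])
  next
    fix i \<phi> assume i: "natural i" "fml \<phi>" "\<exists>n. loc \<phi> n"
    then obtain n where n: "loc \<phi> n" by blast
    have "loc (cAll i \<phi>) n" unfolding loc_def
    proof (intro conjI allI impI)
      show "natural n" using n unfolding loc_def by blast
      fix A s s' assume s: "asn A s \<and> asn A s' \<and> (\<forall>k. k \<epsilon> n --> val s k = val s' k)"
      have "Sat A (updv s i x) \<phi> <-> Sat A (updv s' i x) \<phi>" if "x \<epsilon> A" for x
        using n s that asn_updv val_updv natural_mem[of n] unfolding loc_def by simp
      then show "Sat A s (cAll i \<phi>) <-> Sat A s' (cAll i \<phi>)" using s i by (simp add: Sat_simps)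
    qed
    then show "\<exists>n. loc (cAll i \<phi>) n" by blast
  qed
  then show ?thesis unfolding loc_def .
qed

end

section \<open>Coding predicates by formulas\<close>

text \<open>
  A structure is a transitive set \<open>W\<close> with a distinguished \<open>\<omega>\<close>-sequence \<open>b\<close> that is one of its
  elements. The variables below \<open>n0\<close> are reserved for the given formula \<open>\<phi>\<close>, whose parameters are
  the entries of \<open>b\<close>; variable \<open>0\<close> keeps \<open>b\<close> itself, and the \<open>i\<close>-th auxiliary variable is \<open>pn i\<close>.
\<close>

locale coded_universe = inaccessible_universe mem \<delta>
  for mem :: "'v => 'v => bool" (infix "\<epsilon>" 50) and \<delta> +
  fixes \<phi> n0
  assumes fml_\<phi>: "fml \<phi>" and n0: "natural n0" "empty \<epsilon> n0"
    and local_\<phi>: "asn A s ==> asn A s' ==> (\<And>k. k \<epsilon> n0 ==> val s k = val s' k) ==> Sat A s \<phi> <-> Sat A s' \<phi>"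
begin

definition wf_str :: "'v => 'v => bool" where
  "wf_str W b <-> transitive W \<and> b \<epsilon> W \<and> function_on b omega"

definition J :: "'v => 'v => 'v => bool" where
  "J W b x <-> Sat W (updv b empty x) \<phi>"

primrec pn :: "nat => 'v" where
  "pn 0 = n0"
| "pn (Suc i) = succ (pn i)"

lemma natural_pn [simp]: "natural (pn i)"
  by (induction i) (auto simp: n0 natural_succ)

lemma pn_mem: "i < j ==> pn i \<epsilon> pn j"
  by (induction j) (auto simp: less_Suc_eq)

lemma pn_inject: "pn i = pn j <-> i = j"
  using pn_mem[of i j] pn_mem[of j i] by (metis linorder_neqE_nat not_mem_self)

lemma pn_above: "k \<epsilon> n0 ==> k \<noteq> pn i"
proof
  assume k: "k \<epsilon> n0" "k = pn i"
  have "i = 0 \<or> n0 \<epsilon> pn i" using pn_mem[of 0 i] by auto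
  then show False using k mem_asym[of n0 "pn i"] by auto
qed

lemma pn_neq_empty: "pn i \<noteq> empty" "empty \<noteq> pn i"
  using pn_above[OF n0(2)] by metis+

primrec asg :: "nat => 'v => (nat => 'v) => 'v" where
  "asg 0 b e = updv b empty b"
| "asg (Suc k) b e = updv (asg k b (\<lambda>n. e (Suc n))) (pn k) (e 0)"

lemma opair_components: "transitive W ==> opair x y \<epsilon> a ==> a \<epsilon> W ==> x \<epsilon> W \<and> y \<epsilon> W"
  using transitiveD[of W] opair_mem_Union2[of x y a] by (metis mem_Union)

lemma wf_asn: "wf_str W b ==> asn W b"
  unfolding wf_str_def asn_def using opair_components function_on_val mem_omega by metis

lemma asg_asn: "wf_str W b ==> (\<And>i. i < k ==> e i \<epsilon> W) ==> asn W (asg k b e)"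
proof (induction k arbitrary: e)
  case 0
  then show ?case using asn_updv[OF wf_asn[OF 0(1)]] unfolding wf_str_def by simp
next
  case (Suc k)
  then show ?case by (auto intro!: asn_updv)
qed

lemma asg_val: "i < k ==> val (asg k b e) (pn (k - Suc i)) = e i"
proof (induction k arbitrary: e i)
  case (Suc k)
  show ?case
  proof (cases i)
    case (Suc j)
    then have "k - i \<noteq> k" "j < k" using Suc.prems by auto
    then show ?thesis using Suc Suc.IH[of j] by (simp add: val_updv pn_inject)
  qed (simp add: val_updv)
qed simp

lemma asg_empty: "val (asg k b e) empty = b"
  by (induction k arbitrary: e) (auto simp: val_updv pn_neq_empty)

lemma asg_low: "m \<epsilon> n0 ==> m \<noteq> empty ==> val (asg k b e) m = val b m"
  using natural_mem[OF n0(1), of m] pn_above[of m]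
  by (induction k arbitrary: e) (auto simp: val_updv)

lemma asg_J: "wf_str W b ==> (\<And>i. i < k ==> e i \<epsilon> W) ==> x \<epsilon> W ==>
  Sat W (updv (asg k b e) empty x) \<phi> <-> J W b x"
  unfolding J_def
  using wf_asn[of W b] asg_asn[of W b k e]
  by (intro local_\<phi>) (auto intro!: asn_updv simp: val_updv natural_mem[OF n0(1)] asg_low)

definition coded :: "nat => ('v => 'v => (nat => 'v) => bool) => bool" where
  "coded k R <-> (\<exists>\<psi>. fml \<psi> \<and>
     (\<forall>W b e. wf_str W b \<and> (\<forall>i<k. e i \<epsilon> W) --> (R W b e <-> Sat W (asg k b e) \<psi>)))"

lemma codedI: "fml \<psi> ==> (\<And>W b e. wf_str W b ==> (\<And>i. i < k ==> e i \<epsilon> W) ==> R W b e <-> Sat W (asg k b e) \<psi>) ==> coded k R"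
  unfolding coded_def by blast

lemma coded_cong: "coded k R ==>
  (\<And>W b e. wf_str W b ==> (\<And>i. i < k ==> e i \<epsilon> W) ==> R' W b e <-> R W b e) ==> coded k R'"
  unfolding coded_def by (elim exE, rule_tac x = \<psi> in exI) simp

named_theorems coded_intros

lemma coded_mem [coded_intros]: "i < k ==> j < k ==> coded k (\<lambda>W b e. e i \<epsilon> e j)"
  by (rule codedI[where \<psi> = "cMem (pn (k - Suc i)) (pn (k - Suc j))"])
    (simp_all add: fml_intros Sat_simps asg_asn asg_val)

lemma coded_eq [coded_intros]: "i < k ==> j < k ==> coded k (\<lambda>W b e. e i = e j)"
  by (rule codedI[where \<psi> = "cEq (pn (k - Suc i)) (pn (k - Suc j))"])
    (simp_all add: fml_intros Sat_simps asg_asn asg_val)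

lemma coded_b [coded_intros]: "i < k ==> coded k (\<lambda>W b e. e i = b)"
  by (rule codedI[where \<psi> = "cEq (pn (k - Suc i)) empty"])
    (simp_all add: fml_intros Sat_simps asg_asn asg_val asg_empty)

lemma coded_neg [coded_intros]: "coded k R ==> coded k (\<lambda>W b e. \<not> R W b e)"
  unfolding coded_def
  by (elim exE conjE, rule_tac x = "cNeg \<psi>" in exI) (simp add: fml_intros Sat_simps(3) asg_asn)

lemma coded_conj [coded_intros]: "coded k R ==> coded k R' ==> coded k (\<lambda>W b e. R W b e \<and> R' W b e)"
  unfolding coded_def
  by (elim exE conjE, rule_tac x = "cConj \<psi> \<psi>'" in exI) (simp add: fml_intros Sat_simps(4) asg_asn)

lemma coded_imp [coded_intros]: "coded k R ==> coded k R' ==> coded k (\<lambda>W b e. R W b e --> R' W b e)"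
  by (rule coded_cong[OF coded_neg[OF coded_conj[OF _ coded_neg]]]) auto

lemma coded_disj [coded_intros]: "coded k R ==> coded k R' ==> coded k (\<lambda>W b e. R W b e \<or> R' W b e)"
  by (rule coded_cong[OF coded_neg[OF coded_conj[OF coded_neg coded_neg]]]) auto

lemma coded_iff [coded_intros]: "coded k R ==> coded k R' ==> coded k (\<lambda>W b e. R W b e <-> R' W b e)"
  by (rule coded_cong[OF coded_conj[OF coded_imp[of k R R'] coded_imp[of k R' R]]]) auto

lemma coded_all [coded_intros]:
  assumes "coded (Suc k) (\<lambda>W b e. Q W b (e 0) (\<lambda>n. e (Suc n)))"
  shows "coded k (\<lambda>W b e. \<forall>x. x \<epsilon> W --> Q W b x e)"
proof -
  obtain \<psi> where \<psi>: "fml \<psi>" "\<And>W b e. wf_str W b ==> (\<And>i. i < Suc k ==> e i \<epsilon> W) ==>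
      Q W b (e 0) (\<lambda>n. e (Suc n)) <-> Sat W (asg (Suc k) b e) \<psi>"
    using assms unfolding coded_def by blast
  show ?thesis
  proof (rule codedI)
    show "fml (cAll (pn k) \<psi>)" using \<psi>(1) by (simp add: fml_intros)
    fix W b e assume W: "wf_str W b" "\<And>i. i < k ==> e i \<epsilon> W"
    have "Q W b x e <-> Sat W (updv (asg k b e) (pn k) x) \<psi>" if "x \<epsilon> W" for x
      using \<psi>(2)[OF W(1), of "case_nat x e"] W(2) that by (simp add: less_Suc_eq_0_disj split: nat.split) force
    then show "(\<forall>x. x \<epsilon> W --> Q W b x e) <-> Sat W (asg k b e) (cAll (pn k) \<psi>)"
      using W \<psi>(1) by (simp add: Sat_simps asg_asn)
  qed
qed

lemma coded_ex [coded_intros]: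
  assumes "coded (Suc k) (\<lambda>W b e. Q W b (e 0) (\<lambda>n. e (Suc n)))"
  shows "coded k (\<lambda>W b e. \<exists>x. x \<epsilon> W \<and> Q W b x e)"
  by (rule coded_cong[OF coded_neg[OF coded_all[OF coded_neg[OF assms]]]]) auto

lemma coded_J [coded_intros]:
  assumes i: "i < k"
  shows "coded k (\<lambda>W b e. J W b (e i))"
proof (rule codedI)
  let ?p = "pn (k - Suc i)"
  show "fml (cNeg (cAll empty (cNeg (cConj (cEq empty ?p) \<phi>))))" by (simp add: fml_intros fml_\<phi>)
  fix W b e assume W: "wf_str W b" "\<And>i. i < k ==> e i \<epsilon> W"
  have "Sat W (updv (asg k b e) empty x) (cConj (cEq empty ?p) \<phi>) <-> x = e i \<and> J W b x" if "x \<epsilon> W" for x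
    using W that by (simp add: fml_intros fml_\<phi> Sat_simps asg_asn asn_updv val_updv pn_neq_empty asg_val[OF i] asg_J)
  then show "J W b (e i) <-> Sat W (asg k b e) (cNeg (cAll empty (cNeg (cConj (cEq empty ?p) \<phi>))))"
    using W i by (simp add: fml_intros fml_\<phi> Sat_simps(3,5) asg_asn asn_updv)
qed

subsection \<open>Absolute predicates\<close>

lemma wf_transD: "wf_str W b ==> y \<epsilon> W ==> x \<epsilon> y ==> x \<epsilon> W"
  unfolding wf_str_def using transitiveD by blast

lemma wf_opairD: "wf_str W b ==> opair x y \<epsilon> a ==> a \<epsilon> W ==> x \<epsilon> W" "wf_str W b ==> opair x y \<epsilon> a ==> a \<epsilon> W ==> y \<epsilon> W"
  unfolding wf_str_def using opair_components by blast+

lemma coded_upair: "i < k ==> j < k ==> l < k ==> coded k (\<lambda>W b e. e i = upair (e j) (e l))"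
proof (rule coded_cong)
  assume "i < k" "j < k" "l < k"
  then show "coded k (\<lambda>W b e. \<forall>x. x \<epsilon> W --> (x \<epsilon> e i <-> x = e j \<or> x = e l))"
    by (intro coded_intros) auto
  fix W b e assume "wf_str W b" "\<And>i. i < k ==> e i \<epsilon> W"
  then show "e i = upair (e j) (e l) <-> (\<forall>x. x \<epsilon> W --> (x \<epsilon> e i <-> x = e j \<or> x = e l))"
    using wf_transD[of W b "e i"] \<open>i < k\<close> \<open>j < k\<close> \<open>l < k\<close> unfolding set_eq_iff[of "e i"] mem_upair by metis
qed

lemma coded_opair [coded_intros]: "i < k ==> j < k ==> l < k ==> coded k (\<lambda>W b e. e i = opair (e j) (e l))"
proof (rule coded_cong)
  assume *: "i < k" "j < k" "l < k"
  then show "coded k (\<lambda>W b e. \<exists>u. u \<epsilon> W \<and> (\<exists>v. v \<epsilon> W \<and> u = upair (e j) (e j) \<and> v = upair (e j) (e l) \<and> e i = upair u v))"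
    by (intro coded_intros coded_upair) auto
  fix W b e assume W: "wf_str W b" "\<And>i. i < k ==> e i \<epsilon> W"
  show "e i = opair (e j) (e l) <-> (\<exists>u. u \<epsilon> W \<and> (\<exists>v. v \<epsilon> W \<and> u = upair (e j) (e j) \<and> v = upair (e j) (e l) \<and> e i = upair u v))"
    using wf_transD[OF W(1) W(2)[OF *(1)]] unfolding opair_def by auto
qed

lemma coded_opair_mem [coded_intros]: "i < k ==> j < k ==> l < k ==> coded k (\<lambda>W b e. opair (e i) (e j) \<epsilon> e l)"
proof (rule coded_cong)
  assume *: "i < k" "j < k" "l < k"
  then show "coded k (\<lambda>W b e. \<exists>p. p \<epsilon> W \<and> p = opair (e i) (e j) \<and> p \<epsilon> e l)"
    by (intro coded_intros) auto
  fix W b e assume W: "wf_str W b" "\<And>i. i < k ==> e i \<epsilon> W"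
  show "opair (e i) (e j) \<epsilon> e l <-> (\<exists>p. p \<epsilon> W \<and> p = opair (e i) (e j) \<and> p \<epsilon> e l)"
    using wf_transD[OF W(1) W(2)[OF *(3)]] by blast
qed

lemma coded_natural [coded_intros]: "i < k ==> coded k (\<lambda>W b e. natural (e i))"
proof (rule coded_cong)
  assume *: "i < k"
  then show "coded k (\<lambda>W b e. \<exists>v. v \<epsilon> W \<and> (\<exists>c. c \<epsilon> W \<and> c = b \<and> opair (e i) v \<epsilon> c))"
    by (intro coded_intros) auto
  fix W b e assume W: "wf_str W b" "\<And>i. i < k ==> e i \<epsilon> W"
  show "natural (e i) <-> (\<exists>v. v \<epsilon> W \<and> (\<exists>c. c \<epsilon> W \<and> c = b \<and> opair (e i) v \<epsilon> c))"
    using wf_opairD(2)[OF W(1)] W(1) unfolding wf_str_def function_on_def by auto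
qed

lemma coded_empty [coded_intros]: "i < k ==> coded k (\<lambda>W b e. e i = empty)"
proof (rule coded_cong)
  assume *: "i < k"
  then show "coded k (\<lambda>W b e. \<not> (\<exists>v. v \<epsilon> W \<and> v \<epsilon> e i))" by (intro coded_intros) auto
  fix W b e assume W: "wf_str W b" "\<And>i. i < k ==> e i \<epsilon> W"
  show "e i = empty <-> \<not> (\<exists>v. v \<epsilon> W \<and> v \<epsilon> e i)"
    using wf_transD[OF W(1) W(2)[OF *]] unfolding set_eq_iff[of "e i"] by auto
qed

lemma coded_num: "i < k ==> coded k (\<lambda>W b e. e i = num m)"
proof (induction m arbitrary: i k)
  case 0
  then show ?case by (simp add: coded_empty)
next
  case (Suc m)
  show ?case
  proof (rule coded_cong)
    show "coded k (\<lambda>W b e. \<exists>u. u \<epsilon> W \<and> u = num m \<and> (\<forall>x. x \<epsilon> W --> (x \<epsilon> e i <-> x \<epsilon> u \<or> x = u)))"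
      using Suc.prems by (intro coded_intros Suc.IH) auto
    fix W b e assume W: "wf_str W b" "\<And>i. i < k ==> e i \<epsilon> W"
    show "e i = num (Suc m) <-> (\<exists>u. u \<epsilon> W \<and> u = num m \<and> (\<forall>x. x \<epsilon> W --> (x \<epsilon> e i <-> x \<epsilon> u \<or> x = u)))"
    proof
      assume "e i = num (Suc m)"
      then show "\<exists>u. u \<epsilon> W \<and> u = num m \<and> (\<forall>x. x \<epsilon> W --> (x \<epsilon> e i <-> x \<epsilon> u \<or> x = u))"
        using wf_transD[OF W(1) W(2)[OF Suc.prems], of "num m"] by simp
    next
      assume "\<exists>u. u \<epsilon> W \<and> u = num m \<and> (\<forall>x. x \<epsilon> W --> (x \<epsilon> e i <-> x \<epsilon> u \<or> x = u))"
      then obtain u where u: "u \<epsilon> W" "num m = u" "\<And>x. x \<epsilon> W ==> x \<epsilon> e i <-> x \<epsilon> u \<or> x = u" by blast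
      have "e i = succ u"
      proof (rule set_eqI)
        fix x
        have "x \<epsilon> W" if "x \<epsilon> e i \<or> x \<epsilon> u \<or> x = u"
          using that u(1) wf_transD[OF W(1) W(2)[OF Suc.prems], of x] wf_transD[OF W(1) u(1), of x] by blast
        then show "x \<epsilon> e i <-> x \<epsilon> succ u" unfolding mem_succ using u(3) by blast
      qed
      then show "e i = num (Suc m)" by (simp add: u(2))
    qed
  qed
qed

lemma coded_tagged: "i < k ==> j < k ==> coded k (\<lambda>W b e. e i = opair (num m) (e j))"
proof (rule coded_cong)
  assume *: "i < k" "j < k"
  then show "coded k (\<lambda>W b e. \<exists>u. u \<epsilon> W \<and> u = num m \<and> e i = opair u (e j))" by (intro coded_intros coded_num) auto
  fix W b e assume W: "wf_str W b" "\<And>i. i < k ==> e i \<epsilon> W"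
  have "num m \<epsilon> W" if "e i = opair (num m) (e j)"
    using wf_transD[OF W(1) wf_transD[OF W(1) W(2)[OF *(1)]], of "upair (num m) (num m)" "num m"] that
    unfolding opair_def by simp
  then show "e i = opair (num m) (e j) <-> (\<exists>u. u \<epsilon> W \<and> u = num m \<and> e i = opair u (e j))" by auto
qed

lemma coded_tagged2: "i < k ==> j < k ==> l < k ==> coded k (\<lambda>W b e. e i = opair (num m) (opair (e j) (e l)))"
proof (rule coded_cong)
  assume *: "i < k" "j < k" "l < k"
  then show "coded k (\<lambda>W b e. \<exists>u. u \<epsilon> W \<and> u = opair (e j) (e l) \<and> e i = opair (num m) u)"
    by (intro coded_intros coded_tagged) auto
  fix W b e assume W: "wf_str W b" "\<And>i. i < k ==> e i \<epsilon> W"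
  have "u \<epsilon> W" if "e i = opair (num m) u" for u
    using wf_transD[OF W(1) wf_transD[OF W(1) W(2)[OF *(1)]], of "upair (num m) u" u] that
    unfolding opair_def by simp
  then show "e i = opair (num m) (opair (e j) (e l)) <-> (\<exists>u. u \<epsilon> W \<and> u = opair (e j) (e l) \<and> e i = opair (num m) u)"
    by auto
qed

lemma coded_codes [coded_intros]:
  "i < k ==> j < k ==> l < k ==> coded k (\<lambda>W b e. e i = cMem (e j) (e l))"
  "i < k ==> j < k ==> l < k ==> coded k (\<lambda>W b e. e i = cEq (e j) (e l))"
  "i < k ==> j < k ==> coded k (\<lambda>W b e. e i = cNeg (e j))"
  "i < k ==> j < k ==> l < k ==> coded k (\<lambda>W b e. e i = cConj (e j) (e l))"
  "i < k ==> j < k ==> l < k ==> coded k (\<lambda>W b e. e i = cAll (e j) (e l))"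
  unfolding cMem_def cEq_def cNeg_def cConj_def cAll_def by (intro coded_tagged coded_tagged2; assumption)+

lemma coded_function_on [coded_intros]: "i < k ==> coded k (\<lambda>W b e. function_on (e i) omega)"
proof (rule coded_cong)
  assume *: "i < k"
  then show "coded k (\<lambda>W b e. (\<forall>p. p \<epsilon> W --> p \<epsilon> e i --> (\<exists>x. x \<epsilon> W \<and> (\<exists>y. y \<epsilon> W \<and> p = opair x y))) \<and>
      (\<forall>x. x \<epsilon> W --> (\<forall>y. y \<epsilon> W --> (\<forall>z. z \<epsilon> W --> opair x y \<epsilon> e i \<and> opair x z \<epsilon> e i --> y = z))) \<and>
      (\<forall>x. x \<epsilon> W --> (natural x <-> (\<exists>y. y \<epsilon> W \<and> opair x y \<epsilon> e i))))"
    by (intro coded_intros) auto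
  fix W b e assume W: "wf_str W b" "\<And>i. i < k ==> e i \<epsilon> W"
  note t = wf_transD[OF W(1) W(2)[OF *]]
  note o = wf_opairD[OF W(1) _ W(2)[OF *]]
  have n: "x \<epsilon> W" if "natural x" for x
  proof -
    have "opair x (val b x) \<epsilon> b" using W(1) that function_on_val[of b omega x] unfolding wf_str_def by simp
    then show ?thesis using wf_opairD(1)[OF W(1)] W(1) unfolding wf_str_def by blast
  qed
  have t2: "x \<epsilon> W \<and> y \<epsilon> W" if "opair x y \<epsilon> e i" for x y using o that by blast
  show "function_on (e i) omega <-> (\<forall>p. p \<epsilon> W --> p \<epsilon> e i --> (\<exists>x. x \<epsilon> W \<and> (\<exists>y. y \<epsilon> W \<and> p = opair x y))) \<and>
      (\<forall>x. x \<epsilon> W --> (\<forall>y. y \<epsilon> W --> (\<forall>z. z \<epsilon> W --> opair x y \<epsilon> e i \<and> opair x z \<epsilon> e i --> y = z))) \<and>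
      (\<forall>x. x \<epsilon> W --> (natural x <-> (\<exists>y. y \<epsilon> W \<and> opair x y \<epsilon> e i)))"
    (is "_ <-> ?a \<and> ?b \<and> ?c")
  proof -
    have "(\<forall>p. p \<epsilon> e i --> (\<exists>x y. p = opair x y)) <-> ?a" using t t2 by metis
    moreover have "(\<forall>x y z. opair x y \<epsilon> e i \<and> opair x z \<epsilon> e i --> y = z) <-> ?b" using t2 by meson
    moreover have "(\<forall>x. natural x <-> (\<exists>y. opair x y \<epsilon> e i)) <-> ?c" using t2 n by meson
    ultimately show ?thesis unfolding function_on_def partial_fun_def mem_omega by argo
  qed
qed

lemma coded_transitive [coded_intros]: "i < k ==> coded k (\<lambda>W b e. transitive (e i))"
proof (rule coded_cong)
  assume *: "i < k"
  then show "coded k (\<lambda>W b e. \<forall>x. x \<epsilon> W --> (\<forall>y. y \<epsilon> W --> y \<epsilon> x --> x \<epsilon> e i --> y \<epsilon> e i))"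
    by (intro coded_intros) auto
  fix W b e assume W: "wf_str W b" "\<And>i. i < k ==> e i \<epsilon> W"
  note t = wf_transD[OF W(1) W(2)[OF *]]
  show "transitive (e i) <-> (\<forall>x. x \<epsilon> W --> (\<forall>y. y \<epsilon> W --> y \<epsilon> x --> x \<epsilon> e i --> y \<epsilon> e i))"
    unfolding transitive_def subset_def using t wf_transD[OF W(1)] by metis
qed

end

section \<open>The descent\<close>

context coded_universe
begin

text \<open>
  The formula \<open>Theta\<close> says that a structure \<open>W\<close> computes its own generic ultrapower by the tower that
  \<open>J\<close> defines over \<open>W\<close>: a condition \<open>(\<theta>, T)\<close> is a \<open>J\<close>-positive set \<open>T\<close> at level \<open>\<theta>\<close>, each \<open>M \<in> T\<close> collapses
  by some \<open>\<pi>\<close> into the transitive set \<open>A\<close> that \<open>Tf\<close> assigns to \<open>M \<inter> h\<close> (\<open>Pt\<close>), and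
  \<open>Ev M \<psi> s\<close> says that \<open>A\<close> satisfies \<open>\<psi>\<close> under the collapse of the assignment \<open>s\<close>.
\<close>

definition up :: "'v => 'v => 'v => 'v => 'v => bool" where
  "up W s i x s' <-> function_on s' omega \<and> (\<forall>k. k \<epsilon> W --> (\<forall>v. v \<epsilon> W --> opair k v \<epsilon> s' -->
     k = i \<and> v = x \<or> k \<noteq> i \<and> opair k v \<epsilon> s))"

definition cmp :: "'v => 'v => 'v => 'v => bool" where
  "cmp W \<pi> s \<sigma> <-> function_on \<sigma> omega \<and> (\<forall>k. k \<epsilon> W --> (\<forall>v. v \<epsilon> W --> opair k v \<epsilon> s -->
     (\<exists>w. w \<epsilon> W \<and> opair v w \<epsilon> \<pi> \<and> opair k w \<epsilon> \<sigma>)))"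

definition tarski :: "'v => 'v => ('v => bool) => 'v => bool" where
  "tarski W F E s <->
     (\<forall>i. i \<epsilon> W --> (\<forall>j. j \<epsilon> W --> (\<forall>p. p \<epsilon> W --> natural i \<and> natural j -->
       (p = cMem i j --> (E p <-> (\<exists>u. u \<epsilon> W \<and> (\<exists>v. v \<epsilon> W \<and> opair i u \<epsilon> s \<and> opair j v \<epsilon> s \<and> u \<epsilon> v)))) \<and>
       (p = cEq i j --> (E p <-> (\<exists>u. u \<epsilon> W \<and> opair i u \<epsilon> s \<and> opair j u \<epsilon> s)))))) \<and>
     (\<forall>\<chi>. \<chi> \<epsilon> W --> (\<forall>p. p \<epsilon> W --> \<chi> \<epsilon> F \<and> p = cNeg \<chi> --> (E p <-> \<not> E \<chi>))) \<and>
     (\<forall>\<chi>. \<chi> \<epsilon> W --> (\<forall>\<chi>'. \<chi>' \<epsilon> W --> (\<forall>p. p \<epsilon> W --> \<chi> \<epsilon> F \<and> \<chi>' \<epsilon> F \<and> p = cConj \<chi> \<chi>' -->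
       (E p <-> E \<chi> \<and> E \<chi>'))))"

definition TS :: "'v => 'v => 'v => 'v => bool" where
  "TS W F A \<tau> <-> (\<forall>s. s \<epsilon> W --> function_on s omega \<and> (\<forall>k. k \<epsilon> W --> (\<forall>v. v \<epsilon> W --> opair k v \<epsilon> s --> v \<epsilon> A)) -->
     tarski W F (\<lambda>p. opair p s \<epsilon> \<tau>) s \<and>
     (\<forall>i. i \<epsilon> W --> (\<forall>\<chi>. \<chi> \<epsilon> W --> (\<forall>p. p \<epsilon> W --> natural i \<and> \<chi> \<epsilon> F \<and> p = cAll i \<chi> -->
       (opair p s \<epsilon> \<tau> <-> (\<forall>x. x \<epsilon> W --> x \<epsilon> A --> (\<forall>s'. s' \<epsilon> W --> up W s i x s' --> opair \<chi> s' \<epsilon> \<tau>)))))))"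

definition Pt :: "'v => 'v => 'v => 'v => 'v => 'v => 'v => bool" where
  "Pt W c h Tf M A \<pi> <->
     (\<exists>M0. M0 \<epsilon> W \<and> opair M0 A \<epsilon> Tf \<and> (\<forall>x. x \<epsilon> W --> (x \<epsilon> M0 <-> x \<epsilon> h \<and> x \<epsilon> M))) \<and>
     (\<forall>p. p \<epsilon> W --> p \<epsilon> \<pi> --> (\<exists>x. x \<epsilon> W \<and> (\<exists>y. y \<epsilon> W \<and> p = opair x y \<and> x \<epsilon> M \<and> y \<epsilon> A))) \<and>
     (\<forall>x. x \<epsilon> W --> x \<epsilon> M --> (\<exists>y. y \<epsilon> W \<and> opair x y \<epsilon> \<pi>)) \<and>
     (\<forall>x. x \<epsilon> W --> (\<forall>y. y \<epsilon> W --> opair x y \<epsilon> \<pi> -->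
       (\<forall>z. z \<epsilon> W --> (z \<epsilon> y <-> (\<exists>x'. x' \<epsilon> W \<and> x' \<epsilon> x \<and> opair x' z \<epsilon> \<pi>))))) \<and>
     (\<forall>x. x \<epsilon> W --> (\<forall>x'. x' \<epsilon> W --> (\<forall>y. y \<epsilon> W --> opair x y \<epsilon> \<pi> \<and> opair x' y \<epsilon> \<pi> --> x = x'))) \<and>
     transitive A \<and> (\<exists>c'. c' \<epsilon> W \<and> opair c c' \<epsilon> \<pi> \<and> cmp W \<pi> c c')"

definition Ev :: "'v => 'v => 'v => 'v => 'v => 'v => 'v => 'v => bool" where
  "Ev W c h Tf F M \<psi> s <-> (\<exists>A. A \<epsilon> W \<and> (\<exists>\<pi>. \<pi> \<epsilon> W \<and> (\<exists>\<tau>. \<tau> \<epsilon> W \<and> (\<exists>\<sigma>. \<sigma> \<epsilon> W \<and>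
     Pt W c h Tf M A \<pi> \<and> TS W F A \<tau> \<and> cmp W \<pi> s \<sigma> \<and> opair \<psi> \<sigma> \<epsilon> \<tau>))))"

definition total :: "'v => 'v => 'v => bool" where
  "total W M s <-> (\<forall>k. k \<epsilon> W --> (\<forall>v. v \<epsilon> W --> opair k v \<epsilon> s --> v \<epsilon> M))"

definition JJ :: "'v => 'v => 'v => 'v => bool" where
  "JJ W b \<theta> X <-> (\<exists>q. q \<epsilon> W \<and> q = opair \<theta> X \<and> J W b q)"

definition Cond :: "'v => 'v => 'v => 'v => 'v => 'v => 'v => bool" where
  "Cond W b c h Tf \<theta> T <-> \<not> JJ W b \<theta> T \<and> (\<exists>M. M \<epsilon> W \<and> M \<epsilon> T) \<and>
     (\<forall>M. M \<epsilon> W --> M \<epsilon> T --> (\<exists>X. X \<epsilon> W \<and> M \<epsilon> X \<and> JJ W b \<theta> X) \<and>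
       (\<exists>A. A \<epsilon> W \<and> (\<exists>\<pi>. \<pi> \<epsilon> W \<and> Pt W c h Tf M A \<pi>)))"

definition Le :: "'v => 'v => 'v => 'v => 'v => 'v => 'v => bool" where
  "Le W c h Tf F T' T <-> (\<forall>M'. M' \<epsilon> W --> M' \<epsilon> T' --> (\<exists>M. M \<epsilon> W \<and> M \<epsilon> T \<and>
     (\<forall>x. x \<epsilon> W --> x \<epsilon> M --> x \<epsilon> M') \<and>
     (\<forall>\<chi>. \<chi> \<epsilon> W --> (\<forall>s. s \<epsilon> W --> \<chi> \<epsilon> F \<and> function_on s omega \<and> total W M s -->
       (Ev W c h Tf F M' \<chi> s <-> Ev W c h Tf F M \<chi> s)))))"

definition clF :: "'v => 'v => bool" where
  "clF W F <->
     (\<forall>i. i \<epsilon> W --> (\<forall>j. j \<epsilon> W --> natural i \<and> natural j -->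
       (\<exists>p. p \<epsilon> W \<and> p \<epsilon> F \<and> p = cMem i j) \<and> (\<exists>p. p \<epsilon> W \<and> p \<epsilon> F \<and> p = cEq i j))) \<and>
     (\<forall>\<chi>. \<chi> \<epsilon> W --> \<chi> \<epsilon> F --> (\<exists>p. p \<epsilon> W \<and> p \<epsilon> F \<and> p = cNeg \<chi>)) \<and>
     (\<forall>\<chi>. \<chi> \<epsilon> W --> (\<forall>\<chi>'. \<chi>' \<epsilon> W --> \<chi> \<epsilon> F \<and> \<chi>' \<epsilon> F --> (\<exists>p. p \<epsilon> W \<and> p \<epsilon> F \<and> p = cConj \<chi> \<chi>'))) \<and>
     (\<forall>i. i \<epsilon> W --> (\<forall>\<chi>. \<chi> \<epsilon> W --> natural i \<and> \<chi> \<epsilon> F --> (\<exists>p. p \<epsilon> W \<and> p \<epsilon> F \<and> p = cAll i \<chi>)))"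

definition clU :: "'v => bool" where
  "clU W <-> (\<forall>s. s \<epsilon> W --> (\<forall>i. i \<epsilon> W --> (\<forall>x. x \<epsilon> W --> function_on s omega \<and> natural i -->
     (\<exists>s'. s' \<epsilon> W \<and> up W s i x s'))))"

text \<open>
  The clauses of \<open>Theta\<close> about \<open>Ev\<close>: Tarski's clauses, decision of any formula by a stronger condition,
  and representation by an element of \<open>W\<close> of a witness against a universal formula.
\<close>

definition clB :: "'v => 'v => 'v => 'v => 'v => 'v => bool" where
  "clB W b c h Tf F <-> (\<forall>\<theta>. \<theta> \<epsilon> W --> (\<forall>T. T \<epsilon> W --> (\<forall>M. M \<epsilon> W --> (\<forall>s. s \<epsilon> W -->
     Cond W b c h Tf \<theta> T \<and> M \<epsilon> T \<and> function_on s omega \<and> total W M s -->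
     tarski W F (\<lambda>p. Ev W c h Tf F M p s) s \<and>
     (\<forall>i. i \<epsilon> W --> (\<forall>\<chi>. \<chi> \<epsilon> W --> (\<forall>p. p \<epsilon> W --> (\<forall>x. x \<epsilon> W --> (\<forall>s'. s' \<epsilon> W -->
       natural i \<and> \<chi> \<epsilon> F \<and> p = cAll i \<chi> \<and> Ev W c h Tf F M p s \<and> x \<epsilon> M \<and> up W s i x s' -->
       Ev W c h Tf F M \<chi> s')))))))))"

definition clC :: "'v => 'v => 'v => 'v => 'v => 'v => bool" where
  "clC W b c h Tf F <-> (\<forall>\<theta>. \<theta> \<epsilon> W --> (\<forall>T. T \<epsilon> W --> (\<forall>s. s \<epsilon> W --> (\<forall>\<psi>. \<psi> \<epsilon> W -->
     Cond W b c h Tf \<theta> T \<and> function_on s omega \<and> \<psi> \<epsilon> F -->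
     (\<exists>\<theta>'. \<theta>' \<epsilon> W \<and> (\<exists>T'. T' \<epsilon> W \<and> Cond W b c h Tf \<theta>' T' \<and> Le W c h Tf F T' T \<and>
       (\<forall>M. M \<epsilon> W --> M \<epsilon> T' --> total W M s) \<and>
       ((\<forall>M. M \<epsilon> W --> M \<epsilon> T' --> Ev W c h Tf F M \<psi> s) \<or>
        (\<forall>M. M \<epsilon> W --> M \<epsilon> T' --> \<not> Ev W c h Tf F M \<psi> s))))))))"

definition clD :: "'v => 'v => 'v => 'v => 'v => 'v => bool" where
  "clD W b c h Tf F <-> (\<forall>\<theta>. \<theta> \<epsilon> W --> (\<forall>T. T \<epsilon> W --> (\<forall>s. s \<epsilon> W --> (\<forall>i. i \<epsilon> W --> (\<forall>\<chi>. \<chi> \<epsilon> W --> (\<forall>p. p \<epsilon> W -->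
     Cond W b c h Tf \<theta> T \<and> function_on s omega \<and> natural i \<and> \<chi> \<epsilon> F \<and> p = cAll i \<chi> \<and>
     (\<forall>M. M \<epsilon> W --> M \<epsilon> T --> total W M s \<and> \<not> Ev W c h Tf F M p s) -->
     (\<exists>\<theta>'. \<theta>' \<epsilon> W \<and> (\<exists>T'. T' \<epsilon> W \<and> (\<exists>x. x \<epsilon> W \<and> (\<exists>s'. s' \<epsilon> W \<and>
       Cond W b c h Tf \<theta>' T' \<and> up W s i x s' \<and>
       (\<forall>M. M \<epsilon> W --> M \<epsilon> T' --> total W M s' \<and> \<not> Ev W c h Tf F M \<chi> s')))))))))))"

definition Theta :: "'v => 'v => bool" where
  "Theta W b <-> (\<exists>c. c \<epsilon> W \<and> (\<exists>h. h \<epsilon> W \<and> (\<exists>Tf. Tf \<epsilon> W \<and> (\<exists>F. F \<epsilon> W \<and> c = b \<and>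
     (\<exists>z. z \<epsilon> W \<and> (\<exists>t. t \<epsilon> W \<and> (\<exists>q. q \<epsilon> W \<and> z = empty \<and> t = opair Tf F \<and> q = opair h t \<and> opair z q \<epsilon> c))) \<and>
     clF W F \<and> clU W \<and> (\<exists>\<theta>. \<theta> \<epsilon> W \<and> (\<exists>T. T \<epsilon> W \<and> Cond W b c h Tf \<theta> T)) \<and>
     clB W b c h Tf F \<and> clC W b c h Tf F \<and> clD W b c h Tf F))))"

lemma coded_up [coded_intros]: "i < k ==> j < k ==> l < k ==> m < k ==> coded k (\<lambda>W b e. up W (e i) (e j) (e l) (e m))"
  unfolding up_def by (intro coded_intros) auto

lemma coded_cmp [coded_intros]: "i < k ==> j < k ==> l < k ==> coded k (\<lambda>W b e. cmp W (e i) (e j) (e l))"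
  unfolding cmp_def by (intro coded_intros) auto

lemma coded_total [coded_intros]: "i < k ==> j < k ==> coded k (\<lambda>W b e. total W (e i) (e j))"
  unfolding total_def by (intro coded_intros) auto

lemma coded_JJ [coded_intros]: "i < k ==> j < k ==> coded k (\<lambda>W b e. JJ W b (e i) (e j))"
  unfolding JJ_def by (intro coded_intros) auto

lemma coded_TS [coded_intros]: "i < k ==> j < k ==> l < k ==> coded k (\<lambda>W b e. TS W (e i) (e j) (e l))"
  unfolding TS_def tarski_def by (intro coded_intros) auto

lemma coded_Pt [coded_intros]: "i1 < k ==> i2 < k ==> i3 < k ==> i4 < k ==> i5 < k ==> i6 < k ==>
  coded k (\<lambda>W b e. Pt W (e i1) (e i2) (e i3) (e i4) (e i5) (e i6))"
  unfolding Pt_def by (intro coded_intros) auto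

lemma coded_Ev [coded_intros]: "i1 < k ==> i2 < k ==> i3 < k ==> i4 < k ==> i5 < k ==> i6 < k ==> i7 < k ==>
  coded k (\<lambda>W b e. Ev W (e i1) (e i2) (e i3) (e i4) (e i5) (e i6) (e i7))"
  unfolding Ev_def by (intro coded_intros) auto

lemma coded_Cond [coded_intros]: "i1 < k ==> i2 < k ==> i3 < k ==> i4 < k ==> i5 < k ==>
  coded k (\<lambda>W b e. Cond W b (e i1) (e i2) (e i3) (e i4) (e i5))"
  unfolding Cond_def by (intro coded_intros) auto

lemma coded_Le [coded_intros]: "i1 < k ==> i2 < k ==> i3 < k ==> i4 < k ==> i5 < k ==> i6 < k ==>
  coded k (\<lambda>W b e. Le W (e i1) (e i2) (e i3) (e i4) (e i5) (e i6))"
  unfolding Le_def by (intro coded_intros) auto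

lemma coded_Theta: "coded 0 (\<lambda>W b e. Theta W b)"
  unfolding Theta_def clF_def clU_def clB_def clC_def clD_def tarski_def
  by (intro coded_intros) auto

lemma wf_natural: "wf_str W b ==> natural k ==> k \<epsilon> W"
  using function_on_val[of b omega k] wf_opairD(1)[of W b k "val b k" b] unfolding wf_str_def by simp

lemma wf_val: "wf_str W b ==> s \<epsilon> W ==> function_on s omega ==> natural k ==> val s k \<epsilon> W"
  using function_on_val[of s omega k] wf_opairD(2)[of W b k "val s k" s] by simp

lemma opair_updv: "opair k v \<epsilon> updv s i x <-> natural k \<and> v = (if k = i then x else val s k)"
  using function_on_opair_iff[OF function_on_updv] val_updv by auto

lemma up_iff:
  assumes "wf_str W b" "s \<epsilon> W" "function_on s omega" "s' \<epsilon> W" "natural i"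
  shows "up W s i x s' <-> s' = updv s i x"
proof
  assume u: "up W s i x s'"
  then have f: "function_on s' omega" unfolding up_def by blast
  show "s' = updv s i x"
  proof (rule function_on_omega_eqI[OF f function_on_updv])
    fix k assume k: "natural k"
    have "opair k (val s' k) \<epsilon> s'" using function_on_val[OF f] k by simp
    then have "k = i \<and> val s' k = x \<or> k \<noteq> i \<and> opair k (val s' k) \<epsilon> s"
      using u wf_natural[OF assms(1) k] wf_val[OF assms(1,4) f k] unfolding up_def by blast
    then show "val s' k = val (updv s i x) k"
      using function_on_opair_iff[OF assms(3)] val_updv[OF k] by auto
  qed
next
  assume "s' = updv s i x"
  then show "up W s i x s'"
    unfolding up_def using function_on_updv opair_updv function_on_opair_iff[OF assms(3)] by auto
qed

lemma cmp_iff: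
  assumes "wf_str W b" "s \<epsilon> W" "function_on s omega" "\<pi> \<epsilon> W"
  shows "cmp W \<pi> s \<sigma> <-> function_on \<sigma> omega \<and> (\<forall>k. natural k --> opair (val s k) (val \<sigma> k) \<epsilon> \<pi>)"
proof (cases "function_on \<sigma> omega")
  case True
  have "(\<forall>k. k \<epsilon> W --> (\<forall>v. v \<epsilon> W --> opair k v \<epsilon> s --> (\<exists>w. w \<epsilon> W \<and> opair v w \<epsilon> \<pi> \<and> opair k w \<epsilon> \<sigma>))) <->
    (\<forall>k. natural k --> opair (val s k) (val \<sigma> k) \<epsilon> \<pi>)"
    unfolding function_on_opair_iff[OF True] function_on_opair_iff[OF assms(3)] mem_omega
    using wf_natural[OF assms(1)] wf_val[OF assms(1-3)] wf_opairD(2)[OF assms(1) _ assms(4)] by blast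
  then show ?thesis unfolding cmp_def by blast
qed (simp add: cmp_def)

lemma total_iff:
  assumes "wf_str W b" "s \<epsilon> W" "function_on s omega"
  shows "total W M s <-> (\<forall>k. natural k --> val s k \<epsilon> M)"
  unfolding total_def function_on_opair_iff[OF assms(3)] mem_omega
  using wf_natural[OF assms(1)] wf_val[OF assms] by blast

lemma clF_iff:
  assumes "wf_str W b" "F \<epsilon> W"
  shows "clF W F <-> fml_closed F"
proof -
  have e: "(\<exists>p. p \<epsilon> W \<and> p \<epsilon> F \<and> p = q) <-> q \<epsilon> F" for q using wf_transD[OF assms, of q] by blast
  show ?thesis unfolding clF_def fml_closed_def mem_omega e
    by (intro arg_cong2[where f = "(\<and>)"]; use wf_natural[OF assms(1)] wf_transD[OF assms] in meson)
qed

lemma tarski_iff: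
  assumes "wf_str W b" "s \<epsilon> W" "function_on s omega" "F \<epsilon> W" "fml_closed F"
  shows "tarski W F E s <->
     (\<forall>i j. natural i \<and> natural j --> (E (cMem i j) <-> val s i \<epsilon> val s j) \<and> (E (cEq i j) <-> val s i = val s j)) \<and>
     (\<forall>\<chi>. \<chi> \<epsilon> F --> (E (cNeg \<chi>) <-> \<not> E \<chi>)) \<and>
     (\<forall>\<chi> \<chi>'. \<chi> \<epsilon> F \<and> \<chi>' \<epsilon> F --> (E (cConj \<chi> \<chi>') <-> E \<chi> \<and> E \<chi>'))"
proof -
  note t = wf_transD[OF assms(1,4)] and v = wf_val[OF assms(1-3)] and n = wf_natural[OF assms(1)]
  note c = assms(5)[unfolded fml_closed_def mem_omega]
  have m: "(\<exists>u. u \<epsilon> W \<and> (\<exists>v. v \<epsilon> W \<and> opair i u \<epsilon> s \<and> opair j v \<epsilon> s \<and> u \<epsilon> v)) <-> val s i \<epsilon> val s j"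
    "(\<exists>u. u \<epsilon> W \<and> opair i u \<epsilon> s \<and> opair j u \<epsilon> s) <-> val s i = val s j" if "natural i" "natural j" for i j
    unfolding function_on_opair_iff[OF assms(3)] mem_omega using that v by auto
  have "(\<forall>i. i \<epsilon> W --> (\<forall>j. j \<epsilon> W --> (\<forall>p. p \<epsilon> W --> natural i \<and> natural j -->
       (p = cMem i j --> (E p <-> (\<exists>u. u \<epsilon> W \<and> (\<exists>v. v \<epsilon> W \<and> opair i u \<epsilon> s \<and> opair j v \<epsilon> s \<and> u \<epsilon> v)))) \<and>
       (p = cEq i j --> (E p <-> (\<exists>u. u \<epsilon> W \<and> opair i u \<epsilon> s \<and> opair j u \<epsilon> s)))))) <->
     (\<forall>i j. natural i \<and> natural j --> (E (cMem i j) <-> val s i \<epsilon> val s j) \<and> (E (cEq i j) <-> val s i = val s j))"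
    (is "?l <-> ?r")
  proof
    assume l: ?l
    show ?r
    proof (intro allI impI)
      fix i j assume ij: "natural i \<and> natural j"
      have "cMem i j \<epsilon> F" "cEq i j \<epsilon> F" using c[THEN conjunct1, rule_format, OF ij] by simp_all
      then have "cMem i j \<epsilon> W" "cEq i j \<epsilon> W" using t by simp_all
      then show "(E (cMem i j) <-> val s i \<epsilon> val s j) \<and> (E (cEq i j) <-> val s i = val s j)"
        using l[rule_format, of i j "cMem i j"] l[rule_format, of i j "cEq i j"] m[of i j] n[of i] n[of j] ij by argo
    qed
  next
    assume r: ?r
    show ?l by (intro allI impI) (use r m in simp)
  qed
  moreover have "(\<forall>\<chi>. \<chi> \<epsilon> W --> (\<forall>p. p \<epsilon> W --> \<chi> \<epsilon> F \<and> p = cNeg \<chi> --> (E p <-> \<not> E \<chi>))) <->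
      (\<forall>\<chi>. \<chi> \<epsilon> F --> (E (cNeg \<chi>) <-> \<not> E \<chi>))"
    using t c by metis
  moreover have "(\<forall>\<chi>. \<chi> \<epsilon> W --> (\<forall>\<chi>'. \<chi>' \<epsilon> W --> (\<forall>p. p \<epsilon> W --> \<chi> \<epsilon> F \<and> \<chi>' \<epsilon> F \<and> p = cConj \<chi> \<chi>' -->
       (E p <-> E \<chi> \<and> E \<chi>')))) <-> (\<forall>\<chi> \<chi>'. \<chi> \<epsilon> F \<and> \<chi>' \<epsilon> F --> (E (cConj \<chi> \<chi>') <-> E \<chi> \<and> E \<chi>'))"
    using t c by metis
  ultimately show ?thesis unfolding tarski_def by argo
qed

lemma TS_Sat:
  assumes wf: "wf_str W b" and F: "F \<epsilon> W" "fml_closed F" and U: "clU W" and A: "A \<epsilon> W"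
    and TS: "TS W F A \<tau>" and \<chi>: "fml \<chi>" and \<sigma>: "\<sigma> \<epsilon> W" "asn A \<sigma>"
  shows "opair \<chi> \<sigma> \<epsilon> \<tau> <-> Sat A \<sigma> \<chi>"
proof -
  have FF: "fml \<psi> ==> \<psi> \<epsilon> F" for \<psi> using F(2) unfolding fml_def by blast
  have pre: "function_on s omega \<and> (\<forall>k. k \<epsilon> W --> (\<forall>v. v \<epsilon> W --> opair k v \<epsilon> s --> v \<epsilon> A))" if "asn A s" for s
    using that function_on_opair_iff unfolding asn_def by auto
  have tar: "tarski W F (\<lambda>p. opair p s \<epsilon> \<tau>) s" and
    all: "\<And>i \<psi>. natural i ==> fml \<psi> ==> opair (cAll i \<psi>) s \<epsilon> \<tau> <-> (\<forall>x. x \<epsilon> A --> opair \<psi> (updv s i x) \<epsilon> \<tau>)"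
    if s: "s \<epsilon> W" "asn A s" for s
  proof -
    note t = TS[unfolded TS_def, rule_format, OF s(1) pre[OF s(2)]]
    show "tarski W F (\<lambda>p. opair p s \<epsilon> \<tau>) s" using t by blast
    fix i \<psi> assume i: "natural i" "fml \<psi>"
    have "cAll i \<psi> \<epsilon> F" "\<psi> \<epsilon> F" using FF[OF fml_intros(5)[OF i]] FF[OF i(2)] .
    then have c: "cAll i \<psi> \<epsilon> W" "\<psi> \<epsilon> W" "\<psi> \<epsilon> F" "i \<epsilon> W" using wf_transD[OF wf F(1)] wf_natural[OF wf] i by blast+
    have "opair (cAll i \<psi>) s \<epsilon> \<tau> <-> (\<forall>x. x \<epsilon> W --> x \<epsilon> A --> (\<forall>s'. s' \<epsilon> W --> up W s i x s' --> opair \<psi> s' \<epsilon> \<tau>))"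
      using t c i by blast
    also have "\<dots> <-> (\<forall>x. x \<epsilon> A --> opair \<psi> (updv s i x) \<epsilon> \<tau>)"
    proof -
      have "(\<forall>s'. s' \<epsilon> W --> up W s i x s' --> opair \<psi> s' \<epsilon> \<tau>) <-> opair \<psi> (updv s i x) \<epsilon> \<tau>" if "x \<epsilon> A" for x
      proof -
        have "x \<epsilon> W" using wf_transD[OF wf A that] .
        then obtain s' where s': "s' \<epsilon> W" "up W s i x s'" using U s asn_function c i unfolding clU_def by blast
        note u = up_iff[OF wf s(1) asn_function[OF s(2)] _ i(1), where x = x]
        have "updv s i x \<epsilon> W" using s' u[OF s'(1)] by simp
        then show ?thesis using u by metis
      qed
      then show ?thesis using wf_transD[OF wf A] by blast
    qed
    finally show "opair (cAll i \<psi>) s \<epsilon> \<tau> <-> (\<forall>x. x \<epsilon> A --> opair \<psi> (updv s i x) \<epsilon> \<tau>)" .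
  qed
  have tar': "(natural i \<and> natural j --> (opair (cMem i j) s \<epsilon> \<tau> <-> val s i \<epsilon> val s j) \<and> (opair (cEq i j) s \<epsilon> \<tau> <-> val s i = val s j)) \<and>
     (fml \<psi> --> (opair (cNeg \<psi>) s \<epsilon> \<tau> <-> \<not> opair \<psi> s \<epsilon> \<tau>)) \<and>
     (fml \<psi> \<and> fml \<psi>' --> (opair (cConj \<psi> \<psi>') s \<epsilon> \<tau> <-> opair \<psi> s \<epsilon> \<tau> \<and> opair \<psi>' s \<epsilon> \<tau>))"
    if s: "s \<epsilon> W" "asn A s" for s i j \<psi> \<psi>'
  proof -
    note t = tar[OF s, unfolded tarski_iff[OF wf s(1) asn_function[OF s(2)] F]]
    show ?thesis
      using t[THEN conjunct1, rule_format, of i j] t[THEN conjunct2, THEN conjunct1, rule_format, OF FF, of \<psi>]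
        t[THEN conjunct2, THEN conjunct2, rule_format, of \<psi> \<psi>'] FF[of \<psi>] FF[of \<psi>'] by argo
  qed
  define P where "P \<psi> <-> (\<forall>s. s \<epsilon> W \<and> asn A s --> (opair \<psi> s \<epsilon> \<tau> <-> Sat A s \<psi>))" for \<psi>
  have "P \<chi>"
  proof (rule fml_induct[where P = P, OF _ \<chi>])
    show "fo1 P" unfolding P_def by (intro fo_intros)
    fix i \<psi> assume i: "natural i" "fml \<psi>" and P: "P \<psi>"
    have "updv s i x \<epsilon> W" if "s \<epsilon> W" "asn A s" "x \<epsilon> A" for s x
    proof -
      have "\<exists>s'. s' \<epsilon> W \<and> up W s i x s'"
        using U that asn_function i wf_natural[OF wf] wf_transD[OF wf A] unfolding clU_def by blast
      then show ?thesis using up_iff[OF wf that(1) asn_function[OF that(2)] _ i(1)] by auto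
    qed
    then show "P (cAll i \<psi>)" using P i unfolding P_def by (simp add: all Sat_simps(5) asn_updv cong: conj_cong)
  qed (use tar' in \<open>simp_all add: P_def Sat_simps(1-4)\<close>)
  then show ?thesis using \<sigma> unfolding P_def by blast
qed

theorem los:
  assumes wf: "wf_str W b" and F: "F \<epsilon> W" "fml_closed F" and U: "clU W"
    and B: "clB W b c h Tf F" and C: "clC W b c h Tf F" and D: "clD W b c h Tf F"
    and \<psi>: "fml \<psi>" and s: "s \<epsilon> W" "function_on s omega" and T: "\<theta> \<epsilon> W" "T \<epsilon> W" "Cond W b c h Tf \<theta> T"
    and tot: "\<forall>M. M \<epsilon> T --> total W M s"
  shows "((\<forall>M. M \<epsilon> T --> Ev W c h Tf F M \<psi> s) --> Sat W s \<psi>) \<and> ((\<forall>M. M \<epsilon> T --> \<not> Ev W c h Tf F M \<psi> s) --> \<not> Sat W s \<psi>)"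
proof -
  let ?E = "\<lambda>M \<psi> s. Ev W c h Tf F M \<psi> s" and ?C = "Cond W b c h Tf"
  have FF: "fml \<psi> ==> \<psi> \<epsilon> F" for \<psi> using F(2) unfolding fml_def by blast
  have FW: "fml \<psi> ==> \<psi> \<epsilon> W" for \<psi> using FF wf_transD[OF wf F(1)] by blast
  have asn: "asn W s" if "s \<epsilon> W" "function_on s omega" for s unfolding asn_def using that wf_val[OF wf that] by blast
  have TW: "M \<epsilon> W" if "M \<epsilon> T" "T \<epsilon> W" for M T using that wf_transD[OF wf] by blast
  have ne: "\<exists>M. M \<epsilon> T \<and> M \<epsilon> W" if "?C \<theta> T" for \<theta> T using that unfolding Cond_def by blast
  define good where "good \<theta> T s <-> \<theta> \<epsilon> W \<and> T \<epsilon> W \<and> ?C \<theta> T \<and> s \<epsilon> W \<and> function_on s omega \<and> (\<forall>M. M \<epsilon> T --> total W M s)"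
    for \<theta> T s
  have BB: "tarski W F (\<lambda>p. ?E M p s) s" "natural i ==> fml \<chi> ==> ?E M (cAll i \<chi>) s ==> x \<epsilon> M ==> updv s i x \<epsilon> W ==> ?E M \<chi> (updv s i x)"
    if g: "good \<theta> T s" "M \<epsilon> T" for \<theta> T s M i \<chi> x
  proof -
    have pre: "\<theta> \<epsilon> W" "T \<epsilon> W" "M \<epsilon> W" "s \<epsilon> W" "?C \<theta> T \<and> M \<epsilon> T \<and> function_on s omega \<and> total W M s"
      using g TW unfolding good_def by blast+
    note b = B[unfolded clB_def, rule_format, OF pre]
    show "tarski W F (\<lambda>p. ?E M p s) s" using b by blast
    assume i: "natural i" "fml \<chi>" "?E M (cAll i \<chi>) s" "x \<epsilon> M" "updv s i x \<epsilon> W"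
    have "up W s i x (updv s i x)" using up_iff[OF wf] pre i by blast
    then show "?E M \<chi> (updv s i x)"
      using b i FF FW[OF i(2)] FW[OF fml_intros(5)[OF i(1,2)]] wf_natural[OF wf] TW[OF i(4) pre(3)] by blast
  qed
  have tar: "(natural i \<and> natural j --> (?E M (cMem i j) s <-> val s i \<epsilon> val s j) \<and> (?E M (cEq i j) s <-> val s i = val s j)) \<and>
     (fml \<psi> --> (?E M (cNeg \<psi>) s <-> \<not> ?E M \<psi> s)) \<and>
     (fml \<psi> \<and> fml \<psi>' --> (?E M (cConj \<psi> \<psi>') s <-> ?E M \<psi> s \<and> ?E M \<psi>' s))"
    if g: "good \<theta> T s" "M \<epsilon> T" for \<theta> T s M i j \<psi> \<psi>'
  proof -
    have "s \<epsilon> W" "function_on s omega" using g unfolding good_def by blast+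
    note t = BB(1)[OF g, unfolded tarski_iff[OF wf this F]]
    show ?thesis
      using t[THEN conjunct1, rule_format, of i j] t[THEN conjunct2, THEN conjunct1, rule_format, OF FF, of \<psi>]
        t[THEN conjunct2, THEN conjunct2, rule_format, of \<psi> \<psi>'] FF[of \<psi>] FF[of \<psi>'] by argo
  qed
  have refine: "\<exists>\<theta>' T'. good \<theta>' T' s' \<and> good \<theta>' T' s \<and> ((\<forall>M. M \<epsilon> T' --> ?E M \<chi> s') \<or> (\<forall>M. M \<epsilon> T' --> \<not> ?E M \<chi> s')) \<and>
      (\<forall>M'. M' \<epsilon> T' --> (\<exists>M. M \<epsilon> T \<and> (\<forall>x. x \<epsilon> M --> x \<epsilon> M') \<and> (\<forall>\<chi>. fml \<chi> --> (?E M' \<chi> s <-> ?E M \<chi> s))))"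
    if g: "good \<theta> T s" and s': "s' \<epsilon> W" "function_on s' omega" and \<chi>: "fml \<chi>" for \<theta> T s s' \<chi>
  proof -
    have pre: "\<theta> \<epsilon> W" "T \<epsilon> W" "?C \<theta> T \<and> function_on s' omega \<and> \<chi> \<epsilon> F" using g s' FF[OF \<chi>] unfolding good_def by blast+
    obtain \<theta>' T' where T': "\<theta>' \<epsilon> W" "T' \<epsilon> W" "?C \<theta>' T'" "Le W c h Tf F T' T" "\<forall>M. M \<epsilon> W --> M \<epsilon> T' --> total W M s'"
      "(\<forall>M. M \<epsilon> W --> M \<epsilon> T' --> ?E M \<chi> s') \<or> (\<forall>M. M \<epsilon> W --> M \<epsilon> T' --> \<not> ?E M \<chi> s')"
      using C[unfolded clC_def, rule_format, OF pre(1,2) s'(1) FW[OF \<chi>] pre(3)] by blast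
    have le: "\<exists>M. M \<epsilon> T \<and> (\<forall>x. x \<epsilon> M --> x \<epsilon> M') \<and> (\<forall>\<chi>. fml \<chi> --> (?E M' \<chi> s <-> ?E M \<chi> s))" if M': "M' \<epsilon> T'" for M'
    proof -
      obtain M where M: "M \<epsilon> T" "\<forall>x. x \<epsilon> W --> x \<epsilon> M --> x \<epsilon> M'" "\<forall>\<chi>. \<chi> \<epsilon> W --> (\<forall>s. s \<epsilon> W --> \<chi> \<epsilon> F \<and> function_on s omega \<and> total W M s --> (?E M' \<chi> s <-> ?E M \<chi> s))"
        using T'(4)[unfolded Le_def] M' TW[OF M' T'(2)] by blast
      have "s \<epsilon> W" "function_on s omega" "total W M s" using g M(1) unfolding good_def by blast+
      then show ?thesis using M FF FW TW[OF _ TW[OF M(1) pre(2)]] by (intro exI[of _ M]) blast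
    qed
    moreover have "total W M' s" if M': "M' \<epsilon> T'" for M'
    proof -
      obtain M where M: "M \<epsilon> T" "\<forall>x. x \<epsilon> M --> x \<epsilon> M'" using le[OF M'] by blast
      then have "total W M s" using g unfolding good_def by blast
      then show ?thesis using M(2) unfolding total_def by blast
    qed
    ultimately have "good \<theta>' T' s \<and> good \<theta>' T' s'"
      using g T' s' TW[OF _ T'(2)] unfolding good_def by blast
    moreover have "(\<forall>M. M \<epsilon> T' --> ?E M \<chi> s') \<or> (\<forall>M. M \<epsilon> T' --> \<not> ?E M \<chi> s')" using T'(6) TW[OF _ T'(2)] by blast
    ultimately show ?thesis using le by (intro exI[of _ \<theta>'] exI[of _ T']) blast
  qed
  define P where "P \<psi> <-> (\<forall>s \<theta> T. good \<theta> T s -->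
     ((\<forall>M. M \<epsilon> T --> ?E M \<psi> s) --> Sat W s \<psi>) \<and> ((\<forall>M. M \<epsilon> T --> \<not> ?E M \<psi> s) --> \<not> Sat W s \<psi>))" for \<psi>
  have sas: "asn W s" if "good \<theta> T s" for \<theta> T s using that asn unfolding good_def by blast
  have neg: "\<exists>M. M \<epsilon> T" if "good \<theta> T s" for \<theta> T s using that ne unfolding good_def by blast
  have "P \<psi>"
  proof (rule fml_induct[where P = P, OF _ \<psi>])
    have "fo mem (\<lambda>e. Ev W c h Tf F (e 0) (e (Suc 0)) (e (Suc (Suc 0))))"
      unfolding Ev_def Pt_def TS_def tarski_def cmp_def up_def by (intro fo_intros)
    note foE = fo_sub3[OF this]
    show "fo1 P"
      unfolding P_def good_def Cond_def total_def JJ_def J_def Pt_def cmp_def by (intro fo_intros foE)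
  next
    fix i j assume ij: "natural i" "natural j"
    have "(?E M (cMem i j) s <-> Sat W s (cMem i j)) \<and> (?E M (cEq i j) s <-> Sat W s (cEq i j))"
      if "good \<theta> T s" "M \<epsilon> T" for \<theta> T s M
      using tar[OF that, of i j] ij Sat_simps(1,2)[OF sas[OF that(1)] ij] by blast
    then show "P (cMem i j)" "P (cEq i j)" unfolding P_def using neg by blast+
  next
    fix \<psi> assume \<psi>: "fml \<psi>" "P \<psi>"
    show "P (cNeg \<psi>)" unfolding P_def
    proof (intro allI impI)
      fix s \<theta> T assume g: "good \<theta> T s"
      show "((\<forall>M. M \<epsilon> T --> ?E M (cNeg \<psi>) s) --> Sat W s (cNeg \<psi>)) \<and> ((\<forall>M. M \<epsilon> T --> \<not> ?E M (cNeg \<psi>) s) --> \<not> Sat W s (cNeg \<psi>))"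
        using \<psi>(2)[unfolded P_def, rule_format, OF g] tar[OF g] \<psi>(1) Sat_simps(3)[OF sas[OF g] \<psi>(1)] by blast
    qed
  next
    fix \<psi> \<psi>' assume \<psi>: "fml \<psi>" "fml \<psi>'" "P \<psi>" "P \<psi>'"
    show "P (cConj \<psi> \<psi>')" unfolding P_def
    proof (intro allI impI conjI)
      fix s \<theta> T assume g: "good \<theta> T s"
      note S = Sat_simps(4)[OF sas[OF g] \<psi>(1,2)]
      show "Sat W s (cConj \<psi> \<psi>')" if "\<forall>M. M \<epsilon> T --> ?E M (cConj \<psi> \<psi>') s"
        using \<psi>(3,4)[unfolded P_def, rule_format, OF g] tar[OF g] \<psi>(1,2) S that by blast
      assume no: "\<forall>M. M \<epsilon> T --> \<not> ?E M (cConj \<psi> \<psi>') s"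
      have sW: "s \<epsilon> W" "function_on s omega" using g unfolding good_def by blast+
      obtain \<theta>' T' where T': "good \<theta>' T' s" "(\<forall>M. M \<epsilon> T' --> ?E M \<psi> s) \<or> (\<forall>M. M \<epsilon> T' --> \<not> ?E M \<psi> s)"
        "\<And>M'. M' \<epsilon> T' ==> \<exists>M. M \<epsilon> T \<and> (\<forall>x. x \<epsilon> M --> x \<epsilon> M') \<and> (\<forall>\<chi>. fml \<chi> --> (?E M' \<chi> s <-> ?E M \<chi> s))"
        using refine[OF g sW \<psi>(1)] by blast
      have "\<not> ?E M' (cConj \<psi> \<psi>') s" if "M' \<epsilon> T'" for M' using T'(3)[OF that] no fml_intros(4)[OF \<psi>(1,2)] by blast
      then have "\<not> (?E M' \<psi> s \<and> ?E M' \<psi>' s)" if "M' \<epsilon> T'" for M' using tar[OF T'(1) that] \<psi>(1,2) that by blast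
      then show "\<not> Sat W s (cConj \<psi> \<psi>')"
        using \<psi>(3,4)[unfolded P_def, rule_format, OF T'(1)] T'(2) S by blast
    qed
  next
    fix i \<psi> assume i: "natural i" "fml \<psi>" and \<psi>: "P \<psi>"
    show "P (cAll i \<psi>)" unfolding P_def
    proof (intro allI impI conjI)
      fix s \<theta> T assume g: "good \<theta> T s"
      have pre: "\<theta> \<epsilon> W" "T \<epsilon> W" "s \<epsilon> W" "?C \<theta> T" "function_on s omega" "\<forall>M. M \<epsilon> T --> total W M s"
        using g unfolding good_def by blast+
      note S = Sat_simps(5)[OF sas[OF g] i]
      have u: "updv s i x \<epsilon> W" if "x \<epsilon> W" for x
      proof -
        have "\<exists>s'. s' \<epsilon> W \<and> up W s i x s'"
          using U pre i wf_natural[OF wf] that unfolding clU_def by blast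
        then show ?thesis using up_iff[OF wf pre(3,5) _ i(1)] by auto
      qed
      show "Sat W s (cAll i \<psi>)" if ev: "\<forall>M. M \<epsilon> T --> ?E M (cAll i \<psi>) s" unfolding S
      proof (intro allI impI)
        fix x assume x: "x \<epsilon> W"
        obtain \<theta>' T' where T': "good \<theta>' T' (updv s i x)" "good \<theta>' T' s"
          "\<And>M'. M' \<epsilon> T' ==> \<exists>M. M \<epsilon> T \<and> (\<forall>x. x \<epsilon> M --> x \<epsilon> M') \<and> (\<forall>\<chi>. fml \<chi> --> (?E M' \<chi> s <-> ?E M \<chi> s))"
          using refine[OF g u[OF x] function_on_updv i(2)] by blast
        have "x \<epsilon> M" if "M \<epsilon> T'" for M
        proof -
          have "total W M (updv s i x)" using T'(1) that unfolding good_def by blast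
          then show ?thesis using total_iff[OF wf u[OF x] function_on_updv] val_updv[OF i(1)] i(1) by fastforce
        qed
        moreover have "?E M (cAll i \<psi>) s" if "M \<epsilon> T'" for M
          using T'(3)[OF that] ev fml_intros(5)[OF i] by blast
        ultimately have "?E M \<psi> (updv s i x)" if "M \<epsilon> T'" for M
          using BB(2)[OF T'(2) that i _ _ u[OF x]] that by blast
        then show "Sat W (updv s i x) \<psi>" using \<psi>[unfolded P_def, rule_format, OF T'(1)] by blast
      qed
      assume no: "\<forall>M. M \<epsilon> T --> \<not> ?E M (cAll i \<psi>) s"
      have "cAll i \<psi> \<epsilon> F" "\<psi> \<epsilon> F" using FF[OF fml_intros(5)[OF i]] FF[OF i(2)] .
      then have preD: "?C \<theta> T \<and> function_on s omega \<and> natural i \<and> \<psi> \<epsilon> F \<and> cAll i \<psi> = cAll i \<psi> \<and>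
        (\<forall>M. M \<epsilon> W --> M \<epsilon> T --> total W M s \<and> \<not> ?E M (cAll i \<psi>) s)"
        using pre no i by simp
      obtain \<theta>' T' x s' where T': "\<theta>' \<epsilon> W" "T' \<epsilon> W" "x \<epsilon> W" "s' \<epsilon> W" "?C \<theta>' T'" "up W s i x s'"
        "\<forall>M. M \<epsilon> W --> M \<epsilon> T' --> total W M s' \<and> \<not> ?E M \<psi> s'"
        using D[unfolded clD_def, rule_format, OF pre(1-3) wf_natural[OF wf i(1)] FW[OF i(2)] FW[OF fml_intros(5)[OF i]] preD]
        by blast
      have s': "s' = updv s i x" using up_iff[OF wf pre(3,5) T'(4) i(1)] T'(6) by blast
      have "good \<theta>' T' s'" using T' TW[OF _ T'(2)] s' function_on_updv unfolding good_def by blast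
      then have "\<not> Sat W s' \<psi>" using \<psi>[unfolded P_def, rule_format, of \<theta>' T' s'] T'(7) TW[OF _ T'(2)] by blast
      then show "\<not> Sat W s (cAll i \<psi>)" unfolding S s' using T'(3) by blast
    qed
  qed
  moreover have "good \<theta> T s" unfolding good_def using assms by blast
  ultimately show ?thesis unfolding P_def by blast
qed

text \<open>By \<open>los\<close>, a structure satisfying \<open>Theta\<close> has a member that also does: the set \<open>A\<close> of some \<open>M\<close>.\<close>

theorem not_Theta: "wf_str W b ==> \<not> Theta W b"
proof -
  obtain \<psi> where \<psi>: "fml \<psi>" "\<And>W b. wf_str W b ==> Theta W b <-> Sat W (updv b empty b) \<psi>"
    using coded_Theta unfolding coded_def by auto
  define P where "P W <-> (\<forall>b. wf_str W b --> \<not> Sat W (updv b empty b) \<psi>)" for W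
  have "P W" for W
  proof (rule mem_induct[where P = P])
    show "fo1 P" unfolding P_def wf_str_def by (intro fo_intros)
    fix W assume IH: "\<And>A. A \<epsilon> W ==> P A"
    show "P W" unfolding P_def
    proof (intro allI impI notI)
      fix b assume wf: "wf_str W b" and sat: "Sat W (updv b empty b) \<psi>"
      have "Theta W b" using \<psi>(2)[OF wf] sat by blast
      then obtain h Tf F \<theta> T where F: "F \<epsilon> W" and cl: "clF W F" "clU W" and T: "\<theta> \<epsilon> W" "T \<epsilon> W" "Cond W b b h Tf \<theta> T"
        and B: "clB W b b h Tf F" "clC W b b h Tf F" "clD W b b h Tf F"
        unfolding Theta_def by blast
      note F' = F cl(1)[unfolded clF_iff[OF wf F]]
      let ?s = "updv b empty b"
      have b: "b \<epsilon> W" "function_on b omega" using wf unfolding wf_str_def by blast+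
      have "\<exists>s. s \<epsilon> W \<and> up W b empty b s"
        using cl(2) b wf_natural[OF wf natural_empty] unfolding clU_def by simp
      then have s: "?s \<epsilon> W" using up_iff[OF wf b _ natural_empty] by auto
      have FW: "\<psi> \<epsilon> F" using F'(2) \<psi>(1) unfolding fml_def by blast
      have pre: "Cond W b b h Tf \<theta> T \<and> function_on ?s omega \<and> \<psi> \<epsilon> F" using T(3) function_on_updv FW by blast
      obtain \<theta>' T' where T': "\<theta>' \<epsilon> W" "T' \<epsilon> W" "Cond W b b h Tf \<theta>' T'" "\<forall>M. M \<epsilon> W --> M \<epsilon> T' --> total W M ?s"
        "(\<forall>M. M \<epsilon> W --> M \<epsilon> T' --> Ev W b h Tf F M \<psi> ?s) \<or> (\<forall>M. M \<epsilon> W --> M \<epsilon> T' --> \<not> Ev W b h Tf F M \<psi> ?s)"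
        using B(2)[unfolded clC_def, rule_format, OF T(1,2) s wf_transD[OF wf F FW] pre] by blast
      note TW = wf_transD[OF wf T'(2)]
      obtain M where M: "M \<epsilon> T'" "M \<epsilon> W" using T'(3) unfolding Cond_def by blast
      have "\<forall>M. M \<epsilon> T' --> total W M ?s" using T'(4) TW by blast
      then have "\<not> (\<forall>M. M \<epsilon> T' --> \<not> Ev W b h Tf F M \<psi> ?s)"
        using los[OF wf F' cl(2) B \<psi>(1) s function_on_updv T'(1-3)] sat by blast
      then have "\<not> (\<forall>M. M \<epsilon> W --> M \<epsilon> T' --> \<not> Ev W b h Tf F M \<psi> ?s)" using TW by meson
      then have "\<forall>M. M \<epsilon> W --> M \<epsilon> T' --> Ev W b h Tf F M \<psi> ?s" using T'(5) by argo
      then have "Ev W b h Tf F M \<psi> ?s" using M by simp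
      then obtain A \<pi> \<tau> \<sigma> where A: "A \<epsilon> W" "\<pi> \<epsilon> W" "\<sigma> \<epsilon> W" "Pt W b h Tf M A \<pi>" "TS W F A \<tau>"
        "cmp W \<pi> ?s \<sigma>" "opair \<psi> \<sigma> \<epsilon> \<tau>"
        unfolding Ev_def by blast
      note pt = A(4)[unfolded Pt_def]
      have ranA: "y \<epsilon> A" if xy: "opair x y \<epsilon> \<pi>" for x y
      proof -
        obtain x' y' where "opair x y = opair x' y'" "y' \<epsilon> A"
          using pt[THEN conjunct2, THEN conjunct1, rule_format, OF wf_transD[OF wf A(2) xy] xy] by blast
        then show ?thesis by simp
      qed
      have coll: "\<forall>x. x \<epsilon> W --> (\<forall>y. y \<epsilon> W --> opair x y \<epsilon> \<pi> -->
        (\<forall>z. z \<epsilon> W --> (z \<epsilon> y <-> (\<exists>x'. x' \<epsilon> W \<and> x' \<epsilon> x \<and> opair x' z \<epsilon> \<pi>))))"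
        by (rule pt[THEN conjunct2, THEN conjunct2, THEN conjunct2, THEN conjunct1])
      have sv: "y = y'" if "opair x y \<epsilon> \<pi>" "opair x y' \<epsilon> \<pi>" for x y y'
      proof (rule set_eqI)
        fix z
        have xy: "x \<epsilon> W" "y \<epsilon> W" "y' \<epsilon> W" using wf_opairD[OF wf _ A(2)] that by blast+
        have "z \<epsilon> y <-> z \<epsilon> y'" if "z \<epsilon> W"
          using coll[rule_format, OF xy(1,2) \<open>opair x y \<epsilon> \<pi>\<close> that] coll[rule_format, OF xy(1,3) \<open>opair x y' \<epsilon> \<pi>\<close> that] by argo
        then show "z \<epsilon> y <-> z \<epsilon> y'" using wf_transD[OF wf xy(2)] wf_transD[OF wf xy(3)] by blast
      qed
      obtain c where c: "c \<epsilon> W" "opair b c \<epsilon> \<pi>" "cmp W \<pi> b c" and trA: "transitive A"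
        using pt[THEN conjunct2, THEN conjunct2, THEN conjunct2, THEN conjunct2, THEN conjunct2] by blast
      note c' = c(3)[unfolded cmp_iff[OF wf b A(2)]]
      note \<sigma> = A(6)[unfolded cmp_iff[OF wf s function_on_updv A(2)]]
      have eq: "\<sigma> = updv c empty c"
      proof (rule function_on_omega_eqI[OF _ function_on_updv])
        show "function_on \<sigma> omega" using \<sigma> by blast
        fix k assume k: "natural k"
        have 1: "opair (val ?s k) (val \<sigma> k) \<epsilon> \<pi>" "opair (val b k) (val c k) \<epsilon> \<pi>" using \<sigma> c' k by blast+
        show "val \<sigma> k = val (updv c empty c) k"
          using sv[OF 1(1), of c] sv[OF 1(1), of "val c k"] 1(2) c(2) by (auto simp: val_updv[OF k] split: if_splits)
      qed
      have "asn A \<sigma>" using \<sigma> ranA unfolding asn_def by blast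
      then have "Sat A (updv c empty c) \<psi>"
        using TS_Sat[OF wf F' cl(2) A(1,5) \<psi>(1) A(3)] A(7) eq by blast
      moreover have "wf_str A c" using trA ranA[OF c(2)] c' unfolding wf_str_def by blast
      ultimately show False using IH[OF A(1)] unfolding P_def by blast
    qed
  qed
  then show "wf_str W b ==> \<not> Theta W b" using \<psi>(2) unfolding P_def by blast
qed

end

section \<open>The universe computes its generic ultrapower\<close>

locale definable_tower = minimal_tower mem \<delta> I \<kappa>0 f0 \<kappa>1 S1 \<kappa>h + coded_universe mem \<delta> \<phi> n0
  for mem :: "'v => 'v => bool" (infix "\<epsilon>" 50) and \<delta> I \<kappa>0 f0 \<kappa>1 S1 \<kappa>h \<phi> n0 +
  fixes s0
  assumes s0: "asn Vd s0"
    and defines_tower: "\<And>\<theta> X. \<theta> \<epsilon> Vd ==> X \<epsilon> Vd ==> Sat Vd (updv s0 empty (opair \<theta> X)) \<phi> <-> \<theta> \<epsilon> Ix \<and> null \<theta> X"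
begin

definition hh :: 'v where "hh = Hl \<kappa>h"
definition Tf :: 'v where "Tf = lam (lift \<kappa>1 \<kappa>h S1) AA"
definition b0 :: 'v where "b0 = updv s0 empty (opair hh (opair Tf FF))"

lemma \<kappa>h_Ix: "\<kappa>h \<epsilon> Ix" using h(1) Sp_Ix by blast

lemma hh_Vd: "hh \<epsilon> Vd" unfolding hh_def using Hl_Vd[OF \<kappa>h_Ix] .

lemma opair_Tf: "opair M0 A \<epsilon> Tf <-> M0 \<epsilon> lift \<kappa>1 \<kappa>h S1 \<and> A = AA M0"
  unfolding Tf_def by (rule opair_mem_lam) (intro fo_intros)

lemma Tf_Vd: "Tf \<epsilon> Vd"
proof (rule Vd_subset)
  show "prod (Zl \<kappa>h) (Pow (Hl \<kappa>0)) \<epsilon> Vd"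
    using Vd_prod[OF Zl_Vd[OF \<kappa>h_Ix] Vd_Pow[OF Hl_Vd[OF Sp_Ix[OF Sp0]]]] .
  have "p \<epsilon> Tf <-> (\<exists>x. x \<epsilon> lift \<kappa>1 \<kappa>h S1 \<and> p = opair x (AA x))" for p
    unfolding Tf_def by (rule mem_lam) (intro fo_intros)
  then show "Tf \<sqsubseteq> prod (Zl \<kappa>h) (Pow (Hl \<kappa>0))"
    unfolding subset_def[of Tf] using AA_Hl0 by (auto simp: mem_lift)
qed

lemma asn_Vd: "asn Vd s ==> s \<epsilon> Vd"
proof (rule VdI)
  assume s: "asn Vd s"
  have m: "p \<epsilon> s <-> (\<exists>k. natural k \<and> p = opair k (val s k))" for p
    using function_on_mem[OF asn_function[OF s]] by simp
  have "k \<epsilon> Vd" if "natural k" for k using Vd_mem[OF omega_Vd] that by simp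
  then show "s \<sqsubseteq> Vd" unfolding subset_def m using Vd_opair asn_val[OF s] by blast
  show "small s"
    by (rule small_image[where F = "\<lambda>k. opair k (val s k)", OF _ small_omega]) (intro fo_intros, simp add: m)
qed

lemma asn_b0: "asn Vd b0"
  unfolding b0_def using asn_updv[OF s0 Vd_opair[OF hh_Vd Vd_opair[OF Tf_Vd FF_Vd]]] .

lemma wf0: "wf_str Vd b0"
  unfolding wf_str_def using transitive_Vd asn_Vd[OF asn_b0] asn_function[OF asn_b0] by blast

lemma b0_Vd: "b0 \<epsilon> Vd" and b0_fun: "function_on b0 omega"
  using wf0 unfolding wf_str_def by blast+

lemma fun_asn: "s \<epsilon> Vd ==> function_on s omega ==> asn Vd s"
  unfolding asn_def using wf_val[OF wf0] by blast

lemma updv_Vd: "s \<epsilon> Vd ==> function_on s omega ==> x \<epsilon> Vd ==> updv s i x \<epsilon> Vd"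
  using asn_Vd asn_updv fun_asn by blast

lemma up0: "s \<epsilon> Vd ==> function_on s omega ==> x \<epsilon> Vd ==> natural i ==> up Vd s i x (updv s i x)"
  using up_iff[OF wf0] updv_Vd by blast

lemma clU0: "clU Vd"
  unfolding clU_def using up0 updv_Vd by blast

lemma JJ0: "\<theta> \<epsilon> Vd ==> X \<epsilon> Vd ==> JJ Vd b0 \<theta> X <-> \<theta> \<epsilon> Ix \<and> null \<theta> X"
proof -
  assume v: "\<theta> \<epsilon> Vd" "X \<epsilon> Vd"
  have "updv b0 empty x = updv s0 empty x" for x
    by (rule function_on_omega_eqI[OF function_on_updv function_on_updv]) (simp add: val_updv b0_def)
  then show ?thesis unfolding JJ_def J_def using defines_tower[OF v] Vd_opair[OF v] by simp
qed

definition tr :: "'v => 'v => 'v" where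
  "tr \<pi> s = lam omega (\<lambda>k. val \<pi> (val s k))"

lemma function_on_tr: "function_on (tr \<pi> s) omega" and val_tr: "natural k ==> val (tr \<pi> s) k = val \<pi> (val s k)"
  and mem_tr: "p \<epsilon> tr \<pi> s <-> (\<exists>k. k \<epsilon> omega \<and> p = opair k (val \<pi> (val s k)))"
proof -
  have f: "fot mem (\<lambda>e. val \<pi> (val s (e 0)))" by (intro fo_intros)
  show "function_on (tr \<pi> s) omega" unfolding tr_def by (rule function_on_lam[OF f])
  show "natural k ==> val (tr \<pi> s) k = val \<pi> (val s k)" unfolding tr_def by (rule val_lam[OF f]) simp
  show "p \<epsilon> tr \<pi> s <-> (\<exists>k. k \<epsilon> omega \<and> p = opair k (val \<pi> (val s k)))" unfolding tr_def by (rule mem_lam[OF f])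
qed

lemma fot_tr [fo_intros]: "fot mem t ==> fot mem u ==> fot mem (\<lambda>e. tr (t e) (u e))"
  by (rule fot_sub2) (rule fot_set, rule mem_tr, intro fo_intros)

lemma tr_updv: "tr \<pi> (updv s i x) = updv (tr \<pi> s) i (val \<pi> x)"
  by (rule function_on_omega_eqI[OF function_on_tr function_on_updv]) (simp add: val_tr val_updv)

lemma cmp_tr:
  assumes \<pi>: "function_on \<pi> M" "\<pi> \<epsilon> Vd" and s: "s \<epsilon> Vd" "function_on s omega" "\<And>k. natural k ==> val s k \<epsilon> M"
  shows "cmp Vd \<pi> s \<sigma> <-> \<sigma> = tr \<pi> s"
proof
  assume "cmp Vd \<pi> s \<sigma>"
  then have c: "function_on \<sigma> omega" "\<And>k. natural k ==> opair (val s k) (val \<sigma> k) \<epsilon> \<pi>"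
    unfolding cmp_iff[OF wf0 s(1,2) \<pi>(2)] by blast+
  show "\<sigma> = tr \<pi> s"
    by (rule function_on_omega_eqI[OF c(1) function_on_tr])
      (use c(2) function_on_opair_iff[OF \<pi>(1)] val_tr in simp)
next
  assume "\<sigma> = tr \<pi> s"
  then show "cmp Vd \<pi> s \<sigma>" unfolding cmp_iff[OF wf0 s(1,2) \<pi>(2)]
    using function_on_tr val_tr function_on_val[OF \<pi>(1)] s(3) by simp
qed

lemma TS0:
  assumes A: "A \<epsilon> Vd" and T: "truth_set A \<tau>"
  shows "TS Vd FF A \<tau>"
  unfolding TS_def
proof (intro allI impI)
  fix s assume s: "s \<epsilon> Vd" "function_on s omega \<and> (\<forall>k. k \<epsilon> Vd --> (\<forall>v. v \<epsilon> Vd --> opair k v \<epsilon> s --> v \<epsilon> A))"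
  have f: "function_on s omega" using s(2) by blast
  have "val s k \<epsilon> A" if k: "natural k" for k
    using s(2) function_on_val[OF f, of k] wf_natural[OF wf0 k] wf_val[OF wf0 s(1) f k] k by simp
  then have a: "asn A s" unfolding asn_def using f by blast
  note t = T[unfolded truth_set_iff, rule_format, OF a]
  have "tarski Vd FF (\<lambda>p. opair p s \<epsilon> \<tau>) s"
    unfolding tarski_iff[OF wf0 s(1) f FF_Vd fml_closed_FF] mem_FF
    using t[THEN conjunct1] t[THEN conjunct2, THEN conjunct1] t[THEN conjunct2, THEN conjunct2, THEN conjunct1] by argo
  moreover have "opair (cAll i \<chi>) s \<epsilon> \<tau> <->
      (\<forall>x. x \<epsilon> Vd --> x \<epsilon> A --> (\<forall>s'. s' \<epsilon> Vd --> up Vd s i x s' --> opair \<chi> s' \<epsilon> \<tau>))" if i: "natural i" "fml \<chi>" for i \<chi>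
  proof -
    have "(\<forall>s'. s' \<epsilon> Vd --> up Vd s i x s' --> opair \<chi> s' \<epsilon> \<tau>) <-> opair \<chi> (updv s i x) \<epsilon> \<tau>" if "x \<epsilon> A" for x
      using up_iff[OF wf0 s(1) f _ i(1), of _ x] updv_Vd[OF s(1) f Vd_mem[OF A that], of i] by blast
    then show ?thesis
      using t[THEN conjunct2, THEN conjunct2, THEN conjunct2, rule_format, of i \<chi>] i Vd_mem[OF A] by auto
  qed
  ultimately show "tarski Vd FF (\<lambda>p. opair p s \<epsilon> \<tau>) s \<and>
     (\<forall>i. i \<epsilon> Vd --> (\<forall>\<chi>. \<chi> \<epsilon> Vd --> (\<forall>p. p \<epsilon> Vd --> natural i \<and> \<chi> \<epsilon> FF \<and> p = cAll i \<chi> -->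
       (opair p s \<epsilon> \<tau> <-> (\<forall>x. x \<epsilon> Vd --> x \<epsilon> A --> (\<forall>s'. s' \<epsilon> Vd --> up Vd s i x s' --> opair \<chi> s' \<epsilon> \<tau>))))))"
    unfolding mem_FF by simp
qed

abbreviation P0 :: "'v => 'v => 'v => bool" where "P0 \<equiv> Pt Vd b0 hh Tf"
abbreviation E0 :: "'v => 'v => 'v => bool" where "E0 \<equiv> Ev Vd b0 hh Tf FF"
abbreviation C0 :: "'v => 'v => bool" where "C0 \<equiv> Cond Vd b0 b0 hh Tf"

lemma PtD:
  assumes p: "P0 M A \<pi>" and v: "M \<epsilon> Vd" "A \<epsilon> Vd" "\<pi> \<epsilon> Vd"
  shows "collapse M \<pi>" "inter M hh \<epsilon> lift \<kappa>1 \<kappa>h S1" "A = AA (inter M hh)" "x \<epsilon> M ==> val \<pi> x \<epsilon> A" "b0 \<epsilon> M"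
proof -
  note p1 = p[unfolded Pt_def, THEN conjunct1]
    and p2 = p[unfolded Pt_def, THEN conjunct2, THEN conjunct1, rule_format]
    and p3 = p[unfolded Pt_def, THEN conjunct2, THEN conjunct2, THEN conjunct1, rule_format]
    and p4 = p[unfolded Pt_def, THEN conjunct2, THEN conjunct2, THEN conjunct2, THEN conjunct1, rule_format]
    and p5 = p[unfolded Pt_def, THEN conjunct2, THEN conjunct2, THEN conjunct2, THEN conjunct2, THEN conjunct1, rule_format]
    and p6 = p[unfolded Pt_def, THEN conjunct2, THEN conjunct2, THEN conjunct2, THEN conjunct2, THEN conjunct2]
  have el: "x \<epsilon> Vd \<and> y \<epsilon> Vd \<and> x \<epsilon> M \<and> y \<epsilon> A" if xy: "opair x y \<epsilon> \<pi>" for x y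
  proof -
    obtain x' y' where "opair x y = opair x' y'" "x' \<epsilon> Vd" "y' \<epsilon> Vd" "x' \<epsilon> M" "y' \<epsilon> A"
      using p2[OF Vd_mem[OF v(3) xy] xy] by blast
    then show ?thesis by simp
  qed
  have c: "z \<epsilon> y <-> (\<exists>x'. x' \<epsilon> x \<and> opair x' z \<epsilon> \<pi>)" if xy: "opair x y \<epsilon> \<pi>" for x y z
  proof -
    have "z \<epsilon> Vd" if "z \<epsilon> y" using Vd_mem[of y z] el[OF xy] that by blast
    then show ?thesis using p4[of x y z] el[OF xy] xy el[of _ z] by blast
  qed
  have "y = y'" if "opair x y \<epsilon> \<pi>" "opair x y' \<epsilon> \<pi>" for x y y'
    by (rule set_eqI) (simp add: c[OF that(1)] c[OF that(2)])
  moreover have "\<exists>x y. q = opair x y" if "q \<epsilon> \<pi>" for q using p2[OF Vd_mem[OF v(3) that] that] by blast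
  ultimately have "partial_fun \<pi>" unfolding partial_fun_def by blast
  moreover have "x \<epsilon> M <-> (\<exists>y. opair x y \<epsilon> \<pi>)" for x using p3[OF Vd_mem[OF v(1)], of x] el[of x] by blast
  ultimately have f: "function_on \<pi> M" unfolding function_on_def by blast
  note o = function_on_opair_iff[OF f]
  show "collapse M \<pi>" unfolding collapse_def
  proof (intro conjI allI impI f)
    fix x t assume "x \<epsilon> M"
    then have "opair x (val \<pi> x) \<epsilon> \<pi>" using function_on_val[OF f] by blast
    from c[OF this, of t] show "t \<epsilon> val \<pi> x <-> (\<exists>y. y \<epsilon> M \<and> y \<epsilon> x \<and> t = val \<pi> y)" unfolding o by blast
  next
    fix x y assume "x \<epsilon> M \<and> y \<epsilon> M \<and> val \<pi> x = val \<pi> y"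
    then have "opair x (val \<pi> x) \<epsilon> \<pi>" "opair y (val \<pi> x) \<epsilon> \<pi>" using o by auto
    then show "x = y" using p5[of x y "val \<pi> x"] el by blast
  qed
  show "x \<epsilon> M ==> val \<pi> x \<epsilon> A" using el[OF function_on_val[OF f]] by blast
  show "b0 \<epsilon> M" using p6 el by blast
  obtain M0 where M0: "M0 \<epsilon> Vd" "opair M0 A \<epsilon> Tf" "\<forall>x. x \<epsilon> Vd --> (x \<epsilon> M0 <-> x \<epsilon> hh \<and> x \<epsilon> M)" using p1 by blast
  have "M0 = inter M hh"
    by (rule set_eqI) (use M0(3) Vd_mem[OF M0(1)] Vd_mem[OF v(1)] in auto)
  then show "inter M hh \<epsilon> lift \<kappa>1 \<kappa>h S1" "A = AA (inter M hh)" using M0(2) unfolding opair_Tf by blast+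
qed

lemma Ev0:
  assumes p: "P0 M A \<pi>" and v: "M \<epsilon> Vd" "A \<epsilon> Vd" "\<pi> \<epsilon> Vd"
    and s: "s \<epsilon> Vd" "function_on s omega" "total Vd M s" and \<psi>: "fml \<psi>"
  shows "E0 M \<psi> s <-> Sat A (tr \<pi> s) \<psi>"
proof -
  have sM: "val s k \<epsilon> M" if "natural k" for k using s(3) that total_iff[OF wf0 s(1,2)] by blast
  note d = PtD[OF p v]
  have a: "asn A (tr \<pi> s)" unfolding asn_def using function_on_tr val_tr d(4) sM by simp
  have "tr \<pi> s \<epsilon> Vd"
  proof (rule asn_Vd)
    show "asn Vd (tr \<pi> s)" using a Vd_mem[OF v(2)] unfolding asn_def by blast
  qed
  note t = this a cmp_tr[OF collapse_function[OF d(1)] v(3) s(1,2) sM]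
  show ?thesis
  proof
    assume "E0 M \<psi> s"
    then obtain A' \<pi>' \<tau> \<sigma> where e: "A' \<epsilon> Vd" "\<pi>' \<epsilon> Vd" "\<tau> \<epsilon> Vd" "P0 M A' \<pi>'" "TS Vd FF A' \<tau>" "cmp Vd \<pi>' s \<sigma>" "opair \<psi> \<sigma> \<epsilon> \<tau>"
      unfolding Ev_def by blast
    note d' = PtD[OF e(4) v(1) e(1,2)]
    have eq: "A' = A" "\<pi>' = \<pi>" using d(3) d'(3) collapse_unique[OF d(1) d'(1)] by auto
    have "\<sigma> = tr \<pi> s" using e(6) t(3) eq by blast
    then show "Sat A (tr \<pi> s) \<psi>"
      using TS_Sat[OF wf0 FF_Vd fml_closed_FF clU0 v(2) _ \<psi> t(1,2)] e(5,7) eq by blast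
  next
    assume sat: "Sat A (tr \<pi> s) \<psi>"
    obtain \<tau> where \<tau>: "\<tau> \<sqsubseteq> prod FF (Pow (prod omega A))" "truth_set A \<tau>" using truth_set_exists by blast
    have "\<tau> \<epsilon> Vd" using Vd_subset[OF Vd_prod[OF FF_Vd Vd_Pow[OF Vd_prod[OF omega_Vd v(2)]]] \<tau>(1)] .
    moreover have "opair \<psi> (tr \<pi> s) \<epsilon> \<tau>" using Sat_iff[OF \<tau>(2) \<psi> a] sat by blast
    ultimately show "E0 M \<psi> s" unfolding Ev_def using v p TS0[OF v(2) \<tau>(2)] t(1,3) by blast
  qed
qed

end

context definable_tower
begin

lemma inter_hh: "\<kappa>h \<sqsubseteq> \<theta> ==> inter (inter M (Hl \<theta>)) hh = inter M hh"
  unfolding hh_def by (rule inter_inter_Hl)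

lemma CondD:
  assumes c: "C0 \<theta> T" and v: "\<theta> \<epsilon> Vd" "T \<epsilon> Vd"
  shows "\<theta> \<epsilon> Ix" "pos \<theta> T" "\<kappa>h \<sqsubseteq> \<theta>" "M \<epsilon> T ==> \<exists>A \<pi>. A \<epsilon> Vd \<and> \<pi> \<epsilon> Vd \<and> P0 M A \<pi>"
proof -
  note c1 = c[unfolded Cond_def, THEN conjunct1]
    and c2 = c[unfolded Cond_def, THEN conjunct2, THEN conjunct1]
    and c3 = c[unfolded Cond_def, THEN conjunct2, THEN conjunct2, rule_format]
  have X: "\<exists>X. M \<epsilon> X \<and> \<theta> \<epsilon> Ix \<and> null \<theta> X" if "M \<epsilon> T" for M
    using c3[OF Vd_mem[OF v(2) that] that] JJ0[OF v(1)] by blast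
  show P: "\<exists>A \<pi>. A \<epsilon> Vd \<and> \<pi> \<epsilon> Vd \<and> P0 M A \<pi>" if "M \<epsilon> T" for M
    using c3[OF Vd_mem[OF v(2) that] that] by blast
  obtain M0 where M0: "M0 \<epsilon> T" using c2 by blast
  then show i: "\<theta> \<epsilon> Ix" using X by blast
  have Z: "T \<sqsubseteq> Zl \<theta>" unfolding subset_def using X null_subset_Zl subsetD by blast
  then show "pos \<theta> T" unfolding pos_def using c1 JJ0[OF v] i by blast
  show "\<kappa>h \<sqsubseteq> \<theta>"
  proof (rule ccontr)
    assume "\<not> \<kappa>h \<sqsubseteq> \<theta>"
    then have "\<theta> \<sqsubseteq> \<kappa>h" using Ix_linear[OF i \<kappa>h_Ix] by blast
    obtain A \<pi> where A: "A \<epsilon> Vd" "\<pi> \<epsilon> Vd" "P0 M0 A \<pi>" using P[OF M0] by blast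
    have "b0 \<epsilon> M0" by (rule PtD(5)[OF A(3) Vd_mem[OF v(2) M0] A(1,2)])
    moreover have "M0 \<sqsubseteq> Hl \<theta>" using subsetD[OF Z M0] unfolding mem_Zl by blast
    ultimately have "b0 \<epsilon> Hl \<kappa>h" using Hl_mono[OF \<open>\<theta> \<sqsubseteq> \<kappa>h\<close>] subsetD by blast
    note t = Hl_trans[OF \<kappa>h_Ix]
    let ?q = "opair hh (opair Tf FF)"
    have "opair empty ?q \<epsilon> b0" unfolding b0_def opair_updv by simp
    then have "opair empty ?q \<epsilon> Hl \<kappa>h" using t[OF \<open>b0 \<epsilon> Hl \<kappa>h\<close>] by blast
    then have "upair empty ?q \<epsilon> Hl \<kappa>h" using t[of "opair empty ?q"] unfolding opair_def[of empty] by simp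
    then have "?q \<epsilon> Hl \<kappa>h" using t[of "upair empty ?q"] by simp
    then have "upair hh hh \<epsilon> Hl \<kappa>h" using t[of ?q] unfolding opair_def[of hh] by simp
    then have "hh \<epsilon> Hl \<kappa>h" using t[of "upair hh hh"] by simp
    then show False unfolding hh_def by simp
  qed
qed

definition gp :: "'v => 'v => 'v => bool" where
  "gp \<theta> M \<pi> <-> good \<theta> M \<pi> \<and> b0 \<epsilon> M \<and> inter M hh \<epsilon> lift \<kappa>1 \<kappa>h S1 \<and> (\<forall>x. x \<epsilon> M --> val \<pi> x \<epsilon> AA M)"

lemma good_fun:
  assumes g: "good \<theta> M \<pi>" and s: "s \<epsilon> M" "function_on s omega"
  shows "natural k ==> val s k \<epsilon> M" "val \<pi> s = tr \<pi> s"
proof -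
  note c = good_collapse[OF g]
  show v: "val s k \<epsilon> M" if "natural k" for k
    using good_val[OF g s(1) function_on_partial[OF s(2)] good_natural[OF g that] function_on_val[OF s(2)]] that by simp
  have o: "opair k (val s k) \<epsilon> M \<and> val \<pi> (opair k (val s k)) = opair k (val \<pi> (val s k))" if "natural k" for k
    using good_opair[OF g] collapse_opair_eq[OF g] good_natural[OF g that] v[OF that] collapse_natural[OF g that] by simp
  show "val \<pi> s = tr \<pi> s"
  proof (rule set_eqI)
    fix t
    have "t \<epsilon> val \<pi> s <-> (\<exists>y. y \<epsilon> M \<and> y \<epsilon> s \<and> t = val \<pi> y)" by (rule collapse_mem[OF c s(1)])
    also have "\<dots> <-> (\<exists>k. k \<epsilon> omega \<and> t = opair k (val \<pi> (val s k)))"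
      unfolding function_on_mem[OF s(2)] using o mem_omega by metis
    finally show "t \<epsilon> val \<pi> s <-> t \<epsilon> tr \<pi> s" unfolding mem_tr .
  qed
qed

lemma gp_Pt:
  assumes g: "gp \<theta> M \<pi>" and \<theta>: "\<kappa>h \<sqsubseteq> \<theta>"
  shows "M \<epsilon> Vd" "\<pi> \<epsilon> Vd" "P0 M (AA M) \<pi>"
proof -
  have g': "good \<theta> M \<pi>" "b0 \<epsilon> M" "inter M hh \<epsilon> lift \<kappa>1 \<kappa>h S1" "\<And>x. x \<epsilon> M ==> val \<pi> x \<epsilon> AA M"
    using g unfolding gp_def by blast+
  note c = good_collapse[OF g'(1)]
  note f = collapse_function[OF c]
  note o = collapse_opair[OF c]
  show M: "M \<epsilon> Vd" using Zl_mem_Vd[OF good_Ix[OF g'(1)] good_Zl[OF g'(1)]] .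
  have "\<pi> \<sqsubseteq> prod M (AA M)" unfolding subset_def using function_on_mem[OF f] g'(4) by auto
  then show \<pi>: "\<pi> \<epsilon> Vd" using Vd_subset[OF Vd_prod[OF M AA_Vd]] by blast
  have el: "x \<epsilon> Vd \<and> val \<pi> x \<epsilon> Vd" if "x \<epsilon> M" for x using Vd_mem[OF M that] Vd_mem[OF AA_Vd g'(4)[OF that]] by blast
  show "P0 M (AA M) \<pi>" unfolding Pt_def
  proof (intro conjI)
    have "AA (inter M hh) = AA M" unfolding hh_def by (rule AA_inter[OF _ M]) simp
    then show "\<exists>M0. M0 \<epsilon> Vd \<and> opair M0 (AA M) \<epsilon> Tf \<and> (\<forall>x. x \<epsilon> Vd --> (x \<epsilon> M0 <-> x \<epsilon> hh \<and> x \<epsilon> M))"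
      unfolding opair_Tf using g'(3) inter_Vd[OF M] by (intro exI[of _ "inter M hh"]) auto
    show "\<forall>p. p \<epsilon> Vd --> p \<epsilon> \<pi> --> (\<exists>x. x \<epsilon> Vd \<and> (\<exists>y. y \<epsilon> Vd \<and> p = opair x y \<and> x \<epsilon> M \<and> y \<epsilon> AA M))"
      unfolding function_on_mem[OF f] using el g'(4) by blast
    show "\<forall>x. x \<epsilon> Vd --> x \<epsilon> M --> (\<exists>y. y \<epsilon> Vd \<and> opair x y \<epsilon> \<pi>)" unfolding o using el by blast
    show "\<forall>x. x \<epsilon> Vd --> (\<forall>y. y \<epsilon> Vd --> opair x y \<epsilon> \<pi> -->
       (\<forall>z. z \<epsilon> Vd --> (z \<epsilon> y <-> (\<exists>x'. x' \<epsilon> Vd \<and> x' \<epsilon> x \<and> opair x' z \<epsilon> \<pi>))))"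
      unfolding o using collapse_mem[OF c] el by blast
    show "\<forall>x. x \<epsilon> Vd --> (\<forall>x'. x' \<epsilon> Vd --> (\<forall>y. y \<epsilon> Vd --> opair x y \<epsilon> \<pi> \<and> opair x' y \<epsilon> \<pi> --> x = x'))"
      unfolding o using collapse_inj[OF c] by blast
    show "transitive (AA M)" by (rule transitive_AA)
    have "cmp Vd \<pi> b0 (val \<pi> b0)"
      using cmp_tr[OF f \<pi> b0_Vd b0_fun good_fun(1)[OF g'(1,2) b0_fun]] good_fun(2)[OF g'(1,2) b0_fun] by blast
    then show "\<exists>c'. c' \<epsilon> Vd \<and> opair b0 c' \<epsilon> \<pi> \<and> cmp Vd \<pi> b0 c'" unfolding o using el[OF g'(2)] g'(2) by blast
  qed
qed

lemma CondI:
  assumes \<theta>: "Sp \<theta>" "\<kappa>h \<sqsubseteq> \<theta>" and T: "pos \<theta> T" and g: "\<And>M. M \<epsilon> T ==> \<exists>\<pi>. gp \<theta> M \<pi>"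
  shows "\<theta> \<epsilon> Vd" "T \<epsilon> Vd" "C0 \<theta> T"
proof -
  have i: "\<theta> \<epsilon> Ix" using Sp_Ix \<theta> by blast
  show v: "\<theta> \<epsilon> Vd" using i delta_subset_Vd unfolding mem_Ix by blast
  have TZ: "T \<sqsubseteq> Zl \<theta>" using T unfolding pos_def by blast
  show v': "T \<epsilon> Vd" using Vd_subset[OF Zl_Vd[OF i] TZ] .
  show "C0 \<theta> T" unfolding Cond_def
  proof (intro conjI allI impI)
    show "\<not> JJ Vd b0 \<theta> T" using JJ0[OF v v'] T unfolding pos_def by blast
    show "\<exists>M. M \<epsilon> Vd \<and> M \<epsilon> T" using pos_nonempty[OF i T] Vd_mem[OF v'] by blast
    fix M assume M: "M \<epsilon> T"
    then have MZ: "M \<epsilon> Zl \<theta>" using TZ subsetD by blast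
    then have "M \<epsilon> Hl \<theta>" using Sp_subsetI[OF \<theta>(1)] unfolding mem_Zl by blast
    let ?X = "SET M'. M' \<epsilon> Zl \<theta> \<and> \<not> M \<epsilon> M'"
    have n: "null \<theta> ?X" by (rule null_fine[OF i \<open>M \<epsilon> Hl \<theta>\<close>])
    have "M \<epsilon> ?X" by (subst mem_sep) (intro fo_intros, simp add: MZ)
    moreover have "?X \<epsilon> Vd" using Vd_subset[OF Zl_Vd[OF i] null_subset_Zl[OF i n]] .
    ultimately show "\<exists>X. X \<epsilon> Vd \<and> M \<epsilon> X \<and> JJ Vd b0 \<theta> X" using JJ0[OF v] n i by blast
    show "\<exists>A. A \<epsilon> Vd \<and> (\<exists>\<pi>. \<pi> \<epsilon> Vd \<and> P0 M A \<pi>)" using g[OF M] gp_Pt[OF _ \<theta>(2)] AA_Vd by blast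
  qed
qed

lemma LeI:
  assumes c: "C0 \<theta> T" "\<theta> \<epsilon> Vd" "T \<epsilon> Vd" and c': "C0 \<theta>' T'" "\<theta>' \<epsilon> Vd" "T' \<epsilon> Vd"
    and le: "\<theta> \<sqsubseteq> \<theta>'" "T' \<sqsubseteq> lift \<theta> \<theta>' T"
  shows "Le Vd b0 hh Tf FF T' T"
  unfolding Le_def
proof (intro allI impI)
  fix M' assume M'T: "M' \<epsilon> T'"
  let ?M = "inter M' (Hl \<theta>)"
  have M: "?M \<epsilon> T" using subsetD[OF le(2) M'T] by simp
  note MV = Vd_mem[OF c(3) M] and M'V = Vd_mem[OF c'(3) M'T]
  obtain A \<pi> where A: "A \<epsilon> Vd" "\<pi> \<epsilon> Vd" "P0 ?M A \<pi>" using CondD(4)[OF c M] by blast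
  obtain A' \<pi>' where A': "A' \<epsilon> Vd" "\<pi>' \<epsilon> Vd" "P0 M' A' \<pi>'" using CondD(4)[OF c' M'T] by blast
  note d = PtD[OF A(3) MV A(1,2)] and d' = PtD[OF A'(3) M'V A'(1,2)]
  have eq: "A = A'" using d(3) d'(3) inter_hh[OF CondD(3)[OF c]] by simp
  have "E0 M' \<chi> s <-> E0 ?M \<chi> s" if s: "s \<epsilon> Vd" "\<chi> \<epsilon> FF" "function_on s omega" "total Vd ?M s" for \<chi> s
  proof -
    have t: "total Vd M' s" using s(4) unfolding total_def by simp
    have "val s k \<epsilon> ?M" if "natural k" for k using s(4) that total_iff[OF wf0 s(1,3)] by blast
    then have "val \<pi> (val s k) = val \<pi>' (val s k)" if "natural k" for k
      using collapse_restrict_eq[OF d(1) d'(1) refl] Hl_trans[OF CondD(1)[OF c]] that by blast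
    then have "tr \<pi> s = tr \<pi>' s"
      by (intro function_on_omega_eqI[OF function_on_tr function_on_tr]) (simp add: val_tr)
    then show ?thesis
      using Ev0[OF A(3) MV A(1,2) s(1,3,4)] Ev0[OF A'(3) M'V A'(1,2) s(1,3) t] s(2) eq unfolding mem_FF by simp
  qed
  then show "\<exists>M. M \<epsilon> Vd \<and> M \<epsilon> T \<and> (\<forall>x. x \<epsilon> Vd --> x \<epsilon> M --> x \<epsilon> M') \<and>
     (\<forall>\<chi>. \<chi> \<epsilon> Vd --> (\<forall>s. s \<epsilon> Vd --> \<chi> \<epsilon> FF \<and> function_on s omega \<and> total Vd M s --> (E0 M' \<chi> s <-> E0 M \<chi> s)))"
    using M MV by (intro exI[of _ ?M]) auto
qed

lemma gp_pos:
  assumes \<theta>: "Sp \<theta>" "\<kappa>h \<sqsubseteq> \<theta>" "b0 \<epsilon> Hl \<theta>" and R: "pos \<theta> R" and hR: "\<And>M. M \<epsilon> R ==> inter M hh \<epsilon> lift \<kappa>1 \<kappa>h S1"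
  shows "\<exists>R'. pos \<theta> R' \<and> R' \<sqsubseteq> R \<and> (\<forall>M. M \<epsilon> R' --> (\<exists>\<pi>. gp \<theta> M \<pi>))"
proof -
  have i: "\<theta> \<epsilon> Ix" using Sp_Ix \<theta> by blast
  have "ae \<theta> (\<lambda>M. (\<exists>\<pi>. good \<theta> M \<pi>) \<and> (\<forall>\<pi> x. good \<theta> M \<pi> \<and> x \<epsilon> M --> val \<pi> x \<epsilon> AA M) \<and> b0 \<epsilon> M)"
    by (intro ae_conj[OF i] ae_good[OF \<theta>(1) subset_trans[OF h(2) \<theta>(2)]] ae_collapse_AA[OF \<theta>(1,2)] ae_fine[OF i \<theta>(3)])
  then obtain R' where R': "pos \<theta> R'" "R' \<sqsubseteq> R"
    "\<And>M. M \<epsilon> R' ==> (\<exists>\<pi>. good \<theta> M \<pi>) \<and> (\<forall>\<pi> x. good \<theta> M \<pi> \<and> x \<epsilon> M --> val \<pi> x \<epsilon> AA M) \<and> b0 \<epsilon> M"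
    using pos_ae[OF i R] by blast
  have "\<exists>\<pi>. gp \<theta> M \<pi>" if "M \<epsilon> R'" for M
    unfolding gp_def using R'(3)[OF that] hR[OF subsetD[OF R'(2) that]] by blast
  then show ?thesis using R' by blast
qed

lemma inter_hh_lift: "M \<epsilon> Zl \<theta> ==> \<kappa>h \<sqsubseteq> \<theta> ==> inter M hh \<epsilon> lift \<kappa>1 \<kappa>h S1 <-> M \<epsilon> lift \<kappa>1 \<theta> S1"
  unfolding mem_lift hh_def using Zl_inter[of M \<theta> \<kappa>h] inter_inter_Hl[OF h(3), of M] by simp

lemma Cond_exists: "\<exists>\<theta>. \<theta> \<epsilon> Vd \<and> (\<exists>T. T \<epsilon> Vd \<and> C0 \<theta> T)"
proof -
  obtain \<theta> where \<theta>: "Sp \<theta>" "b0 \<epsilon> Hl \<theta>" "\<kappa>h \<sqsubseteq> \<theta>" using Sp_above[OF b0_Vd, of \<kappa>h] \<kappa>h_Ix mem_Ix by blast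
  have S1: "\<kappa>1 \<epsilon> Ix" "pos \<kappa>1 S1" using minimal unfolding minimal_bound_def by blast+
  have R: "pos \<theta> (lift \<kappa>1 \<theta> S1)" by (rule pos_lift[OF S1(1) Sp_Ix[OF \<theta>(1)] subset_trans[OF h(3) \<theta>(3)] S1(2)])
  have "inter M hh \<epsilon> lift \<kappa>1 \<kappa>h S1" if "M \<epsilon> lift \<kappa>1 \<theta> S1" for M
    using inter_hh_lift[OF _ \<theta>(3)] that by (meson mem_lift)
  then obtain T where "pos \<theta> T" "\<And>M. M \<epsilon> T ==> \<exists>\<pi>. gp \<theta> M \<pi>" using gp_pos[OF \<theta>(1,3,2) R] by blast
  then show ?thesis using CondI[OF \<theta>(1,3)] by blast
qed

lemma Cond_refine:
  assumes c: "C0 \<theta> T" "\<theta> \<epsilon> Vd" "T \<epsilon> Vd" and s: "s \<epsilon> Vd"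
  shows "\<exists>\<theta>' T'. Sp \<theta>' \<and> \<kappa>h \<sqsubseteq> \<theta>' \<and> b0 \<epsilon> Hl \<theta>' \<and> \<theta> \<sqsubseteq> \<theta>' \<and> pos \<theta>' T' \<and> T' \<sqsubseteq> lift \<theta> \<theta>' T \<and> (\<forall>M. M \<epsilon> T' --> s \<epsilon> M \<and> (\<exists>\<pi>. gp \<theta>' M \<pi>))"
proof -
  note d = CondD[OF c]
  obtain \<theta>' where \<theta>': "Sp \<theta>'" "upair b0 s \<epsilon> Hl \<theta>'" "\<theta> \<sqsubseteq> \<theta>'"
    using Sp_above[OF Vd_upair[OF b0_Vd s], of \<theta>] d(1) mem_Ix by blast
  have i: "\<theta>' \<epsilon> Ix" using Sp_Ix \<theta>' by blast
  have b: "b0 \<epsilon> Hl \<theta>'" "s \<epsilon> Hl \<theta>'" using Hl_trans[OF i \<theta>'(2)] by auto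
  have \<kappa>h: "\<kappa>h \<sqsubseteq> \<theta>'" using subset_trans[OF d(3) \<theta>'(3)] .
  obtain R where R: "pos \<theta>' R" "R \<sqsubseteq> lift \<theta> \<theta>' T" "\<And>M. M \<epsilon> R ==> s \<epsilon> M"
    using pos_ae[OF i pos_lift[OF d(1) i \<theta>'(3) d(2)] ae_fine[OF i b(2)]] by blast
  have "inter M hh \<epsilon> lift \<kappa>1 \<kappa>h S1" if "M \<epsilon> R" for M
  proof -
    have N: "inter M (Hl \<theta>) \<epsilon> T" using subsetD[OF R(2) that] by simp
    obtain A \<pi> where A: "A \<epsilon> Vd" "\<pi> \<epsilon> Vd" "P0 (inter M (Hl \<theta>)) A \<pi>" using d(4)[OF N] by blast
    then show ?thesis using PtD(2)[OF A(3) Vd_mem[OF c(3) N] A(1,2)] inter_hh[OF d(3)] by simp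
  qed
  then obtain T' where T': "pos \<theta>' T'" "T' \<sqsubseteq> R" "\<And>M. M \<epsilon> T' ==> \<exists>\<pi>. gp \<theta>' M \<pi>"
    using gp_pos[OF \<theta>'(1) \<kappa>h b(1) R(1)] by blast
  then show ?thesis using \<theta>' \<kappa>h b(1) R(3) subsetD[OF T'(2)] subset_trans[OF T'(2) R(2)] by blast
qed

lemma clB0: "clB Vd b0 b0 hh Tf FF"
  unfolding clB_def
proof (intro allI impI)
  fix \<theta> T M s
  assume v: "\<theta> \<epsilon> Vd" "T \<epsilon> Vd" "M \<epsilon> Vd" "s \<epsilon> Vd" and a: "C0 \<theta> T \<and> M \<epsilon> T \<and> function_on s omega \<and> total Vd M s"
  then have s: "function_on s omega" "total Vd M s" by blast+
  obtain A \<pi> where A: "A \<epsilon> Vd" "\<pi> \<epsilon> Vd" "P0 M A \<pi>" using CondD(4)[of \<theta> T M] v a by blast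
  note d = PtD[OF A(3) v(3) A(1,2)]
  note E = Ev0[OF A(3) v(3) A(1,2) v(4) s]
  have sM: "val s k \<epsilon> M" if "natural k" for k using s(2) that total_iff[OF wf0 v(4) s(1)] by blast
  have t: "asn A (tr \<pi> s)" unfolding asn_def using function_on_tr val_tr d(4) sM by simp
  note S = Sat_simps[OF t]
  have 1: "tarski Vd FF (\<lambda>p. E0 M p s) s"
    unfolding tarski_iff[OF wf0 v(4) s(1) FF_Vd fml_closed_FF] mem_FF
  proof (intro conjI allI impI)
    fix i j assume ij: "natural i \<and> natural j"
    show "E0 M (cMem i j) s <-> val s i \<epsilon> val s j"
      using E[OF fml_intros(1)] S(1) ij val_tr collapse_mem_iff[OF d(1) sM sM] by simp
    show "E0 M (cEq i j) s <-> val s i = val s j"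
      using E[OF fml_intros(2)] S(2) ij val_tr collapse_inj[OF d(1) sM sM] by auto
  next
    fix \<chi> assume "fml \<chi>"
    then show "E0 M (cNeg \<chi>) s <-> \<not> E0 M \<chi> s" using E S(3) fml_intros(3) by simp
  next
    fix \<chi> \<chi>' assume "fml \<chi> \<and> fml \<chi>'"
    then show "E0 M (cConj \<chi> \<chi>') s <-> E0 M \<chi> s \<and> E0 M \<chi>' s" using E S(4) fml_intros(4) by simp
  qed
  have 2: "E0 M \<chi> s'" if x: "natural i" "fml \<chi>" "E0 M (cAll i \<chi>) s" "x \<epsilon> M" "s' \<epsilon> Vd" "up Vd s i x s'" for i \<chi> x s'
  proof -
    have s': "s' = updv s i x" using x up_iff[OF wf0 v(4) s(1) x(5,1)] by blast
    have "total Vd M s'" using x(4) sM val_updv total_iff[OF wf0 x(5)] function_on_updv unfolding s' by simp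
    moreover have "Sat A (updv (tr \<pi> s) i (val \<pi> x)) \<chi>"
      using x(3) E[OF fml_intros(5)[OF x(1,2)]] S(5)[OF x(1,2)] d(4)[OF x(4)] by blast
    ultimately show ?thesis
      using Ev0[OF A(3) v(3) A(1,2) x(5) _ _ x(2)] function_on_updv unfolding s' tr_updv by blast
  qed
  show "tarski Vd FF (\<lambda>p. E0 M p s) s \<and>
     (\<forall>i. i \<epsilon> Vd --> (\<forall>\<chi>. \<chi> \<epsilon> Vd --> (\<forall>p. p \<epsilon> Vd --> (\<forall>x. x \<epsilon> Vd --> (\<forall>s'. s' \<epsilon> Vd -->
       natural i \<and> \<chi> \<epsilon> FF \<and> p = cAll i \<chi> \<and> E0 M p s \<and> x \<epsilon> M \<and> up Vd s i x s' --> E0 M \<chi> s')))))"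
    unfolding mem_FF using 1 2 by blast
qed

lemma foE0: "fo mem (\<lambda>e. E0 (e 0) \<psi> s)"
  unfolding Ev_def Pt_def TS_def tarski_def cmp_def up_def by (intro fo_intros)

lemma gp_total: "gp \<theta> M \<pi> ==> s \<epsilon> M ==> s \<epsilon> Vd ==> function_on s omega ==> total Vd M s"
  unfolding gp_def using total_iff[OF wf0] good_fun(1) by blast

lemma clC0: "clC Vd b0 b0 hh Tf FF"
  unfolding clC_def
proof (intro allI impI)
  fix \<theta> T s \<psi>
  assume v: "\<theta> \<epsilon> Vd" "T \<epsilon> Vd" "s \<epsilon> Vd" "\<psi> \<epsilon> Vd" and a: "C0 \<theta> T \<and> function_on s omega \<and> \<psi> \<epsilon> FF"
  then have c: "C0 \<theta> T" "\<theta> \<epsilon> Vd" "T \<epsilon> Vd" and s: "function_on s omega" by blast+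
  obtain \<theta>' R where R: "Sp \<theta>'" "\<kappa>h \<sqsubseteq> \<theta>'" "\<theta> \<sqsubseteq> \<theta>'" "pos \<theta>' R" "R \<sqsubseteq> lift \<theta> \<theta>' T" "\<And>M. M \<epsilon> R ==> s \<epsilon> M \<and> (\<exists>\<pi>. gp \<theta>' M \<pi>)"
    using Cond_refine[OF c v(3)] by blast
  obtain T' where T': "pos \<theta>' T'" "T' \<sqsubseteq> R" "(\<forall>M. M \<epsilon> T' --> E0 M \<psi> s) \<or> (\<forall>M. M \<epsilon> T' --> \<not> E0 M \<psi> s)"
    using pos_split[OF Sp_Ix[OF R(1)] R(4) foE0[of \<psi> s]] by blast
  have g: "s \<epsilon> M \<and> (\<exists>\<pi>. gp \<theta>' M \<pi>)" if "M \<epsilon> T'" for M using R(6)[OF subsetD[OF T'(2) that]] .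
  then have c': "\<theta>' \<epsilon> Vd" "T' \<epsilon> Vd" "C0 \<theta>' T'" using CondI[OF R(1,2) T'(1)] by blast+
  have "Le Vd b0 hh Tf FF T' T" by (rule LeI[OF c c'(3,1,2) R(3) subset_trans[OF T'(2) R(5)]])
  moreover have "total Vd M s" if "M \<epsilon> T'" for M using g[OF that] gp_total v(3) s by blast
  ultimately show "\<exists>\<theta>'. \<theta>' \<epsilon> Vd \<and> (\<exists>T'. T' \<epsilon> Vd \<and> C0 \<theta>' T' \<and> Le Vd b0 hh Tf FF T' T \<and>
       (\<forall>M. M \<epsilon> Vd --> M \<epsilon> T' --> total Vd M s) \<and>
       ((\<forall>M. M \<epsilon> Vd --> M \<epsilon> T' --> E0 M \<psi> s) \<or> (\<forall>M. M \<epsilon> Vd --> M \<epsilon> T' --> \<not> E0 M \<psi> s)))"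
    using c' T'(3) by (intro exI[of _ \<theta>'] conjI exI[of _ T']) auto
qed

lemma clD0: "clD Vd b0 b0 hh Tf FF"
  unfolding clD_def
proof (intro allI impI)
  fix \<theta> T s i \<chi> p
  assume v: "\<theta> \<epsilon> Vd" "T \<epsilon> Vd" "s \<epsilon> Vd" and a: "C0 \<theta> T \<and> function_on s omega \<and> natural i \<and> \<chi> \<epsilon> FF \<and> p = cAll i \<chi> \<and>
     (\<forall>M. M \<epsilon> Vd --> M \<epsilon> T --> total Vd M s \<and> \<not> E0 M p s)"
  then have c: "C0 \<theta> T" "\<theta> \<epsilon> Vd" "T \<epsilon> Vd" and s: "function_on s omega" and i: "natural i" "fml \<chi>"
    and no: "\<And>M. M \<epsilon> T ==> total Vd M s \<and> \<not> E0 M (cAll i \<chi>) s"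
    using Vd_mem[OF v(2)] unfolding mem_FF by blast+
  note fa = fml_intros(5)[OF i]
  obtain \<theta>1 T1 where R: "Sp \<theta>1" "\<kappa>h \<sqsubseteq> \<theta>1" "\<theta> \<sqsubseteq> \<theta>1" "pos \<theta>1 T1" "T1 \<sqsubseteq> lift \<theta> \<theta>1 T" "b0 \<epsilon> Hl \<theta>1"
    "\<And>M. M \<epsilon> T1 ==> s \<epsilon> M \<and> (\<exists>\<pi>. gp \<theta>1 M \<pi>)"
    using Cond_refine[OF c v(3)] by blast
  have c1: "\<theta>1 \<epsilon> Vd" "T1 \<epsilon> Vd" "C0 \<theta>1 T1" using CondI[OF R(1,2,4)] R(7) by blast+
  have le: "Le Vd b0 hh Tf FF T1 T" by (rule LeI[OF c c1(3,1,2) R(3,5)])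
  have no1: "\<not> E0 M (cAll i \<chi>) s" if M: "M \<epsilon> T1" for M
  proof -
    obtain N where N: "N \<epsilon> T" "\<forall>\<chi>. \<chi> \<epsilon> Vd --> (\<forall>s. s \<epsilon> Vd --> \<chi> \<epsilon> FF \<and> function_on s omega \<and> total Vd N s --> (E0 M \<chi> s <-> E0 N \<chi> s))"
      using le[unfolded Le_def, rule_format, OF Vd_mem[OF c1(2) M] M] by blast
    have "cAll i \<chi> \<epsilon> FF" using fa mem_FF by blast
    then show ?thesis using N(2)[rule_format, OF Vd_mem[OF FF_Vd] v(3), of "cAll i \<chi>"] no[OF N(1)] s by blast
  qed
  define Q where "Q M y <-> (\<forall>\<pi>. collapse M \<pi> --> \<not> Sat (AA M) (updv (tr \<pi> s) i y) \<chi>)" for M y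
  have foQ: "fo2 Q" unfolding Q_def by (intro fo_intros)
  have ex: "\<exists>y. y \<epsilon> AA M \<and> Q M y" if M: "M \<epsilon> T1" for M
  proof -
    obtain \<pi> where g: "s \<epsilon> M" "gp \<theta>1 M \<pi>" using R(7)[OF M] by blast
    note P = gp_Pt[OF g(2) R(2)]
    note tot = gp_total[OF g(2,1) v(3) s]
    have "\<not> Sat (AA M) (tr \<pi> s) (cAll i \<chi>)"
      using Ev0[OF P(3,1) AA_Vd P(2) v(3) s tot fa] no1[OF M] by blast
    moreover have "asn (AA M) (tr \<pi> s)"
      unfolding asn_def using function_on_tr val_tr g total_iff[OF wf0 v(3) s] tot unfolding gp_def by simp
    ultimately obtain y where y: "y \<epsilon> AA M" "\<not> Sat (AA M) (updv (tr \<pi> s) i y) \<chi>" using Sat_simps(5)[OF _ i] by blast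
    have "\<pi>' = \<pi>" if "collapse M \<pi>'" for \<pi>'
      using collapse_unique[OF that good_collapse[of \<theta>1 M \<pi>]] g(2) unfolding gp_def by blast
    then show ?thesis unfolding Q_def using y by blast
  qed
  have sub: "inter M hh \<epsilon> lift \<kappa>1 \<kappa>h S1" if "M \<epsilon> T1" for M using R(7)[OF that] unfolding gp_def by blast
  have "T1 \<sqsubseteq> lift \<kappa>1 \<theta>1 S1"
    unfolding subset_def using sub inter_hh_lift[OF pos_subset_Zl[OF R(4)] R(2)] by blast
  from AA_surjective[OF R(1,2,4) this foQ ex]
  obtain \<theta>2 S2 x where S2: "Sp \<theta>2" "\<theta>1 \<sqsubseteq> \<theta>2" "pos \<theta>2 S2" "S2 \<sqsubseteq> lift \<theta>1 \<theta>2 T1" "x \<epsilon> Hl \<theta>2"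
    "\<And>M. M \<epsilon> S2 ==> x \<epsilon> M \<and> (\<exists>\<pi>. good \<theta>2 M \<pi> \<and> Q (inter M (Hl \<theta>1)) (val \<pi> x))"
    by metis
  have \<kappa>2: "\<kappa>h \<sqsubseteq> \<theta>2" using subset_trans[OF R(2) S2(2)] .
  have b2: "b0 \<epsilon> Hl \<theta>2" using subsetD[OF Hl_mono[OF S2(2)] R(6)] .
  have N: "inter M (Hl \<theta>1) \<epsilon> T1" if "M \<epsilon> S2" for M using subsetD[OF S2(4) that] by simp
  have "inter M hh \<epsilon> lift \<kappa>1 \<kappa>h S1" if "M \<epsilon> S2" for M using sub[OF N[OF that]] inter_hh[OF R(2)] by simp
  then obtain T' where T': "pos \<theta>2 T'" "T' \<sqsubseteq> S2" "\<And>M. M \<epsilon> T' ==> \<exists>\<pi>. gp \<theta>2 M \<pi>"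
    using gp_pos[OF S2(1) \<kappa>2 b2 S2(3)] by blast
  have c': "\<theta>2 \<epsilon> Vd" "T' \<epsilon> Vd" "C0 \<theta>2 T'" using CondI[OF S2(1) \<kappa>2 T'(1,3)] by blast+
  have x: "x \<epsilon> Vd" using Vd_mem[OF Hl_Vd[OF Sp_Ix[OF S2(1)]] S2(5)] .
  let ?s = "updv s i x"
  note s' = updv_Vd[OF v(3) s x, of i]
  have "total Vd M ?s \<and> \<not> E0 M \<chi> ?s" if M: "M \<epsilon> T'" for M
  proof -
    let ?N = "inter M (Hl \<theta>1)"
    obtain \<pi> where g: "gp \<theta>2 M \<pi>" using T'(3)[OF M] by blast
    note P = gp_Pt[OF g \<kappa>2]
    note NT = N[OF subsetD[OF T'(2) M]]
    obtain \<pi>1 where g1: "s \<epsilon> ?N" "gp \<theta>1 ?N \<pi>1" using R(7)[OF NT] by blast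
    obtain \<pi>2 where g2: "x \<epsilon> M" "good \<theta>2 M \<pi>2" "Q ?N (val \<pi>2 x)" using S2(6)[OF subsetD[OF T'(2) M]] by blast
    have gd: "good \<theta>2 M \<pi>" "good \<theta>1 ?N \<pi>1" using g g1 unfolding gp_def by blast+
    have eq: "\<pi>2 = \<pi>" using collapse_unique[OF good_collapse[OF g2(2)] good_collapse[OF gd(1)]] .
    have "val s k \<epsilon> ?N" if "natural k" for k using good_fun(1)[OF gd(2) g1(1) s that] .
    then have "val \<pi>1 (val s k) = val \<pi> (val s k)" if "natural k" for k
      using good_restrict_val[OF gd(2,1) refl] that by blast
    then have "tr \<pi>1 s = tr \<pi> s"
      by (intro function_on_omega_eqI[OF function_on_tr function_on_tr]) (simp add: val_tr)
    moreover have "AA ?N = AA M" by (rule AA_inter[OF R(2) P(1)])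
    ultimately have ns: "\<not> Sat (AA M) (tr \<pi> ?s) \<chi>"
      using g2(3) good_collapse[OF gd(2)] unfolding Q_def tr_updv eq by metis
    have "s \<epsilon> M" using g1(1) by simp
    then have tot: "total Vd M ?s"
      using total_iff[OF wf0 s' function_on_updv] good_fun(1)[OF gd(1) _ s] g2(1) val_updv by simp
    then show ?thesis using Ev0[OF P(3,1) AA_Vd P(2) s' function_on_updv tot i(2)] ns by blast
  qed
  then show "\<exists>\<theta>'. \<theta>' \<epsilon> Vd \<and> (\<exists>T'. T' \<epsilon> Vd \<and> (\<exists>x. x \<epsilon> Vd \<and> (\<exists>s'. s' \<epsilon> Vd \<and>
       C0 \<theta>' T' \<and> up Vd s i x s' \<and> (\<forall>M. M \<epsilon> Vd --> M \<epsilon> T' --> total Vd M s' \<and> \<not> E0 M \<chi> s'))))"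
    using c' x s' up0[OF v(3) s x i(1)]
    by (intro exI[of _ \<theta>2] conjI exI[of _ T'] exI[of _ x] exI[of _ ?s]) auto
qed

lemma contradiction: False
proof -
  obtain \<theta> T where "\<theta> \<epsilon> Vd" "T \<epsilon> Vd" "C0 \<theta> T" using Cond_exists by blast
  have "Theta Vd b0" unfolding Theta_def
  proof (intro exI conjI)
    show "b0 \<epsilon> Vd" "hh \<epsilon> Vd" "Tf \<epsilon> Vd" "FF \<epsilon> Vd" "b0 = b0" by (simp_all add: b0_Vd hh_Vd Tf_Vd FF_Vd)
    show "empty \<epsilon> Vd" "empty = empty" by (simp_all add: empty_Vd)
    show "opair Tf FF \<epsilon> Vd" "opair hh (opair Tf FF) \<epsilon> Vd" using Vd_opair hh_Vd Tf_Vd FF_Vd by blast+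
    show "opair Tf FF = opair Tf FF" "opair hh (opair Tf FF) = opair hh (opair Tf FF)" by simp_all
    show "opair empty (opair hh (opair Tf FF)) \<epsilon> b0" unfolding b0_def opair_updv by simp
    show "clF Vd FF" unfolding clF_iff[OF wf0 FF_Vd] by (rule fml_closed_FF)
    show "clU Vd" "clB Vd b0 b0 hh Tf FF" "clC Vd b0 b0 hh Tf FF" "clD Vd b0 b0 hh Tf FF"
      by (rule clU0 clB0 clC0 clD0)+
    show "\<theta> \<epsilon> Vd" "T \<epsilon> Vd" "C0 \<theta> T" by fact+
  qed
  then show False using not_Theta[OF wf0] by blast
qed

end

lemma (in minimal_tower) not_definable: "\<not> tower_definable \<delta> I"
proof
  let ?R = "SET p. \<exists>\<kappa> A. p = opair \<kappa> A \<and> \<kappa> \<epsilon> index \<delta> \<and> A \<epsilon> app I \<kappa>"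
  assume "tower_definable \<delta> I"
  then obtain s \<phi> where \<phi>: "maps s omega Vd" "fml \<phi>" "\<And>x. x \<epsilon> Vd ==> x \<epsilon> ?R <-> Sat Vd (upd s (num 0) x) \<phi>"
    unfolding tower_definable_def definable_over_def Vset_eq[OF ordinal_delta] by blast
  have s: "asn Vd s" using \<phi>(1) unfolding asn_maps .
  have r: "(\<exists>\<kappa> A. p = opair \<kappa> A \<and> \<kappa> \<epsilon> index \<delta> \<and> A \<epsilon> app I \<kappa>) <-> (\<exists>\<kappa> A. p = opair \<kappa> A \<and> \<kappa> \<epsilon> Ix \<and> null \<kappa> A)" for p
    unfolding Ix_def[symmetric] null_def using app_I by metis
  have R: "p \<epsilon> ?R <-> (\<exists>\<kappa> A. p = opair \<kappa> A \<and> \<kappa> \<epsilon> Ix \<and> null \<kappa> A)" for p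
    unfolding r
  proof (rule bounded_coll[where a = Vd], intro fo_intros)
    fix p assume "\<exists>\<kappa> A. p = opair \<kappa> A \<and> \<kappa> \<epsilon> Ix \<and> null \<kappa> A"
    then obtain \<kappa> A where p: "p = opair \<kappa> A" "\<kappa> \<epsilon> Ix" "null \<kappa> A" by blast
    have "\<kappa> \<epsilon> Vd" using delta_subset_Vd p(2) unfolding mem_Ix by blast
    moreover have "A \<epsilon> Vd" using Vd_subset[OF Zl_Vd[OF p(2)] null_subset_Zl[OF p(2,3)]] .
    ultimately show "p \<epsilon> Vd" using Vd_opair p(1) by blast
  qed
  obtain n where n: "natural n" "\<forall>A s s'. asn A s \<and> asn A s' \<and> (\<forall>k. k \<epsilon> n --> val s k = val s' k) --> (Sat A s \<phi> <-> Sat A s' \<phi>)"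
    using Sat_local[OF \<phi>(2)] by blast
  have ne: "empty \<epsilon> succ n" using ordinal_linear[OF ordinal_empty natural_ordinal[OF n(1)]] by auto
  have "definable_tower mem \<delta> I \<kappa>0 f0 \<kappa>1 S1 \<kappa>h \<phi> (succ n) s"
  proof unfold_locales
    show "fml \<phi>" "natural (succ n)" "empty \<epsilon> succ n" "asn Vd s" by (fact \<phi>(2) natural_succ[OF n(1)] ne s)+
    show "Sat A s \<phi> <-> Sat A s' \<phi>" if "asn A s" "asn A s'" "\<And>k. k \<epsilon> succ n ==> val s k = val s' k" for A s s'
      using n(2) that by simp
    fix \<theta> X assume v: "\<theta> \<epsilon> Vd" "X \<epsilon> Vd"
    show "Sat Vd (updv s empty (opair \<theta> X)) \<phi> <-> \<theta> \<epsilon> Ix \<and> null \<theta> X"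
      using \<phi>(3)[OF Vd_opair[OF v]] upd_eq[OF asn_function[OF s]] unfolding R by simp
  qed
  then show False by (rule definable_tower.contradiction)
qed

theorem theorem4:
  fixes E :: "'v \<Rightarrow> 'v \<Rightarrow> bool"
  assumes "ZFC E"
    and "set_universe.lepoll E
           (set_universe.Pow E (set_universe.omega E)) (set_universe.omega2 E)"
  shows "\<forall>\<delta>. set_universe.inaccessible E \<delta> \<longrightarrow>
           \<not> (\<exists>I. set_universe.tower E \<delta> I \<and>
                   set_universe.tower_concentrates E \<delta> I (set_universe.GIC_omega1 E) \<and>
                   set_universe.tower_definable E \<delta> I \<and>
                   set_universe.precipitous E \<delta> I)"
proof (intro allI impI notI; elim exE conjE)
  fix \<delta> I
  assume \<delta>: "set_universe.inaccessible E \<delta>" and I: "set_universe.tower E \<delta> I"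
    "set_universe.tower_concentrates E \<delta> I (set_universe.GIC_omega1 E)"
    "set_universe.tower_definable E \<delta> I" "set_universe.precipitous E \<delta> I"
  interpret tower_universe E \<delta> I
    by unfold_locales (fact assms(1) \<delta> I(1))+
  obtain \<kappa>0 where \<kappa>0: "Sp \<kappa>0" using Sp_above[OF empty_Vd omega_delta] by blast
  interpret precipitous_tower E \<delta> I \<kappa>0
    by unfold_locales (fact I(2) \<kappa>0 I(4))+
  obtain f0 \<kappa>1 S1 \<kappa>h where m: "minimal_tower E \<delta> I \<kappa>0 f0 \<kappa>1 S1 \<kappa>h" using minimal_tower_exists by blast
  show False by (rule notE[OF minimal_tower.not_definable[OF m] I(3)])
qed

end
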